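(* Let $p$ be a prime with $p\equiv 5\pmod 8$, with notation as in the context. Assume the extended Riemann hypothesis holds for (the Dedekind zeta functions of) the fields $k(\zeta_n,\sqrt[n]{u_p})$ for every squarefree integer $n>0$. Then there exist integers $m_0,n_0$ with $m_0\equiv n_0\equiv 1\pmod 2$ and a prime number $q$ such that (i) $(\mathcal L_{m_0}\mathcal F_{n_0}-2\mathcal F_{m_0})\,b\equiv 0\pmod{p^2}$, and (ii) $q\nmid 2bp$, and there exist $i\in\{1,2,4\}$ and $a\in\mathbb F_{q^i}\setminus\mathbb F_{q^i}^p$ with $f_{\alpha_0,q}(a)=0$, where $\alpha_0:=\alpha(m_0,n_0)$ and $\mathbb F_{q^i}^p$ is the set of $p$-th powers in $\mathbb F_{q^i}$.
   Context: Let $k=\mathbb Q(\sqrt p)$, $\zeta_n$ a primitive $n$-th root of unity, and $u_p=(t+b\sqrt p)/2>1$ ($t,b$ positive integers) the fundamental unit of $k$. Define integer sequences indexed by $n\in\mathbb Z$ by $\mathcal F_0=0,\ \mathcal F_1=1,\ \mathcal F_{n+2}=t\mathcal F_{n+1}+\mathcal F_n$ and $\mathcal L_0=2,\ \mathcal L_1=t,\ \mathcal L_{n+2}=t\mathcal L_{n+1}+\mathcal L_n$. For integers $m,n$ let $\alpha(m,n):=\frac{\mathcal L_n\mathcal L_m+(\mathcal L_m\mathcal F_n-2\mathcal F_m)b\sqrt p}{2}$; for $\alpha=\alpha(m,n)$ let $N=N_{k/\mathbb Q}(\alpha)$, $T=\mathrm{Tr}_{k/\mathbb Q}(\alpha)$,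 $f_\alpha(X)=X^4-TX^3+(N+2)X^2-TX+1$, and $f_{\alpha,q}\in\mathbb F_q[X]$ its reduction modulo a prime $q$. *)

theory Defs
  imports
    "HOL-Analysis.Analysis"
    "HOL-Algebra.Algebraic_Closure_Type"
    "HOL-Algebra.Generated_Fields"
    "HOL-Algebra.QuotRing"
    "HOL-Number_Theory.Residues"
begin

section \<open>Number fields inside the complex numbers\<close>

abbreviation CC :: "complex ring" where
  "CC \<equiv> ring_of_type_algebra"

definition ring_of_integers :: "complex set \<Rightarrow> complex ring" where
  "ring_of_integers K = CC\<lparr>carrier := {x \<in> K. algebraic_int x}\<rparr>"

text \<open>Extensionality makes the embeddings of \<open>K\<close> into the complex numbers a finite set of
  HOL functions when \<open>K\<close> is a number field.\<close>

definition field_embeddings :: "complex set \<Rightarrow> (complex \<Rightarrow> complex) set" where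
  "field_embeddings K = ring_hom (CC\<lparr>carrier := K\<rparr>) CC \<inter> extensional K"

definition field_norm :: "complex set \<Rightarrow> complex \<Rightarrow> complex" where
  "field_norm K x = (\<Prod>\<sigma>\<in>field_embeddings K. \<sigma> x)"

definition field_trace :: "complex set \<Rightarrow> complex \<Rightarrow> complex" where
  "field_trace K x = (\<Sum>\<sigma>\<in>field_embeddings K. \<sigma> x)"


section \<open>Dedekind zeta functions and the extended Riemann hypothesis\<close>

definition nonzero_ideals :: "complex set \<Rightarrow> complex set set" where
  "nonzero_ideals K = {I. ideal I (ring_of_integers K) \<and> I \<noteq> {0}}"

definition ideal_norm :: "complex set \<Rightarrow> complex set \<Rightarrow> nat" where
  "ideal_norm K I = card (carrier (ring_of_integers K Quot I))"

definition dedekind_series :: "complex set \<Rightarrow> complex \<Rightarrow> complex" where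
  "dedekind_series K s = (\<Sum>\<^sub>\<infinity>I\<in>nonzero_ideals K. of_nat (ideal_norm K I) powr (- s))"

text \<open>The analytic continuation of the Dedekind series to the plane without \<open>1\<close>; its value
  at \<open>1\<close> is left open. By the identity theorem it is unique away from \<open>1\<close>.\<close>

definition is_dedekind_zeta :: "complex set \<Rightarrow> (complex \<Rightarrow> complex) \<Rightarrow> bool" where
  "is_dedekind_zeta K Z \<longleftrightarrow>
     Z holomorphic_on (UNIV - {1}) \<and> (\<forall>s. Re s > 1 \<longrightarrow> Z s = dedekind_series K s)"

definition extended_riemann_hypothesis :: "complex set \<Rightarrow> bool" where
  "extended_riemann_hypothesis K \<longleftrightarrow>
     (\<exists>Z. is_dedekind_zeta K Z \<and>
        (\<forall>s. 0 < Re s \<and> Re s < 1 \<and> Z s = 0 \<longrightarrow> Re s = 1 / 2))"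


section \<open>The real quadratic field and its fundamental unit\<close>

definition quad_field :: "nat \<Rightarrow> complex set" where
  "quad_field p = generate_field CC {of_real (sqrt (real p))}"

definition fundamental_unit :: "nat \<Rightarrow> real \<Rightarrow> bool" where
  "fundamental_unit p u \<longleftrightarrow>
     u > 1 \<and> complex_of_real u \<in> Units (ring_of_integers (quad_field p)) \<and>
     (\<forall>w \<in> Units (ring_of_integers (quad_field p)).
        \<exists>j::int. w = of_real u powi j \<or> w = - (of_real u powi j))"

text \<open>Once a primitive \<open>n\<close>-th root of unity is adjoined, the field does not depend on which
  \<open>n\<close>-th root of \<open>u\<close> is chosen; here \<open>u > 0\<close>, and the real positive root is used.\<close>

definition kummer_field :: "nat \<Rightarrow> real \<Rightarrow> nat \<Rightarrow> complex set" where
  "kummer_field p u n = generate_field CC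
     {of_real (sqrt (real p)), cis (2 * pi / real n), of_real (root n u)}"


section \<open>The sequences and the quartic polynomial\<close>

function rec_seq :: "int \<Rightarrow> int \<Rightarrow> int \<Rightarrow> int \<Rightarrow> int" where
  "rec_seq t x0 x1 n =
     (if n = 0 then x0 else if n = 1 then x1
      else if n > 1 then t * rec_seq t x0 x1 (n - 1) + rec_seq t x0 x1 (n - 2)
      else rec_seq t x0 x1 (n + 2) - t * rec_seq t x0 x1 (n + 1))"
  by auto
termination
  by (relation "Wellfounded.measure (\<lambda>(t, x0, x1, n). nat \<bar>2 * n - 1\<bar>)") auto

declare rec_seq.simps [simp del]

definition seqF :: "int \<Rightarrow> int \<Rightarrow> int" where
  "seqF t = rec_seq t 0 1"

definition seqL :: "int \<Rightarrow> int \<Rightarrow> int" where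
  "seqL t = rec_seq t 2 t"

lemma rec_seq_rec: "rec_seq t x0 x1 (n + 2) = t * rec_seq t x0 x1 (n + 1) + rec_seq t x0 x1 n"
proof (cases "n \<ge> 0")
  case True
  then show ?thesis
    by (subst rec_seq.simps) (simp add: algebra_simps)
next
  case False
  then show ?thesis
    by (subst (3) rec_seq.simps) (simp add: algebra_simps)
qed

lemma seqF_rec:
  "seqF t 0 = 0" "seqF t 1 = 1" "seqF t (n + 2) = t * seqF t (n + 1) + seqF t n"
  by (simp_all add: seqF_def rec_seq_rec) (simp_all add: rec_seq.simps)

lemma seqL_rec:
  "seqL t 0 = 2" "seqL t 1 = t" "seqL t (n + 2) = t * seqL t (n + 1) + seqL t n"
  by (simp_all add: seqL_def rec_seq_rec) (simp_all add: rec_seq.simps)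

definition alpha :: "nat \<Rightarrow> int \<Rightarrow> int \<Rightarrow> int \<Rightarrow> int \<Rightarrow> complex" where
  "alpha p t b m n =
     (of_int (seqL t n * seqL t m)
       + of_int ((seqL t m * seqF t n - 2 * seqF t m) * b) * of_real (sqrt (real p))) / 2"

definition f_poly :: "nat \<Rightarrow> complex \<Rightarrow> complex poly" where
  "f_poly p \<alpha> =
     (let N = field_norm (quad_field p) \<alpha>; T = field_trace (quad_field p) \<alpha>
      in [:1, - T, N + 2, - T, 1:])"

text \<open>Reduction modulo \<open>q\<close> of a complex polynomial whose coefficients are integers. The result is
  a polynomial over \<open>residue_ring q\<close> in the list representation of \<open>HOL-Algebra\<close>, leading
  coefficient first.\<close>

definition reduce_poly :: "nat \<Rightarrow> complex poly \<Rightarrow> int list" where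
  "reduce_poly q f =
     rev (Polynomial.coeffs (map_poly (\<lambda>c. (THE z::int. of_int z = c) mod int q) f))"

text \<open>Evaluation in an extension \<open>F\<close> of the prime field, which is embedded into \<open>F\<close> by
  sending \<open>c\<close> to \<open>c\<close> times the unit element.\<close>

definition eval_ext :: "'a ring \<Rightarrow> int list \<Rightarrow> 'a \<Rightarrow> 'a" where
  "eval_ext F g a = ring.eval F (map (\<lambda>c. add_pow F c \<one>\<^bsub>F\<^esub>) g) a"

definition pth_powers :: "'a ring \<Rightarrow> nat \<Rightarrow> 'a set" where
  "pth_powers F p = (\<lambda>x. x [^]\<^bsub>F\<^esub> p) ` carrier F"

end

theory Submission
  imports Defs "Jordan_Normal_Form.Char_Poly" "HOL-Number_Theory.Number_Theory" "HOL-Computational_Algebra.Nth_Powers"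
begin

text \<open>
  The fundamental unit \<open>u\<close> has norm \<open>-1\<close>, so \<open>u ^ p\<^sup>2 = (L + V * sqrt p) / 2\<close> with \<open>L\<^sup>2 + 4 = p * V\<^sup>2\<close>, and
  \<open>p\<^sup>2\<close> divides \<open>V\<close>. For \<open>n0 = p\<^sup>2\<close> and \<open>m0 = e * p\<^sup>2\<close> with a sign \<open>e\<close>, the polynomial of the theorem
  is \<open>quartic (e * L)\<close> at \<open>e * X\<close>. Suppose that modulo all but finitely many primes \<open>q\<close> congruent to \<open>1\<close>
  modulo \<open>p\<close>, all roots of \<open>quartic L\<close> and \<open>quartic (- L)\<close> are \<open>p\<close>-th powers. The product of the
  discriminants that govern the splitting of the two quartics is \<open>L\<^sup>2 - 4\<close> times a square, so if \<open>L\<^sup>2 - 4\<close> is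
  not a square modulo \<open>q\<close>, one of the quartics splits modulo \<open>q\<close>, and substituting \<open>X ^ p\<close> into it gives a
  polynomial of degree \<open>4 * p\<close> with \<open>4 * p\<close> roots modulo \<open>q\<close>.

  If a monic integer polynomial \<open>h\<close> has a root whose powers below \<open>degree h\<close> are linearly independent
  over the rationals, then the number of its roots modulo \<open>q\<close>, weighted with \<open>ln q / q\<close> and
  summed over \<open>q \<le> Z\<close>, is at most \<open>ln Z + O(1)\<close>. Both substituted quartics are of this kind, because a root
  of the quartic is not a \<open>p\<close>-th power in the field that it generates; so the primes above have density
  at most \<open>1 / (2 * p)\<close>. A generator of the \<open>p\<close>-th cyclotomic field with the square root of \<open>L\<^sup>2 - 4\<close>
  adjoined bounds the density of the remaining primes congruent to \<open>1\<close> by \<open>1 / (2 * (p - 1))\<close>. But all primes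
  congruent to \<open>1\<close> together have density \<open>1 / (p - 1)\<close>, which exceeds the sum of the two bounds.
\<close>

text \<open>The estimate for root counts works in one direction only: it bounds the primes modulo
  which a polynomial has many roots and is blind to all others. So every prime congruent to
  \<open>1\<close> modulo \<open>p\<close> has to be put into a class that comes with roots. One
  quartic does not suffice for this, since nothing can be counted where it fails to split; hence the
  two signs and the third polynomial. A lower bound is needed only for all primes congruent to
  \<open>1\<close>, which is Dirichlet's theorem in Mertens form. The exponent
  \<open>p\<^sup>2\<close> serves twice: it puts \<open>p\<^sup>2\<close> into \<open>V\<close>, and
  it makes \<open>u ^ p\<^sup>2\<close> the \<open>p\<close>-th power of a unit \<open>w\<close>, so
  that a \<open>p\<close>-th root of the large root of the quartic lies next to
  \<open>w\<^sup>2\<close> and can be excluded by size. The condition modulo \<open>8\<close> makes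
  \<open>L\<^sup>2 - 4\<close> a nonresidue modulo \<open>p\<close>, which keeps its square root out
  of the cyclotomic field; its consequence modulo \<open>4\<close> gives the norm \<open>-1\<close>
  and a square root of \<open>p\<close> modulo \<open>q\<close>.\<close>

hide_const (open) Divisibility.prime Determinants.det Finite_Cartesian_Product.vec
  Polynomials.lead_coeff Polynomials.degree UnivPoly.coeff UnivPoly.monom

section \<open>Mertens-type estimates\<close>

text \<open>The pairs \<open>(m, d)\<close> with \<open>d\<close> dividing \<open>m \<le> n\<close>
  correspond to the pairs \<open>(d, k)\<close> with \<open>d * k \<le> n\<close>. The convolution
  sums up to \<open>x\<close> below are all rearranged in this way.\<close>

lemma sum_over_divisors_eq_sum_over_multiples:
  fixes F :: "nat \<Rightarrow> nat \<Rightarrow> 'a::comm_monoid_add"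
  shows "(\<Sum>m=1..n. \<Sum>d | d dvd m. F d (m div d)) = (\<Sum>d=1..n. \<Sum>k=1..n div d. F d k)"
proof -
  have "(\<Sum>m=1..n. \<Sum>d | d dvd m. F d (m div d)) =
      (\<Sum>(m, d)\<in>(SIGMA m:{1..n}. {d. d dvd m}). F d (m div d))"
    by (rule sum.Sigma) (auto intro: finite_divisors_nat)
  also have "\<dots> = (\<Sum>(d, k)\<in>(SIGMA d:{1..n}. {1..n div d}). F d k)"
  proof (rule sum.reindex_bij_witness[where i = "\<lambda>(d, k). (d * k, d)" and j = "\<lambda>(m, d). (d, m div d)"])
    fix a assume "a \<in> (SIGMA d:{1..n}. {1..n div d})"
    then obtain d k where a: "a = (d, k)" "1 \<le> d" "d \<le> n" "1 \<le> k" "k \<le> n div d" by auto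
    then have "d * k \<le> n"
      by (metis dual_order.trans mult_le_mono2 times_div_less_eq_dividend)
    then show "(case a of (d, k) \<Rightarrow> (d * k, d)) \<in> (SIGMA m:{1..n}. {d. d dvd m})"
      using a by auto
  next
    fix a assume "a \<in> (SIGMA m:{1..n}. {d. d dvd m})"
    then obtain m d where a: "a = (m, d)" "1 \<le> m" "m \<le> n" "d dvd m" by auto
    then have "d \<le> m" "d > 0" by (auto intro: dvd_imp_le Nat.gr0I)
    then have "1 \<le> m div d" using a by (simp add: div_greater_zero_iff Suc_le_eq)
    then show "(case a of (m, d) \<Rightarrow> (d, m div d)) \<in> (SIGMA d:{1..n}. {1..n div d})"
      using a \<open>d \<le> m\<close> \<open>d > 0\<close> by (auto intro: div_le_mono)
  qed (auto simp: dvd_div_mult_self)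
  also have "\<dots> = (\<Sum>d=1..n. \<Sum>k=1..n div d. F d k)"
    by (rule sum.Sigma[symmetric]) auto
  finally show ?thesis .
qed

text \<open>Legendre's formula for the factorial in logarithmic form, the common source of the
  bounds of Chebyshev and Mertens.\<close>

lemma ln_fact_eq_sum_mangoldt:
  "ln (fact n :: real) = (\<Sum>d=1..n. mangoldt d * real (n div d))"
proof -
  have "ln (fact n :: real) = (\<Sum>m=1..n. ln (real m))"
    by (simp add: fact_prod, subst ln_prod) auto
  also have "\<dots> = (\<Sum>m=1..n. \<Sum>d | d dvd m. mangoldt d)"
    using mangoldt_sum[where 'a=real] by (intro sum.cong) auto
  also have "\<dots> = (\<Sum>d=1..n. \<Sum>k=1..n div d. mangoldt d)"
    using sum_over_divisors_eq_sum_over_multiples[of "\<lambda>d _. mangoldt d"] .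
  finally show ?thesis by (simp add: mult.commute)
qed

text \<open>Halving: the sum over \<open>k < d \<le> 2 * k\<close> is at most the logarithm of the
  central binomial coefficient, hence at most \<open>2 * k * ln 2\<close>. The constant
  \<open>4\<close> leaves room for the last term of an odd \<open>n\<close>.\<close>

lemma chebyshev_psi_upper: "(\<Sum>d=1..n. mangoldt d :: real) \<le> 4 * real n"
proof (induction n rule: less_induct)
  case (less n)
  have dbl: "(\<Sum>d=1..2*k. mangoldt d :: real) \<le> (\<Sum>d=1..k. mangoldt d) + 2 * real k * ln 2" for k
  proof -
    have eq: "real (2 * k choose k) = fact (2 * k) / (fact k * fact k)"
      by (simp add: binomial_fact)
    have "(\<Sum>d=1..2*k. mangoldt d) - (\<Sum>d=1..k. mangoldt d) = (\<Sum>d\<in>{k+1..2*k}. mangoldt d :: real)"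
      using sum.ub_add_nat[of 1 k "mangoldt :: nat \<Rightarrow> real" k] by (simp add: mult_2)
    \<comment> \<open>The weight is \<open>1\<close> for \<open>k < d \<le> 2 * k\<close> and
      nonnegative for all other \<open>d\<close>, so these may be added; with them the sum is the
      logarithm of a quotient of factorials.\<close>
    also have "\<dots> = (\<Sum>d\<in>{k+1..2*k}. mangoldt d * (real (2 * k div d) - 2 * real (k div d)))"
    proof (rule sum.cong)
      fix d assume d: "d \<in> {k+1..2*k}"
      then have "2 * k div d = 1" by (intro div_nat_eqI) auto
      moreover have "k div d = 0" using d by simp
      ultimately show "mangoldt d = (mangoldt d * (real (2 * k div d) - 2 * real (k div d)) :: real)" by simp
    qed simp
    also have "\<dots> \<le> (\<Sum>d=1..2*k. mangoldt d * (real (2 * k div d) - 2 * real (k div d)))"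
    proof (rule sum_mono2)
      fix d assume "d \<in> {1..2 * k} - {k + 1..2 * k}"
      have "2 * (k div d) \<le> 2 * k div d"
        by (cases "d = 0") (simp_all add: less_eq_div_iff_mult_less_eq mult.assoc)
      then have "2 * real (k div d) \<le> real (2 * k div d)"
        by (metis of_nat_le_iff of_nat_mult of_nat_numeral)
      then show "0 \<le> mangoldt d * (real (2 * k div d) - 2 * real (k div d))"
        by (intro mult_nonneg_nonneg mangoldt_nonneg) simp
    qed auto
    also have "\<dots> = ln (fact (2 * k)) - 2 * (\<Sum>d=1..2*k. mangoldt d * real (k div d))"
      by (simp add: ln_fact_eq_sum_mangoldt sum_subtractf sum_distrib_left algebra_simps)
    also have "(\<Sum>d=1..2*k. mangoldt d * real (k div d)) = (\<Sum>d=1..k. mangoldt d * real (k div d))"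
      by (rule sum.mono_neutral_right) auto
    also have "ln (fact (2 * k)) - 2 * (\<Sum>d=1..k. mangoldt d * real (k div d)) = ln (real (2 * k choose k))"
      using ln_fact_eq_sum_mangoldt[of k] by (simp add: eq ln_div ln_mult)
    also have "\<dots> \<le> ln (2 ^ (2 * k))"
    proof -
      have "(2 * k choose k) \<le> 2 ^ (2 * k)" by (rule binomial_le_pow2)
      then have "real (2 * k choose k) \<le> 2 ^ (2 * k)"
        by (metis of_nat_le_iff of_nat_numeral of_nat_power)
      moreover have "real (2 * k choose k) > 0" by (simp add: zero_less_binomial)
      ultimately show ?thesis by (subst ln_le_cancel_iff) auto
    qed
    also have "\<dots> = 2 * real k * ln 2" by (simp add: ln_realpow)
    finally show ?thesis by simp
  qed
  have ln2: "ln (2::real) \<le> 1" using ln_le_minus_one[of "2::real"] by simp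
  show ?case
  proof (cases "n = 0")
    case False
    define k where "k = n div 2"
    have "k < n" using False by (simp add: k_def)
    then have IH: "(\<Sum>d=1..k. mangoldt d :: real) \<le> 4 * real k" by (rule less.IH)
    have k2: "2 * real k * ln 2 \<le> 2 * real k" using ln2 by (simp add: mult_left_le)
    show ?thesis
    proof (cases "even n")
      case True
      then have "n = 2 * k" by (simp add: k_def)
      then show ?thesis using dbl[of k] IH k2 by simp
    next
      case odd: False
      then have n: "n = Suc (2 * k)" by (simp add: k_def)
      have "mangoldt n \<le> ln (real n)" using False by (intro mangoldt_le) auto
      also have "\<dots> \<le> 2 * real k" using ln_le_minus_one[of "real n"] False n by simp
      finally show ?thesis using dbl[of k] IH k2 n by simp
    qed
  qed simp
qed

lemma chebyshev_theta_upper: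
  "(\<Sum>q | Factorial_Ring.prime q \<and> q \<le> n. ln (real q)) \<le> 4 * real n"
proof -
  have "(\<Sum>q | Factorial_Ring.prime q \<and> q \<le> n. ln (real q)) = (\<Sum>q | Factorial_Ring.prime q \<and> q \<le> n. mangoldt q)"
    by (intro sum.cong) auto
  also have "\<dots> \<le> (\<Sum>d=1..n. mangoldt d)"
    by (intro sum_mono2) (auto simp: mangoldt_nonneg prime_gt_0_nat Suc_le_eq)
  also have "\<dots> \<le> 4 * real n" by (rule chebyshev_psi_upper)
  finally show ?thesis .
qed

text \<open>A single term \<open>n ^ n / n!\<close> of the exponential series is at most the whole
  sum \<open>exp n\<close>.\<close>

lemma ln_fact_ge: "ln (fact n :: real) \<ge> real n * ln (real n) - real n"
proof (cases "n = 0")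
  case False
  then have n: "real n > 0" by simp
  have "summable (\<lambda>k. real n ^ k /\<^sub>R fact k)" by (rule summable_exp_generic)
  then have "(\<Sum>k\<in>{n}. real n ^ k /\<^sub>R fact k) \<le> suminf (\<lambda>k. real n ^ k /\<^sub>R fact k)"
    by (intro sum_le_suminf) auto
  then have "real n ^ n / fact n \<le> exp (real n)" by (simp add: exp_def divide_inverse mult.commute)
  then have "ln (real n ^ n / fact n) \<le> real n"
    using n by (metis exp_gt_zero fact_gt_zero ln_exp ln_le_cancel_iff zero_less_divide_iff zero_less_power)
  then show ?thesis using n by (simp add: ln_div ln_realpow)
qed simp

text \<open>Replacing \<open>n div d\<close> by \<open>n / d\<close> in Legendre's formula increases
  the sum, by at most the Chebyshev sum, that is by \<open>O(n)\<close>. Division by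
  \<open>n\<close> gives both bounds.\<close>

lemma mertens_mangoldt:
  assumes "n \<ge> 1"
  shows "(\<Sum>d=1..n. mangoldt d / real d) \<ge> ln (real n) - 1"
    and "(\<Sum>d=1..n. mangoldt d / real d) \<le> ln (real n) + 4"
proof -
  have n: "real n > 0" using assms by simp
  have lo: "ln (fact n :: real) \<ge> real n * ln (real n) - real n" by (rule ln_fact_ge)
  have "ln (fact n :: real) \<le> (\<Sum>d=1..n. mangoldt d * (real n / real d))"
    unfolding ln_fact_eq_sum_mangoldt
    by (intro sum_mono mult_left_mono mangoldt_nonneg) (auto simp: of_nat_div_le_of_nat)
  also have "\<dots> = real n * (\<Sum>d=1..n. mangoldt d / real d)"
    by (simp add: sum_distrib_left mult_ac)
  finally have "real n * (ln (real n) - 1) \<le> real n * (\<Sum>d=1..n. mangoldt d / real d)"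
    using lo by (simp add: algebra_simps)
  then show "(\<Sum>d=1..n. mangoldt d / real d) \<ge> ln (real n) - 1"
    using n by simp
  have "fact n \<le> (of_nat (n ^ n) :: real)" by (rule fact_le_power)
  then have "fact n \<le> (real n) ^ n" by simp
  then have hi: "ln (fact n :: real) \<le> real n * ln (real n)"
    using n by (metis fact_gt_zero ln_le_cancel_iff ln_realpow zero_less_power)
  have "real n * (\<Sum>d=1..n. mangoldt d / real d) - (\<Sum>d=1..n. mangoldt d) =
      (\<Sum>d=1..n. mangoldt d * (real n / real d - 1))"
    by (simp add: sum_distrib_left sum_subtractf algebra_simps)
  also have "\<dots> \<le> ln (fact n :: real)"
    unfolding ln_fact_eq_sum_mangoldt
  proof (intro sum_mono mult_left_mono mangoldt_nonneg)
    fix d show "real n / real d - 1 \<le> real (n div d)"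
    proof (cases "d = 0")
      case False
      have "n < d * (n div d) + d" using False dividend_less_times_div[of d n] by (simp add: add.commute)
      then have "real n < real d * real (n div d) + real d"
        by (metis of_nat_add of_nat_less_iff of_nat_mult)
      then show ?thesis using False by (simp add: field_simps)
    qed simp
  qed
  finally have "real n * (\<Sum>d=1..n. mangoldt d / real d) \<le> real n * (ln (real n) + 4)"
    using hi chebyshev_psi_upper[of n] by (simp add: algebra_simps)
  then show "(\<Sum>d=1..n. mangoldt d / real d) \<le> ln (real n) + 4"
    using n by simp
qed

text \<open>For a prime \<open>q\<close> the powers with exponent at least \<open>2\<close>
  contribute at most \<open>2 * ln q / q\<^sup>2\<close>, which is summable since
  \<open>ln q\<close> is at most twice the square root of \<open>q\<close>. This is how sums over
  prime powers are later turned into sums over primes.\<close>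

lemma sum_mangoldt_nonprime_bounded:
  "\<exists>C. \<forall>n. (\<Sum>d | d \<in> {1..n} \<and> \<not> Factorial_Ring.prime d. mangoldt d / real d) \<le> (C::real)"
proof -
  have S: "summable (\<lambda>q. 4 * real q powr (-3/2))"
    by (intro summable_mult) (simp add: summable_real_powr_iff)
  define C where "C = (\<Sum>q. 4 * real q powr (-3/2))"
  have "(\<Sum>d | d \<in> {1..n} \<and> \<not> Factorial_Ring.prime d. mangoldt d / real d) \<le> C" for n
  proof -
    let ?D = "{d. d \<in> {1..n} \<and> \<not> Factorial_Ring.prime d \<and> primepow d}"
    let ?f = "\<lambda>d. (aprimedivisor d, multiplicity (aprimedivisor d) d)"
    have *: "Factorial_Ring.prime (aprimedivisor d) \<and> 2 \<le> multiplicity (aprimedivisor d) d \<and>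
        d = aprimedivisor d ^ multiplicity (aprimedivisor d) d \<and> aprimedivisor d \<le> n \<and> multiplicity (aprimedivisor d) d \<le> n"
      if d: "d \<in> ?D" for d
    proof -
      from d obtain q k where qk: "Factorial_Ring.prime q" "k > 0" "d = q ^ k"
        by (auto simp: primepow_def)
      have a: "aprimedivisor d = q" using qk by (simp add: aprimedivisor_prime_power)
      have m: "multiplicity q d = k" using qk by simp
      have "k \<noteq> 1" using d qk by auto
      moreover have "q \<le> q ^ k" using qk by (simp add: self_le_power prime_gt_0_nat Suc_le_eq)
      moreover have "k \<le> q ^ k"
        using power_mono[OF prime_ge_2_nat[OF qk(1)], of k] less_exp[of k] by linarith
      ultimately show ?thesis using a m qk d by auto
    qed
    have "(\<Sum>d | d \<in> {1..n} \<and> \<not> Factorial_Ring.prime d. mangoldt d / real d) = (\<Sum>d\<in>?D. mangoldt d / real d)"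
      by (rule sum.mono_neutral_right) (auto simp: mangoldt_def)
    also have "\<dots> = (\<Sum>d\<in>?D. (\<lambda>(q, k). ln (real q) / real q ^ k) (?f d))"
    proof (rule sum.cong)
      fix d assume d: "d \<in> ?D"
      have "real d = real (aprimedivisor d) ^ multiplicity (aprimedivisor d) d"
        using *[OF d] by (metis of_nat_power)
      then show "mangoldt d / real d = (\<lambda>(q, k). ln (real q) / real q ^ k) (?f d)"
        using d by (simp add: mangoldt_def)
    qed simp
    also have "\<dots> = (\<Sum>(q, k)\<in>?f ` ?D. ln (real q) / real q ^ k)"
    proof (rule sum.reindex[symmetric, unfolded comp_def])
      show "inj_on ?f ?D"
      proof (rule inj_onI)
        fix x y assume "x \<in> ?D" "y \<in> ?D" "?f x = ?f y"
        then show "x = y" using *[of x] *[of y] by (metis prod.inject)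
      qed
    qed
    also have "\<dots> \<le> (\<Sum>(q, k)\<in>{2..n} \<times> {2..n}. ln (real q) / real q ^ k)"
      by (rule sum_mono2) (use * in \<open>auto simp: prime_ge_2_nat\<close>)
    also have "\<dots> = (\<Sum>q=2..n. \<Sum>k=2..n. ln (real q) / real q ^ k)"
      by (rule sum.cartesian_product[symmetric])
    also have "\<dots> \<le> (\<Sum>q=2..n. 4 * real q powr (-3/2))"
    proof (rule sum_mono)
      fix q assume q: "q \<in> {2..n}"
      then have q2: "real q \<ge> 2" by simp
      have "(\<Sum>k=2..n. (1 / real q) ^ k) \<le> 2 / real q ^ 2"
      proof -
        have "(\<Sum>k\<in>{2..n}. (1 / real q) ^ k) \<le> (\<Sum>k\<in>{2..<2+n}. (1 / real q) ^ k)"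
          by (rule sum_mono2) auto
        also have "\<dots> = (1 / real q)^2 * (\<Sum>k<n. (1 / real q) ^ k)"
        proof -
          have "(\<Sum>k=2..<2+n. (1 / real q) ^ k) = (\<Sum>k<n. (1 / real q) ^ (k + 2))"
            using sum.shift_bounds_nat_ivl[of "\<lambda>k. (1 / real q) ^ k" 0 2 n]
            by (simp only: lessThan_atLeast0 add.commute[of 2 n] add_0)
          then show ?thesis by (simp only: power_add sum_distrib_right mult.commute)
        qed
        finally have 1: "(\<Sum>k=2..n. (1 / real q) ^ k) \<le> (1 / real q)^2 * (\<Sum>k<n. (1 / real q) ^ k)" .
        have "(\<Sum>k<n. (1 / real q) ^ k) \<le> (\<Sum>k. (1 / real q) ^ k)"
          using q2 by (intro sum_le_suminf summable_geometric) auto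
        also have "(\<Sum>k. (1 / real q) ^ k) = 1 / (1 - 1 / real q)"
          using q2 by (intro suminf_geometric) auto
        also have "\<dots> \<le> 2" using q2 by (simp add: field_simps)
        finally have "(1 / real q)^2 * (\<Sum>k<n. (1 / real q) ^ k) \<le> (1 / real q)^2 * 2"
          by (rule mult_left_mono) simp
        with 1 show ?thesis by (simp add: power_one_over)
      qed
      then have "ln (real q) * (\<Sum>k=2..n. (1 / real q) ^ k) \<le> ln (real q) * (2 / real q ^ 2)"
        using q2 by (intro mult_left_mono) auto
      moreover have "ln (real q) \<le> 2 * real q powr (1/2)"
      proof -
        have "ln (real q powr (1/2)) \<le> real q powr (1/2)"
          using q2 by (intro order.trans[OF ln_le_minus_one]) auto
        then show ?thesis using q2 by (simp add: ln_powr)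
      qed
      moreover have "2 * real q powr (1/2) * (2 / real q ^ 2) = 4 * real q powr (-3/2)"
      proof -
        have "real q powr (-3/2) = real q powr (1/2 - 2)" by simp
        also have "\<dots> = real q powr (1/2) / real q powr 2" by (rule powr_diff)
        also have "real q powr 2 = real q ^ 2" using q2 by (simp add: powr_numeral)
        finally show ?thesis by (simp only: times_divide_eq_right times_divide_eq_left)
      qed
      ultimately have "ln (real q) * (\<Sum>k=2..n. (1 / real q) ^ k) \<le> 4 * real q powr (-3/2)"
        by (smt (verit) divide_nonneg_nonneg mult_right_mono zero_le_power2)
      then show "(\<Sum>k=2..n. ln (real q) / real q ^ k) \<le> 4 * real q powr (-3/2)"
        by (simp add: sum_distrib_left power_one_over)
    qed
    also have "\<dots> \<le> C"
      unfolding C_def using S by (intro sum_le_suminf) auto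
    finally show ?thesis .
  qed
  then show ?thesis by blast
qed

section \<open>Division by monic polynomials; polynomials with many roots modulo a prime\<close>

lemma monic_division:
  fixes G P :: "'a::comm_ring_1 poly"
  assumes K: "\<And>x y. x \<in> K \<Longrightarrow> y \<in> K \<Longrightarrow> x - y \<in> K" "\<And>x y. x \<in> K \<Longrightarrow> y \<in> K \<Longrightarrow> x * y \<in> K"
      "0 \<in> K"
    and G: "lead_coeff G = 1" "\<And>i. poly.coeff G i \<in> K" and P: "\<And>i. poly.coeff P i \<in> K"
  obtains Q R where "P = Q * G + R" "\<And>i. poly.coeff Q i \<in> K" "\<And>i. poly.coeff R i \<in> K"
    "\<And>i. i \<ge> degree G \<Longrightarrow> poly.coeff R i = 0"
    "\<And>i. i + degree G > degree P \<Longrightarrow> poly.coeff Q i = 0"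
proof -
  \<comment> \<open>\<open>K\<close> is a subring that contains the coefficients; as the divisor is
    monic, quotient and remainder stay in it. It will be the whole ring \<open>int\<close> or a real
    subfield. The degree bounds of quotient and remainder are put on coefficients, so that they also
    cover zero polynomials.\<close>
  have Kadd: "x + y \<in> K" if "x \<in> K" "y \<in> K" for x y
    using K(1)[OF that(1) K(1)[OF K(3) that(2)]] by simp
  have "\<exists>Q R. P = Q * G + R \<and> (\<forall>i. poly.coeff Q i \<in> K) \<and> (\<forall>i. poly.coeff R i \<in> K) \<and>
      (\<forall>i\<ge>degree G. poly.coeff R i = 0) \<and> (\<forall>i. i + degree G > degree P \<longrightarrow> poly.coeff Q i = 0)"
    using P
  proof (induction "degree P" arbitrary: P rule: less_induct)
    case less
    show ?case
    proof (cases "degree P < degree G \<or> P = 0")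
      case True
      then have "\<forall>i\<ge>degree G. poly.coeff P i = 0"
        by (auto intro: coeff_eq_0)
      with less.prems K(3) show ?thesis
        by (intro exI[of _ 0] exI[of _ P]) auto
    next
      case False
      then have dG: "degree G \<le> degree P" by simp
      show ?thesis
      proof (cases "degree P = 0")
        case True
        then obtain c where c: "P = [:c:]" by (metis degree_0_id)
        have "G = 1" using G(1) dG True
          by (metis degree_0_id le_zero_eq of_int_1 one_poly_eq_simps(1) one_pCons)
        then show ?thesis using less.prems K(3) dG True
          by (intro exI[of _ P] exI[of _ 0]) (auto simp: coeff_eq_0)
      next
        case False
        define d where "d = degree P - degree G"
        define S where "S = Polynomial.monom (lead_coeff P) d"
        define P' where "P' = P - S * G"
        have cS: "poly.coeff (S * G) i = (if i < d then 0 else lead_coeff P * poly.coeff G (i - d))" for i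
          unfolding S_def by (simp add: coeff_monom_mult)
        have z: "poly.coeff P' i = 0" if "i \<ge> degree P" for i
          using that dG G(1) by (cases "i = degree P")
            (auto simp: P'_def cS d_def coeff_eq_0)
        have "degree P' < degree P"
          using z False by (metis leading_coeff_0_iff not_le_imp_less degree_0 gr0I order_refl)
        moreover have "\<And>i. poly.coeff P' i \<in> K"
          using less.prems G(2) K by (auto simp: P'_def cS)
        ultimately obtain Q R where QR: "P' = Q * G + R" "\<forall>i. poly.coeff Q i \<in> K" "\<forall>i. poly.coeff R i \<in> K"
           "\<forall>i\<ge>degree G. poly.coeff R i = 0" "\<forall>i. i + degree G > degree P' \<longrightarrow> poly.coeff Q i = 0"
          using less.hyps[of P'] by blast
        have "P = (S + Q) * G + R"
          using QR(1) by (simp add: P'_def algebra_simps)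
        moreover have "\<forall>i. poly.coeff (S + Q) i \<in> K"
          using QR(2) less.prems K(3) Kadd by (auto simp: S_def)
        moreover have "\<forall>i. i + degree G > degree P \<longrightarrow> poly.coeff (S + Q) i = 0"
          using QR(5) \<open>degree P' < degree P\<close> dG by (auto simp: S_def d_def)
        ultimately show ?thesis using QR(3,4) by blast
      qed
    qed
  qed
  then show ?thesis using that by blast
qed

text \<open>Over a field a nonzero polynomial has at most as many roots as its degree; here the
  field is given by integers modulo \<open>q\<close>, and the roots are divided off one at a time.
  With the degree bound put on coefficients, the empty set of roots forces
  \<open>R = 0\<close>.\<close>

lemma prime_dvd_coeff_of_many_roots:
  fixes R :: "int poly" and q :: int
  assumes "Factorial_Ring.prime q" "finite A" "\<And>i. i \<ge> card A \<Longrightarrow> poly.coeff R i = 0"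
    "\<And>r. r \<in> A \<Longrightarrow> q dvd poly R r" "\<And>r s. r \<in> A \<Longrightarrow> s \<in> A \<Longrightarrow> q dvd r - s \<Longrightarrow> r = s"
  shows "q dvd poly.coeff R i"
  using assms(2-)
proof (induction A arbitrary: R i rule: finite_induct)
  case empty
  then show ?case by simp
next
  case (insert r A)
  define Q where "Q = synthetic_div R r"
  have R: "R = [:-r, 1:] * Q + [:poly R r:]"
    using synthetic_div_correct'[of r R] by (simp add: Q_def)
  have cR: "poly.coeff R (Suc j) = poly.coeff Q j - r * poly.coeff Q (Suc j)" for j
    by (subst R) simp
  \<comment> \<open>From the index \<open>card A\<close> on, each coefficient of \<open>Q\<close> is
    \<open>r\<close> times the next one, and far enough out they vanish.\<close>
  have hi: "poly.coeff Q j = 0" if "j \<ge> card A" for j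
  proof -
    have step: "poly.coeff Q j = r * poly.coeff Q (Suc j)" if "j \<ge> card A" for j
    proof -
      have "poly.coeff R (Suc j) = 0" using that insert.prems(1) insert.hyps by simp
      then show ?thesis using cR[of j] by simp
    qed
    have "poly.coeff Q j = r ^ n * poly.coeff Q (j + n)" for n
    proof (induction n)
      case (Suc n)
      show ?case using Suc.IH step[of "j + n"] that by (simp only: power_Suc2 mult.assoc add_Suc_right)
    qed simp
    from this[of "Suc (degree Q)"] show ?thesis by (simp add: coeff_eq_0)
  qed
  have "q dvd poly.coeff Q j" for j
  proof (rule insert.IH)
    fix s assume s: "s \<in> A"
    have "poly R s - poly R r = (s - r) * poly Q s"
      by (subst (1) R) (simp add: algebra_simps)
    then have "q dvd (s - r) * poly Q s"
      using insert.prems(2)[of s] insert.prems(2)[of r] s by (metis dvd_diff insertCI)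
    moreover have "\<not> q dvd s - r"
      using insert.prems(3)[of s r] s insert.hyps by auto
    ultimately show "q dvd poly Q s"
      using assms(1) prime_dvd_mult_iff by blast
  qed (use hi insert.prems(3) in auto)
  moreover have "poly.coeff R 0 = poly R r - r * poly.coeff Q 0"
    by (subst R) simp
  ultimately show ?case
    using insert.prems(2)[of r] by (cases i) (simp_all add: cR dvd_diff)
qed

section \<open>Nonprincipal characters\<close>

text \<open>A Dirichlet character modulo \<open>N\<close>, reduced to the properties that the
  estimates use; the vanishing sum over a period expresses that it is not principal.\<close>

locale nonprincipal_character =
  fixes N :: nat and ch :: "nat \<Rightarrow> complex"
  assumes mult: "ch (m * n) = ch m * ch n"
    and one: "ch 1 = 1"
    and modulus_pos: "N > 0"
    and periodic: "ch (n + N) = ch n"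
    and norm_le: "norm (ch n) \<le> 1"
    and sum_period: "(\<Sum>n<N. ch n) = 0"
begin

lemma norm_partial_sum: "norm (\<Sum>n<x. ch n) \<le> real N"
proof (induction x rule: less_induct)
  case (less x)
  show ?case
  proof (cases "x \<le> N")
    case True
    have "norm (\<Sum>n<x. ch n) \<le> (\<Sum>n<x. 1)"
      by (rule order.trans[OF norm_sum sum_mono]) (rule norm_le)
    then show ?thesis using True by simp
  next
    case False
    have "(\<Sum>n<x. ch n) = (\<Sum>n<N. ch n) + (\<Sum>n=N..<x. ch n)"
      using sum.atLeastLessThan_concat[of 0 N x ch] False by (simp add: lessThan_atLeast0)
    also have "(\<Sum>n=N..<x. ch n) = (\<Sum>n=0..<x-N. ch (n + N))"
      using sum.shift_bounds_nat_ivl[of ch 0 N "x - N"] False by simp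
    also have "\<dots> = (\<Sum>n<x-N. ch n)"
      by (simp add: periodic lessThan_atLeast0)
    finally show ?thesis using less.IH[of "x - N"] False sum_period modulus_pos by simp
  qed
qed

text \<open>Abel summation against the partial sums starting at \<open>m\<close>; each is a
  difference of two initial sums and so has norm at most \<open>2 * N\<close>.\<close>

lemma norm_sum_antimono_le:
  fixes b :: "nat \<Rightarrow> real"
  assumes "\<And>n. n \<ge> m \<Longrightarrow> b (Suc n) \<le> b n" "\<And>n. n \<ge> m \<Longrightarrow> b n \<ge> 0" "m \<le> k"
  shows "norm (\<Sum>n=m..<k. ch n * of_real (b n)) \<le> 2 * real N * b m"
proof -
  define S where "S k = (\<Sum>n=m..<k. ch n)" for k
  have S: "norm (S k) \<le> 2 * real N" if "m \<le> k" for k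
  proof -
    have "S k = (\<Sum>n<k. ch n) - (\<Sum>n<m. ch n)"
      using sum_diff_nat_ivl[of 0 m k ch] that by (simp add: S_def lessThan_atLeast0)
    then show ?thesis
      using norm_partial_sum[of k] norm_partial_sum[of m]
        norm_triangle_ineq4[of "\<Sum>n<k. ch n" "\<Sum>n<m. ch n"] by simp
  qed
  have eq: "(\<Sum>n=m..<k. ch n * of_real (b n)) =
      S k * of_real (b k) + (\<Sum>n=m..<k. S (Suc n) * of_real (b n - b (Suc n)))" if "m \<le> k" for k
    using that by (induction k rule: dec_induct) (auto simp: S_def algebra_simps)
  have "norm (\<Sum>n=m..<k. S (Suc n) * of_real (b n - b (Suc n))) \<le>
      (\<Sum>n=m..<k. 2 * real N * (b n - b (Suc n)))"
  proof (rule order.trans[OF norm_sum sum_mono])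
    fix n assume n: "n \<in> {m..<k}"
    then have "norm (of_real (b n - b (Suc n)) :: complex) = b n - b (Suc n)"
      using assms(1)[of n] by (simp only: norm_of_real) auto
    moreover have "b n - b (Suc n) \<ge> 0" using n assms(1)[of n] by simp
    ultimately show "norm (S (Suc n) * of_real (b n - b (Suc n))) \<le> 2 * real N * (b n - b (Suc n))"
      using S[of "Suc n"] n by (simp only: norm_mult) (intro mult_right_mono, auto)
  qed
  also have "\<dots> = 2 * real N * (b m - b k)"
    using assms(3) by (induction k rule: dec_induct) (auto simp: algebra_simps)
  finally have "norm (\<Sum>n=m..<k. ch n * of_real (b n)) \<le> norm (S k * of_real (b k)) + 2 * real N * (b m - b k)"
    unfolding eq[OF assms(3)] using norm_triangle_ineq by (smt (verit, best))
  also have "norm (S k * of_real (b k)) \<le> 2 * real N * b k"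
    using S[OF assms(3)] assms(2)[OF assms(3)]
    by (simp add: norm_mult mult_right_mono)
  finally show ?thesis by (simp add: algebra_simps)
qed

definition harm_sum :: "nat \<Rightarrow> complex" where
  "harm_sum x = (\<Sum>n=1..x. ch n / of_nat n)"

text \<open>The value at \<open>1\<close> of the Dirichlet \<open>L\<close>-function of the
  character.\<close>

definition L_one :: complex where "L_one = lim harm_sum"

lemma harm_sum_diff: 
  assumes "x \<le> y" shows "norm (harm_sum y - harm_sum x) \<le> 2 * real N / real (Suc x)"
proof -
  have "harm_sum y - harm_sum x = (\<Sum>n=Suc x..<Suc y. ch n * of_real (1 / real n))"
  proof -
    have "(\<Sum>n=1..<Suc x. ch n / of_nat n) + (\<Sum>n=Suc x..<Suc y. ch n / of_nat n) = (\<Sum>n=1..<Suc y. ch n / of_nat n)"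
      using assms by (intro sum.atLeastLessThan_concat) auto
    then show ?thesis
      unfolding harm_sum_def atLeastLessThanSuc_atLeastAtMost by (simp add: algebra_simps)
  qed
  also have "norm \<dots> \<le> 2 * real N * (1 / real (Suc x))"
    using assms by (intro norm_sum_antimono_le) (auto simp: field_simps)
  finally show ?thesis by simp
qed

lemma norm_harm_sum_minus_L_one: "norm (harm_sum x - L_one) \<le> 2 * real N / real (Suc x)"
proof -
  have "Cauchy harm_sum"
  proof (rule CauchyI')
    fix e :: real assume "e > 0"
    obtain M where M: "real (Suc M) > 2 * real N / e" 
      by (metis dual_order.strict_trans lessI of_nat_less_iff reals_Archimedean2)
    have "norm (harm_sum m - harm_sum n) < e" if "M \<le> m" "m < n" for m n
    proof -
      have "norm (harm_sum m - harm_sum n) \<le> 2 * real N / real (Suc m)"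
        using harm_sum_diff[of m n] that by (simp add: norm_minus_commute)
      also have "\<dots> \<le> 2 * real N / real (Suc M)"
        using that by (intro divide_left_mono) auto
      also have "\<dots> < e" using M \<open>e > 0\<close> by (simp add: field_simps)
      finally show ?thesis .
    qed
    then show "\<exists>M. \<forall>m\<ge>M. \<forall>n>m. dist (harm_sum m) (harm_sum n) < e"
      unfolding dist_norm by blast
  qed
  then have "harm_sum \<longlonglongrightarrow> L_one"
    unfolding L_one_def using Cauchy_convergent convergent_LIMSEQ_iff by blast
  then have "(\<lambda>y. norm (harm_sum y - harm_sum x)) \<longlonglongrightarrow> norm (L_one - harm_sum x)"
    by (intro tendsto_intros)
  then have "norm (L_one - harm_sum x) \<le> 2 * real N / real (Suc x)"
    by (rule LIMSEQ_le_const2) (use harm_sum_diff in blast)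
  then show ?thesis by (simp add: norm_minus_commute)
qed

text \<open>\<open>ln n / n\<close> decreases from \<open>n = 3\<close> on, because
  \<open>ln n \<ge> 1\<close> there; the two earlier terms are bounded separately.\<close>

lemma norm_sum_ln_bounded: "\<exists>C. \<forall>x. norm (\<Sum>n=1..x. ch n * of_real (ln (real n) / real n)) \<le> C"
proof -
  define C where "C = (\<Sum>n=1..<3. norm (ch n * of_real (ln (real n) / real n))) + 2 * real N * (ln 3 / 3)"
  have dec: "ln (real (Suc n)) / real (Suc n) \<le> ln (real n) / real n" if "n \<ge> 3" for n
  proof -
    have n: "real n \<ge> 3" using that by simp
    have "1 \<le> ln (real n)"
    proof -
      have "exp 1 \<le> (3::real)" using exp_le by simp
      then show ?thesis using n by (metis exp_gt_zero ln_exp ln_mono order.trans)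
    qed
    have "ln (real (Suc n)) - ln (real n) = ln (1 + 1 / real n)"
    proof -
      have "1 + 1 / real n = real (Suc n) / real n" using n by (simp add: field_simps)
      then show ?thesis using n ln_div[of "real (Suc n)" "real n"] by (simp del: of_nat_Suc)
    qed
    also have "\<dots> \<le> 1 / real n" using ln_add_one_self_le_self[of "1 / real n"] by simp
    finally have "real n * (ln (real (Suc n)) - ln (real n)) \<le> real n * (1 / real n)"
      by (rule mult_left_mono) simp
    then have "real n * ln (real (Suc n)) \<le> real n * ln (real n) + 1"
      using n by (simp add: right_diff_distrib del: of_nat_Suc)
    also have "\<dots> \<le> real n * ln (real n) + ln (real n)" using \<open>1 \<le> ln (real n)\<close> by simp
    finally have "ln (real (Suc n)) * real n \<le> ln (real n) * real (Suc n)"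
      by (simp add: algebra_simps)
    then show ?thesis using n by (simp add: divide_le_eq le_divide_eq mult.commute del: of_nat_Suc)
  qed
  have "norm (\<Sum>n=1..x. ch n * of_real (ln (real n) / real n)) \<le> C" for x
  proof (cases "x \<ge> 3")
    case True
    let ?f = "\<lambda>n. ch n * complex_of_real (ln (real n) / real n)"
    have "(\<Sum>n=1..x. ?f n) = (\<Sum>n=1..<3. ?f n) + (\<Sum>n=3..<Suc x. ?f n)"
      using sum.atLeastLessThan_concat[of 1 3 "Suc x" ?f] True
      by (simp add: atLeastLessThanSuc_atLeastAtMost)
    also have "norm \<dots> \<le> (\<Sum>n=1..<3. norm (?f n)) + 2 * real N * (ln (real 3) / real 3)"
      using True dec norm_sum[of ?f "{1..<3}"]
      by (intro order.trans[OF norm_triangle_ineq] add_mono norm_sum_antimono_le) auto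
    finally show ?thesis by (simp add: C_def)
  next
    case False
    have "norm (\<Sum>n=1..x. ch n * complex_of_real (ln (real n) / real n)) \<le>
        (\<Sum>n=1..x. norm (ch n * complex_of_real (ln (real n) / real n)))" by (rule norm_sum)
    also have "\<dots> \<le> (\<Sum>n=1..<3. norm (ch n * complex_of_real (ln (real n) / real n)))"
      using False by (intro sum_mono2) auto
    also have "\<dots> \<le> C" by (simp add: C_def)
    finally show ?thesis .
  qed
  then show ?thesis by blast
qed

text \<open>The logarithm is the convolution of the von Mangoldt function with \<open>1\<close>, so
  the sum with \<open>ln\<close> becomes a sum with \<open>mangoldt d\<close> and weights
  \<open>harm_sum (x div d)\<close>. Each weight is \<open>L_one\<close> up to
  \<open>O(d / x)\<close>, and Chebyshev's bound absorbs the errors. It remains to divide by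
  \<open>L_one\<close>.\<close>

lemma norm_sum_mangoldt_bounded:
  assumes "L_one \<noteq> 0"
  shows "\<exists>C. \<forall>x. norm (\<Sum>n=1..x. ch n * of_real (mangoldt n / real n)) \<le> C"
proof -
  obtain C where C: "\<And>x. norm (\<Sum>n=1..x. ch n * of_real (ln (real n) / real n)) \<le> C"
    using norm_sum_ln_bounded by blast
  have "norm (\<Sum>n=1..x. ch n * of_real (mangoldt n / real n)) \<le> (C + 8 * real N) / norm L_one" for x
  proof (cases "x = 0")
    case True
    then show ?thesis using C[of 0] by (simp add: divide_nonneg_nonneg)
  next
    case False
    let ?M = "\<lambda>d. ch d * complex_of_real (mangoldt d / real d)"
    have "(\<Sum>n=1..x. ch n * of_real (ln (real n) / real n)) =
        (\<Sum>n=1..x. \<Sum>d | d dvd n. ?M d * (ch (n div d) / of_nat (n div d)))"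
    proof (rule sum.cong)
      fix n assume n: "n \<in> {1..x}"
      have "(\<Sum>d | d dvd n. ?M d * (ch (n div d) / of_nat (n div d))) =
          (\<Sum>d | d dvd n. ch n / of_nat n * of_real (mangoldt d))"
      proof (rule sum.cong)
        fix d assume "d \<in> {d. d dvd n}"
        then obtain k where k: "n = d * k" by auto
        with n have "d > 0" "k > 0" by (auto intro: Nat.gr0I)
        then show "?M d * (ch (n div d) / of_nat (n div d)) = ch n / of_nat n * of_real (mangoldt d)"
          by (simp add: k mult field_simps)
      qed simp
      also have "\<dots> = ch n / of_nat n * of_real (\<Sum>d | d dvd n. mangoldt d)"
        by (simp add: sum_distrib_left)
      also have "(\<Sum>d | d dvd n. mangoldt d) = ln (real n)"
        using mangoldt_sum[of n, where 'a=real] n by simp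
      finally show "ch n * of_real (ln (real n) / real n) = (\<Sum>d | d dvd n. ?M d * (ch (n div d) / of_nat (n div d)))"
        by simp
    qed simp
    also have "\<dots> = (\<Sum>d=1..x. ?M d * harm_sum (x div d))"
      unfolding harm_sum_def sum_distrib_left
      by (rule sum_over_divisors_eq_sum_over_multiples)
    also have "\<dots> = (\<Sum>d=1..x. ?M d) * L_one + (\<Sum>d=1..x. ?M d * (harm_sum (x div d) - L_one))"
      unfolding sum_distrib_right sum.distrib[symmetric] 
      by (intro sum.cong refl) (simp only: right_diff_distrib add_diff_eq add_diff_cancel_left')
    finally have eq: "(\<Sum>d=1..x. ?M d) * L_one = (\<Sum>n=1..x. ch n * of_real (ln (real n) / real n)) -
        (\<Sum>d=1..x. ?M d * (harm_sum (x div d) - L_one))" by simp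
    have "norm (\<Sum>d=1..x. ?M d * (harm_sum (x div d) - L_one)) \<le> (\<Sum>d=1..x. mangoldt d * (2 * real N / real x))"
    proof (rule order.trans[OF norm_sum sum_mono])
      fix d assume d: "d \<in> {1..x}"
      have "x < d * (x div d) + d" using d dividend_less_times_div[of d x] by (simp add: add.commute)
      then have "real x < real d * real (Suc (x div d))"
        by (metis add.commute mult_Suc_right of_nat_less_iff of_nat_mult)
      then have le: "2 * real N / real (Suc (x div d)) \<le> 2 * real N * real d / real x"
        using d by (simp add: field_simps mult_left_mono del: of_nat_Suc)
      have "norm (?M d) \<le> mangoldt d / real d"
        using norm_le[of d] mangoldt_nonneg[of d] by (simp add: norm_mult mult_left_le_one_le norm_divide divide_right_mono)
      then have "norm (?M d * (harm_sum (x div d) - L_one)) \<le> mangoldt d / real d * (2 * real N * real d / real x)"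
        unfolding norm_mult[of "?M d"]
        by (intro mult_mono order.trans[OF norm_harm_sum_minus_L_one le]) (auto simp: mangoldt_nonneg)
      also have "\<dots> = mangoldt d * (2 * real N / real x)" using d by simp
      finally show "norm (?M d * (harm_sum (x div d) - L_one)) \<le> mangoldt d * (2 * real N / real x)" .
    qed
    also have "\<dots> = (\<Sum>d=1..x. mangoldt d) * (2 * real N / real x)"
      by (rule sum_distrib_right[symmetric])
    also have "\<dots> \<le> 4 * real x * (2 * real N / real x)"
      by (intro mult_right_mono chebyshev_psi_upper) auto
    also have "\<dots> = 8 * real N" using False by simp
    finally have "norm ((\<Sum>d=1..x. ?M d) * L_one) \<le> C + 8 * real N"
      unfolding eq using C[of x] norm_triangle_ineq4 by (smt (verit, best))
    then show ?thesis using assms by (simp add: norm_mult field_simps)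
  qed
  then show ?thesis by blast
qed

end

section \<open>The case of a vanishing value at one\<close>

definition moebius :: "nat \<Rightarrow> real" where
  "moebius n = (if squarefree n then (-1) ^ card (prime_factors n) else 0)"

lemma abs_moebius_le: "\<bar>moebius n\<bar> \<le> 1"
  by (simp add: moebius_def)

lemma sum_neg_one_power_card_Pow:
  assumes "finite A" shows "(\<Sum>S\<in>Pow A. (-1) ^ card S :: real) = (if A = {} then 1 else 0)"
  using assms
proof (induction A rule: finite_induct)
  case (insert a A)
  have "inj_on (insert a) (Pow A)" using insert.hyps by (auto simp: inj_on_def)
  then have "(\<Sum>S\<in>insert a ` Pow A. (-1) ^ card S :: real) = (\<Sum>S\<in>Pow A. (-1) ^ card (insert a S))"
    by (simp add: sum.reindex)
  also have "\<dots> = (\<Sum>S\<in>Pow A. - ((-1) ^ card S))"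
  proof (rule sum.cong)
    fix S assume "S \<in> Pow A"
    then have "finite S" "a \<notin> S" using insert.hyps finite_subset by auto
    then show "(- 1) ^ card (insert a S) = (- ((- 1) ^ card S) :: real)" by simp
  qed simp
  finally show ?case
    using insert.hyps by (simp add: Pow_insert sum.union_disjoint sum_negf)
      (subst sum.union_disjoint, auto simp: sum_negf)
qed simp

text \<open>Squarefree divisors correspond to sets of prime factors, and the alternating sum over
  all subsets of a nonempty set vanishes.\<close>

lemma sum_moebius_divisors:
  assumes "n > 0" shows "(\<Sum>d | d dvd n. moebius d) = (if n = 1 then 1 else 0)"
proof -
  let ?P = "prime_factors n"
  have "(\<Sum>d | d dvd n. moebius d) = (\<Sum>d | d dvd n \<and> squarefree d. (-1) ^ card (prime_factors d))"
    using assms by (intro sum.mono_neutral_cong_right) (auto simp: moebius_def intro: finite_divisors_nat)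
  also have "\<dots> = (\<Sum>S\<in>Pow ?P. (-1) ^ card S)"
  proof (rule sum.reindex_bij_witness[where i = "\<lambda>S. \<Prod>S" and j = prime_factors])
    fix d assume "d \<in> {d. d dvd n \<and> squarefree d}"
    then have d: "d dvd n" "squarefree d" by auto
    then have "d \<noteq> 0" using assms by (auto intro: Nat.gr0I)
    then have "d = (\<Prod>q\<in>prime_factors d. q ^ multiplicity q d)"
      using prod_prime_factors[of d] by simp
    also have "\<dots> = (\<Prod>q\<in>prime_factors d. q)"
    proof (rule prod.cong)
      fix q assume q: "q \<in> prime_factors d"
      then have "multiplicity q d \<le> 1"
        using d(2) \<open>d \<noteq> 0\<close> squarefree_factorial_semiring'[of d] by auto
      moreover have "multiplicity q d > 0" using q \<open>d \<noteq> 0\<close>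
        by (simp add: in_prime_factors_iff prime_multiplicity_gt_zero_iff prime_imp_prime_elem)
      ultimately show "q ^ multiplicity q d = q" by (simp add: le_Suc_eq)
    qed simp
    finally show "\<Prod>(prime_factors d) = d" by simp
    show "prime_factors d \<in> Pow ?P" using d assms dvd_prime_factors[of n d] by simp
  next
    fix S assume "S \<in> Pow ?P"
    then have S: "finite S" "\<And>q. q \<in> S \<Longrightarrow> Factorial_Ring.prime q" "\<And>q. q \<in> S \<Longrightarrow> q dvd n"
      using finite_subset by auto
    have "prime_factors (\<Prod>S) = (\<Union>q\<in>S. prime_factors q)"
    proof -
      have "0 \<notin> id ` S" using S(2) by (metis id_apply imageE not_prime_0)
      from prime_factors_prod[OF S(1) this] show ?thesis by simp
    qed
    also have "\<dots> = S" using S(2) by (auto simp: prime_prime_factors)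
    finally show "prime_factors (\<Prod>S) = S" .
    have cop: "coprime a b" if "a \<in> S" "b \<in> S" "a \<noteq> b" for a b
      using that S(2) primes_coprime by blast
    have "squarefree (\<Prod>S)"
      using S(1,2) cop by (intro squarefree_prod_coprime) (auto simp: squarefree_prime)
    moreover have "\<Prod>S dvd n"
      using S cop by (induction S rule: finite_induct) (auto intro!: divides_mult prod_coprime_right simp: coprime_commute)
    ultimately show "\<Prod>S \<in> {d. d dvd n \<and> squarefree d}" by simp
  qed auto
  also have "\<dots> = (if ?P = {} then 1 else 0)"
    by (rule sum_neg_one_power_card_Pow) simp
  also have "?P = {} \<longleftrightarrow> n = 1" using assms by (simp add: prime_factorization_empty_iff)
  finally show ?thesis by simp
qed

text \<open>Split \<open>ln (x / d)\<close> into \<open>ln x - ln n\<close> and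
  \<open>ln (n / d)\<close>: the first part survives only for \<open>n = 1\<close>, the second is
  Moebius inversion of \<open>ln\<close> as the divisor sum of \<open>mangoldt\<close>.\<close>

lemma sum_moebius_ln_divisors:
  assumes "n > 0" "x > 0"
  shows "(\<Sum>d | d dvd n. moebius d * ln (x / real d)) = (if n = 1 then ln x else 0) + mangoldt n"
proof -
  have fin: "finite {d. d dvd n}" using assms by simp
  have "(\<Sum>d | d dvd n. moebius d * ln (x / real d)) =
      (\<Sum>d | d dvd n. moebius d * (ln x - ln (real n)) + moebius d * ln (real (n div d)))"
  proof (rule sum.cong)
    fix d assume "d \<in> {d. d dvd n}"
    then obtain k where k: "n = d * k" by auto
    with assms have "d > 0" "k > 0" by (auto intro: Nat.gr0I)
    then show "moebius d * ln (x / real d) = moebius d * (ln x - ln (real n)) + moebius d * ln (real (n div d))"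
      using assms by (simp add: k ln_mult ln_div algebra_simps)
  qed simp
  also have "\<dots> = (\<Sum>d | d dvd n. moebius d) * (ln x - ln (real n)) + (\<Sum>d | d dvd n. moebius d * ln (real (n div d)))"
    by (simp add: sum.distrib sum_distrib_right)
  also have "(\<Sum>d | d dvd n. moebius d) * (ln x - ln (real n)) = (if n = 1 then ln x else 0)"
    using sum_moebius_divisors[OF assms(1)] by simp
  also have "(\<Sum>d | d dvd n. moebius d * ln (real (n div d))) =
      (\<Sum>d | d dvd n. \<Sum>e | e dvd n \<and> d * e dvd n. moebius d * mangoldt e)"
  proof (rule sum.cong)
    fix d assume "d \<in> {d. d dvd n}"
    then obtain k where k: "n = d * k" by auto
    with assms have dk: "d > 0" "k > 0" by (auto intro: Nat.gr0I)
    have "{e. e dvd k} = {e. e dvd n \<and> d * e dvd n}" using k dk by auto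
    moreover have "ln (real k) = (\<Sum>e | e dvd k. mangoldt e)"
      using mangoldt_sum[of k, where 'a=real] dk by simp
    ultimately show "moebius d * ln (real (n div d)) = (\<Sum>e | e dvd n \<and> d * e dvd n. moebius d * mangoldt e)"
      using k dk by (simp add: sum_distrib_left)
  qed simp
  also have "\<dots> = (\<Sum>e | e dvd n. \<Sum>d | d dvd n \<and> d * e dvd n. moebius d * mangoldt e)"
    using sum.swap_restrict[OF fin fin, of "\<lambda>d e. moebius d * mangoldt e" "\<lambda>d e. d * e dvd n"] by simp
  also have "\<dots> = (\<Sum>e | e dvd n. if e = n then mangoldt n else 0)"
  proof (rule sum.cong)
    fix e assume "e \<in> {e. e dvd n}"
    then obtain k where k: "n = e * k" by auto
    with assms have ek: "e > 0" "k > 0" by (auto intro: Nat.gr0I)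
    have "{d. d dvd n \<and> d * e dvd n} = {d. d dvd k}" using k ek by (auto simp: mult.commute[of _ e])
    then have "(\<Sum>d | d dvd n \<and> d * e dvd n. moebius d * mangoldt e) = (if k = 1 then 1 else 0) * mangoldt e"
      using sum_moebius_divisors[OF ek(2)] by (simp flip: sum_distrib_right)
    then show "(\<Sum>d | d dvd n \<and> d * e dvd n. moebius d * mangoldt e) = (if e = n then mangoldt n else 0)"
      using k ek by auto
  qed simp
  also have "\<dots> = mangoldt n" using fin by simp
  finally show ?thesis .
qed

context nonprincipal_character
begin

text \<open>If the value at \<open>1\<close> vanishes, the sum with \<open>mangoldt\<close> is
  \<open>- ln x + O(1)\<close>. The weights \<open>moebius d * ln (x / d)\<close> produce
  \<open>ln x\<close> plus this sum, while each \<open>harm_sum (x div d)\<close> is only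
  \<open>O(d / x)\<close>; the errors add up to \<open>x * ln x - ln (fact x) \<le> x\<close>, times
  \<open>2 * N / x\<close>.\<close>

lemma norm_ln_plus_sum_mangoldt_bounded:
  assumes "L_one = 0" and "x \<ge> 1"
  shows "norm (of_real (ln (real x)) + (\<Sum>n=1..x. ch n * of_real (mangoldt n / real n))) \<le> 2 * real N"
proof -
  let ?W = "\<lambda>d. ch d / of_nat d * of_real (moebius d * ln (real x / real d))"
  have "(\<Sum>d=1..x. ?W d * harm_sum (x div d)) =
      (\<Sum>n=1..x. \<Sum>d | d dvd n. ?W d * (ch (n div d) / of_nat (n div d)))"
    unfolding harm_sum_def sum_distrib_left
    by (rule sum_over_divisors_eq_sum_over_multiples[symmetric])
  also have "\<dots> = (\<Sum>n=1..x. ch n / of_nat n * of_real ((if n = 1 then ln (real x) else 0) + mangoldt n))"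
  proof (rule sum.cong)
    fix n assume n: "n \<in> {1..x}"
    have "(\<Sum>d | d dvd n. ?W d * (ch (n div d) / of_nat (n div d))) =
        (\<Sum>d | d dvd n. ch n / of_nat n * of_real (moebius d * ln (real x / real d)))"
    proof (rule sum.cong)
      fix d assume "d \<in> {d. d dvd n}"
      then obtain k where k: "n = d * k" by auto
      with n have "d > 0" "k > 0" by (auto intro: Nat.gr0I)
      then show "?W d * (ch (n div d) / of_nat (n div d)) = ch n / of_nat n * of_real (moebius d * ln (real x / real d))"
        by (simp add: k mult)
    qed simp
    also have "\<dots> = ch n / of_nat n * of_real (\<Sum>d | d dvd n. moebius d * ln (real x / real d))"
      by (simp only: sum_distrib_left of_real_sum)
    also have "(\<Sum>d | d dvd n. moebius d * ln (real x / real d)) = (if n = 1 then ln (real x) else 0) + mangoldt n"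
      using n assms by (intro sum_moebius_ln_divisors) auto
    finally show "(\<Sum>d | d dvd n. ?W d * (ch (n div d) / of_nat (n div d))) =
      ch n / of_nat n * of_real ((if n = 1 then ln (real x) else 0) + mangoldt n)" .
  qed simp
  also have "\<dots> = (\<Sum>n=1..x. (if n = 1 then of_real (ln (real x)) else 0) + ch n * of_real (mangoldt n / real n))"
    using one by (intro sum.cong) (auto simp: algebra_simps)
  also have "\<dots> = of_real (ln (real x)) + (\<Sum>n=1..x. ch n * of_real (mangoldt n / real n))"
    using assms by (simp add: sum.distrib)
  finally have eq: "of_real (ln (real x)) + (\<Sum>n=1..x. ch n * of_real (mangoldt n / real n)) =
      (\<Sum>d=1..x. ?W d * harm_sum (x div d))" by simp
  have "norm (\<Sum>d=1..x. ?W d * harm_sum (x div d)) \<le> (\<Sum>d=1..x. (2 * real N / real x) * ln (real x / real d))"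
  proof (rule order.trans[OF norm_sum sum_mono])
    fix d assume d: "d \<in> {1..x}"
    have "x < d * (x div d) + d" using d dividend_less_times_div[of d x] by (simp add: add.commute)
    then have "real x < real d * real (Suc (x div d))"
      by (metis add.commute mult_Suc_right of_nat_less_iff of_nat_mult)
    then have "2 * real N / real (Suc (x div d)) \<le> 2 * real N * real d / real x"
      using d by (simp add: field_simps mult_left_mono del: of_nat_Suc)
    then have h: "norm (harm_sum (x div d)) \<le> 2 * real N * real d / real x"
      using norm_harm_sum_minus_L_one[of "x div d"] assms(1) by simp
    have l: "ln (real x / real d) \<ge> 0" using d by simp
    have "norm (ch d) * \<bar>moebius d\<bar> \<le> 1 * 1"
      by (intro mult_mono norm_le abs_moebius_le) auto
    then have "norm (ch d) * \<bar>moebius d\<bar> * (ln (real x / real d) / real d) \<le> 1 * (ln (real x / real d) / real d)"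
      using l by (intro mult_right_mono) auto
    moreover have "norm (?W d) = norm (ch d) * \<bar>moebius d\<bar> * (ln (real x / real d) / real d)"
      using l by (simp add: norm_mult norm_divide abs_mult)
    ultimately have "norm (?W d) \<le> ln (real x / real d) / real d" by simp
    then have "norm (?W d * harm_sum (x div d)) \<le> (ln (real x / real d) / real d) * (2 * real N * real d / real x)"
      unfolding norm_mult[of "?W d"] using h l by (intro mult_mono) auto
    also have "\<dots> = (2 * real N / real x) * ln (real x / real d)" using d by (simp add: field_simps)
    finally show "norm (?W d * harm_sum (x div d)) \<le> (2 * real N / real x) * ln (real x / real d)" .
  qed
  also have "\<dots> = (2 * real N / real x) * (real x * ln (real x) - ln (fact x))"
  proof -
    have "(\<Sum>d=1..x. ln (real x / real d)) = (\<Sum>d=1..x. ln (real x) - ln (real d))"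
      using assms by (intro sum.cong) (auto simp: ln_div)
    also have "\<dots> = real x * ln (real x) - ln (fact x)"
      by (simp add: sum_subtractf fact_prod, subst ln_prod) auto
    finally show ?thesis by (simp only: sum_distrib_left[symmetric])
  qed
  also have "\<dots> \<le> (2 * real N / real x) * real x"
    by (intro mult_left_mono) (use ln_fact_ge[of x] assms in auto)
  also have "\<dots> = 2 * real N" using assms by simp
  finally show ?thesis unfolding eq .
qed

end

text \<open>Monsky's argument: if the series of the character at 1 vanished, the Lambert series
  \<open>\<Sum>ch(n) x^n / (1 - x^n)\<close> would stay bounded as \<open>x\<close> tends to 1, but its power series
  coefficients are nonnegative and at least 1 at the squares.\<close>

lemma sum_divisors_prime_power_times:
  fixes f :: "nat \<Rightarrow> real"
  assumes f: "\<And>m n. f (m * n) = f m * f n" and q: "Factorial_Ring.prime q" "\<not> q dvd m" "m > 0"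
  shows "(\<Sum>d | d dvd q ^ k * m. f d) = (\<Sum>i\<le>k. f (q ^ i)) * (\<Sum>d | d dvd m. f d)"
proof -
  have "(\<Sum>i\<le>k. f (q ^ i)) * (\<Sum>d | d dvd m. f d) = (\<Sum>(i, d)\<in>{..k} \<times> {d. d dvd m}. f (q ^ i * d))"
    by (simp add: sum_product sum.cartesian_product f)
  also have "\<dots> = (\<Sum>d | d dvd q ^ k * m. f d)"
  proof (rule sum.reindex_cong[symmetric, where l = "\<lambda>(i, d). q ^ i * d"])
    have nd: "\<not> q dvd d" if "d dvd m" for d using that q(2) dvd_trans by blast
    show "inj_on (\<lambda>(i, d). q ^ i * d) ({..k} \<times> {d. d dvd m})"
    proof (rule inj_onI, clarify)
      fix i d i' d' assume d: "d dvd m" "d' dvd m" and eq: "q ^ i * d = q ^ i' * d'"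
      have "multiplicity q (q ^ j * e) = j" if "e dvd m" for j e
        using nd[OF that] that q by (intro multiplicity_eqI) (auto simp: power_Suc2 prime_gt_0_nat simp del: power_Suc)
      from this[OF d(1), of i] this[OF d(2), of i'] eq have "i = i'" by simp
      with eq q show "i = i' \<and> d = d'" by (simp add: prime_gt_0_nat)
    qed
    show "{d. d dvd q ^ k * m} = (\<lambda>(i, d). q ^ i * d) ` ({..k} \<times> {d. d dvd m})"
    proof (intro equalityI subsetI)
      fix d assume "d \<in> {d. d dvd q ^ k * m}"
      then obtain a b where ab: "d = a * b" "a dvd q ^ k" "b dvd m"
        using division_decomp[of d "q ^ k" m] by blast
      then obtain i where "i \<le> k" "a = q ^ i" using divides_primepow_nat[OF q(1)] by blast
      then show "d \<in> (\<lambda>(i, d). q ^ i * d) ` ({..k} \<times> {d. d dvd m})" using ab by force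
    qed (auto intro!: mult_dvd_mono le_imp_power_dvd)
  qed (auto)
  finally show ?thesis by simp
qed

text \<open>By multiplicativity it suffices to consider the sums of \<open>f q ^ i\<close> over
  \<open>i \<le> k\<close>, which are nonnegative for each of the three possible values of
  \<open>f q\<close>.\<close>

lemma sum_divisors_sign_nonneg:
  fixes f :: "nat \<Rightarrow> real"
  assumes f: "\<And>m n. f (m * n) = f m * f n" "f 1 = 1" "\<And>n. f n \<in> {-1, 0, 1}" and "n > 0"
  shows "(\<Sum>d | d dvd n. f d) \<ge> 0"
  using \<open>n > 0\<close>
proof (induction n rule: less_induct)
  case (less n)
  show ?case
  proof (cases "n = 1")
    case True then show ?thesis using f(2) by simp
  next
    case False
    then obtain q where q: "Factorial_Ring.prime q" "q dvd n" using prime_factor_nat by blast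
    define k where "k = multiplicity q n"
    obtain m where m: "n = q ^ k * m" "\<not> q dvd m"
      using multiplicity_decompose'[of n q] q less.prems unfolding k_def
      by (metis not_prime_unit prime_gt_0_nat gr_implies_not_zero)
    have k: "k > 0" using q m by (intro Nat.gr0I) auto
    have m0: "m > 0" using m less.prems by (intro Nat.gr0I) auto
    have "1 < q ^ k" using k prime_gt_1_nat[OF q(1)] by (intro one_less_power) auto
    then have "m < n" using m m0 by simp
    then have "(\<Sum>d | d dvd m. f d) \<ge> 0" using less.IH m0 by blast
    moreover have "(\<Sum>i\<le>k. f (q ^ i)) \<ge> 0"
    proof -
      have pw: "f (q ^ i) = f q ^ i" for i by (induction i) (use f in auto)
      have "(\<Sum>i\<le>k. (-1::real) ^ i) = (if even k then 1 else 0)"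
        by (induction k) auto
      then have "(\<Sum>i\<le>k. (-1::real) ^ i) \<ge> 0" by simp
      then show ?thesis using f(3)[of q] by (elim insertE emptyE) (simp_all add: pw sum_nonneg)
    qed
    ultimately show ?thesis
      unfolding m(1) sum_divisors_prime_power_times[OF f(1) q(1) m(2) m0] by simp
  qed
qed

text \<open>In a square all exponents are even, and then each of the local factors is at least
  \<open>1\<close>.\<close>

lemma sum_divisors_sign_square:
  fixes f :: "nat \<Rightarrow> real"
  assumes f: "\<And>m n. f (m * n) = f m * f n" "f 1 = 1" "\<And>n. f n \<in> {-1, 0, 1}" and "n > 0"
  shows "(\<Sum>d | d dvd n\<^sup>2. f d) \<ge> 1"
  using \<open>n > 0\<close>
proof (induction n rule: less_induct)
  case (less n)
  show ?case
  proof (cases "n = 1")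
    case True then show ?thesis using f(2) by simp
  next
    case False
    then obtain q where q: "Factorial_Ring.prime q" "q dvd n" using prime_factor_nat by blast
    define k where "k = multiplicity q n"
    obtain m where m: "n = q ^ k * m" "\<not> q dvd m"
      using multiplicity_decompose'[of n q] q less.prems unfolding k_def
      by (metis not_prime_unit prime_gt_0_nat gr_implies_not_zero)
    have k: "k > 0" using q m by (intro Nat.gr0I) auto
    have m0: "m > 0" using m less.prems by (intro Nat.gr0I) auto
    have "1 < q ^ k" using k prime_gt_1_nat[OF q(1)] by (intro one_less_power) auto
    then have "m < n" using m m0 by simp
    then have 1: "(\<Sum>d | d dvd m\<^sup>2. f d) \<ge> 1" using less.IH m0 by blast
    have n2: "n\<^sup>2 = q ^ (2 * k) * m\<^sup>2" by (simp add: m(1) power_mult_distrib power_mult[symmetric] mult.commute)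
    have nd: "\<not> q dvd m\<^sup>2" using m(2) q(1) prime_dvd_power_nat by blast
    have "(\<Sum>i\<le>2*k. f (q ^ i)) \<ge> 1"
    proof -
      have pw: "f (q ^ i) = f q ^ i" for i by (induction i) (use f in auto)
      have "(\<Sum>i\<le>2*k. (-1::real) ^ i) = 1" by (induction k) auto
      moreover have "(\<Sum>i\<le>2*k. (0::real) ^ i) = 1" by (induction k) auto
      ultimately show ?thesis using f(3)[of q] by (auto simp: pw)
    qed
    then show ?thesis
      unfolding n2 using sum_divisors_prime_power_times[OF f(1) q(1) nd, of "2 * k"] 1 m0
      by (simp) (metis mult_mono' mult_1 zero_le_one)
  qed
qed

text \<open>The inequality of arithmetic and geometric means for the exponents \<open>i\<close> and
  \<open>d - 1 - i\<close>. It will give the monotonicity of the coefficients \<open>b\<close> in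
  the next proof; this is why the argument there is a square \<open>x = y\<^sup>2\<close>.\<close>

lemma geometric_sum_ge:
  fixes y :: real assumes "0 < y"
  shows "(\<Sum>i<d. (y\<^sup>2) ^ i) \<ge> real d * y ^ (d - 1)"
proof -
  have "(\<Sum>i<d. (y\<^sup>2) ^ i) = (\<Sum>i<d. (y\<^sup>2) ^ (d - Suc i))"
    by (rule sum.nat_diff_reindex[symmetric])
  then have "2 * (\<Sum>i<d. (y\<^sup>2) ^ i) = (\<Sum>i<d. (y\<^sup>2) ^ i + (y\<^sup>2) ^ (d - Suc i))"
    by (simp add: sum.distrib)
  also have "\<dots> \<ge> (\<Sum>i<d. 2 * y ^ (d - 1))"
  proof (rule sum_mono)
    fix i assume "i \<in> {..<d}"
    then have "y ^ (d - 1) = y ^ i * y ^ (d - Suc i)" by (simp flip: power_add)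
    then show "2 * y ^ (d - 1) \<le> (y\<^sup>2) ^ i + (y\<^sup>2) ^ (d - Suc i)"
      using sum_squares_bound[of "y ^ i" "y ^ (d - Suc i)"] by (simp add: power_mult[symmetric] mult_ac)
  qed
  finally show ?thesis by simp
qed

context nonprincipal_character
begin

lemma L_one_nonzero_if_real:
  assumes r: "\<And>n. ch n \<in> {-1, 0, 1}"
  shows "L_one \<noteq> 0"
proof
  assume L0: "L_one = 0"
  define f where "f n = Re (ch n)" for n
  have chf: "ch n = of_real (f n)" for n using r[of n] by (auto simp: f_def)
  have f: "\<And>m n. f (m * n) = f m * f n" "f 1 = 1" "\<And>n. f n \<in> {-1, 0, 1}"
  proof -
    show "f (m * n) = f m * f n" for m n
      using mult[of m n] unfolding chf by (simp flip: of_real_mult)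
    show "f 1 = 1" using one by (simp add: f_def)
    show "f n \<in> {-1, 0, 1}" for n using r[of n] by (auto simp: f_def)
  qed
  define A where "A m = (\<Sum>d | d dvd m. f d)" for m
  \<comment> \<open>The squares up to \<open>K\<^sup>2\<close> contribute at least
    \<open>3 / 4\<close> each, and the upper bound tends to \<open>2 * N\<close>; this value of
    \<open>K\<close> makes the two incompatible.\<close>
  define K where "K = 4 * N + 4"
  obtain y :: real where y: "0 < y" "y < 1" "(y\<^sup>2) ^ (K\<^sup>2) \<ge> 3 / 4"
  proof -
    have "((\<lambda>y::real. (y\<^sup>2) ^ (K\<^sup>2)) \<longlongrightarrow> (1\<^sup>2) ^ (K\<^sup>2)) (at_left 1)"
      by (intro tendsto_intros)
    then have "eventually (\<lambda>y::real. (y\<^sup>2) ^ (K\<^sup>2) > 3 / 4) (at_left 1)"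
      by (rule order_tendstoD) simp
    moreover have "eventually (\<lambda>y::real. y \<in> {0<..<1}) (at_left 1)"
      by (rule eventually_at_left_real) simp
    ultimately have "eventually (\<lambda>y::real. (y\<^sup>2) ^ (K\<^sup>2) > 3 / 4 \<and> y \<in> {0<..<1}) (at_left 1)"
      by eventually_elim auto
    then obtain y :: real where "(y\<^sup>2) ^ (K\<^sup>2) > 3 / 4 \<and> y \<in> {0<..<1}"
      using eventually_happens[of _ "at_left (1::real)"] by auto
    then show ?thesis using that by auto
  qed
  define x where "x = y\<^sup>2"
  have x: "0 < x" "x < 1" using y by (auto simp: x_def power_less_one_iff)
  define g where "g d = (\<Sum>i<d. x ^ i)" for d
  \<comment> \<open>Chosen such that \<open>(1 - x) * x ^ d / (1 - x ^ d) = 1 / d - b d\<close>. The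
    part \<open>1 / d\<close> sums to almost \<open>L_one = 0\<close>; the part \<open>b\<close>
    decreases, so Abel summation bounds it by a multiple of \<open>b 1 = 1 - x\<close>, which
    cancels the factor \<open>1 - x\<close>.\<close>
  define b where "b d = 1 / real d - x ^ d / g d" for d
  have g_pos: "g d > 0" if "d \<ge> 1" for d
    unfolding g_def using that x by (intro sum_pos2[of _ 0]) auto
  have g_geom: "(1 - x) * g d = 1 - x ^ d" for d
    using sum_gp_strict[of x d] x by (simp add: g_def)
  have b_nonneg: "b d \<ge> 0" if "d \<ge> 1" for d
  proof -
    have "real d * x ^ d = (\<Sum>i<d. x ^ d)" by simp
    also have "\<dots> \<le> g d"
      unfolding g_def by (intro sum_mono power_decreasing) (use x in auto)
    finally show ?thesis using g_pos[OF that] that by (simp add: b_def field_simps)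
  qed
  \<comment> \<open>Since \<open>g (Suc d) = 1 + x * g d\<close>, the claim amounts to
    \<open>d * (d + 1) * x ^ d \<le> g d * g (d + 1)\<close>, and the two geometric sums are
    estimated from below by their middle terms.\<close>
  have b_dec: "b (Suc d) \<le> b d" if d: "d \<ge> 1" for d
  proof -
    have "g d \<ge> real d * y ^ (d - 1)" "g (Suc d) \<ge> real (Suc d) * y ^ d"
      using geometric_sum_ge[OF y(1), of d] geometric_sum_ge[OF y(1), of "Suc d"]
      by (auto simp: g_def x_def)
    then have "g d * g (Suc d) \<ge> (real d * y ^ (d - 1)) * (real (Suc d) * y ^ d)"
      by (intro mult_mono) (use y g_pos[OF d] in auto)
    also have "(real d * y ^ (d - 1)) * (real (Suc d) * y ^ d) = real d * real (Suc d) * y ^ (d - 1 + d)"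
      by (simp add: power_add)
    also have "\<dots> \<ge> real d * real (Suc d) * y ^ (d + d)"
      using y by (intro mult_left_mono power_decreasing) auto
    finally have ge: "real d * real (Suc d) * x ^ d \<le> g d * g (Suc d)"
      by (simp add: x_def power_mult[symmetric] mult_2)
    have gs: "g (Suc d) = 1 + x * g d"
      unfolding g_def by (simp add: sum.lessThan_Suc_shift sum_distrib_left del: sum.lessThan_Suc)
    have "x ^ d / g d - x ^ Suc d / g (Suc d) = x ^ d / (g d * g (Suc d))"
      using g_pos[OF d] g_pos[of "Suc d"] by (simp add: field_simps) (simp add: gs algebra_simps)
    also have "\<dots> \<le> 1 / (real d * real (Suc d))"
      using ge g_pos[OF d] g_pos[of "Suc d"] d by (simp add: field_simps del: of_nat_Suc)
    also have "\<dots> = 1 / real d - 1 / real (Suc d)"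
      using d by (simp add: field_simps)
    finally show ?thesis by (simp add: b_def)
  qed
  \<comment> \<open>The Lambert series is truncated at \<open>M\<close>; the last two terms are the
    cost of this and vanish as \<open>M\<close> grows.\<close>
  have key: "(\<Sum>m=1..M. A m * x ^ m) \<le> 2 * real N + 2 * real N / (real (Suc M) * (1 - x)) + real M * (x ^ M / (1 - x))" for M
  proof -
    have main: "(\<Sum>d=1..M. f d * (x ^ d / (1 - x ^ d))) \<le> 2 * real N / (real (Suc M) * (1 - x)) + 2 * real N * (1 / (1-x) * b 1)"
    proof -
      have "(\<Sum>d=1..M. f d * (x ^ d / (1 - x ^ d))) =
          (\<Sum>d=1..M. f d / real d / (1 - x) - f d * b d / (1 - x))"
      proof (rule sum.cong)
        fix d assume d: "d \<in> {1..M}"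
        have "x ^ d / (1 - x ^ d) = x ^ d / g d / (1 - x)"
          using g_geom[of d] by (simp add: field_simps)
        then show "f d * (x ^ d / (1 - x ^ d)) = f d / real d / (1 - x) - f d * b d / (1 - x)"
          by (simp add: b_def right_diff_distrib diff_divide_distrib)
      qed simp
      also have "\<dots> = ((\<Sum>d=1..M. f d / real d) - (\<Sum>d=1..M. f d * b d)) / (1 - x)"
        by (simp add: sum_subtractf sum_divide_distrib diff_divide_distrib)
      also have "\<dots> \<le> (2 * real N / real (Suc M) + 2 * real N * b 1) / (1 - x)"
      proof (intro divide_right_mono)
        have "harm_sum M = of_real (\<Sum>d=1..M. f d / real d)" by (simp add: harm_sum_def chf)
        then have 1: "\<bar>\<Sum>d=1..M. f d / real d\<bar> \<le> 2 * real N / real (Suc M)"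
          using norm_harm_sum_minus_L_one[of M] L0 by (simp only: diff_zero norm_of_real)
        have "(\<Sum>d=1..<Suc M. ch d * of_real (b d)) = of_real (\<Sum>d=1..M. f d * b d)"
          by (simp add: chf atLeastLessThanSuc_atLeastAtMost)
        then have 2: "\<bar>\<Sum>d=1..M. f d * b d\<bar> \<le> 2 * real N * b 1"
          using norm_sum_antimono_le[of 1 b "Suc M"] b_dec b_nonneg by (simp only: norm_of_real)
        show "(\<Sum>d=1..M. f d / real d) - (\<Sum>d=1..M. f d * b d) \<le> 2 * real N / real (Suc M) + 2 * real N * b 1"
          using 1 2 by linarith
      qed (use x in simp)
      finally show ?thesis by (simp add: add_divide_distrib)
    qed
    have b1: "1 / (1 - x) * b 1 = 1" using x by (simp add: b_def g_def)
    have "(\<Sum>m=1..M. A m * x ^ m) = (\<Sum>m=1..M. \<Sum>d | d dvd m. f d * x ^ (d * (m div d)))"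
      by (simp add: A_def sum_distrib_right)
    also have "\<dots> = (\<Sum>d=1..M. \<Sum>k=1..M div d. f d * x ^ (d * k))"
      by (rule sum_over_divisors_eq_sum_over_multiples)
    also have "\<dots> \<le> (\<Sum>d=1..M. f d * (x ^ d / (1 - x ^ d)) + x ^ M / (1 - x))"
    proof (rule sum_mono)
      fix d assume d: "d \<in> {1..M}"
      have xd: "0 < x ^ d" "x ^ d < 1" using x d by (auto simp: power_less_one_iff)
      have "x ^ d / (1 - x ^ d) - (\<Sum>k=1..M div d. x ^ (d * k)) = (x ^ d) ^ Suc (M div d) / (1 - x ^ d)"
      proof -
        have "(\<Sum>k=1..M div d. x ^ (d * k)) = (\<Sum>k\<le>M div d. (x ^ d) ^ k) - 1"
          by (simp add: power_mult atMost_atLeast0 sum.atLeast_Suc_atMost[of 0])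
        also have "(\<Sum>k\<le>M div d. (x ^ d) ^ k) = (1 - (x ^ d) ^ Suc (M div d)) / (1 - x ^ d)"
          using xd sum_gp0[of "x ^ d" "M div d"] by simp
        finally show ?thesis using xd by (simp add: field_simps)
      qed
      moreover have "(x ^ d) ^ Suc (M div d) / (1 - x ^ d) \<le> x ^ M / (1 - x)"
      proof (rule frac_le)
        have "M \<le> d * Suc (M div d)" using d dividend_less_times_div[of d M] by simp
        then show "(x ^ d) ^ Suc (M div d) \<le> x ^ M"
          unfolding power_mult[symmetric] by (intro power_decreasing) (use x in auto)
        show "1 - x \<le> 1 - x ^ d" using x d power_decreasing[of 1 d x] by simp
      qed (use x in auto)
      moreover have "0 \<le> (x ^ d) ^ Suc (M div d) / (1 - x ^ d)" using xd by simp
      ultimately have "\<bar>x ^ d / (1 - x ^ d) - (\<Sum>k=1..M div d. x ^ (d * k))\<bar> \<le> x ^ M / (1 - x)"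
        by linarith
      then have "\<bar>f d\<bar> * \<bar>x ^ d / (1 - x ^ d) - (\<Sum>k=1..M div d. x ^ (d * k))\<bar> \<le> x ^ M / (1 - x)"
        using f(3)[of d] x by auto
      then have "- (f d * (x ^ d / (1 - x ^ d) - (\<Sum>k=1..M div d. x ^ (d * k)))) \<le> x ^ M / (1 - x)"
        unfolding abs_mult[symmetric] by linarith
      then show "(\<Sum>k=1..M div d. f d * x ^ (d * k)) \<le> f d * (x ^ d / (1 - x ^ d)) + x ^ M / (1 - x)"
        by (simp add: right_diff_distrib sum_distrib_left)
    qed
    also have "\<dots> = (\<Sum>d=1..M. f d * (x ^ d / (1 - x ^ d))) + real M * (x ^ M / (1 - x))"
      by (simp add: sum.distrib)
    finally show ?thesis using main b1 by simp
  qed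
  have low: "(\<Sum>m=1..M. A m * x ^ m) \<ge> real K * (3 / 4)" if M: "M \<ge> K\<^sup>2" for M
  proof -
    have "real K * (3 / 4) = (\<Sum>k=1..K. 3 / 4 :: real)" by simp
    also have "\<dots> \<le> (\<Sum>k=1..K. A (k\<^sup>2) * x ^ (k\<^sup>2))"
    proof (rule sum_mono)
      fix k assume k: "k \<in> {1..K}"
      have "1 * (3 / 4) \<le> A (k\<^sup>2) * x ^ (k\<^sup>2)"
      proof (rule mult_mono)
        show "1 \<le> A (k\<^sup>2)" unfolding A_def using k by (intro sum_divisors_sign_square f) auto
        have "x ^ (K\<^sup>2) \<le> x ^ (k\<^sup>2)" using x k by (intro power_decreasing power_mono) auto
        then show "3 / 4 \<le> x ^ (k\<^sup>2)" using y(3) by (simp add: x_def)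
        then show "0 \<le> A (k\<^sup>2)" using \<open>1 \<le> A (k\<^sup>2)\<close> by simp
      qed simp
      then show "3 / 4 \<le> A (k\<^sup>2) * x ^ (k\<^sup>2)" by simp
    qed
    also have "\<dots> = (\<Sum>m\<in>(\<lambda>k. k\<^sup>2) ` {1..K}. A m * x ^ m)"
      by (subst sum.reindex) (auto simp: inj_on_def)
    also have "\<dots> \<le> (\<Sum>m=1..M. A m * x ^ m)"
    proof (rule sum_mono2)
      show "(\<lambda>k. k\<^sup>2) ` {1..K} \<subseteq> {1..M}"
        using M by (auto intro: order.trans[OF power_mono])
      show "0 \<le> A m * x ^ m" if "m \<in> {1..M} - (\<lambda>k. k\<^sup>2) ` {1..K}" for m
        using that x unfolding A_def by (intro mult_nonneg_nonneg sum_divisors_sign_nonneg f) auto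
    qed simp
    finally show ?thesis .
  qed
  have "(\<lambda>M. 2 * real N + 2 * real N / (real (Suc M) * (1 - x)) + real M * (x ^ M / (1 - x))) \<longlonglongrightarrow> 2 * real N + 0 + 0"
  proof (intro tendsto_add tendsto_const)
    have "(\<lambda>M. (2 * real N / (1 - x)) * inverse (real (Suc M))) \<longlonglongrightarrow> (2 * real N / (1 - x)) * 0"
      by (intro tendsto_intros LIMSEQ_inverse_real_of_nat)
    then show "(\<lambda>M. 2 * real N / (real (Suc M) * (1 - x))) \<longlonglongrightarrow> 0"
      by (simp add: field_simps)
    have "(\<lambda>M. (real M * x ^ M) / (1 - x)) \<longlonglongrightarrow> 0 / (1 - x)"
      using x by (intro tendsto_intros powser_times_n_limit_0) auto
    then show "(\<lambda>M. real M * (x ^ M / (1 - x))) \<longlonglongrightarrow> 0" by simp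
  qed
  moreover have "eventually (\<lambda>M. real K * (3 / 4) \<le> 2 * real N + 2 * real N / (real (Suc M) * (1 - x)) + real M * (x ^ M / (1 - x))) sequentially"
    using eventually_ge_at_top[of "K\<^sup>2"] by eventually_elim (use low key in \<open>blast intro: order.trans\<close>)
  ultimately have "real K * (3 / 4) \<le> 2 * real N + 0 + 0"
    by (intro tendsto_lowerbound) auto
  then show False by (simp add: K_def)
qed

end

section \<open>Primes congruent to one\<close>

locale characters_mod_prime =
  fixes p g :: nat
  assumes p: "Factorial_Ring.prime p" "p > 2" and g: "residue_primroot p g"
begin

definition \<omega> :: complex where "\<omega> = cis (2 * pi / real (p - 1))"

text \<open>The discrete logarithm to the base \<open>g\<close>, exponentiated. The index is
  determined modulo \<open>p - 1\<close>, the order of \<open>\<omega>\<close>, so its choice does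
  not matter. The characters modulo \<open>p\<close> are the \<open>chr j\<close> with
  \<open>j < p - 1\<close>, and \<open>j = 0\<close> gives the principal one.\<close>

definition chr :: "nat \<Rightarrow> nat \<Rightarrow> complex" where
  "chr j n = (if p dvd n then 0 else \<omega> ^ (j * (SOME i. [g ^ i = n] (mod p))))"

lemma omega_power_eq_1_iff: "\<omega> ^ k = 1 \<longleftrightarrow> (p - 1) dvd k"
proof
  assume "(p - 1) dvd k"
  then obtain l where l: "k = (p - 1) * l" by blast
  have "\<omega> ^ (p - 1) = 1" using p(2) by (simp add: \<omega>_def Complex.DeMoivre)
  then show "\<omega> ^ k = 1" by (simp add: l power_mult)
next
  assume "\<omega> ^ k = 1"
  then have "cis (real k * (2 * pi / real (p - 1))) = 1" by (simp add: \<omega>_def Complex.DeMoivre)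
  then have "cos (real k * (2 * pi / real (p - 1))) = 1" by (simp add: complex_eq_iff)
  then obtain l :: int where "real k * (2 * pi / real (p - 1)) = of_int l * 2 * pi"
    using cos_one_2pi_int by blast
  then have "(real k / real (p - 1)) * (2 * pi) = of_int l * (2 * pi)"
    by (simp only: times_divide_eq_right times_divide_eq_left mult.assoc)
  moreover have "2 * pi \<noteq> 0" by simp
  ultimately have "real k / real (p - 1) = of_int l" by (simp only: mult_right_cancel not_False_eq_True)
  then have "real k = of_int l * real (p - 1)" using p(2) by (simp only: divide_eq_eq split: if_splits)
  then have "of_int (int k) = (of_int (l * int (p - 1)) :: real)" by simp
  then have "int k = l * int (p - 1)" by (simp only: of_int_eq_iff)
  then have "int (p - 1) dvd int k" by simp
  then show "(p - 1) dvd k" by (simp only: int_dvd_int_iff)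
qed

lemma g_coprime: "coprime p g" and ord_g: "ord p g = p - 1"
  using g p by (auto simp: residue_primroot_def totient_prime)

lemma ex_index: assumes "\<not> p dvd n" shows "\<exists>i<p-1. [g ^ i = n] (mod p)"
proof -
  have "bij_betw (\<lambda>i. g ^ i mod p) {..<p-1} (totatives p)"
    using residue_primroot_is_generator[OF _ g] p by (simp add: totient_prime)
  moreover have "n mod p \<in> totatives p"
    using assms p by (auto simp: totatives_prime mod_greater_zero_iff_not_dvd)
  ultimately obtain i where "i < p - 1" "n mod p = g ^ i mod p" by (auto simp: bij_betw_def)
  then show ?thesis by (auto simp: cong_def)
qed

lemma chr_eq: assumes "[g ^ i = n] (mod p)" shows "chr j n = \<omega> ^ (j * i)"
proof -
  have nd: "\<not> p dvd n"
    using assms g_coprime p(1) by (metis cong_dvd_iff coprime_absorb_left coprime_power_right_iff not_prime_unit)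
  define i' where "i' = (SOME i. [g ^ i = n] (mod p))"
  have "[g ^ i' = n] (mod p)" unfolding i'_def using assms by (rule someI)
  then have "[g ^ i' = g ^ i] (mod p)" using assms by (metis cong_sym cong_trans)
  then have "[i' = i] (mod (p - 1))" using order_divides_expdiff[OF g_coprime] ord_g by simp
  then obtain q1 q2 where q: "i + q2 * (p - 1) = i' + q1 * (p - 1)" unfolding cong_iff_lin_nat by blast
  have "\<omega> ^ (j * (m + l * (p - 1))) = \<omega> ^ (j * m)" for m l
    using omega_power_eq_1_iff[of "j * (l * (p - 1))"] by (simp add: distrib_left power_add)
  from this[of i' q1] this[of i q2] q have "\<omega> ^ (j * i') = \<omega> ^ (j * i)" by simp
  then show ?thesis using nd by (simp add: chr_def i'_def)
qed

lemma chr_cong: "[m = n] (mod p) \<Longrightarrow> chr j m = chr j n"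
  using ex_index[of m] chr_eq cong_dvd_iff[of m n p] chr_def by (metis cong_trans)

lemma chr_mult: "chr j (m * n) = chr j m * chr j n"
proof (cases "p dvd m \<or> p dvd n")
  case True then show ?thesis by (auto simp: chr_def)
next
  case False
  then obtain a b where ab: "[g ^ a = m] (mod p)" "[g ^ b = n] (mod p)" using ex_index by blast
  then have "[g ^ (a + b) = m * n] (mod p)" by (simp add: power_add cong_mult)
  then show ?thesis
    using chr_eq[of "a + b" "m * n" j] chr_eq[OF ab(1), of j] chr_eq[OF ab(2), of j] by (simp add: distrib_left power_add)
qed

lemma chr_one: "chr j 1 = 1" using chr_eq[of 0 1 j] by simp

lemma norm_omega: "norm \<omega> = 1" by (simp add: \<omega>_def)

lemma norm_chr_le: "norm (chr j n) \<le> 1"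
  using ex_index[of n] by (cases "p dvd n") (auto simp: chr_eq norm_power norm_omega, simp add: chr_def)

lemma sum_omega: "(\<Sum>i<p-1. \<omega> ^ (j * i)) = (if (p - 1) dvd j then of_nat (p - 1) else 0)"
proof (cases "(p - 1) dvd j")
  case True
  then have "\<omega> ^ j = 1" by (simp add: omega_power_eq_1_iff)
  then show ?thesis using True by (simp add: power_mult)
next
  case False
  then have "\<omega> ^ j \<noteq> 1" by (simp add: omega_power_eq_1_iff)
  moreover have "(\<omega> ^ j) ^ (p - 1) = 1" using omega_power_eq_1_iff[of "j * (p - 1)"] by (simp add: power_mult)
  ultimately have "(\<Sum>i<p-1. (\<omega> ^ j) ^ i) = 0"
    using geometric_sum[of "\<omega> ^ j" "p - 1"] by simp
  then show ?thesis using False by (simp add: power_mult)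
qed

lemma sum_chr_period: assumes "\<not> (p - 1) dvd j" shows "(\<Sum>n<p. chr j n) = 0"
proof -
  have "(\<Sum>n<p. chr j n) = (\<Sum>n\<in>totatives p. chr j n)"
    using p by (intro sum.mono_neutral_right) (auto simp: totatives_prime chr_def nat_dvd_not_less)
  also have "\<dots> = (\<Sum>i<p-1. chr j (g ^ i mod p))"
  proof -
    have "bij_betw (\<lambda>i. g ^ i mod p) {..<p-1} (totatives p)"
      using residue_primroot_is_generator[OF _ g] p by (simp add: totient_prime)
    then show ?thesis by (rule sum.reindex_bij_betw[symmetric])
  qed
  also have "\<dots> = (\<Sum>i<p-1. \<omega> ^ (j * i))"
    by (intro sum.cong refl chr_eq) (simp add: cong_def)
  finally show ?thesis using sum_omega[of j] assms by simp
qed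

lemma sum_chr_all: "(\<Sum>j<p-1. chr j n) = (if [n = 1] (mod p) then of_nat (p - 1) else 0)"
proof (cases "p dvd n")
  case True
  then have "\<not> [n = 1] (mod p)" using p(1) by (metis cong_dvd_iff not_prime_unit)
  then show ?thesis using True by (simp add: chr_def)
next
  case False
  then obtain i where i: "i < p - 1" "[g ^ i = n] (mod p)" using ex_index by blast
  have "(\<Sum>j<p-1. chr j n) = (\<Sum>j<p-1. \<omega> ^ (i * j))"
    using chr_eq[OF i(2)] by (simp add: mult.commute)
  moreover have "(p - 1) dvd i \<longleftrightarrow> [n = 1] (mod p)"
  proof -
    have "[n = 1] (mod p) \<longleftrightarrow> [g ^ i = 1] (mod p)" using i(2) by (metis cong_sym cong_trans)
    then show ?thesis using ord_divides[of g i p] ord_g by simp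
  qed
  ultimately show ?thesis using sum_omega[of i] by simp
qed

lemma nonprincipal: assumes "0 < j" "j < p - 1" shows "nonprincipal_character p (chr j)"
proof
  show "p > 0" using p by simp
  show "chr j (n + p) = chr j n" for n by (rule chr_cong) (simp add: cong_def)
  show "(\<Sum>n<p. chr j n) = 0" using assms by (intro sum_chr_period) (auto dest: dvd_imp_le)
qed (rule chr_mult chr_one norm_chr_le)+

lemma chr_conj: assumes "j \<le> p - 1" shows "chr (p - 1 - j) n = cnj (chr j n)"
proof (cases "p dvd n")
  case False
  then obtain i where i: "[g ^ i = n] (mod p)" using ex_index by blast
  have "cnj (\<omega> ^ k) * \<omega> ^ k = 1" for k
    using complex_norm_square[of "\<omega> ^ k"] by (simp add: norm_power norm_omega mult.commute)
  moreover have "\<omega> ^ ((p - 1 - j) * i) * \<omega> ^ (j * i) = 1"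
  proof -
    have "(p - 1 - j) * i + j * i = (p - 1) * i" using assms by (metis distrib_right le_add_diff_inverse2)
    then show ?thesis using omega_power_eq_1_iff[of "(p - 1) * i"] by (simp only: power_add[symmetric]) simp
  qed
  ultimately have "\<omega> ^ ((p - 1 - j) * i) = cnj (\<omega> ^ (j * i))"
    by (metis mult_cancel_right mult_zero_right zero_neq_one)
  then show ?thesis using chr_eq[OF i] by simp
qed (simp add: chr_def)

definition msum :: "nat \<Rightarrow> nat \<Rightarrow> complex" where
  "msum j x = (\<Sum>n=1..x. chr j n * of_real (mangoldt n / real n))"

lemma sum_msum: "(\<Sum>j<p-1. msum j x) = of_nat (p - 1) * of_real (\<Sum>n | n \<in> {1..x} \<and> [n = 1] (mod p). mangoldt n / real n)"
proof -
  have "(\<Sum>j<p-1. msum j x) = (\<Sum>n=1..x. (\<Sum>j<p-1. chr j n) * of_real (mangoldt n / real n))"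
    unfolding msum_def by (subst sum.swap) (simp only: sum_distrib_right)
  also have "\<dots> = (\<Sum>n=1..x. if [n = 1] (mod p) then of_nat (p - 1) * of_real (mangoldt n / real n) else 0)"
    by (intro sum.cong refl) (subst sum_chr_all, simp)
  also have "\<dots> = (\<Sum>n | n \<in> {1..x} \<and> [n = 1] (mod p). of_nat (p - 1) * of_real (mangoldt n / real n))"
    by (simp only: sum.inter_filter finite_atLeastAtMost flip: Collect_conj_eq)
  finally show ?thesis by (simp only: sum_distrib_left of_real_sum)
qed

text \<open>The principal character only removes the multiples of \<open>p\<close>. Among these
  \<open>p\<close> is the only prime, so the loss is bounded.\<close>

lemma msum_zero: "\<exists>C. \<forall>x\<ge>1. norm (msum 0 x - of_real (ln (real x))) \<le> C"
proof -
  obtain C where C: "\<And>n. (\<Sum>d | d \<in> {1..n} \<and> \<not> Factorial_Ring.prime d. mangoldt d / real d) \<le> (C::real)"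
    using sum_mangoldt_nonprime_bounded by blast
  have "norm (msum 0 x - of_real (ln (real x))) \<le> 4 + (C + ln (real p) / real p)" if x: "x \<ge> 1" for x
  proof -
    let ?S = "\<Sum>n=1..x. mangoldt n / real n"
    let ?E = "\<Sum>n | n \<in> {1..x} \<and> p dvd n. mangoldt n / real n"
    have "msum 0 x = of_real (\<Sum>n=1..x. if p dvd n then 0 else mangoldt n / real n)"
      unfolding msum_def of_real_sum by (intro sum.cong) (auto simp: chr_def)
    also have "(\<Sum>n=1..x. if p dvd n then 0 else mangoldt n / real n) = ?S - ?E"
    proof -
      have "?S = (\<Sum>n=1..x. (if p dvd n then 0 else mangoldt n / real n) + (if p dvd n then mangoldt n / real n else 0))"
        by (intro sum.cong) auto
      also have "\<dots> = (\<Sum>n=1..x. if p dvd n then 0 else mangoldt n / real n) + ?E"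
        unfolding sum.distrib by (simp only: sum.inter_filter finite_atLeastAtMost)
      finally show ?thesis by simp
    qed
    finally have eq: "msum 0 x - of_real (ln (real x)) = of_real (?S - ?E - ln (real x))" by simp
    have "?E \<le> (\<Sum>n\<in>{p} \<union> {d. d \<in> {1..x} \<and> \<not> Factorial_Ring.prime d}. mangoldt n / real n)"
    proof (rule sum_mono2)
      show "{n. n \<in> {1..x} \<and> p dvd n} \<subseteq> {p} \<union> {d. d \<in> {1..x} \<and> \<not> Factorial_Ring.prime d}"
        using p(1) primes_dvd_imp_eq by blast
    qed (auto simp: mangoldt_nonneg)
    also have "\<dots> \<le> mangoldt p / real p + C"
      using C[of x] p(1) by (subst sum.union_disjoint) auto
    finally have "?E \<le> C + ln (real p) / real p" using p(1) by simp
    moreover have "?E \<ge> 0" by (intro sum_nonneg) (auto simp: mangoldt_nonneg)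
    ultimately show ?thesis
      using mertens_mangoldt[OF x] unfolding eq norm_of_real by linarith
  qed
  then show ?thesis by blast
qed

lemma ex_uniform_bound:
  assumes "finite A" "\<And>j. j \<in> A \<Longrightarrow> \<exists>C. \<forall>x\<ge>(1::nat). h j x \<le> (C::real)"
  shows "\<exists>C. \<forall>x\<ge>1. (\<Sum>j\<in>A. h j x) \<le> C"
  using assms
proof (induction A rule: finite_induct)
  case (insert a A)
  then obtain C D where "\<forall>x\<ge>1. (\<Sum>j\<in>A. h j x) \<le> C" "\<forall>x\<ge>1. h a x \<le> D" by (meson insertCI)
  then show ?case using insert.hyps by (intro exI[of _ "D + C"]) (auto intro: add_mono)
qed auto

text \<open>Suppose that \<open>L_one\<close> vanishes for \<open>chr j\<close>. Real characters are
  excluded, so the conjugate character is a different one with the same defect, and each of the two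
  contributes \<open>- ln x\<close>. The principal character contributes \<open>ln x\<close> and all
  others are bounded above, so the total tends to minus infinity; but it is \<open>p - 1\<close>
  times a sum of nonnegative terms.\<close>

lemma msum_bounded:
  assumes "0 < j" "j < p - 1" shows "\<exists>C. \<forall>x\<ge>1. norm (msum j x) \<le> C"
proof (rule ccontr)
  assume nb: "\<not> ?thesis"
  interpret nc: nonprincipal_character p "chr j" using nonprincipal[OF assms] .
  have L0: "nc.L_one = 0" using nc.norm_sum_mangoldt_bounded nb unfolding msum_def by blast
  have jj: "0 < p - 1 - j" "p - 1 - j < p - 1" using assms by auto
  have neq: "p - 1 - j \<noteq> j"
  proof
    assume eq: "p - 1 - j = j"
    have "chr j n \<in> {-1, 0, 1}" for n
    proof (cases "p dvd n")
      case False
      then obtain i where i: "[g ^ i = n] (mod p)" using ex_index by blast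
      have "cnj (chr j n) = chr j n" using chr_conj[of j n] eq assms by simp
      then have "chr j n = of_real (Re (chr j n))" by (simp add: complex_eq_iff)
      moreover have "norm (chr j n) = 1" using chr_eq[OF i] by (simp add: norm_power norm_omega)
      ultimately have "\<bar>Re (chr j n)\<bar> = 1" by (metis norm_of_real)
      then show ?thesis using \<open>chr j n = of_real (Re (chr j n))\<close> by (auto simp: abs_if split: if_splits)
    qed (simp add: chr_def)
    then show False using nc.L_one_nonzero_if_real L0 by blast
  qed
  have cj: "msum (p - 1 - j) x = cnj (msum j x)" for x
    unfolding msum_def cnj_sum complex_cnj_mult complex_cnj_complex_of_real
    using assms by (intro sum.cong refl) (subst chr_conj, auto)
  have j1: "norm (of_real (ln (real x)) + msum j x) \<le> 2 * real p" if "x \<ge> 1" for x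
    using nc.norm_ln_plus_sum_mangoldt_bounded[OF L0 that] unfolding msum_def .
  have j2: "norm (of_real (ln (real x)) + msum (p - 1 - j) x) \<le> 2 * real p" if "x \<ge> 1" for x
  proof -
    have "of_real (ln (real x)) + msum (p - 1 - j) x = cnj (of_real (ln (real x)) + msum j x)"
      by (simp only: cj complex_cnj_add complex_cnj_complex_of_real)
    then show ?thesis using j1[OF that] by (simp only: complex_mod_cnj)
  qed
  \<comment> \<open>Whether or not \<open>L_one\<close> vanishes, an upper bound holds: in the case
    of vanishing the sum is about \<open>- ln x\<close>.\<close>
  have up: "\<exists>C. \<forall>x\<ge>1. Re (msum i x) \<le> C" if "0 < i" "i < p - 1" for i
  proof -
    interpret ni: nonprincipal_character p "chr i" using nonprincipal[OF that] .
    show ?thesis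
    proof (cases "ni.L_one = 0")
      case True
      have "Re (msum i x) \<le> 2 * real p" if "x \<ge> 1" for x
      proof -
        have "Re (of_real (ln (real x)) + msum i x) \<le> 2 * real p"
          using ni.norm_ln_plus_sum_mangoldt_bounded[OF True that] complex_Re_le_cmod order.trans
          unfolding msum_def by blast
        moreover have "ln (real x) \<ge> 0" using that by simp
        ultimately show ?thesis by simp
      qed
      then show ?thesis by blast
    next
      case False
      from ni.norm_sum_mangoldt_bounded[OF False] obtain C where "\<And>x. norm (msum i x) \<le> C"
        unfolding msum_def by blast
      then show ?thesis using complex_Re_le_cmod order.trans by blast
    qed
  qed
  define A where "A = {..<p-1} - {0, j, p - 1 - j}"
  have "\<exists>C. \<forall>x\<ge>1. (\<Sum>i\<in>A. Re (msum i x)) \<le> C"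
    by (rule ex_uniform_bound) (use up in \<open>auto simp: A_def\<close>)
  then obtain C where C: "\<And>x. x \<ge> 1 \<Longrightarrow> (\<Sum>i\<in>A. Re (msum i x)) \<le> C" by blast
  obtain C0 where C0: "\<And>x. x \<ge> 1 \<Longrightarrow> norm (msum 0 x - of_real (ln (real x))) \<le> C0" using msum_zero by blast
  have "ln (real x) \<le> C0 + C + 4 * real p" if x: "x \<ge> 1" for x
  proof -
    have "0 \<le> Re (\<Sum>i<p-1. msum i x)"
      unfolding sum_msum by (auto intro!: mult_nonneg_nonneg sum_nonneg simp: mangoldt_nonneg)
    also have "\<dots> = (\<Sum>i\<in>A. Re (msum i x)) + (\<Sum>i\<in>{0, j, p-1-j}. Re (msum i x))"
      unfolding A_def Re_sum using assms by (subst sum.subset_diff[of "{0, j, p-1-j}"]) auto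
    also have "(\<Sum>i\<in>{0, j, p-1-j}. Re (msum i x)) = Re (msum 0 x) + Re (msum j x) + Re (msum (p-1-j) x)"
      using assms neq by auto
    finally have s: "0 \<le> (\<Sum>i\<in>A. Re (msum i x)) + (Re (msum 0 x) + Re (msum j x) + Re (msum (p-1-j) x))" .
    have "Re (msum 0 x - of_real (ln (real x))) \<le> C0" using C0[OF x] complex_Re_le_cmod order.trans by blast
    moreover have "Re (of_real (ln (real x)) + msum j x) \<le> 2 * real p" using j1[OF x] complex_Re_le_cmod order.trans by blast
    moreover have "Re (of_real (ln (real x)) + msum (p-1-j) x) \<le> 2 * real p" using j2[OF x] complex_Re_le_cmod order.trans by blast
    ultimately show ?thesis using s C[OF x] by simp
  qed
  moreover obtain x :: nat where "real x > exp (C0 + C + 4 * real p)" using reals_Archimedean2 by blast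
  ultimately show False
    by (metis exp_gt_zero ln_exp ln_less_cancel_iff not_le of_nat_0_less_iff order.strict_trans less_eq_Suc_le One_nat_def)
qed

end

text \<open>Averaging over all characters singles out the \<open>n\<close> congruent to
  \<open>1\<close>. Only the principal character has unbounded sums, and the proper prime powers
  cost a constant.\<close>

lemma mertens_primes_cong_1:
  assumes p: "Factorial_Ring.prime (p::nat)" "p > 2"
  shows "\<exists>C. \<forall>x\<ge>1. (\<Sum>q | Factorial_Ring.prime q \<and> q \<le> x \<and> [q = 1] (mod p). ln (real q) / real q) \<ge>
     ln (real x) / real (p - 1) - C"
proof -
  obtain g where "residue_primroot p g"
    using prime_primitive_root_exists[of p] p by auto
  then interpret characters_mod_prime p g using p by unfold_locales
  obtain C0 where C0: "\<And>x. x \<ge> 1 \<Longrightarrow> norm (msum 0 x - of_real (ln (real x))) \<le> C0" using msum_zero by blast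
  have "\<exists>C. \<forall>x\<ge>1. (\<Sum>j\<in>{0<..<p-1}. norm (msum j x)) \<le> C"
    by (rule ex_uniform_bound) (use msum_bounded in auto)
  then obtain C1 where C1: "\<And>x. x \<ge> 1 \<Longrightarrow> (\<Sum>j\<in>{0<..<p-1}. norm (msum j x)) \<le> C1" by blast
  obtain C2 where C2: "\<And>n. (\<Sum>d | d \<in> {1..n} \<and> \<not> Factorial_Ring.prime d. mangoldt d / real d) \<le> (C2::real)"
    using sum_mangoldt_nonprime_bounded by blast
  have "(\<Sum>q | Factorial_Ring.prime q \<and> q \<le> x \<and> [q = 1] (mod p). ln (real q) / real q) \<ge>
     ln (real x) / real (p - 1) - ((C0 + C1) / real (p - 1) + C2)" if x: "x \<ge> 1" for x
  proof -
    let ?S = "\<Sum>n | n \<in> {1..x} \<and> [n = 1] (mod p). mangoldt n / real n"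
    have "real (p - 1) * ?S = Re (\<Sum>j<p-1. msum j x)" unfolding sum_msum by simp
    also have "{..<p-1} = insert 0 {0<..<p-1}" using p by auto
    also have "Re (\<Sum>j\<in>insert 0 {0<..<p-1}. msum j x) = Re (msum 0 x) + Re (\<Sum>j\<in>{0<..<p-1}. msum j x)" by simp
    also have "\<dots> \<ge> (ln (real x) - C0) + (- C1)"
    proof (rule add_mono)
      have "\<bar>Re (msum 0 x - of_real (ln (real x)))\<bar> \<le> C0" using C0[OF x] abs_Re_le_cmod order.trans by blast
      then show "ln (real x) - C0 \<le> Re (msum 0 x)" by simp
      have "\<bar>Re (\<Sum>j\<in>{0<..<p-1}. msum j x)\<bar> \<le> C1"
        by (rule order.trans[OF abs_Re_le_cmod order.trans[OF norm_sum C1[OF x]]])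
      then show "- C1 \<le> Re (\<Sum>j\<in>{0<..<p-1}. msum j x)" by simp
    qed
    finally have "ln (real x) - (C0 + C1) \<le> ?S * real (p - 1)" by (simp only: mult.commute[of ?S])
    then have "(ln (real x) - (C0 + C1)) / real (p - 1) \<le> ?S"
      using p by (subst pos_divide_le_eq) auto
    then have 1: "?S \<ge> ln (real x) / real (p - 1) - (C0 + C1) / real (p - 1)"
      by (simp only: diff_divide_distrib)
    have "?S \<le> (\<Sum>n\<in>{q. Factorial_Ring.prime q \<and> q \<le> x \<and> [q = 1] (mod p)} \<union> {d. d \<in> {1..x} \<and> \<not> Factorial_Ring.prime d}. mangoldt n / real n)"
      by (rule sum_mono2) (auto simp: mangoldt_nonneg)
    also have "\<dots> = (\<Sum>q | Factorial_Ring.prime q \<and> q \<le> x \<and> [q = 1] (mod p). mangoldt q / real q) + (\<Sum>d | d \<in> {1..x} \<and> \<not> Factorial_Ring.prime d. mangoldt d / real d)"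
      by (rule sum.union_disjoint) auto
    also have "(\<Sum>q | Factorial_Ring.prime q \<and> q \<le> x \<and> [q = 1] (mod p). mangoldt q / real q) =
       (\<Sum>q | Factorial_Ring.prime q \<and> q \<le> x \<and> [q = 1] (mod p). ln (real q) / real q)"
      by (intro sum.cong) auto
    finally have 2: "?S \<le> (\<Sum>q | Factorial_Ring.prime q \<and> q \<le> x \<and> [q = 1] (mod p). ln (real q) / real q)
       + (\<Sum>d | d \<in> {1..x} \<and> \<not> Factorial_Ring.prime d. mangoldt d / real d)" .
    have "a - (b + c) \<le> t" if "a - b \<le> s" "s \<le> t + w" "w \<le> c" for a b c s t w :: real
      using that by linarith
    from this[OF 1 2 C2] show ?thesis .
  qed
  then show ?thesis by blast
qed

section \<open>Resultants and roots modulo primes\<close>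

lemma power_dvd_det_if_rows_dvd:
  fixes A :: "int mat"
  assumes A: "A \<in> carrier_mat n n" and "k \<le> n" and q: "\<And>i j. i < k \<Longrightarrow> j < n \<Longrightarrow> q dvd A $$ (i, j)"
  shows "q ^ k dvd det A"
proof -
  have "q ^ k dvd (\<Prod>i = 0..<n. A $$ (i, \<pi> i))" if "\<pi> permutes {0..<n}" for \<pi>
  proof -
    have "q ^ k = (\<Prod>i = 0..<k. q)" by simp
    also have "\<dots> dvd (\<Prod>i = 0..<k. A $$ (i, \<pi> i))"
    proof (rule prod_dvd_prod)
      fix i assume i: "i \<in> {0..<k}"
      then have "\<pi> i \<in> {0..<n}" using permutes_in_image[OF that] \<open>k \<le> n\<close> by simp
      then show "q dvd A $$ (i, \<pi> i)" using q i by simp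
    qed
    also have "\<dots> dvd (\<Prod>i = 0..<n. A $$ (i, \<pi> i))"
      by (rule prod_dvd_prod_subset) (use \<open>k \<le> n\<close> in auto)
    finally show ?thesis .
  qed
  then show ?thesis unfolding det_def'[OF A] by (intro dvd_sum) auto
qed

lemma abs_det_le:
  fixes A :: "int mat"
  assumes A: "A \<in> carrier_mat n n" and c: "\<And>i j. i < n \<Longrightarrow> j < n \<Longrightarrow> \<bar>A $$ (i, j)\<bar> \<le> c i"
  shows "\<bar>det A\<bar> \<le> fact n * (\<Prod>i<n. c i)"
proof -
  have "\<bar>det A\<bar> \<le> (\<Sum>\<pi> | \<pi> permutes {0..<n}. \<bar>signof \<pi> * (\<Prod>i = 0..<n. A $$ (i, \<pi> i))\<bar>)"
    unfolding det_def'[OF A] by (rule sum_abs)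
  also have "\<dots> \<le> (\<Sum>\<pi> | \<pi> permutes {0..<n}. (\<Prod>i<n. c i))"
  proof (rule sum_mono)
    fix \<pi> assume "\<pi> \<in> {\<pi>. \<pi> permutes {0..<n}}"
    then have \<pi>: "\<pi> permutes {0..<n}" by simp
    have "\<bar>signof \<pi> * (\<Prod>i = 0..<n. A $$ (i, \<pi> i))\<bar> = (\<Prod>i<n. \<bar>A $$ (i, \<pi> i)\<bar>)"
      by (simp add: abs_mult sign_def abs_prod lessThan_atLeast0)
    also have "\<dots> \<le> (\<Prod>i<n. c i)"
    proof (rule prod_mono)
      fix i assume "i \<in> {..<n}"
      then show "0 \<le> \<bar>A $$ (i, \<pi> i)\<bar> \<and> \<bar>A $$ (i, \<pi> i)\<bar> \<le> c i"
        using c[of i "\<pi> i"] permutes_in_image[OF \<pi>, of i] by simp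
    qed
    finally show "\<bar>signof \<pi> * (\<Prod>i = 0..<n. A $$ (i, \<pi> i))\<bar> \<le> (\<Prod>i<n. c i)" .
  qed
  also have "\<dots> = fact n * (\<Prod>i<n. c i)"
    by (simp add: card_permutations[of "{0..<n}" n])
  finally show ?thesis .
qed

text \<open>Divide every polynomial by \<open>G\<close>, the product of the \<open>X - r\<close>
  over \<open>R\<close>. The remainders have degree below \<open>card R\<close> and vanish on
  \<open>R\<close> modulo \<open>q\<close>, so all their coefficients are divisible by
  \<open>q\<close>. In the basis formed by the powers of \<open>X\<close> below
  \<open>card R\<close> and the multiples of \<open>G\<close> by powers of \<open>X\<close>, they
  fill \<open>card R\<close> rows.\<close>

lemma power_dvd_det_of_common_roots:
  fixes P :: "nat \<Rightarrow> int poly" and q :: int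
  assumes q: "Factorial_Ring.prime q" and R: "finite R" "card R \<le> n"
    and deg: "\<And>i l. i < n \<Longrightarrow> l \<ge> n \<Longrightarrow> poly.coeff (P i) l = 0"
    and root: "\<And>i r. i < n \<Longrightarrow> r \<in> R \<Longrightarrow> q dvd poly (P i) r"
    and inj: "\<And>r s. r \<in> R \<Longrightarrow> s \<in> R \<Longrightarrow> q dvd r - s \<Longrightarrow> r = s"
  shows "q ^ card R dvd det (mat n n (\<lambda>(l, i). poly.coeff (P i) l))"
proof -
  define k where "k = card R"
  define G :: "int poly" where "G = (\<Prod>r\<in>R. [:-r, 1:])"
  have G: "lead_coeff G = 1" "degree G = k"
  proof -
    show "lead_coeff G = 1" unfolding G_def by (simp add: lead_coeff_prod)
    have "degree G = (\<Sum>r\<in>R. degree [:-r, 1:])" unfolding G_def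
      by (rule degree_prod_eq_sum_degree) auto
    then show "degree G = k" by (simp add: k_def)
  qed
  have "\<exists>Q S. P i = Q * G + S \<and> (\<forall>l\<ge>k. poly.coeff S l = 0) \<and> (\<forall>l. l \<ge> n - k \<longrightarrow> poly.coeff Q l = 0)" if i: "i < n" for i
  proof -
    have "degree (P i) < n"
    proof (rule ccontr)
      assume "\<not> degree (P i) < n"
      then have "lead_coeff (P i) = 0" using deg[OF i, of "degree (P i)"] by simp
      then show False using \<open>\<not> degree (P i) < n\<close> i by simp
    qed
    then have l: "l + degree G > degree (P i)" if "l \<ge> n - k" for l using that G(2) by linarith
    obtain Q S where "P i = Q * G + S" "\<And>l. l \<ge> degree G \<Longrightarrow> poly.coeff S l = 0"
        "\<And>l. l + degree G > degree (P i) \<Longrightarrow> poly.coeff Q l = 0"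
      using monic_division[of UNIV G "P i"] G(1) by auto
    then show ?thesis using G(2) l by (intro exI[of _ Q] exI[of _ S]) auto
  qed
  then obtain Q S where QS: "\<And>i. i < n \<Longrightarrow> P i = Q i * G + S i"
      "\<And>i l. i < n \<Longrightarrow> l \<ge> k \<Longrightarrow> poly.coeff (S i) l = 0"
      "\<And>i l. i < n \<Longrightarrow> l \<ge> n - k \<Longrightarrow> poly.coeff (Q i) l = 0" by metis
  \<comment> \<open>\<open>U\<close> is the change to this basis and \<open>A'\<close> contains the
    new coordinates; only divisibility of \<open>det A'\<close> matters, so \<open>det U\<close> is
    left unevaluated.\<close>
  define U where "U = mat n n (\<lambda>(l, m). if m < k then (if l = m then 1 else 0) else poly.coeff (Polynomial.monom 1 (m - k) * G) l)"
  define A' where "A' = mat n n (\<lambda>(m, i). if m < k then poly.coeff (S i) m else poly.coeff (Q i) (m - k))"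
  have "mat n n (\<lambda>(l, i). poly.coeff (P i) l) = U * A'"
  proof (rule eq_matI)
    fix l i assume "l < dim_row (U * A')" "i < dim_col (U * A')"
    then have li: "l < n" "i < n" by (auto simp: U_def A'_def)
    have "(U * A') $$ (l, i) = (\<Sum>m = 0..<n. U $$ (l, m) * A' $$ (m, i))"
      using li by (simp add: U_def A'_def scalar_prod_def)
    also have "\<dots> = (\<Sum>m = 0..<k. U $$ (l, m) * A' $$ (m, i)) + (\<Sum>m = k..<n. U $$ (l, m) * A' $$ (m, i))"
      using R(2) by (simp add: k_def sum.atLeastLessThan_concat)
    also have "(\<Sum>m = 0..<k. U $$ (l, m) * A' $$ (m, i)) = (\<Sum>m = 0..<k. if l = m then poly.coeff (S i) m else 0)"
      using li R(2) by (intro sum.cong) (auto simp: U_def A'_def k_def)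
    also have "\<dots> = poly.coeff (S i) l" using QS(2)[OF li(2), of l] by auto
    also have "(\<Sum>m = k..<n. U $$ (l, m) * A' $$ (m, i)) = (\<Sum>m = 0 + k..<(n - k) + k. U $$ (l, m) * A' $$ (m, i))"
      using R(2) by (simp add: k_def)
    also have "\<dots> = (\<Sum>j = 0..<n - k. U $$ (l, j + k) * A' $$ (j + k, i))"
      by (rule sum.shift_bounds_nat_ivl)
    also have "\<dots> = (\<Sum>j = 0..<n - k. poly.coeff (Polynomial.monom (poly.coeff (Q i) j) j * G) l)"
      using li by (intro sum.cong) (auto simp: U_def A'_def coeff_monom_mult)
    also have "\<dots> = poly.coeff ((\<Sum>j = 0..<n - k. Polynomial.monom (poly.coeff (Q i) j) j) * G) l"
      by (simp add: coeff_sum sum_distrib_right)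
    also have "(\<Sum>j = 0..<n - k. Polynomial.monom (poly.coeff (Q i) j) j) = Q i"
      by (rule poly_eqI) (use QS(3)[OF li(2)] in \<open>auto simp: coeff_sum not_less\<close>)
    finally show "mat n n (\<lambda>(l, i). poly.coeff (P i) l) $$ (l, i) = (U * A') $$ (l, i)"
      using li QS(1)[OF li(2)] by simp
  qed (auto simp: U_def A'_def)
  moreover have "det (U * A') = det U * det A'"
    by (rule det_mult[of _ n]) (auto simp: U_def A'_def)
  moreover have "q ^ k dvd det A'"
  proof (rule power_dvd_det_if_rows_dvd[of _ n])
    fix m i assume mi: "m < k" "i < n"
    have "q dvd poly.coeff (S i) m"
    proof (rule prime_dvd_coeff_of_many_roots[OF q R(1)])
      fix r assume r: "r \<in> R"
      have "poly G r = 0" using r R(1) by (auto simp: G_def poly_prod)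
      then have "poly (S i) r = poly (P i) r" using QS(1)[OF mi(2)] by simp
      then show "q dvd poly (S i) r" using root[OF mi(2) r] by simp
    qed (use QS(2)[OF mi(2)] inj in \<open>auto simp: k_def\<close>)
    then show "q dvd A' $$ (m, i)" using mi R(2) by (simp add: A'_def k_def)
  qed (use R(2) in \<open>auto simp: A'_def k_def\<close>)
  ultimately show ?thesis by (simp add: k_def)
qed

text \<open>The Sylvester system of \<open>h\<close> and \<open>\<gamma>\<close>, with
  \<open>\<gamma>\<close> treated as a polynomial of degree \<open>degree h - 1\<close> whatever its
  true degree, so that the size of the determinant does not depend on \<open>\<gamma>\<close>. For
  monic \<open>h\<close> and nonzero \<open>\<gamma>\<close> the determinant is the resultant up to
  sign.\<close>

definition sylvester_rows :: "int poly \<Rightarrow> int poly \<Rightarrow> nat \<Rightarrow> int poly" where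
  "sylvester_rows h \<gamma> i = (if i < degree h - 1 then Polynomial.monom 1 i * h
     else Polynomial.monom 1 (i - (degree h - 1)) * \<gamma>)"

definition res_det :: "int poly \<Rightarrow> int poly \<Rightarrow> int" where
  "res_det h \<gamma> = det (mat (2 * degree h - 1) (2 * degree h - 1) (\<lambda>(l, i). poly.coeff (sylvester_rows h \<gamma> i) l))"

lemma coeff_sylvester_rows:
  assumes "degree \<gamma> < degree h" "i < 2 * degree h - 1" "l \<ge> 2 * degree h - 1"
  shows "poly.coeff (sylvester_rows h \<gamma> i) l = 0"
  using assms by (auto simp: sylvester_rows_def coeff_monom_mult intro!: coeff_eq_0)

text \<open>A kernel vector is a relation \<open>a * h + b * \<gamma> = 0\<close> with
  \<open>degree b < degree h\<close>. At \<open>\<theta>\<close> it makes \<open>b\<close> or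
  \<open>\<gamma>\<close> vanish, and the independence of the powers of \<open>\<theta>\<close>,
  which stands in for irreducibility of \<open>h\<close>, leaves only \<open>b = 0\<close> and then
  \<open>a = 0\<close>.\<close>

lemma res_det_nonzero:
  fixes \<theta> :: complex
  assumes h: "lead_coeff h = 1" "degree h > 0" "poly (map_poly of_int h) \<theta> = 0"
    and ind: "\<And>g :: int poly. degree g < degree h \<Longrightarrow> poly (map_poly of_int g) \<theta> = 0 \<Longrightarrow> g = 0"
    and \<gamma>: "degree \<gamma> < degree h" "\<gamma> \<noteq> 0"
  shows "res_det h \<gamma> \<noteq> 0"
proof
  define d where "d = degree h"
  define n where "n = 2 * d - 1"
  define A where "A = mat n n (\<lambda>(l, i). poly.coeff (sylvester_rows h \<gamma> i) l)"
  have A: "A \<in> carrier_mat n n" by (simp add: A_def)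
  assume "res_det h \<gamma> = 0"
  then have "det A = 0" by (simp add: res_det_def A_def n_def d_def)
  then obtain v where v: "v \<in> carrier_vec n" "v \<noteq> 0\<^sub>v n" "A *\<^sub>v v = 0\<^sub>v n"
    using det_0_iff_vec_prod_zero[OF A] by blast
  define w where "w i = vec_index v i" for i
  have rel: "(\<Sum>i = 0..<n. Polynomial.smult (w i) (sylvester_rows h \<gamma> i)) = 0"
  proof (rule poly_eqI)
    fix l
    show "poly.coeff (\<Sum>i = 0..<n. Polynomial.smult (w i) (sylvester_rows h \<gamma> i)) l = poly.coeff 0 l"
    proof (cases "l < n")
      case True
      have "vec_index (A *\<^sub>v v) l = (\<Sum>i = 0..<n. poly.coeff (sylvester_rows h \<gamma> i) l * w i)"
        using True v(1) by (simp add: A_def scalar_prod_def w_def)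
      then have "(\<Sum>i = 0..<n. poly.coeff (sylvester_rows h \<gamma> i) l * w i) = 0" using v(3) True by simp
      then show ?thesis by (simp add: coeff_sum mult.commute)
    next
      case False
      then show ?thesis using coeff_sylvester_rows[OF \<gamma>(1)] by (simp add: coeff_sum n_def d_def)
    qed
  qed
  define a where "a = (\<Sum>i = 0..<d-1. Polynomial.monom (w i) i)"
  define b where "b = (\<Sum>j = 0..<d. Polynomial.monom (w (j + (d - 1))) j)"
  have d: "d > 0" using h by (simp add: d_def)
  have "(\<Sum>i = 0..<n. Polynomial.smult (w i) (sylvester_rows h \<gamma> i)) = a * h + b * \<gamma>"
  proof -
    have "(\<Sum>i = 0..<n. Polynomial.smult (w i) (sylvester_rows h \<gamma> i)) =
       (\<Sum>i = 0..<d-1. Polynomial.smult (w i) (sylvester_rows h \<gamma> i)) + (\<Sum>i = d-1..<n. Polynomial.smult (w i) (sylvester_rows h \<gamma> i))"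
      using d by (simp add: n_def sum.atLeastLessThan_concat)
    also have "(\<Sum>i = 0..<d-1. Polynomial.smult (w i) (sylvester_rows h \<gamma> i)) = a * h"
      unfolding a_def sum_distrib_right
      by (intro sum.cong) (auto simp: sylvester_rows_def d_def smult_monom simp flip: mult_smult_left)
    also have "(\<Sum>i = d-1..<n. Polynomial.smult (w i) (sylvester_rows h \<gamma> i)) =
        (\<Sum>i = 0 + (d-1)..<d + (d-1). Polynomial.smult (w i) (sylvester_rows h \<gamma> i))"
      using d by (simp add: n_def mult_2)
    also have "\<dots> = (\<Sum>j = 0..<d. Polynomial.smult (w (j + (d - 1))) (sylvester_rows h \<gamma> (j + (d - 1))))"
      by (rule sum.shift_bounds_nat_ivl)
    also have "\<dots> = b * \<gamma>"
      unfolding b_def sum_distrib_right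
      by (intro sum.cong) (auto simp: sylvester_rows_def d_def smult_monom simp flip: mult_smult_left)
    finally show ?thesis .
  qed
  with rel have eq: "a * h + b * \<gamma> = 0" by simp
  have "poly (map_poly of_int (a * h + b * \<gamma>)) \<theta> = 0" using eq by simp
  then have "poly (map_poly of_int b) \<theta> * poly (map_poly of_int \<gamma>) \<theta> = 0"
    using h(3) by (simp add: of_int_poly_hom.hom_add of_int_poly_hom.hom_mult)
  moreover have "poly (map_poly of_int \<gamma>) \<theta> \<noteq> 0" using ind[OF \<gamma>(1)] \<gamma>(2) by blast
  ultimately have "poly (map_poly of_int b) \<theta> = 0" by simp
  moreover have "degree b < degree h"
  proof -
    have "degree b \<le> d - 1" unfolding b_def
      by (intro degree_sum_le) (auto intro: order.trans[OF degree_monom_le])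
    then show ?thesis using d by (simp add: d_def)
  qed
  ultimately have b0: "b = 0" using ind by blast
  with eq h have a0: "a = 0" by auto
  have "w i = 0" if "i < n" for i
  proof (cases "i < d - 1")
    case True
    then have "poly.coeff a i = w i" by (simp add: a_def coeff_sum)
    then show ?thesis using a0 by simp
  next
    case False
    then have "poly.coeff b (i - (d - 1)) = w i" using that by (simp add: b_def coeff_sum n_def)
    then show ?thesis using b0 by simp
  qed
  then have "v = 0\<^sub>v n" using v(1) by (intro eq_vecI) (auto simp: w_def)
  then show False using v(2) by simp
qed

lemma abs_res_det_le:
  assumes h: "degree h > 0" "\<And>i. \<bar>poly.coeff h i\<bar> \<le> H"
    and \<gamma>: "degree \<gamma> < degree h" "\<And>i. \<bar>poly.coeff \<gamma> i\<bar> \<le> Y"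
  shows "\<bar>res_det h \<gamma>\<bar> \<le> fact (2 * degree h - 1) * H ^ (degree h - 1) * Y ^ degree h"
proof -
  define d where "d = degree h"
  define n where "n = 2 * d - 1"
  define A where "A = mat n n (\<lambda>(l, i). poly.coeff (sylvester_rows h \<gamma> i) l)"
  define c where "c i = (if i < d - 1 then H else Y)" for i
  have H: "0 \<le> H" "0 \<le> Y" using h(2)[of 0] \<gamma>(2)[of 0] by auto
  have "\<bar>res_det h \<gamma>\<bar> = \<bar>det (transpose_mat A)\<bar>"
    by (subst det_transpose[of _ n]) (auto simp: res_det_def A_def n_def d_def)
  also have "\<dots> \<le> fact n * (\<Prod>i<n. c i)"
  proof (rule abs_det_le)
    fix i j assume "i < n" "j < n"
    then show "\<bar>transpose_mat A $$ (i, j)\<bar> \<le> c i"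
      using h(2) \<gamma>(2) H by (auto simp: A_def c_def sylvester_rows_def d_def coeff_monom_mult)
  qed (simp add: A_def)
  also have "(\<Prod>i<n. c i) = H ^ (d - 1) * Y ^ d"
  proof -
    have "(\<Prod>i<n. c i) = (\<Prod>i = 0..<d-1. c i) * (\<Prod>i = d-1..<n. c i)"
      using h(1) by (simp add: n_def d_def lessThan_atLeast0 prod.atLeastLessThan_concat)
    also have "(\<Prod>i = 0..<d-1. c i) = H ^ (d - 1)" by (simp add: c_def)
    also have "(\<Prod>i = d-1..<n. c i) = (\<Prod>i = d-1..<n. Y)" by (intro prod.cong) (auto simp: c_def)
    also have "\<dots> = Y ^ d" using h(1) by (simp add: n_def d_def)
    finally show ?thesis .
  qed
  finally show ?thesis by (simp add: n_def d_def mult.assoc)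
qed

section \<open>The number of roots of an integer polynomial modulo primes, on average\<close>

definition roots_mod :: "int poly \<Rightarrow> nat \<Rightarrow> int set" where
  "roots_mod h q = {r \<in> {0..<int q}. int q dvd poly h r}"

lemma finite_roots_mod [simp]: "finite (roots_mod h q)"
  by (rule finite_subset[of _ "{0..<int q}"]) (auto simp: roots_mod_def)

lemma roots_mod_inj: "r \<in> roots_mod h q \<Longrightarrow> s \<in> roots_mod h q \<Longrightarrow> int q dvd r - s \<Longrightarrow> r = s"
  by (auto simp: roots_mod_def) (metis mod_eq_dvd_iff mod_pos_pos_trivial)

lemma card_roots_mod_le:
  assumes "lead_coeff h = 1" "Factorial_Ring.prime q"
  shows "card (roots_mod h q) \<le> degree h"
proof (rule ccontr)
  assume "\<not> ?thesis"
  then have "degree h < card (roots_mod h q)" by simp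
  then have "int q dvd poly.coeff h (degree h)"
    using assms roots_mod_inj[of _ h q]
    by (intro prime_dvd_coeff_of_many_roots[of "int q" "roots_mod h q"]) (auto simp: coeff_eq_0, auto simp: roots_mod_def)
  then show False using assms by simp
qed

text \<open>The prime powers that count the common roots modulo different primes are coprime, so
  their product divides the nonzero resultant.\<close>

lemma sum_common_roots_ln_le:
  assumes h: "lead_coeff h = 1" "degree h > 0" and \<gamma>: "degree \<gamma> < degree h" and nz: "res_det h \<gamma> \<noteq> 0"
  shows "(\<Sum>q | Factorial_Ring.prime q \<and> q \<le> Z. real (card {r \<in> roots_mod h q. int q dvd poly \<gamma> r}) * ln (real q))
    \<le> ln (real_of_int \<bar>res_det h \<gamma>\<bar>)"
proof -
  let ?k = "\<lambda>q. card {r \<in> roots_mod h q. int q dvd poly \<gamma> r}"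
  let ?Q = "{q. Factorial_Ring.prime q \<and> q \<le> Z}"
  have "(\<Prod>q\<in>A. int q ^ ?k q) dvd res_det h \<gamma>" if "finite A" "A \<subseteq> ?Q" for A
    using that
  proof (induction A rule: finite_induct)
    case (insert q A)
    have q: "Factorial_Ring.prime q" using insert.prems by simp
    have "int q ^ ?k q dvd res_det h \<gamma>"
      unfolding res_det_def
    proof (rule power_dvd_det_of_common_roots)
      have "?k q \<le> card (roots_mod h q)" by (rule card_mono) auto
      then show "?k q \<le> 2 * degree h - 1" using card_roots_mod_le[OF h(1) q] h(2) by linarith
      show "int q dvd poly (sylvester_rows h \<gamma> i) r" if "r \<in> {r \<in> roots_mod h q. int q dvd poly \<gamma> r}" for i r
        using that by (auto simp: sylvester_rows_def roots_mod_def)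
    qed (use q coeff_sylvester_rows[OF \<gamma>] roots_mod_inj[of _ h q] in auto)
    moreover have "(\<Prod>q\<in>A. int q ^ ?k q) dvd res_det h \<gamma>" using insert by simp
    moreover have "coprime (int q ^ ?k q) (\<Prod>q\<in>A. int q ^ ?k q)"
    proof (rule prod_coprime_right)
      fix r assume r: "r \<in> A"
      then have "coprime q r" using insert q by (intro primes_coprime) auto
      then show "coprime (int q ^ ?k q) (int r ^ ?k r)" by simp
    qed
    ultimately show ?case using insert.hyps by (simp add: divides_mult)
  qed simp
  then have dvd: "(\<Prod>q\<in>?Q. int q ^ ?k q) dvd res_det h \<gamma>" by simp
  define M where "M = (\<Prod>q\<in>?Q. int q ^ ?k q)"
  have M: "M > 0" "M \<le> \<bar>res_det h \<gamma>\<bar>"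
  proof -
    show "M > 0" unfolding M_def by (intro prod_pos) (auto simp: prime_gt_0_nat)
    show "M \<le> \<bar>res_det h \<gamma>\<bar>"
      by (rule zdvd_imp_le) (use dvd nz in \<open>auto simp: M_def\<close>)
  qed
  have "(\<Sum>q\<in>?Q. real (?k q) * ln (real q)) = (\<Sum>q\<in>?Q. ln (real q ^ ?k q))"
    by (intro sum.cong refl) (simp add: ln_realpow prime_gt_0_nat)
  also have "\<dots> = ln (\<Prod>q\<in>?Q. real q ^ ?k q)"
    by (rule ln_prod[symmetric]) auto
  also have "(\<Prod>q\<in>?Q. real q ^ ?k q) = real_of_int M" by (simp add: M_def)
  also have "ln (real_of_int M) \<le> ln (real_of_int \<bar>res_det h \<gamma>\<bar>)"
    using M by (subst ln_le_cancel_iff) auto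
  finally show ?thesis .
qed

lemma sum_square_le_card_times_sum_squares:
  fixes f :: "'a \<Rightarrow> real"
  shows "(\<Sum>i\<in>I. f i)\<^sup>2 \<le> real (card I) * (\<Sum>i\<in>I. (f i)\<^sup>2)"
  using Cauchy_Schwarz_ineq_sum[of "\<lambda>_. 1" f I] by simp

text \<open>Cauchy-Schwarz for the sizes of the fibres of \<open>\<phi>\<close>. Diagonal pairs are
  counted and have to be subtracted later.\<close>

lemma card_collisions_ge:
  assumes "finite B" and "\<phi> ` B \<subseteq> C" "finite C"
  shows "real (card B) ^ 2 \<le> real (card C) * real (card {(f, g) \<in> B \<times> B. \<phi> f = \<phi> g})"
proof -
  have "real (card B) = (\<Sum>c\<in>C. real (card {f \<in> B. \<phi> f = c}))"
  proof -
    have "card B = (\<Sum>c\<in>C. card {f \<in> B. \<phi> f = c})"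
      using sum.group[OF assms(1,3,2), of "\<lambda>_. 1::nat"] by simp
    then show ?thesis by simp
  qed
  moreover have "card {(f, g) \<in> B \<times> B. \<phi> f = \<phi> g} = (\<Sum>c\<in>C. (card {f \<in> B. \<phi> f = c})\<^sup>2)"
  proof -
    have "{(f, g) \<in> B \<times> B. \<phi> f = \<phi> g} = (\<Union>c\<in>C. {f \<in> B. \<phi> f = c} \<times> {f \<in> B. \<phi> f = c})"
      using assms(2) by auto
    also have "card \<dots> = (\<Sum>c\<in>C. card ({f \<in> B. \<phi> f = c} \<times> {f \<in> B. \<phi> f = c}))"
      using assms by (intro card_UN_disjoint) auto
    finally show ?thesis by (simp add: card_cartesian_product power2_eq_square)
  qed
  ultimately show ?thesis
    using sum_square_le_card_times_sum_squares[of "\<lambda>c. real (card {f \<in> B. \<phi> f = c})" C] by simp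
qed

text \<open>The upper half of Mertens' theorem for the primes of degree one in the field of
  \<open>\<theta>\<close>, without ideals. All polynomials of a box are evaluated at a root
  \<open>r\<close> modulo \<open>q\<close>: at least \<open>1 / q\<close> of all pairs collide. A
  colliding pair makes \<open>r\<close> a common root of \<open>h\<close> and the difference of the
  pair, and the common roots are limited by the logarithm of the resultant, which is about
  \<open>ln Z\<close> if the box has about \<open>Z\<close> elements.\<close>

lemma sum_roots_mod_ln_le:
  fixes \<theta> :: complex and h :: "int poly"
  assumes h: "lead_coeff h = 1" "degree h > 0" "poly (map_poly of_int h) \<theta> = 0"
    and ind: "\<And>g :: int poly. degree g < degree h \<Longrightarrow> poly (map_poly of_int g) \<theta> = 0 \<Longrightarrow> g = 0"
  shows "\<exists>C. \<forall>Z\<ge>1. (\<Sum>q | Factorial_Ring.prime q \<and> q \<le> Z. real (card (roots_mod h q)) * (ln (real q) / real q))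
     \<le> ln (real Z) + C"
proof -
  define d where "d = degree h"
  have d: "d > 0" using h(2) by (simp add: d_def)
  obtain H where H: "\<And>i. \<bar>poly.coeff h i\<bar> \<le> H" "H \<ge> 1"
  proof -
    define H where "H = 1 + (\<Sum>i\<le>degree h. \<bar>poly.coeff h i\<bar>)"
    have "\<bar>poly.coeff h i\<bar> \<le> H" for i
    proof (cases "i \<le> degree h")
      case True
      then have "\<bar>poly.coeff h i\<bar> \<le> (\<Sum>i\<le>degree h. \<bar>poly.coeff h i\<bar>)"
        by (intro member_le_sum) auto
      then show ?thesis by (simp add: H_def)
    qed (simp add: coeff_eq_0 H_def sum_nonneg add_nonneg_nonneg)
    moreover have "H \<ge> 1" by (simp add: H_def sum_nonneg)
    ultimately show ?thesis using that by blast
  qed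
  define C0 where "C0 = real_of_int (fact (2 * d - 1) * H ^ (d - 1))"
  have C0: "C0 \<ge> 1"
  proof -
    have "(1::int) * 1 \<le> fact (2 * d - 1) * H ^ (d - 1)"
      using H(2) by (intro mult_mono) (auto simp: one_le_power fact_ge_1)
    then show ?thesis unfolding C0_def by (metis mult_1 of_int_1 of_int_le_iff)
  qed
  have "(\<Sum>q | Factorial_Ring.prime q \<and> q \<le> Z. real (card (roots_mod h q)) * (ln (real q) / real q))
     \<le> ln (real Z) + (real d * ln 2 + ln C0 + 4 * real d)" if Z: "Z \<ge> 1" for Z
  proof -
    let ?Q = "{q. Factorial_Ring.prime q \<and> q \<le> Z}"
    \<comment> \<open>\<open>Y ^ d\<close> is the size of the box. It must be at least
      \<open>Z\<close>, so that the diagonal pairs cost only a constant, and at most of the order of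
      \<open>Z\<close>, so that the logarithm of the resultant is
      \<open>ln Z + O(1)\<close>.\<close>
    obtain Y :: nat where Y: "Z \<le> Y ^ d" "real Y ^ d \<le> 2 ^ d * real Z" "Y \<ge> 1"
    proof -
      define y where "y = root d (real Z)"
      have y1: "y \<ge> 1" using Z d by (simp add: y_def)
      have yd: "y ^ d = real Z" using d by (simp add: y_def)
      define Y where "Y = nat \<lceil>y\<rceil>"
      have Y: "y \<le> real Y" "real Y \<le> 2 * y" "Y \<ge> 1"
        using y1 unfolding Y_def by linarith+
      have "real Z \<le> real Y ^ d" using Y(1) y1 yd power_mono[of y "real Y" d] by simp
      then have "Z \<le> Y ^ d" by (metis of_nat_le_iff of_nat_power)
      moreover have "real Y ^ d \<le> (2 * y) ^ d" using Y(2) by (intro power_mono) auto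
      ultimately show ?thesis using that Y(3) yd by (simp add: power_mult_distrib)
    qed
    define B where "B = PiE {..<d} (\<lambda>_. {0..<int Y})"
    have finB: "finite B" by (simp add: B_def finite_PiE)
    have cardB: "card B = Y ^ d" by (simp add: B_def card_PiE)
    then have cB: "real (card B) \<ge> real Z" "real (card B) > 0"
      using Y Z by (auto simp flip: of_nat_power)
    define pol where "pol f = (\<Sum>i<d. Polynomial.monom (f i) i)" for f :: "nat \<Rightarrow> int"
    have cpol: "poly.coeff (pol f) i = (if i < d then f i else 0)" for f i
      by (simp add: pol_def coeff_sum)
    have degd: "degree (pol f - pol g) < d" for f g
      using d by (intro le_less_trans[OF degree_le[of "d - 1"]]) (auto simp: cpol)
    define D where "D = {(f, g) \<in> B \<times> B. f \<noteq> g}"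
    have finD: "finite D" unfolding D_def by (rule finite_subset[of _ "B \<times> B"]) (auto simp: finB)
    have res: "res_det h (pol f - pol g) \<noteq> 0" "\<bar>real_of_int (res_det h (pol f - pol g))\<bar> \<le> C0 * real Y ^ d" if fg: "(f, g) \<in> D" for f g
    proof -
      have "pol f - pol g \<noteq> 0"
      proof
        assume "pol f - pol g = 0"
        then have "poly.coeff (pol f) i = poly.coeff (pol g) i" for i by simp
        then have "f i = g i" if "i < d" for i using that cpol by metis
        moreover have "f \<in> B" "g \<in> B" using fg by (auto simp: D_def)
        ultimately have "f = g" unfolding B_def by (intro PiE_ext[of f _ _ g]) auto
        then show False using fg by (simp add: D_def)
      qed
      then show "res_det h (pol f - pol g) \<noteq> 0"
        using res_det_nonzero[OF h ind] degd by (simp add: d_def)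
      have "\<bar>poly.coeff (pol f - pol g) i\<bar> \<le> int Y" for i
      proof (cases "i < d")
        case True
        then have "f i \<in> {0..<int Y}" "g i \<in> {0..<int Y}" using fg by (auto simp: D_def B_def PiE_iff)
        then show ?thesis by (auto simp: cpol)
      qed (simp add: cpol)
      then have "\<bar>res_det h (pol f - pol g)\<bar> \<le> fact (2 * d - 1) * H ^ (d - 1) * int Y ^ d"
        unfolding d_def using H(1) degd h(2) by (intro abs_res_det_le) (auto simp: d_def)
      then have "real_of_int \<bar>res_det h (pol f - pol g)\<bar> \<le> real_of_int (fact (2 * d - 1) * H ^ (d - 1) * int Y ^ d)"
        by (simp only: of_int_le_iff)
      then show "\<bar>real_of_int (res_det h (pol f - pol g))\<bar> \<le> C0 * real Y ^ d" by (simp add: C0_def)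
    qed
    have up: "(\<Sum>q\<in>?Q. real (card {r \<in> roots_mod h q. int q dvd poly (pol f - pol g) r}) * ln (real q)) \<le> ln (C0 * real Y ^ d)"
      if fg: "(f, g) \<in> D" for f g
    proof -
      have "(\<Sum>q\<in>?Q. real (card {r \<in> roots_mod h q. int q dvd poly (pol f - pol g) r}) * ln (real q)) \<le>
          ln (real_of_int \<bar>res_det h (pol f - pol g)\<bar>)"
        using degd res(1)[OF fg] h(1,2) by (intro sum_common_roots_ln_le) (auto simp: d_def)
      also have "\<dots> \<le> ln (C0 * real Y ^ d)"
        using res[OF fg] by (intro ln_mono) auto
      finally show ?thesis .
    qed
    have CY: "C0 * real Y ^ d \<ge> 1"
      using C0 Y(3) mult_mono[of 1 C0 1 "real Y ^ d"] by (simp add: one_le_power)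
    have "(\<Sum>q\<in>?Q. \<Sum>r\<in>roots_mod h q. ln (real q) * (real (card B) ^ 2 / real q - real (card B)))
        \<le> (\<Sum>q\<in>?Q. \<Sum>r\<in>roots_mod h q. ln (real q) * real (card {(f, g) \<in> D. int q dvd poly (pol f - pol g) r}))"
    proof (intro sum_mono mult_left_mono)
      fix q r assume "q \<in> ?Q" "r \<in> roots_mod h q"
      then have q: "Factorial_Ring.prime q" "q > 0" by (auto simp: prime_gt_0_nat)
      then show "0 \<le> ln (real q)" by simp
      let ?\<phi> = "\<lambda>f. poly (pol f) r mod int q"
      let ?E = "{(f, g) \<in> B \<times> B. ?\<phi> f = ?\<phi> g}"
      have "real (card B) ^ 2 \<le> real (card {0..<int q}) * real (card ?E)"
        using finB q by (intro card_collisions_ge) auto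
      then have 1: "real (card B) ^ 2 / real q \<le> real (card ?E)" using q by (simp add: field_simps)
      have "?E \<subseteq> {(f, g) \<in> D. int q dvd poly (pol f - pol g) r} \<union> (\<lambda>f. (f, f)) ` B"
        by (auto simp: D_def mod_eq_dvd_iff)
      then have "card ?E \<le> card ({(f, g) \<in> D. int q dvd poly (pol f - pol g) r} \<union> (\<lambda>f. (f, f)) ` B)"
        using finD finB by (intro card_mono) (auto intro: finite_subset[OF _ finD])
      also have "\<dots> \<le> card {(f, g) \<in> D. int q dvd poly (pol f - pol g) r} + card ((\<lambda>f. (f, f)) ` B)"
        by (rule card_Un_le)
      also have "card ((\<lambda>f. (f, f)) ` B) \<le> card B" using finB by (rule card_image_le)
      finally have "real (card ?E) \<le> real (card {(f, g) \<in> D. int q dvd poly (pol f - pol g) r}) + real (card B)"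
        by linarith
      with 1 show "real (card B) ^ 2 / real q - real (card B) \<le> real (card {(f, g) \<in> D. int q dvd poly (pol f - pol g) r})"
        by linarith
    qed
    also have "\<dots> = (\<Sum>(f, g)\<in>D. \<Sum>q\<in>?Q. real (card {r \<in> roots_mod h q. int q dvd poly (pol f - pol g) r}) * ln (real q))"
    proof -
      have "(\<Sum>q\<in>?Q. \<Sum>r\<in>roots_mod h q. ln (real q) * real (card {(f, g) \<in> D. int q dvd poly (pol f - pol g) r})) =
          (\<Sum>q\<in>?Q. \<Sum>r\<in>roots_mod h q. \<Sum>x\<in>D. if int q dvd poly (pol (fst x) - pol (snd x)) r then ln (real q) else 0)"
      proof (intro sum.cong refl)
        fix q r
        have "{(f, g) \<in> D. int q dvd poly (pol f - pol g) r} = {x \<in> D. int q dvd poly (pol (fst x) - pol (snd x)) r}" by auto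
        then show "ln (real q) * real (card {(f, g) \<in> D. int q dvd poly (pol f - pol g) r}) =
            (\<Sum>x\<in>D. if int q dvd poly (pol (fst x) - pol (snd x)) r then ln (real q) else 0)"
          using finD by (simp add: sum.inter_filter[symmetric] mult.commute)
      qed
      also have "\<dots> = (\<Sum>q\<in>?Q. \<Sum>x\<in>D. \<Sum>r\<in>roots_mod h q. if int q dvd poly (pol (fst x) - pol (snd x)) r then ln (real q) else 0)"
        by (intro sum.cong refl sum.swap)
      also have "\<dots> = (\<Sum>x\<in>D. \<Sum>q\<in>?Q. \<Sum>r\<in>roots_mod h q. if int q dvd poly (pol (fst x) - pol (snd x)) r then ln (real q) else 0)"
        by (rule sum.swap)
      also have "\<dots> = (\<Sum>(f, g)\<in>D. \<Sum>q\<in>?Q. real (card {r \<in> roots_mod h q. int q dvd poly (pol f - pol g) r}) * ln (real q))"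
        by (intro sum.cong refl) (simp add: case_prod_unfold sum.inter_filter[symmetric])
      finally show ?thesis .
    qed
    also have "\<dots> \<le> (\<Sum>(f, g)\<in>D. ln (C0 * real Y ^ d))"
      by (intro sum_mono) (use up in auto)
    also have "\<dots> = real (card D) * ln (C0 * real Y ^ d)" by (simp add: case_prod_unfold)
    also have "\<dots> \<le> real (card B) ^ 2 * ln (C0 * real Y ^ d)"
    proof (rule mult_right_mono)
      have "card D \<le> card (B \<times> B)" using finB by (intro card_mono) (auto simp: D_def)
      then have "card D \<le> card B * card B" by (simp only: card_cartesian_product)
      then show "real (card D) \<le> real (card B) ^ 2" by (metis of_nat_le_iff of_nat_mult power2_eq_square)
      show "0 \<le> ln (C0 * real Y ^ d)" using CY by simp
    qed
    finally have main: "(\<Sum>q\<in>?Q. \<Sum>r\<in>roots_mod h q. ln (real q) * (real (card B) ^ 2 / real q - real (card B)))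
        \<le> real (card B) ^ 2 * ln (C0 * real Y ^ d)" .
    have "(\<Sum>q\<in>?Q. \<Sum>r\<in>roots_mod h q. ln (real q) * (real (card B) ^ 2 / real q - real (card B))) =
       real (card B) ^ 2 * (\<Sum>q\<in>?Q. real (card (roots_mod h q)) * (ln (real q) / real q)) -
       real (card B) * (\<Sum>q\<in>?Q. real (card (roots_mod h q)) * ln (real q))"
      by (simp add: sum_distrib_left sum_subtractf algebra_simps)
    moreover have "(\<Sum>q\<in>?Q. real (card (roots_mod h q)) * ln (real q)) \<le> real d * (4 * real Z)"
    proof -
      have "(\<Sum>q\<in>?Q. real (card (roots_mod h q)) * ln (real q)) \<le> (\<Sum>q\<in>?Q. real d * ln (real q))"
        using card_roots_mod_le[OF h(1)] by (intro sum_mono mult_right_mono) (auto simp: d_def prime_gt_0_nat Suc_le_eq)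
      also have "\<dots> = real d * (\<Sum>q\<in>?Q. ln (real q))" by (simp add: sum_distrib_left)
      also have "\<dots> \<le> real d * (4 * real Z)" by (intro mult_left_mono chebyshev_theta_upper) auto
      finally show ?thesis .
    qed
    ultimately have "real (card B) ^ 2 * (\<Sum>q\<in>?Q. real (card (roots_mod h q)) * (ln (real q) / real q)) \<le>
        real (card B) ^ 2 * ln (C0 * real Y ^ d) + real (card B) * (real d * (4 * real Z))"
      using main cB(2) by (smt (verit, best) mult_left_mono)
    also have "real (card B) * (real d * (4 * real Z)) \<le> real (card B) * (real d * (4 * real (card B)))"
      using cB by (intro mult_left_mono) auto
    also have "real (card B) ^ 2 * ln (C0 * real Y ^ d) + real (card B) * (real d * (4 * real (card B))) =
        real (card B) ^ 2 * (ln (C0 * real Y ^ d) + 4 * real d)"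
      by (simp add: power2_eq_square algebra_simps)
    finally have "(\<Sum>q\<in>?Q. real (card (roots_mod h q)) * (ln (real q) / real q)) \<le> ln (C0 * real Y ^ d) + 4 * real d"
      using cB(2) by simp
    also have "ln (C0 * real Y ^ d) \<le> ln (C0 * (2 ^ d * real Z))"
      using C0 Y(2) CY by (intro ln_mono mult_left_mono) auto
    also have "\<dots> = ln C0 + (real d * ln 2 + ln (real Z))"
      using C0 Z by (simp add: ln_mult ln_realpow)
    finally show ?thesis by simp
  qed
  then show ?thesis by blast
qed

section \<open>Algebraic integers\<close>

text \<open>The coefficients \<open>c\<close> form an integer matrix with eigenvalue
  \<open>x\<close>; the values of \<open>e\<close> are an eigenvector because one of them is
  nonzero.\<close>

lemma algebraic_int_if_stable_span:
  fixes x :: complex and e :: "'i \<Rightarrow> complex"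
  assumes I: "finite I" and k0: "k0 \<in> I" "e k0 \<noteq> 0"
    and st: "\<And>k. k \<in> I \<Longrightarrow> \<exists>c. x * e k = (\<Sum>l\<in>I. of_int (c l) * e l)"
  shows "algebraic_int x"
proof -
  define N where "N = card I"
  obtain h where h: "bij_betw h {0..<N} I"
    using ex_bij_betw_nat_finite[OF I] unfolding N_def by blast
  obtain c where c: "\<And>k. k \<in> I \<Longrightarrow> x * e k = (\<Sum>l\<in>I. of_int (c k l) * e l)"
    using st by metis
  define A where "A = mat N N (\<lambda>(i, j). c (h i) (h j) :: int)"
  define v where "v = Matrix.vec N (\<lambda>i. e (h i))"
  have A: "A \<in> carrier_mat N N" by (simp add: A_def)
  have A': "map_mat complex_of_int A \<in> carrier_mat N N" by (simp add: A_def)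
  have hI: "h i \<in> I" if "i < N" for i using h that by (auto simp: bij_betw_def)
  have "map_mat of_int A *\<^sub>v v = x \<cdot>\<^sub>v v"
  proof (rule eq_vecI)
    fix i assume "i < dim_vec (x \<cdot>\<^sub>v v)"
    then have i: "i < N" by (simp add: v_def)
    have "vec_index (map_mat of_int A *\<^sub>v v) i = (\<Sum>j = 0..<N. of_int (c (h i) (h j)) * e (h j))"
      using i by (simp add: A_def v_def scalar_prod_def)
    also have "\<dots> = (\<Sum>l\<in>I. of_int (c (h i) l) * e l)"
      by (rule sum.reindex_bij_betw[OF h])
    also have "\<dots> = x * e (h i)" using c[OF hI[OF i]] by simp
    finally show "vec_index (map_mat of_int A *\<^sub>v v) i = vec_index (x \<cdot>\<^sub>v v) i"
      using i by (simp add: v_def)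
  qed (simp add: A_def v_def)
  moreover have "v \<noteq> 0\<^sub>v N"
  proof
    obtain i where i: "i < N" "h i = k0" using h k0 by (auto simp: bij_betw_def image_iff)
    assume "v = 0\<^sub>v N"
    then have "vec_index v i = 0" using i by simp
    then show False using i k0 by (simp add: v_def)
  qed
  ultimately have "eigenvalue (map_mat complex_of_int A) x"
    unfolding eigenvalue_def eigenvector_def by (intro exI[of _ v]) (auto simp: A_def v_def)
  then have "poly (char_poly (map_mat of_int A)) x = 0"
    using eigenvalue_root_char_poly[OF A'] by simp
  then have "poly (map_poly of_int (char_poly A)) x = 0"
  proof -
    have "char_poly (map_mat complex_of_int A) = map_poly complex_of_int (char_poly A)"
      by (rule of_int_hom.char_poly_hom[OF A])
    then show ?thesis using \<open>poly (char_poly _) x = 0\<close> by simp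
  qed
  moreover have "lead_coeff (char_poly A) = 1" using degree_monic_char_poly[OF A] by simp
  ultimately show ?thesis unfolding algebraic_int_altdef_ipoly by blast
qed

lemma algebraic_int_power_in_span:
  fixes a :: complex
  assumes "algebraic_int a"
  obtains m where "m > 0" "\<And>i. \<exists>c. a ^ i = (\<Sum>l<m. of_int (c l) * a ^ l)"
proof -
  obtain P :: "int poly" where P: "poly (map_poly of_int P) a = 0" "lead_coeff P = 1"
    using assms algebraic_int_altdef_ipoly by blast
  define m where "m = degree P"
  have m: "m > 0"
  proof (rule Nat.gr0I)
    assume "m = 0"
    then obtain c where "P = [:c:]" by (metis m_def degree_0_id)
    then show False using P by simp
  qed
  have am: "a ^ m = (\<Sum>l<m. of_int (- poly.coeff P l) * a ^ l)"
  proof -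
    have "0 = (\<Sum>l\<le>m. of_int (poly.coeff P l) * a ^ l)"
      using P(1) by (simp add: poly_altdef m_def)
    also have "\<dots> = (\<Sum>l<m. of_int (poly.coeff P l) * a ^ l) + a ^ m"
      using P(2) by (simp add: m_def flip: lessThan_Suc_atMost)
    finally show ?thesis by (simp add: sum_negf eq_neg_iff_add_eq_0 add.commute)
  qed
  have "\<exists>c. a ^ i = (\<Sum>l<m. of_int (c l) * a ^ l)" for i
  proof (induction i)
    case 0
    have "a ^ 0 = (\<Sum>l<m. of_int (if l = 0 then 1 else 0) * a ^ l)"
      using m by (subst sum.remove[of _ 0]) auto
    then show ?case by (intro exI[of _ "\<lambda>l. if l = 0 then 1 else 0"])
  next
    case (Suc i)
    then obtain c where c: "a ^ i = (\<Sum>l<m. of_int (c l) * a ^ l)" by blast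
    define c' where "c' l = (if l = 0 then 0 else c (l - 1)) - c (m - 1) * poly.coeff P l" for l
    have "a ^ Suc i = (\<Sum>l<m. of_int (c l) * a ^ Suc l)"
      by (simp add: c sum_distrib_left mult_ac)
    also have "\<dots> = (\<Sum>l<m. of_int (if l = 0 then 0 else c (l - 1)) * a ^ l) + of_int (c (m - 1)) * a ^ m"
    proof -
      have "(\<Sum>l<m. of_int (c l) * a ^ Suc l) = (\<Sum>l<Suc m. of_int (if l = 0 then 0 else c (l - 1)) * a ^ l)"
        by (subst sum.lessThan_Suc_shift) simp
      then show ?thesis using m by simp
    qed
    also have "of_int (c (m - 1)) * a ^ m = (\<Sum>l<m. of_int (- (c (m - 1) * poly.coeff P l)) * a ^ l)"
      unfolding am by (simp add: sum_distrib_left mult_ac)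
    finally have "a ^ Suc i = (\<Sum>l<m. of_int (c' l) * a ^ l)"
      by (simp only: c'_def diff_conv_add_uminus sum.distrib[symmetric] distrib_right[symmetric] of_int_add[symmetric])
    then show ?case by blast
  qed
  then show ?thesis using that m by blast
qed

text \<open>Multiplication by \<open>a + b\<close> and by \<open>a * b\<close> preserves the span of
  the products \<open>a ^ i * b ^ j\<close> with \<open>i < m\<close> and
  \<open>j < n\<close>.\<close>

lemma
  fixes a b :: complex
  assumes a: "algebraic_int a" and b: "algebraic_int b"
  shows algebraic_int_plus: "algebraic_int (a + b)" and algebraic_int_times: "algebraic_int (a * b)"
proof -
  obtain m where m: "m > 0" "\<And>i. \<exists>c. a ^ i = (\<Sum>l<m. of_int (c l) * a ^ l)"
    using algebraic_int_power_in_span[OF a] by blast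
  obtain n where n: "n > 0" "\<And>i. \<exists>c. b ^ i = (\<Sum>l<n. of_int (c l) * b ^ l)"
    using algebraic_int_power_in_span[OF b] by blast
  define I where "I = {..<m} \<times> {..<n}"
  define e where "e k = a ^ fst k * b ^ snd k" for k :: "nat \<times> nat"
  have I: "finite I" "(0, 0) \<in> I" "e (0, 0) \<noteq> 0" using m n by (auto simp: I_def e_def)
  have sp: "\<exists>c. a ^ i * b ^ j = (\<Sum>k\<in>I. of_int (c k) * e k)" for i j
  proof -
    obtain c c' where c: "a ^ i = (\<Sum>l<m. of_int (c l) * a ^ l)" "b ^ j = (\<Sum>l<n. of_int (c' l) * b ^ l)"
      using m(2) n(2) by metis
    have "a ^ i * b ^ j = (\<Sum>k\<in>I. of_int (c (fst k) * c' (snd k)) * e k)"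
      unfolding c sum_product by (simp add: I_def sum.cartesian_product e_def case_prod_unfold mult_ac)
    then show ?thesis by (intro exI[of _ "\<lambda>k. c (fst k) * c' (snd k)"])
  qed
  show "algebraic_int (a * b)"
  proof (rule algebraic_int_if_stable_span[of I "(0, 0)" e, OF I])
    fix k :: "nat \<times> nat"
    show "\<exists>c. a * b * e k = (\<Sum>l\<in>I. of_int (c l) * e l)"
      using sp[of "Suc (fst k)" "Suc (snd k)"] by (simp add: e_def mult_ac)
  qed
  show "algebraic_int (a + b)"
  proof (rule algebraic_int_if_stable_span[of I "(0, 0)" e, OF I])
    fix k :: "nat \<times> nat"
    obtain c c' where "a ^ Suc (fst k) * b ^ snd k = (\<Sum>l\<in>I. of_int (c l) * e l)"
        "a ^ fst k * b ^ Suc (snd k) = (\<Sum>l\<in>I. of_int (c' l) * e l)" using sp by metis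
    then have "(a + b) * e k = (\<Sum>l\<in>I. of_int (c l + c' l) * e l)"
      by (simp add: e_def algebra_simps sum.distrib)
    then show "\<exists>c. (a + b) * e k = (\<Sum>l\<in>I. of_int (c l) * e l)"
      by (intro exI[of _ "\<lambda>l. c l + c' l"])
  qed
qed

lemma algebraic_int_diff:
  "algebraic_int (a :: complex) \<Longrightarrow> algebraic_int b \<Longrightarrow> algebraic_int (a - b)"
  using algebraic_int_plus[of a "- b"] by simp

lemma algebraic_int_power: "algebraic_int (a :: complex) \<Longrightarrow> algebraic_int (a ^ n)"
  by (induction n) (auto intro: algebraic_int_times)

lemma algebraic_int_sum: "(\<And>i. i \<in> A \<Longrightarrow> algebraic_int (f i :: complex)) \<Longrightarrow> algebraic_int (sum f A)"
  by (induction A rule: infinite_finite_induct) (auto intro: algebraic_int_plus)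

lemma algebraic_int_of_power:
  assumes "algebraic_int ((a :: complex) ^ n)" "n > 0" shows "algebraic_int a"
  by (rule algebraic_int_root[of "a ^ n" "Polynomial.monom 1 n"])
    (use assms in \<open>auto simp: poly_monom degree_monom_eq\<close>)

lemma not_algebraic_int_inverse_prime:
  assumes "Factorial_Ring.prime (p::nat)" shows "\<not> algebraic_int (1 / of_nat p :: complex)"
proof
  assume "algebraic_int (1 / of_nat p :: complex)"
  moreover have "1 / of_nat p \<in> (\<rat> :: complex set)" by simp
  ultimately have "1 / of_nat p \<in> (\<int> :: complex set)" by (rule rational_algebraic_int_is_int)
  then obtain k where "1 / of_nat p = (of_int k :: complex)" by (auto elim: Ints_cases)
  then have "of_int (k * int p) = (1 :: complex)"
    using assms by (simp add: field_simps prime_gt_0_nat)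
  then have "k * int p = 1" by (metis of_int_1 of_int_eq_iff)
  then have "int p dvd 1" by (metis dvd_triv_right)
  then show False using assms by simp
qed

section \<open>Real subfields and radicals of prime degree\<close>

text \<open>The fields of the degree argument are all real, so they are taken as sets of reals and
  calculations stay in the type \<open>real\<close>. Closure under division includes
  \<open>x / 0\<close>, which is \<open>0\<close>.\<close>

definition real_subfield :: "real set \<Rightarrow> bool" where
  "real_subfield K \<longleftrightarrow> 1 \<in> K \<and> (\<forall>x\<in>K. \<forall>y\<in>K. x - y \<in> K \<and> x * y \<in> K \<and> x / y \<in> K)"

lemma real_subfieldD:
  assumes "real_subfield K"
  shows "1 \<in> K" "0 \<in> K" "x \<in> K \<Longrightarrow> y \<in> K \<Longrightarrow> x - y \<in> K" "x \<in> K \<Longrightarrow> y \<in> K \<Longrightarrow> x * y \<in> K"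
    "x \<in> K \<Longrightarrow> y \<in> K \<Longrightarrow> x / y \<in> K" "x \<in> K \<Longrightarrow> y \<in> K \<Longrightarrow> x + y \<in> K" "x \<in> K \<Longrightarrow> - x \<in> K"
    "x \<in> K \<Longrightarrow> x ^ n \<in> K" "x \<in> K \<Longrightarrow> inverse x \<in> K"
proof -
  note K = assms[unfolded real_subfield_def]
  show 1: "1 \<in> K" using K by blast
  then show 0: "0 \<in> K" using K by (metis diff_self)
  show m: "x - y \<in> K" if "x \<in> K" "y \<in> K" for x y using K that by blast
  show u: "- x \<in> K" if "x \<in> K" for x using m[OF 0 that] by simp
  show "x + y \<in> K" if "x \<in> K" "y \<in> K" using m[OF that(1) u[OF that(2)]] by simp
  show t: "x * y \<in> K" if "x \<in> K" "y \<in> K" for x y using K that by blast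
  show d: "x / y \<in> K" if "x \<in> K" "y \<in> K" for x y using K that by blast
  show "inverse x \<in> K" if "x \<in> K" using d[OF 1 that] by (simp add: inverse_eq_divide)
  show "x ^ n \<in> K" if "x \<in> K" using that by (induction n) (auto intro: 1 t)
qed

lemma real_subfield_Rats: "real_subfield \<rat>"
  by (auto simp: real_subfield_def)

lemma real_subfield_of_nat: assumes "real_subfield K" shows "of_nat n \<in> K"
  by (induction n) (auto intro: real_subfieldD[OF assms])

lemma real_subfield_of_int: assumes "real_subfield K" shows "of_int n \<in> K"
  by (cases n) (auto intro: real_subfieldD[OF assms] real_subfield_of_nat[OF assms] simp del: of_nat_Suc)

definition quad_ext :: "real set \<Rightarrow> real \<Rightarrow> real set" where
  "quad_ext K s = {x + y * s | x y. x \<in> K \<and> y \<in> K}"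

lemma quad_extI: "x \<in> K \<Longrightarrow> y \<in> K \<Longrightarrow> x + y * s \<in> quad_ext K s"
  by (auto simp: quad_ext_def)

lemma quad_ext_eq_iff:
  assumes K: "real_subfield K" and s: "s \<notin> K" and xy: "x \<in> K" "y \<in> K" "x' \<in> K" "y' \<in> K"
  shows "x + y * s = x' + y' * s \<longleftrightarrow> x = x' \<and> y = y'"
proof
  assume eq: "x + y * s = x' + y' * s"
  have "y = y'"
  proof (rule ccontr)
    assume "y \<noteq> y'"
    then have "s = (x' - x) / (y - y')" using eq by (simp add: field_simps)
    moreover have "(x' - x) / (y - y') \<in> K" by (intro real_subfieldD(5)[OF K] real_subfieldD(3)[OF K] xy)
    ultimately show False using s by simp
  qed
  then show "x = x' \<and> y = y'" using eq by simp
qed simp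

lemma real_subfield_quad_ext:
  assumes K: "real_subfield K" and s: "s \<notin> K" "s\<^sup>2 \<in> K"
  shows "real_subfield (quad_ext K s)"
proof -
  note D = real_subfieldD[OF K]
  have diff: "u - v \<in> quad_ext K s" if uv: "u \<in> quad_ext K s" "v \<in> quad_ext K s" for u v
  proof -
    obtain x y x' y' where *: "u = x + y * s" "v = x' + y' * s" "x \<in> K" "y \<in> K" "x' \<in> K" "y' \<in> K"
      using uv by (auto simp: quad_ext_def)
    have "u - v = (x - x') + (y - y') * s" by (simp add: * algebra_simps)
    moreover have "x - x' \<in> K" "y - y' \<in> K" using * by (auto intro!: D(3))
    ultimately show ?thesis unfolding quad_ext_def by blast
  qed
  have mult: "u * v \<in> quad_ext K s" if uv: "u \<in> quad_ext K s" "v \<in> quad_ext K s" for u v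
  proof -
    obtain x y x' y' where *: "u = x + y * s" "v = x' + y' * s" "x \<in> K" "y \<in> K" "x' \<in> K" "y' \<in> K"
      using uv by (auto simp: quad_ext_def)
    have "u * v = (x * x' + y * y' * s\<^sup>2) + (x * y' + y * x') * s"
      by (simp add: * algebra_simps power2_eq_square)
    moreover have "x * x' + y * y' * s\<^sup>2 \<in> K" "x * y' + y * x' \<in> K"
      by (intro D(6) D(4); use * s(2) in simp)+
    ultimately show ?thesis unfolding quad_ext_def by blast
  qed
  have inv: "inverse u \<in> quad_ext K s" if u: "u \<in> quad_ext K s" for u
  proof -
    obtain x y where *: "u = x + y * s" "x \<in> K" "y \<in> K" using u by (auto simp: quad_ext_def)
    show ?thesis
    proof (cases "u = 0")
      case True
      then show ?thesis using quad_extI[OF D(2,2), of s] by simp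
    next
      case False
      define n where "n = x\<^sup>2 - y\<^sup>2 * s\<^sup>2"
      have n: "n \<in> K" unfolding n_def by (intro D(3) D(4) s(2) D(8)[OF *(2)] D(8)[OF *(3)])
      have nu: "n = u * (x - y * s)" by (simp add: n_def * algebra_simps power2_eq_square)
      have "x - y * s \<noteq> 0"
      proof
        assume "x - y * s = 0"
        then have "x + (- y) * s = 0 + 0 * s" by simp
        then have "x = 0 \<and> - y = 0" using quad_ext_eq_iff[OF K s(1) *(2) D(7)[OF *(3)] D(2) D(2)] by simp
        then show False using False * by simp
      qed
      then have "inverse u = (x - y * s) / n"
        unfolding nu by (metis inverse_eq_divide nonzero_divide_mult_cancel_right)
      then have "inverse u = x / n + (- y / n) * s" by (simp add: diff_divide_distrib)
      moreover have "x / n \<in> K" "- y / n \<in> K" by (intro D(5) D(7); use * n in simp)+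
      ultimately show ?thesis unfolding quad_ext_def by blast
    qed
  qed
  have "1 \<in> quad_ext K s" using quad_extI[OF D(1,2), of s] by simp
  then show ?thesis unfolding real_subfield_def using diff mult inv by (simp add: divide_inverse)
qed

lemma subset_quad_ext: assumes "real_subfield K" "x \<in> K" shows "x \<in> quad_ext K s"
  using quad_extI[OF assms(2) real_subfieldD(2)[OF assms(1)], of s] by simp

lemma gen_in_quad_ext: assumes "real_subfield K" shows "s \<in> quad_ext K s"
  using quad_extI[OF real_subfieldD(2,1)[OF assms], of s] by simp

text \<open>The conjugation that changes the sign of \<open>s\<close> respects powers; this is
  computed in coordinates instead of constructing the automorphism.\<close>

lemma quad_ext_conjugate_power:
  assumes K: "real_subfield K" and s: "s\<^sup>2 \<in> K" and xy: "x \<in> K" "y \<in> K"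
  shows "\<exists>U\<in>K. \<exists>W\<in>K. (x + y * s) ^ n = U + W * s \<and> (x - y * s) ^ n = U - W * s"
proof (induction n)
  case 0
  show ?case using real_subfieldD[OF K] by (intro bexI[of _ 1] bexI[of _ 0]) auto
next
  case (Suc n)
  then obtain U W where UW: "U \<in> K" "W \<in> K" "(x + y * s) ^ n = U + W * s" "(x - y * s) ^ n = U - W * s" by blast
  note D = real_subfieldD[OF K]
  have "(x + y * s) ^ Suc n = (x * U + y * W * s\<^sup>2) + (x * W + y * U) * s"
    unfolding power_Suc UW(3) by (simp add: algebra_simps power2_eq_square)
  moreover have "(x - y * s) ^ Suc n = (x * U + y * W * s\<^sup>2) - (x * W + y * U) * s"
    unfolding power_Suc UW(4) by (simp add: algebra_simps power2_eq_square)
  moreover have "x * U + y * W * s\<^sup>2 \<in> K" "x * W + y * U \<in> K"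
    by (intro D(6) D(4); use UW xy s in simp)+
  ultimately show ?case by blast
qed

lemma map_poly_of_real_mult:
  "map_poly complex_of_real (P * Q) = map_poly of_real P * map_poly of_real Q"
  by (rule poly_eqI) (simp add: coeff_map_poly coeff_mult)

text \<open>The constant term of the minimal polynomial of \<open>c\<close> over \<open>K\<close> is, up to a root of unity,
  a power of \<open>c\<close> with exponent prime to \<open>p\<close>.\<close>

lemma radical_powers_independent:
  fixes c :: real and \<kappa> :: "nat \<Rightarrow> real"
  assumes K: "real_subfield K" and p: "Factorial_Ring.prime (p::nat)" and c: "c > 0" "c ^ p \<in> K" "c \<notin> K"
    and \<kappa>: "\<And>i. \<kappa> i \<in> K" and rel: "(\<Sum>i<p. \<kappa> i * c ^ i) = 0" and i: "i < p"
  shows "\<kappa> i = 0"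
proof (rule ccontr)
  assume nz: "\<kappa> i \<noteq> 0"
  note D = real_subfieldD[OF K]
  define good where "good P \<longleftrightarrow> P \<noteq> 0 \<and> (\<forall>i. poly.coeff P i \<in> K) \<and> poly P c = 0" for P :: "real poly"
  define P0 where "P0 = (\<Sum>i<p. Polynomial.monom (\<kappa> i) i)"
  have cP0: "poly.coeff P0 l = (if l < p then \<kappa> l else 0)" for l by (simp add: P0_def coeff_sum)
  have "poly.coeff P0 i \<noteq> 0" using nz i cP0 by simp
  then have P0: "good P0" "degree P0 < p"
  proof -
    have "poly P0 c = 0" using rel by (simp add: P0_def poly_sum poly_monom)
    moreover have "P0 \<noteq> 0" using \<open>poly.coeff P0 i \<noteq> 0\<close> by auto
    ultimately show "good P0" unfolding good_def using \<kappa> D(2) by (simp add: cP0)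
    show "degree P0 < p" using i by (intro le_less_trans[OF degree_le[of "p - 1"]]) (auto simp: cP0)
  qed
  \<comment> \<open>An annihilating polynomial of least degree over \<open>K\<close>. Made monic it
    is the minimal polynomial of \<open>c\<close>, and its degree \<open>j\<close> is below
    \<open>p\<close>.\<close>
  obtain G0 where G0: "good G0" "\<And>P. good P \<Longrightarrow> degree G0 \<le> degree P"
    using P0(1) ex_has_least_nat[of good P0 degree] by auto
  define G where "G = Polynomial.smult (inverse (lead_coeff G0)) G0"
  have l0: "lead_coeff G0 \<noteq> 0" using G0(1) by (simp add: good_def)
  have G: "lead_coeff G = 1" "\<And>i. poly.coeff G i \<in> K" "poly G c = 0" "degree G = degree G0"
    using l0 G0(1) D by (auto simp: G_def good_def)
  define j where "j = degree G"
  have j: "0 < j" "j < p"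
  proof -
    show "j < p" using G0(2)[OF P0(1)] P0(2) G(4) by (simp add: j_def)
    show "0 < j"
    proof (rule Nat.gr0I)
      assume "j = 0"
      then obtain d where "G = [:d:]" by (metis j_def degree_0_id)
      then show False using G by simp
    qed
  qed
  define XP where "XP = Polynomial.monom 1 p - [:c ^ p:]"
  have XPK: "poly.coeff XP i \<in> K" for i
    using D c(2) by (auto simp: XP_def coeff_pCons split: nat.splits)
  obtain Q R where QR: "XP = Q * G + R" "\<And>i. poly.coeff R i \<in> K" "\<And>i. i \<ge> degree G \<Longrightarrow> poly.coeff R i = 0"
    using monic_division[of K G XP] D(2,3,4) G(1,2) XPK by metis
  have "R = 0"
  proof (rule ccontr)
    assume "R \<noteq> 0"
    have "poly R c = poly XP c - poly Q c * poly G c" using QR(1) by simp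
    also have "\<dots> = 0" using G(3) by (simp add: XP_def poly_monom)
    finally have "good R" using \<open>R \<noteq> 0\<close> QR(2) by (simp add: good_def)
    then have "degree G \<le> degree R" using G0(2) G(4) by simp
    then have "lead_coeff R = 0" using QR(3) by simp
    then show False using \<open>R \<noteq> 0\<close> by simp
  qed
  then have XPG: "XP = Q * G" using QR(1) by simp
  define Gc where "Gc = map_poly complex_of_real G"
  have Gc: "degree Gc = j" "lead_coeff Gc = 1"
    using G(1) by (auto simp: Gc_def j_def degree_map_poly)
  obtain zs where zs: "Gc = (\<Prod>z\<leftarrow>zs. [:-z, 1:])" "length zs = j"
    using fundamental_theorem_algebra_factorized[of Gc] Gc by auto
  \<comment> \<open>The minimal polynomial divides \<open>X ^ p - c ^ p\<close>, so all its complex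
    roots have modulus \<open>c\<close>, and the absolute value of its constant term is
    \<open>c ^ j\<close>.\<close>
  have nz: "norm z = c" if "z \<in> set zs" for z
  proof -
    have "poly Gc z = 0" using that by (simp add: zs poly_prod_list prod_list_zero_iff image_iff)
    then have "poly (map_poly complex_of_real XP) z = 0"
      unfolding XPG Gc_def by (simp add: map_poly_of_real_mult)
    then have "z ^ p = of_real (c ^ p)"
    proof -
      have "map_poly complex_of_real XP = Polynomial.monom 1 p - [:of_real (c ^ p):]"
        by (rule poly_eqI) (auto simp: XP_def coeff_map_poly coeff_pCons split: nat.splits)
      then show ?thesis using \<open>poly (map_poly complex_of_real XP) z = 0\<close> by (simp add: poly_monom)
    qed
    then have "norm z ^ p = c ^ p" using c(1) by (metis norm_of_real norm_power abs_of_pos zero_less_power)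
    then show ?thesis using c(1) prime_gt_0_nat[OF p] by (metis norm_ge_zero order.strict_implies_order power_eq_iff_eq_base)
  qed
  have "\<bar>poly G 0\<bar> = norm (poly Gc 0)"
    by (simp add: Gc_def poly_0_coeff_0 coeff_map_poly)
  also have "\<dots> = (\<Prod>z\<leftarrow>zs. norm z)"
    unfolding zs(1) by (induction zs) (auto simp: norm_mult)
  also have "\<dots> = c ^ length zs"
    using nz by (induction zs) auto
  finally have "\<bar>poly G 0\<bar> = c ^ j" by (simp add: zs(2))
  moreover have "poly G 0 \<in> K" using G(2)[of 0] by (simp add: poly_0_coeff_0)
  ultimately have cj: "c ^ j \<in> K" using D(7) by (metis abs_if)
  have "coprime j p" using j p prime_nat_iff'' by (metis coprime_commute nat_dvd_not_less prime_imp_coprime_nat)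
  then obtain a b where ab: "a * j = b * p + 1"
    using coprime_bezout_strong[of j p] p by (metis mult.commute not_prime_1)
  have "c = (c ^ j) ^ a / (c ^ p) ^ b"
    using ab c(1) by (simp flip: power_mult add: mult.commute[of j] mult.commute[of p] power_add)
  also have "\<dots> \<in> K" by (intro D(5) D(8) cj c(2))
  finally show False using c(3) by simp
qed

section \<open>The radical of a root of the quartic\<close>

text \<open>The Dickson polynomials with parameter \<open>1\<close>, that is, rescaled Chebyshev
  polynomials. They carry an equation for \<open>z ^ n + 1 / z ^ n\<close> over to
  \<open>z + 1 / z\<close>, on which conjugation is easy.\<close>

fun dickson :: "nat \<Rightarrow> real \<Rightarrow> real" where
  "dickson 0 x = 2"
| "dickson (Suc 0) x = x"
| "dickson (Suc (Suc n)) x = x * dickson (Suc n) x - dickson n x"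

lemma dickson_plus_inverse:
  assumes "z \<noteq> 0" shows "dickson n (z + 1 / z) = z ^ n + 1 / z ^ n"
proof -
  define i where "i = 1 / z"
  have zi: "z * i = 1" using assms by (simp add: i_def)
  have "dickson n (z + i) = z ^ n + i ^ n"
  proof (induction n rule: induct_nat_012)
    case (ge2 n)
    have "(z + i) * (z * z ^ n + i * i ^ n) = z * (z * z ^ n) + i * (i * i ^ n) + (z * i) * i ^ n + (z * i) * z ^ n"
      by (simp add: algebra_simps)
    then show ?case using ge2 zi by simp
  qed auto
  then show ?thesis by (simp add: i_def power_one_over)
qed

lemma dickson_cos: "dickson n (2 * cos x) = 2 * cos (real n * x)"
proof (induction n rule: induct_nat_012)
  case (ge2 n)
  have "cos (real (Suc (Suc n)) * x) = cos (real (Suc n) * x + x)"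
    and "cos (real n * x) = cos (real (Suc n) * x - x)" by (simp_all add: algebra_simps)
  then show ?case using ge2 by (simp add: cos_add cos_diff del: of_nat_Suc)
qed auto

lemma dickson_conjugate:
  assumes K: "real_subfield K" and s: "s\<^sup>2 \<in> K" and xy: "x \<in> K" "y \<in> K"
  shows "\<exists>U\<in>K. \<exists>W\<in>K. dickson n (x + y * s) = U + W * s \<and> dickson n (x - y * s) = U - W * s"
proof (induction n rule: induct_nat_012)
  case 0
  have "2 \<in> K" using real_subfield_of_nat[OF K, of 2] by simp
  then show ?case using real_subfieldD(2)[OF K] by (intro bexI[of _ 2] bexI[of _ 0]) auto
next
  case 1
  then show ?case using xy by (intro bexI[of _ x] bexI[of _ y]) auto
next
  case (ge2 n)
  note D = real_subfieldD[OF K]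
  obtain U W where 1: "U \<in> K" "W \<in> K" "dickson n (x + y * s) = U + W * s" "dickson n (x - y * s) = U - W * s"
    using ge2 by blast
  obtain U' W' where 2: "U' \<in> K" "W' \<in> K" "dickson (Suc n) (x + y * s) = U' + W' * s" "dickson (Suc n) (x - y * s) = U' - W' * s"
    using ge2 by blast
  have "dickson (Suc (Suc n)) (x + y * s) = (x * U' + y * W' * s\<^sup>2 - U) + (x * W' + y * U' - W) * s"
    unfolding dickson.simps 1 2 by (simp add: algebra_simps power2_eq_square)
  moreover have "dickson (Suc (Suc n)) (x - y * s) = (x * U' + y * W' * s\<^sup>2 - U) - (x * W' + y * U' - W) * s"
    unfolding dickson.simps 1 2 by (simp add: algebra_simps power2_eq_square)
  moreover have "x * U' + y * W' * s\<^sup>2 - U \<in> K" "x * W' + y * U' - W \<in> K"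
    by (intro D(3) D(6) D(4); use 1 2 xy s in simp)+
  ultimately show ?case by blast
qed

text \<open>On the interval from \<open>-2\<close> to \<open>2\<close> one can write
  \<open>x = 2 * cos y\<close>, and the value is \<open>2 * cos (n * y)\<close>.\<close>

lemma abs_gt_2_if_dickson_gt_2:
  assumes "\<bar>dickson n x\<bar> > 2" shows "\<bar>x\<bar> > 2"
proof (rule ccontr)
  assume "\<not> \<bar>x\<bar> > 2"
  then have "x = 2 * cos (arccos (x / 2))" by (simp add: abs_le_iff)
  then have "dickson n x = 2 * cos (real n * arccos (x / 2))" using dickson_cos by metis
  then show False using assms abs_cos_le_one[of "real n * arccos (x / 2)"] by (simp add: abs_mult)
qed

lemma ex_plus_inverse:
  assumes "\<bar>x\<bar> > (2::real)" shows "\<exists>y. \<bar>y\<bar> > 1 \<and> x = y + 1 / y"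
proof -
  have main: "\<exists>y>1. x = y + 1 / y" if "x > 2" for x :: real
  proof -
    define y where "y = (x + sqrt (x\<^sup>2 - 4)) / 2"
    have "x\<^sup>2 - 4 \<ge> 0" using power_mono[of 2 x 2] that by simp
    then have "(sqrt (x\<^sup>2 - 4))\<^sup>2 = x\<^sup>2 - 4" by simp
    then have "y * y = x * y - 1" by (simp add: y_def field_simps power2_eq_square)
    moreover have "y > 1"
    proof -
      have "1 < (x + r) / 2" if "2 < x" "0 \<le> r" for r :: real using that by (simp add: less_divide_eq)
      then show ?thesis unfolding y_def using that real_sqrt_ge_zero[OF \<open>x\<^sup>2 - 4 \<ge> 0\<close>] by blast
    qed
    ultimately show ?thesis by (intro exI[of _ y]) (auto simp: field_simps)
  qed
  show ?thesis
  proof (cases "x > 2")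
    case True then show ?thesis using main by force
  next
    case False
    then have "- x > 2" using assms by linarith
    then obtain y where "y > 1" "- x = y + 1 / y" using main by blast
    then show ?thesis by (intro exI[of _ "-y"]) auto
  qed
qed

lemma sqrt_prime_not_Rats: "Factorial_Ring.prime (p::nat) \<Longrightarrow> sqrt (real p) \<notin> \<rat>"
proof
  assume p: "Factorial_Ring.prime p" and "sqrt (real p) \<in> \<rat>"
  moreover have "algebraic_int (sqrt (real p))" by (intro algebraic_int_sqrt int_imp_algebraic_int) auto
  ultimately have "sqrt (real p) \<in> \<int>" by (intro rational_algebraic_int_is_int)
  then obtain n where n: "sqrt (real p) = of_int n" by (auto elim: Ints_cases)
  then have "real p = of_int (n\<^sup>2)" by (metis of_int_power of_nat_0_le_iff real_sqrt_pow2)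
  then have "int p = n\<^sup>2" by (metis of_int_eq_iff of_int_of_nat_eq)
  then have "p = (nat \<bar>n\<bar>)\<^sup>2" by (metis nat_int nat_power_eq abs_ge_zero power2_abs)
  then show False using p by (metis prime_power_iff Suc_1 n_not_Suc_n numeral_2_eq_2)
qed

text \<open>For \<open>M = e * L\<close> the number \<open>\<alpha>\<close> has norm
  \<open>M ^ 3 - 2 * M\<^sup>2 + 4 * M - 4\<close> and trace \<open>e * M\<^sup>2\<close>; passing
  to \<open>e * X\<close> removes the sign from the odd coefficients.\<close>

definition quartic :: "int \<Rightarrow> int poly" where
  "quartic M = [:1, - M\<^sup>2, M ^ 3 - 2 * M\<^sup>2 + 4 * M - 2, - M\<^sup>2, 1:]"

text \<open>Here \<open>v\<close> is the \<open>p\<close>-th power of a unit \<open>w\<close> of norm \<open>-1\<close>, and \<open>e\<close> is a sign; \<open>A\<close> and \<open>B\<close>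
  are the conjugate values of \<open>\<alpha>\<close> up to sign. If \<open>a = c ^ p\<close> with \<open>c\<close> in \<open>k(a)\<close>, then
  \<open>c + 1 / c\<close> is an integer of \<open>k\<close> too close to \<open>w\<^sup>2\<close>.\<close>

locale unit_power =
  fixes p :: nat and L V lw bw :: int and w v :: real and e :: int
  assumes p: "Factorial_Ring.prime p" "p \<ge> 5"
    and w: "w = (of_int lw + of_int bw * sqrt (real p)) / 2" "lw\<^sup>2 + 4 = int p * bw\<^sup>2" "w \<ge> 10"
    and v: "v = (of_int L + of_int V * sqrt (real p)) / 2" "L\<^sup>2 + 4 = int p * V\<^sup>2" "v = w ^ p"
    and LV: "L > 2" "V > 0" and e: "e = 1 \<or> e = -1"
begin

abbreviation sp :: real where "sp \<equiv> sqrt (real p)"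

definition k :: "real set" where "k = quad_ext \<rat> sp"

text \<open>Since \<open>v\<close> has norm \<open>-1\<close>, conjugation in \<open>k\<close>
  replaces \<open>v\<close> by \<open>- 1 / v\<close>; it exchanges \<open>A\<close> and
  \<open>B\<close>. Then \<open>a\<close> is the larger root of
  \<open>X\<^sup>2 - A * X + 1\<close>.\<close>

definition A :: real where "A = v\<^sup>2 - e * v - 1 - e / v"
definition B :: real where "B = 1 / v\<^sup>2 + e / v - 1 + e * v"
definition s :: real where "s = sqrt (A\<^sup>2 - 4)"
definition K :: "real set" where "K = quad_ext k s"
definition a :: real where "a = (A + s) / 2"
definition c :: real where "c = root p a"

lemma odd_p: "odd p" using p prime_odd_nat by auto

lemma ee: "real_of_int e * real_of_int e = 1" using e by auto

lemma v_ge: "v \<ge> w ^ 5" using v(3) w(3) p(2) power_increasing[of 5 p w] by simp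

lemma v_big: "v \<ge> 100000"
proof -
  have "(10::real) ^ 5 \<le> w ^ 5" using w(3) by (intro power_mono) auto
  then show ?thesis using v_ge by simp
qed

lemma real_norm_eq: "real_of_int L ^ 2 + 4 = real p * real_of_int V ^ 2"
  using v(2) by (metis of_int_add of_int_mult of_int_numeral of_int_of_nat_eq of_int_power)

lemma inverse_v: "1 / v = (of_int V * sp - of_int L) / 2"
proof -
  have "v * ((of_int V * sp - of_int L) / 2) = (real p * real_of_int V ^ 2 - real_of_int L ^ 2) / 4"
    by (simp add: v(1) field_simps power2_eq_square)
  also have "\<dots> = 1" using real_norm_eq by simp
  finally show ?thesis using v_big by (simp add: field_simps)
qed

lemma v_sq: "v\<^sup>2 = L * v + 1"
proof -
  have "v - 1 / v = L" unfolding inverse_v using v(1) by (simp add: field_simps)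
  then have "v * (v - 1 / v) = v * L" by simp
  then show ?thesis using v_big by (simp add: right_diff_distrib power2_eq_square algebra_simps)
qed

lemma A_eq: "A = (of_int (L\<^sup>2) + of_int ((L - 2 * e) * V) * sp) / 2"
proof -
  note v_sq
  then have "A = L * v - e * (v + 1 / v)" by (simp add: A_def algebra_simps)
  also have "v + 1 / v = V * sp" unfolding inverse_v by (simp add: v(1) field_simps)
  finally show ?thesis by (simp add: v(1) field_simps power2_eq_square)
qed

lemma B_eq: "B = (of_int (L\<^sup>2) - of_int ((L - 2 * e) * V) * sp) / 2"
proof -
  have "1 / v\<^sup>2 = (v\<^sup>2 - L * v) / v\<^sup>2" using v_sq by simp
  also have "\<dots> = 1 - L * (1 / v)" using v_big by (simp add: diff_divide_distrib power2_eq_square)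
  finally have "1 / v\<^sup>2 = 1 - L * (1 / v)" .
  then have "B = - L * (1 / v) + e * (v + 1 / v)" by (simp add: B_def algebra_simps)
  also have "v + 1 / v = V * sp" unfolding inverse_v by (simp add: v(1) field_simps)
  finally show ?thesis unfolding inverse_v by (simp add: field_simps power2_eq_square)
qed

lemma AB_sum: "A + B = of_int (L\<^sup>2)" unfolding A_eq B_eq by (simp add: field_simps)

lemma AB_prod: "A * B = of_int ((e * L) ^ 3 - 2 * (e * L)\<^sup>2 + 4 * (e * L) - 4)"
proof -
  have "4 * (A * B) = (of_int (L\<^sup>2))\<^sup>2 - (of_int ((L - 2 * e) * V))\<^sup>2 * real p"
    unfolding A_eq B_eq by (simp add: field_simps power2_eq_square)
  also have "\<dots> = real_of_int L ^ 4 - (real_of_int L - 2 * e)\<^sup>2 * (real p * real_of_int V ^ 2)"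
    by (simp add: power_mult_distrib mult_ac flip: power_mult)
  also have "\<dots> = real_of_int L ^ 4 - (real_of_int L - 2 * e)\<^sup>2 * (real_of_int L ^ 2 + 4)"
    by (simp add: real_norm_eq)
  also have "\<dots> = 4 * (real_of_int (e * L) ^ 3 - 2 * real_of_int (e * L) ^ 2 + 4 * real_of_int (e * L) - 4)"
    using e by (elim disjE) (simp_all add: algebra_simps power2_eq_square power3_eq_cube power4_eq_xxxx)
  finally show ?thesis by simp
qed

lemma quartic_factor:
  "poly (map_poly of_int (quartic (e * L))) x = (x\<^sup>2 - A * x + 1) * (x\<^sup>2 - B * x + 1)"
proof -
  have "(x\<^sup>2 - A * x + 1) * (x\<^sup>2 - B * x + 1) = x ^ 4 - (A + B) * x ^ 3 + (A * B + 2) * x\<^sup>2 - (A + B) * x + 1"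
    by (simp add: algebra_simps power2_eq_square power3_eq_cube power4_eq_xxxx)
  then show ?thesis unfolding AB_sum AB_prod using e
    by (elim disjE) (simp_all add: quartic_def algebra_simps power2_eq_square power3_eq_cube power4_eq_xxxx)
qed

lemma A_bounds: "v\<^sup>2 - v - 2 \<le> A" "A \<le> v\<^sup>2 + v" "A > 2"
proof -
  have iv: "0 < 1 / v" "1 / v < 1" using v_big by auto
  have "A = v\<^sup>2 - v - 1 - 1 / v \<or> A = v\<^sup>2 + v - 1 + 1 / v" using e by (auto simp: A_def)
  then show 1: "v\<^sup>2 - v - 2 \<le> A" "A \<le> v\<^sup>2 + v" using iv v_big by linarith+
  have "v\<^sup>2 \<ge> 100000 * v" using v_big by (simp add: power2_eq_square)
  then show "A > 2" using 1 v_big by linarith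
qed

lemma B_bounds: "\<bar>B\<bar> > 2" "\<bar>B\<bar> \<le> v + 3"
proof -
  have iv: "0 < 1 / v" "1 / v < 1" using v_big by auto
  then have "(1 / v)\<^sup>2 < 1" "(1 / v)\<^sup>2 > 0" by (auto simp only: power_less_one_iff zero_less_power) 
  then have iv2: "0 < 1 / v\<^sup>2" "1 / v\<^sup>2 < 1" by (simp_all only: power_one_over)
  have "B = 1 / v\<^sup>2 + 1 / v - 1 + v \<or> B = 1 / v\<^sup>2 - 1 / v - 1 - v" using e by (auto simp: B_def)
  then show "\<bar>B\<bar> > 2" "\<bar>B\<bar> \<le> v + 3" using iv iv2 v_big by linarith+
qed

lemma k_field: "real_subfield k"
  unfolding k_def using sqrt_prime_not_Rats[OF p(1)] by (intro real_subfield_quad_ext real_subfield_Rats) auto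

lemma k_eq_iff: "x \<in> \<rat> \<Longrightarrow> y \<in> \<rat> \<Longrightarrow> x' \<in> \<rat> \<Longrightarrow> y' \<in> \<rat> \<Longrightarrow> x + y * sp = x' + y' * sp \<longleftrightarrow> x = x' \<and> y = y'"
  using quad_ext_eq_iff[OF real_subfield_Rats sqrt_prime_not_Rats[OF p(1)]] by blast

lemma A_form: "A = of_int (L\<^sup>2) / 2 + (of_int ((L - 2 * e) * V) / 2) * sp"
  and B_form: "B = of_int (L\<^sup>2) / 2 - (of_int ((L - 2 * e) * V) / 2) * sp"
  unfolding A_eq B_eq by (simp_all add: field_simps)

lemma A_in_k: "A \<in> k" unfolding A_form k_def by (intro quad_extI) auto

lemma L2e_nonzero: "(L - 2 * e) * V \<noteq> 0" using LV e by auto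

lemma A_not_Rats: "A \<notin> \<rat>"
proof
  assume "A \<in> \<rat>"
  then have "A + 0 * sp = of_int (L\<^sup>2) / 2 + (of_int ((L - 2 * e) * V) / 2) * sp" using A_form by simp
  then have "0 = real_of_int ((L - 2 * e) * V) / 2"
    using k_eq_iff[of A 0 "of_int (L\<^sup>2) / 2" "of_int ((L - 2 * e) * V) / 2"] \<open>A \<in> \<rat>\<close>
    by (metis Rats_0 Rats_divide Rats_number_of Rats_of_int)
  then show False using L2e_nonzero by (metis divide_eq_0_iff of_int_eq_0_iff zero_neq_numeral)
qed

lemma s_sq: "s\<^sup>2 = A\<^sup>2 - 4" and s_pos: "s > 0"
proof -
  have "A\<^sup>2 > 4" using power_strict_mono[of 2 A 2] A_bounds(3) by simp
  then show "s\<^sup>2 = A\<^sup>2 - 4" "s > 0" by (auto simp: s_def)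
qed

lemma disc_prod: "(A\<^sup>2 - 4) * (B\<^sup>2 - 4) = real p * (of_int (L * (e * L - 2) * V))\<^sup>2"
proof -
  have "(A\<^sup>2 - 4) * (B\<^sup>2 - 4) = (A * B + 4)\<^sup>2 - 4 * (A + B)\<^sup>2"
    by (simp add: algebra_simps power2_eq_square)
  also have "\<dots> = (real_of_int L)\<^sup>2 * (real_of_int (e * L) - 2)\<^sup>2 * (real_of_int L ^ 2 + 4)"
    unfolding AB_sum AB_prod using e
    by (elim disjE) (simp_all add: algebra_simps power2_eq_square power3_eq_cube power4_eq_xxxx)
  finally show ?thesis by (simp add: real_norm_eq power_mult_distrib mult_ac)
qed

text \<open>The norm of a square in \<open>k\<close> is a rational square, but the norm
  \<open>(A\<^sup>2 - 4) * (B\<^sup>2 - 4)\<close> is \<open>p\<close> times a nonzero one.\<close>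

lemma s_not_in_k: "s \<notin> k"
proof
  assume "s \<in> k"
  then obtain x y where xy: "s = x + y * sp" "x \<in> \<rat>" "y \<in> \<rat>" by (auto simp: k_def quad_ext_def)
  define P Q where "P = real_of_int (L\<^sup>2) / 2" and "Q = real_of_int ((L - 2 * e) * V) / 2"
  have PQ: "P \<in> \<rat>" "Q \<in> \<rat>" by (auto simp: P_def Q_def)
  have "(x\<^sup>2 + y\<^sup>2 * real p) + (2 * x * y) * sp = s\<^sup>2"
    by (simp add: xy(1) algebra_simps power2_eq_square)
  also have "s\<^sup>2 = (P\<^sup>2 + Q\<^sup>2 * real p - 4) + (2 * P * Q) * sp"
    unfolding s_sq A_form P_def[symmetric] Q_def[symmetric]
    by (simp add: algebra_simps power2_eq_square)
  finally have *: "x\<^sup>2 + y\<^sup>2 * real p = P\<^sup>2 + Q\<^sup>2 * real p - 4" "2 * x * y = 2 * P * Q"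
    using k_eq_iff[of "x\<^sup>2 + y\<^sup>2 * real p" "2 * x * y" "P\<^sup>2 + Q\<^sup>2 * real p - 4" "2 * P * Q"] xy PQ by auto
  have "B\<^sup>2 - 4 = (P\<^sup>2 + Q\<^sup>2 * real p - 4) - (2 * P * Q) * sp"
    unfolding B_form P_def[symmetric] Q_def[symmetric]
    by (simp add: algebra_simps power2_eq_square)
  also have "\<dots> = (x - y * sp)\<^sup>2"
    unfolding *[symmetric] by (simp add: algebra_simps power2_eq_square)
  finally have "(A\<^sup>2 - 4) * (B\<^sup>2 - 4) = (s * (x - y * sp))\<^sup>2" by (simp add: s_sq power_mult_distrib)
  also have "s * (x - y * sp) = x\<^sup>2 - y\<^sup>2 * real p"
    by (simp add: xy(1) algebra_simps power2_eq_square)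
  finally have "(x\<^sup>2 - y\<^sup>2 * real p)\<^sup>2 = (sp * of_int (L * (e * L - 2) * V))\<^sup>2"
    using disc_prod by (simp add: power_mult_distrib)
  then have "\<bar>x\<^sup>2 - y\<^sup>2 * real p\<bar> = sp * \<bar>real_of_int (L * (e * L - 2) * V)\<bar>"
  proof -
    assume "(x\<^sup>2 - y\<^sup>2 * real p)\<^sup>2 = (sp * of_int (L * (e * L - 2) * V))\<^sup>2"
    then have "\<bar>x\<^sup>2 - y\<^sup>2 * real p\<bar> = \<bar>sp * of_int (L * (e * L - 2) * V)\<bar>"
      by (simp only: abs_eq_iff power2_eq_iff)
    then show ?thesis by (simp only: abs_mult[of sp]) simp
  qed
  moreover have nz: "real_of_int (L * (e * L - 2) * V) \<noteq> 0"
    unfolding of_int_eq_0_iff using LV e by auto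
  ultimately have "sp = \<bar>x\<^sup>2 - y\<^sup>2 * real p\<bar> / \<bar>real_of_int (L * (e * L - 2) * V)\<bar>" by simp
  also have "\<dots> \<in> \<rat>" using xy by (auto simp: abs_if intro!: Rats_divide)
  finally show False using sqrt_prime_not_Rats[OF p(1)] by simp
qed

lemma K_field: "real_subfield K"
proof -
  have "4 \<in> k" using real_subfield_of_nat[OF k_field, of 4] by simp
  then have "s\<^sup>2 \<in> k" unfolding s_sq using A_in_k by (intro real_subfieldD(3,8)[OF k_field])
  then show ?thesis unfolding K_def by (intro real_subfield_quad_ext k_field s_not_in_k)
qed

lemma a_props: "a * a = A * a - 1" "a > 1" "1 / a = (A - s) / 2"
proof -
  show 1: "a * a = A * a - 1"
    using s_sq by (simp add: a_def field_simps power2_eq_square)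
  show "a > 1" using A_bounds(3) s_pos by (simp add: a_def)
  then show "1 / a = (A - s) / 2"
    using s_sq by (simp add: a_def field_simps power2_eq_square)
qed

lemma c_props: "c ^ p = a" "c > 1"
proof -
  show "c ^ p = a" using a_props(2) p(2) by (simp add: c_def)
  show "c > 1" using a_props(2) p(2) by (simp add: c_def)
qed

lemma c_sum: "c ^ p + 1 / c ^ p = A"
  unfolding c_props(1) a_props(3) by (simp add: a_def field_simps)

lemma w_form: "w = of_int lw / 2 + (of_int bw / 2) * sp" using w(1) by (simp add: field_simps)

lemma inverse_w: "- 1 / w = of_int lw / 2 - (of_int bw / 2) * sp"
proof -
  have n: "real_of_int lw ^ 2 + 4 = real p * real_of_int bw ^ 2"
    using w(2) by (metis of_int_add of_int_mult of_int_numeral of_int_of_nat_eq of_int_power)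
  have "w * (of_int lw / 2 - (of_int bw / 2) * sp) = (real_of_int lw ^ 2 - real p * real_of_int bw ^ 2) / 4"
    by (simp add: w_form field_simps power2_eq_square)
  also have "\<dots> = - 1" using n by simp
  finally show ?thesis using w(3) by (simp add: field_simps)
qed

text \<open>\<open>c ^ p = a\<close> differs from \<open>v\<^sup>2 = (w\<^sup>2) ^ p\<close> by a
  relative error of order \<open>1 / v\<close>, and \<open>v \<ge> w ^ 5\<close> makes this smaller
  than \<open>x = 1 / w ^ 4\<close>. Extracting the root needs only
  \<open>(1 + x) ^ p \<ge> 1 + x\<close> and \<open>(1 - x) ^ p \<le> 1 - x\<close>.\<close>

lemma c_close: "\<bar>c - w\<^sup>2\<bar> \<le> 1 / w\<^sup>2"
proof -
  have w0: "w > 0" using w(3) by simp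
  have pp: "p > 0" using p(2) by simp
  define x where "x = 1 / w ^ 4"
  have x: "0 < x" "x < 1" using w(3) by (auto simp: x_def one_less_power)
  have wx: "w\<^sup>2 + 1 / w\<^sup>2 = w\<^sup>2 * (1 + x)" "w\<^sup>2 - 1 / w\<^sup>2 = w\<^sup>2 * (1 - x)"
    using w0 by (simp_all add: x_def field_simps power2_eq_square power4_eq_xxxx)
  have v2: "(w\<^sup>2) ^ p = v\<^sup>2" by (simp add: v(3) power_mult[symmetric] mult.commute)
  have vw: "10 * w ^ 4 \<le> v"
  proof -
    have "10 * w ^ 4 \<le> w * w ^ 4" using w(3) by (intro mult_right_mono) auto
    then show ?thesis using v_ge by (simp flip: power_Suc)
  qed
  then have vx: "v * x \<ge> 10" using w0 by (simp add: x_def field_simps)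
  have aA: "A - 1 \<le> a" "a \<le> A"
  proof -
    have "a + 1 / a = A" using c_sum unfolding c_props(1) .
    moreover have "0 < 1 / a" "1 / a < 1" using a_props(2) by auto
    ultimately show "A - 1 \<le> a" "a \<le> A" by linarith+
  qed
  have "c ^ p \<le> (w\<^sup>2 + 1 / w\<^sup>2) ^ p"
  proof -
    have "v * 1 \<le> v * (v * x)" using vx v_big by (intro mult_left_mono) auto
    then have "c ^ p \<le> v\<^sup>2 * (1 + x)" using aA(2) A_bounds(2) c_props by (simp add: algebra_simps power2_eq_square)
    also have "\<dots> \<le> v\<^sup>2 * (1 + x) ^ p"
      using x pp by (intro mult_left_mono self_le_power) auto
    finally show ?thesis unfolding wx power_mult_distrib v2 .
  qed
  then have 1: "c \<le> w\<^sup>2 + 1 / w\<^sup>2" using power_le_imp_le_base[of c "p - 1" "w\<^sup>2 + 1 / w\<^sup>2"] pp by simp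
  have "(w\<^sup>2 - 1 / w\<^sup>2) ^ p \<le> c ^ p"
  proof -
    have "(1 - x) ^ p \<le> 1 - x" using x pp power_decreasing[of 1 p "1 - x"] by simp
    then have "v\<^sup>2 * (1 - x) ^ p \<le> v\<^sup>2 * (1 - x)" by (intro mult_left_mono) auto
    also have "\<dots> \<le> c ^ p"
    proof -
      have "v * 10 \<le> v * (v * x)" using vx v_big by (intro mult_left_mono) auto
      moreover have "v\<^sup>2 * (1 - x) = v\<^sup>2 - v * (v * x)" by (simp add: algebra_simps power2_eq_square)
      ultimately show ?thesis using aA(1) A_bounds(1) c_props(1) v_big by linarith
    qed
    finally show ?thesis unfolding wx power_mult_distrib v2 .
  qed
  then have 2: "w\<^sup>2 - 1 / w\<^sup>2 \<le> c" using power_le_imp_le_base[of "w\<^sup>2 - 1 / w\<^sup>2" "p - 1" c] pp c_props by simp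
  show ?thesis using 1 2 by linarith
qed

lemma alg_int_if_quartic_root:
  assumes "poly (map_poly of_int (quartic M)) (x::real) = 0" shows "algebraic_int (complex_of_real x)"
proof -
  have "algebraic_int x" unfolding algebraic_int_altdef_ipoly
    using assms by (intro exI[of _ "quartic M"]) (simp add: quartic_def)
  then show ?thesis by simp
qed

lemma alg_int_radical_plus_inverse:
  assumes x: "x \<noteq> (0::real)" "x ^ p + 1 / x ^ p = A \<or> x ^ p + 1 / x ^ p = B"
  shows "algebraic_int (complex_of_real (x + 1 / x))"
proof -
  have q: "(y\<^sup>2 - A * y + 1) * (y\<^sup>2 - B * y + 1) = 0" if "y + 1 / y = A \<or> y + 1 / y = B" "y \<noteq> 0" for y
  proof -
    have "y\<^sup>2 - (y + 1 / y) * y + 1 = 0" using that(2) by (simp add: distrib_right power2_eq_square)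
    then show ?thesis using that(1) by (elim disjE) (simp_all only: mult_zero_left mult_zero_right)
  qed
  have "algebraic_int (complex_of_real (x ^ p))" "algebraic_int (complex_of_real ((1 / x) ^ p))"
    by (rule alg_int_if_quartic_root[of "e * L"], unfold quartic_factor, rule q;
        use x in \<open>simp add: power_one_over add.commute\<close>)+
  then have "algebraic_int (complex_of_real x)" "algebraic_int (complex_of_real (1 / x))"
    using p(2) algebraic_int_of_power[of "complex_of_real x" p] algebraic_int_of_power[of "complex_of_real (1 / x)" p]
    by (simp_all only: of_real_power)
  then show ?thesis unfolding of_real_add by (rule algebraic_int_plus)
qed

text \<open>If \<open>c = x + y * s\<close> with \<open>x\<close> and \<open>y\<close> in
  \<open>k\<close>, its conjugate over \<open>k\<close> is the real \<open>p\<close>-th root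
  \<open>1 / c\<close> of \<open>1 / a\<close>, so \<open>\<beta> = c + 1 / c\<close> lies in
  \<open>k\<close>. The norm of \<open>\<beta> - w\<^sup>2\<close> is then a nonzero integer,
  although its two factors are at most \<open>3 / w\<^sup>2\<close> and \<open>2 * w + 2\<close> in
  absolute value and \<open>w \<ge> 10\<close>.\<close>

lemma c_not_in_K: "c \<notin> K"
proof
  assume "c \<in> K"
  then obtain x y where xy: "c = x + y * s" "x \<in> k" "y \<in> k" by (auto simp: K_def quad_ext_def)
  note D = real_subfieldD[OF k_field]
  have k2: "2 \<in> k" "4 \<in> k" using real_subfield_of_nat[OF k_field, of 2] real_subfield_of_nat[OF k_field, of 4] by auto
  have s2: "s\<^sup>2 \<in> k" unfolding s_sq by (intro D(3) D(8) A_in_k k2)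
  obtain U W where UW: "U \<in> k" "W \<in> k" "(x + y * s) ^ p = U + W * s" "(x - y * s) ^ p = U - W * s"
    using quad_ext_conjugate_power[OF k_field s2 xy(2,3), of p] by blast
  have "U + W * s = A / 2 + (1 / 2) * s"
    using UW(3) c_props(1) by (simp add: xy(1) a_def add_divide_distrib)
  then have "U = A / 2 \<and> W = 1 / 2"
    using quad_ext_eq_iff[OF k_field s_not_in_k UW(1,2), of "A / 2" "1 / 2"] D(5)[OF A_in_k k2(1)] D(5)[OF D(1) k2(1)] by simp
  then have UW_eq: "U = A / 2" "W = 1 / 2" by auto
  have "(x - y * s) ^ p = (A - s) / 2" unfolding UW(4) UW_eq by (simp add: diff_divide_distrib)
  also have "\<dots> = (1 / c) ^ p" using a_props(3) c_props(1) by (simp add: power_one_over)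
  \<comment> \<open>Here \<open>p\<close> is odd, so real \<open>p\<close>-th roots are unique and
    no sign is lost.\<close>
  finally have "root p ((x - y * s) ^ p) = root p ((1 / c) ^ p)" by simp
  then have cinv: "x - y * s = 1 / c" by (metis odd_real_root_power_cancel[OF odd_p])
  define \<beta> where "\<beta> = c + 1 / c"
  have "\<beta> = 2 * x" unfolding \<beta>_def cinv[symmetric] by (simp add: xy(1))
  then have "\<beta> \<in> k" using D(4)[OF k2(1) xy(2)] by simp
  then obtain r1 r2 where r: "\<beta> = r1 + r2 * sp" "r1 \<in> \<rat>" "r2 \<in> \<rat>" by (auto simp: k_def quad_ext_def)
  define \<beta>' where "\<beta>' = r1 - r2 * sp"
  \<comment> \<open>The equation \<open>c ^ p + 1 / c ^ p = A\<close> reads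
    \<open>dickson p \<beta> = A\<close> and can be conjugated to
    \<open>dickson p \<beta>' = B\<close>. Because \<open>\<bar>B\<bar> > 2\<close>, also
    \<open>\<beta>'\<close> has the form \<open>z + 1 / z\<close> with real \<open>z\<close>, and
    \<open>\<bar>B\<bar> \<le> v + 3\<close> bounds \<open>z\<close> by a multiple of
    \<open>w\<close>.\<close>
  have "dickson p \<beta> = A"
    unfolding \<beta>_def using dickson_plus_inverse[of c p] c_props(2) c_sum by simp
  moreover have "sp\<^sup>2 \<in> \<rat>" by simp
  then obtain U' W' where UW': "U' \<in> \<rat>" "W' \<in> \<rat>" "dickson p \<beta> = U' + W' * sp" "dickson p \<beta>' = U' - W' * sp"
    using dickson_conjugate[OF real_subfield_Rats _ r(2,3), of sp p] unfolding r(1)[symmetric] \<beta>'_def by blast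
  ultimately have "U' + W' * sp = of_int (L\<^sup>2) / 2 + (of_int ((L - 2 * e) * V) / 2) * sp" using A_form by simp
  then have "U' = of_int (L\<^sup>2) / 2 \<and> W' = of_int ((L - 2 * e) * V) / 2"
    using k_eq_iff[of U' W' "of_int (L\<^sup>2) / 2" "of_int ((L - 2 * e) * V) / 2"] UW'(1,2)
    by (metis Rats_divide Rats_number_of Rats_of_int)
  then have UW'_eq: "U' = of_int (L\<^sup>2) / 2" "W' = of_int ((L - 2 * e) * V) / 2" by auto
  have B: "dickson p \<beta>' = B" unfolding UW'(4) UW'_eq B_form ..
  then have b2: "\<bar>\<beta>'\<bar> > 2" using B_bounds(1) abs_gt_2_if_dickson_gt_2 by metis
  then obtain z where z: "\<bar>z\<bar> > 1" "\<beta>' = z + 1 / z" using ex_plus_inverse by blast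
  then have z0: "z \<noteq> 0" by auto
  have zB: "z ^ p + 1 / z ^ p = B" using B dickson_plus_inverse[OF z0] z(2) by simp
  have zle: "\<bar>z\<bar> \<le> 2 * w"
  proof -
    have "\<bar>z ^ p\<bar> \<ge> 1" using z(1) by (simp add: power_abs one_le_power)
    then have "\<bar>1 / z ^ p\<bar> \<le> 1" using z0 by (simp add: divide_le_eq)
    then have "\<bar>z ^ p\<bar> \<le> v + 4" using zB B_bounds(2) by linarith
    also have "\<dots> \<le> 2 * v" using v_big by simp
    also have "\<dots> \<le> 2 ^ p * v" using v_big p(2) self_le_power[of "2::real" p] by (intro mult_right_mono) auto
    also have "\<dots> = (2 * w) ^ p" by (simp add: v(3) power_mult_distrib)
    finally have "\<bar>z\<bar> ^ p \<le> (2 * w) ^ p" by (simp add: power_abs)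
    then show ?thesis using power_le_imp_le_base[of "\<bar>z\<bar>" "p - 1" "2 * w"] p(2) w(3) by simp
  qed
  have b'le: "\<bar>\<beta>'\<bar> \<le> 2 * w + 1"
  proof -
    have "\<bar>1 / z\<bar> \<le> 1" using z(1) z0 by (simp add: divide_le_eq)
    then show ?thesis using zle z(2) by linarith
  qed
  have w2: "w\<^sup>2 \<ge> 100" using power_mono[of 10 w 2] w(3) by simp
  have iw2: "0 < 1 / w\<^sup>2" "1 / w\<^sup>2 \<le> 1 / 100" using w2 w(3) by (auto simp: field_simps)
  have ble: "\<bar>\<beta> - w\<^sup>2\<bar> \<le> 3 / w\<^sup>2"
  proof -
    have "w\<^sup>2 - c \<le> 1 / 100" using c_close iw2(2) by linarith
    then have "w\<^sup>2 \<le> 2 * c" using w2 by linarith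
    then have "c \<ge> w\<^sup>2 / 2" by simp
    then have "1 / c \<le> 1 / (w\<^sup>2 / 2)" using w2 by (intro divide_left_mono) (auto intro!: mult_pos_pos)
    then have "1 / c \<le> 2 / w\<^sup>2" by simp
    moreover have "1 / c > 0" using c_props(2) by simp
    moreover have "3 / w\<^sup>2 = 1 / w\<^sup>2 + 2 / w\<^sup>2" by (simp add: add_divide_distrib[symmetric])
    ultimately show ?thesis using c_close unfolding \<beta>_def by linarith
  qed
  define q1 q2 where "q1 = (of_int lw / 2)\<^sup>2 + (of_int bw / 2)\<^sup>2 * real p" and "q2 = 2 * (of_int lw / 2) * (real_of_int bw / 2)"
  have q: "q1 \<in> \<rat>" "q2 \<in> \<rat>" by (auto simp: q1_def q2_def)
  have wq: "w\<^sup>2 = q1 + q2 * sp"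
    unfolding w_form q1_def q2_def by (simp add: algebra_simps power2_eq_square)
  have wq': "1 / w\<^sup>2 = q1 - q2 * sp"
  proof -
    have "1 / w\<^sup>2 = (- 1 / w)\<^sup>2" by (simp add: power_divide)
    then show ?thesis unfolding inverse_w q1_def q2_def by (simp add: algebra_simps power2_eq_square)
  qed
  define n where "n = (\<beta> - w\<^sup>2) * (\<beta>' - 1 / w\<^sup>2)"
  have "n = ((r1 + r2 * sp) - (q1 + q2 * sp)) * ((r1 - r2 * sp) - (q1 - q2 * sp))"
    unfolding n_def r(1)[symmetric] \<beta>'_def[symmetric] wq[symmetric] wq'[symmetric] ..
  also have "\<dots> = (r1 - q1)\<^sup>2 - (r2 - q2)\<^sup>2 * real p"
    by (simp add: algebra_simps power2_eq_square)
  also have "\<dots> \<in> \<rat>" using r q by auto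
  finally have nQ: "n \<in> \<rat>" .
  have "algebraic_int (complex_of_real n)"
  proof -
    have b1: "algebraic_int (complex_of_real \<beta>)" unfolding \<beta>_def
      using c_props(2) c_sum by (intro alg_int_radical_plus_inverse) auto
    have b2: "algebraic_int (complex_of_real \<beta>')" unfolding z(2)
      using z0 zB by (intro alg_int_radical_plus_inverse) auto
    have ww: "w * w = lw * w + 1"
    proof -
      have "w + (- 1 / w) = of_int lw" unfolding inverse_w by (simp add: w_form)
      then have "w * (w + (- 1 / w)) = w * of_int lw" by simp
      then show ?thesis using w(3) by (simp add: distrib_left algebra_simps)
    qed
    have w1: "algebraic_int (complex_of_real w)" "algebraic_int (complex_of_real (1 / w))"
    proof -
      have "algebraic_int w" unfolding algebraic_int_altdef_ipoly
        using ww by (intro exI[of _ "[:-1, - lw, 1:]"]) (simp add: algebra_simps)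
      moreover have "algebraic_int (1 / w)"
      proof -
        have "(1 / w) * (1 / w) = (w * w - lw * w) / (w * w)" using ww by simp
        also have "\<dots> = 1 - lw * (1 / w)" using w(3) by (simp add: diff_divide_distrib)
        finally have "poly (map_poly of_int [:-1, lw, 1:]) (1 / w) = 0" by (simp add: distrib_left)
        then show ?thesis unfolding algebraic_int_altdef_ipoly by (intro exI[of _ "[:-1, lw, 1:]"]) simp
      qed
      ultimately show "algebraic_int (complex_of_real w)" "algebraic_int (complex_of_real (1 / w))" by (simp_all only: algebraic_int_of_real_iff)
    qed
    have "complex_of_real n = (complex_of_real \<beta> - complex_of_real w ^ 2) * (complex_of_real \<beta>' - complex_of_real (1 / w) ^ 2)"
      by (simp add: n_def power_one_over)
    then show ?thesis
      using algebraic_int_times[OF algebraic_int_diff[OF b1 algebraic_int_power[OF w1(1)]] algebraic_int_diff[OF b2 algebraic_int_power[OF w1(2)]]]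
      by simp
  qed
  then have "algebraic_int n" by (simp only: algebraic_int_of_real_iff)
  then have "n \<in> \<int>" using nQ rational_algebraic_int_is_int by blast
  then obtain N where N: "n = of_int N" by (auto elim: Ints_cases)
  have "n \<noteq> 0"
  proof
    assume "n = 0"
    have 1: "\<beta>' \<noteq> 1 / w\<^sup>2"
    proof
      assume "\<beta>' = 1 / w\<^sup>2"
      then show False using b2 iw2 by linarith
    qed
    then have "r1 + r2 * sp = q1 + q2 * sp" using \<open>n = 0\<close> wq r(1) by (simp add: n_def)
    then have "r1 = q1 \<and> r2 = q2" using k_eq_iff r q by blast
    then show False using 1 wq' \<beta>'_def by simp
  qed
  then have "\<bar>n\<bar> \<ge> 1" using N by simp
  have "\<bar>n\<bar> \<le> (3 / w\<^sup>2) * (2 * w + 2)"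
  proof -
    have "\<bar>\<beta>' - 1 / w\<^sup>2\<bar> \<le> 2 * w + 2" using b'le iw2 by linarith
    then show ?thesis unfolding n_def abs_mult using ble by (intro mult_mono) auto
  qed
  also have "\<dots> < 1"
  proof -
    have "3 * (2 * w + 2) \<le> 9 * w" using w(3) by simp
    also have "\<dots> < w * w" using w(3) by (intro mult_strict_right_mono) auto
    finally show ?thesis using w(3) by (simp add: divide_less_eq power2_eq_square)
  qed
  finally show False using \<open>\<bar>n\<bar> \<ge> 1\<close> by simp
qed

lemma a_in_K: "a \<in> K"
proof -
  note D = real_subfieldD[OF K_field]
  have "2 \<in> K" using real_subfield_of_nat[OF K_field, of 2] by simp
  moreover have "A \<in> K" "s \<in> K" unfolding K_def using subset_quad_ext[OF k_field A_in_k] gen_in_quad_ext[OF k_field] by auto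
  ultimately show ?thesis unfolding a_def by (intro D(5) D(6))
qed

lemma a_not_in_k: "a \<notin> k"
proof
  assume "a \<in> k"
  have "2 \<in> k" using real_subfield_of_nat[OF k_field, of 2] by simp
  then have "2 * a - A \<in> k" using \<open>a \<in> k\<close> A_in_k by (intro real_subfieldD(3,4)[OF k_field])
  then show False using s_not_in_k by (simp add: a_def)
qed

text \<open>Reduced by \<open>a\<^sup>2 = A * a - 1\<close>, the relation has two coordinates over
  \<open>k\<close>. As \<open>A\<close> is irrational, the first one gives \<open>g 3 = 0\<close>,
  after which the second gives \<open>g 2 = 0\<close>.\<close>

lemma cubic_at_a:
  fixes g :: "nat \<Rightarrow> int"
  assumes rel: "of_int (g 0) + of_int (g 1) * a + of_int (g 2) * a ^ 2 + of_int (g 3) * a ^ 3 = 0" and l: "l < 4"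
  shows "g l = 0"
proof -
  note D = real_subfieldD[OF k_field]
  define G where "G i = real_of_int (g i)" for i
  have Gk: "G i \<in> k" for i unfolding G_def by (rule real_subfield_of_int[OF k_field])
  have a2: "a ^ 2 = A * a - 1" using a_props(1) by (simp add: power2_eq_square)
  have a3: "a ^ 3 = (A * A - 1) * a - A"
  proof -
    have "a ^ 3 = A * a ^ 2 - a" unfolding power3_eq_cube a_props(1) by (simp add: algebra_simps power2_eq_square)
    then show ?thesis unfolding a2 by (simp add: algebra_simps)
  qed
  define x where "x = G 0 - G 2 - G 3 * A"
  define y where "y = G 1 + G 2 * A + G 3 * (A * A - 1)"
  have xk: "x \<in> k" "y \<in> k" unfolding x_def y_def by (intro D(1,3,4,6) Gk A_in_k)+
  have "x + y * a = 0 + 0 * a" using rel unfolding a2 a3 x_def y_def G_def by (simp add: algebra_simps)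
  then have "x = 0" "y = 0" using quad_ext_eq_iff[OF k_field a_not_in_k xk D(2) D(2)] by auto
  have g3: "G 3 = 0"
  proof (rule ccontr)
    assume "G 3 \<noteq> 0"
    then have "A = (G 0 - G 2) / G 3" using \<open>x = 0\<close> by (simp add: x_def field_simps)
    then show False using A_not_Rats by (simp add: G_def)
  qed
  have g2: "G 2 = 0"
  proof (rule ccontr)
    assume "G 2 \<noteq> 0"
    then have "A = - G 1 / G 2" using \<open>y = 0\<close> g3 by (simp add: y_def field_simps)
    then show False using A_not_Rats by (simp add: G_def)
  qed
  have "G 1 = 0" "G 0 = 0" using \<open>x = 0\<close> \<open>y = 0\<close> g2 g3 by (auto simp: x_def y_def)
  moreover have "l = 0 \<or> l = 1 \<or> l = 2 \<or> l = 3" using l by auto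
  ultimately show ?thesis using g2 g3 by (auto simp: G_def)
qed

text \<open>The degree \<open>4 * p\<close> is composed of \<open>p\<close> over \<open>K\<close>
  and \<open>4\<close> for \<open>a\<close> over the rationals: with exponents written as
  \<open>l * p + i\<close>, the factors \<open>c ^ (l * p)\<close> become
  \<open>a ^ l\<close>.\<close>

lemma radical_independent:
  fixes g :: "int poly"
  assumes deg: "degree g < 4 * p" and rel: "poly (map_poly of_int g) c = 0"
  shows "g = 0"
proof -
  define G where "G l i = real_of_int (poly.coeff g (l * p + i))" for l i
  define \<kappa> where "\<kappa> i = G 0 i + G 1 i * a + G 2 i * a ^ 2 + G 3 i * a ^ 3" for i
  have \<kappa>K: "\<kappa> i \<in> K" for i
    unfolding \<kappa>_def G_def by (intro real_subfieldD(4,6,8)[OF K_field] real_subfield_of_int[OF K_field] a_in_K)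
  have "poly (map_poly of_int g) c = (\<Sum>m<4 * p. of_int (poly.coeff g m) * c ^ m)"
  proof -
    have "poly (map_poly of_int g) c = (\<Sum>m\<le>degree g. of_int (poly.coeff g m) * c ^ m)"
      by (simp add: poly_altdef)
    also have "\<dots> = (\<Sum>m<4 * p. of_int (poly.coeff g m) * c ^ m)"
      using deg by (intro sum.mono_neutral_left) (auto simp: coeff_eq_0)
    finally show ?thesis .
  qed
  also have "\<dots> = (\<Sum>l<4. \<Sum>i<p. of_int (poly.coeff g (l * p + i)) * c ^ (l * p + i))"
  proof -
    define F where "F m = of_int (poly.coeff g m) * c ^ m" for m
    have "(\<Sum>m<4 * p. F m) = (\<Sum>l<4. sum F {l * p..<l * p + p})" by (rule sum.nat_group[symmetric])
    also have "\<dots> = (\<Sum>l<4. \<Sum>i<p. F (l * p + i))"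
    proof (rule sum.cong[OF refl])
      fix l show "sum F {l * p..<l * p + p} = (\<Sum>i<p. F (l * p + i))"
        using sum.shift_bounds_nat_ivl[of F 0 "l * p" p] by (simp add: lessThan_atLeast0 add.commute)
    qed
    finally show ?thesis by (simp add: F_def)
  qed
  also have "\<dots> = (\<Sum>i<p. \<kappa> i * c ^ i)"
  proof -
    have "c ^ (l * p + i) = a ^ l * c ^ i" for l i
      unfolding c_props(1)[symmetric] by (simp add: power_add mult.commute flip: power_mult)
    then show ?thesis
      by (subst sum.swap) (simp add: \<kappa>_def G_def eval_nat_numeral algebra_simps)
  qed
  finally have "(\<Sum>i<p. \<kappa> i * c ^ i) = 0" using rel by simp
  then have \<kappa>0: "\<kappa> i = 0" if "i < p" for i
    using radical_powers_independent[OF K_field p(1) _ _ c_not_in_K \<kappa>K _ that] c_props a_in_K by simp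
  have "poly.coeff g m = 0" for m
  proof (cases "m < 4 * p")
    case True
    define l i where "l = m div p" and "i = m mod p"
    have "m = l * p + i" "i < p" "l < 4"
      using True p(2) by (auto simp: l_def i_def less_mult_imp_div_less)
    moreover have "poly.coeff g (l * p + i) = 0"
      using cubic_at_a[of "\<lambda>l. poly.coeff g (l * p + i)" l] \<kappa>0[OF \<open>i < p\<close>] \<open>l < 4\<close> by (simp add: \<kappa>_def G_def)
    ultimately show ?thesis by simp
  qed (use deg in \<open>simp add: coeff_eq_0\<close>)
  then show ?thesis by (simp add: poly_eq_iff)
qed

end

section \<open>Adjoining a square root to a cyclotomic field\<close>

text \<open>Divisibility in the ring of all algebraic integers; it takes the place of a prime ideal
  above \<open>p\<close>.\<close>

definition alg_dvd :: "complex \<Rightarrow> complex \<Rightarrow> bool" where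
  "alg_dvd x y \<longleftrightarrow> (\<exists>z. algebraic_int z \<and> y = x * z)"

lemma alg_dvd_add: "alg_dvd x y \<Longrightarrow> alg_dvd x z \<Longrightarrow> alg_dvd x (y + z)"
  unfolding alg_dvd_def by (metis algebraic_int_plus distrib_left)

lemma alg_dvd_mult: "alg_dvd x y \<Longrightarrow> algebraic_int z \<Longrightarrow> alg_dvd x (y * z)"
  unfolding alg_dvd_def by (metis algebraic_int_times mult.assoc)

lemma alg_dvd_diff: "alg_dvd x y \<Longrightarrow> alg_dvd x z \<Longrightarrow> alg_dvd x (y - z)"
  using alg_dvd_add[of x y "- z"] alg_dvd_mult[of x z "-1"] by simp

lemma alg_dvd_refl: "algebraic_int z \<Longrightarrow> alg_dvd x (x * z)"
  unfolding alg_dvd_def by blast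

lemma alg_int_of_int: "algebraic_int (of_int n :: complex)"
  by (intro int_imp_algebraic_int) auto

lemma alg_int_poly: "algebraic_int x \<Longrightarrow> algebraic_int (poly (map_poly of_int g) (x::complex))"
  by (simp add: poly_altdef) (intro algebraic_int_sum algebraic_int_times algebraic_int_power alg_int_of_int)

text \<open>The quotient of \<open>X ^ (2 * p) - D ^ p\<close> by \<open>X\<^sup>2 - D\<close>. For
  odd \<open>p\<close> and \<open>D \<noteq> 0\<close> its complex roots are the products of a
  square root of \<open>D\<close> and a \<open>p\<close>-th root of unity different from
  \<open>1\<close>.\<close>

definition cyclo_sqrt_poly :: "int \<Rightarrow> nat \<Rightarrow> int poly" where
  "cyclo_sqrt_poly D p = (\<Sum>i<p. Polynomial.monom (D ^ (p - Suc i)) (2 * i))"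

lemma poly_cyclo_sqrt:
  "(x\<^sup>2 - D) * poly (cyclo_sqrt_poly D p) x = x ^ (2 * p) - D ^ p"
  using power_diff_sumr2[of "x\<^sup>2" p D]
  by (simp add: cyclo_sqrt_poly_def poly_sum poly_monom power_mult[symmetric])

lemma poly_cyclo_sqrt_complex:
  "(x\<^sup>2 - of_int D) * poly (map_poly of_int (cyclo_sqrt_poly D p)) (x::complex) = x ^ (2 * p) - of_int D ^ p"
proof -
  have "map_poly of_int (cyclo_sqrt_poly D p) = (\<Sum>i<p. Polynomial.monom (of_int D ^ (p - Suc i)) (2 * i) :: complex poly)"
    by (rule poly_eqI) (auto simp: cyclo_sqrt_poly_def coeff_map_poly coeff_sum intro!: sum.cong)
  then show ?thesis using power_diff_sumr2[of "x\<^sup>2" p "of_int D :: complex"]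
    by (simp add: poly_sum poly_monom power_mult[symmetric])
qed

lemma cyclo_sqrt_monic:
  assumes "p > 0"
  shows "degree (cyclo_sqrt_poly D p) = 2 * (p - 1)" "lead_coeff (cyclo_sqrt_poly D p) = 1"
proof -
  have co: "poly.coeff (cyclo_sqrt_poly D p) (2 * (p - 1)) = 1"
  proof -
    have "poly.coeff (cyclo_sqrt_poly D p) (2 * (p - 1)) = (\<Sum>i<p. if i = p - 1 then D ^ (p - Suc i) else 0)"
      unfolding cyclo_sqrt_poly_def coeff_sum by (intro sum.cong) auto
    also have "\<dots> = 1" using assms by (subst sum.delta) auto
    finally show ?thesis .
  qed
  have "degree (cyclo_sqrt_poly D p) \<le> 2 * (p - 1)"
    unfolding cyclo_sqrt_poly_def by (intro degree_sum_le) (auto intro: order.trans[OF degree_monom_le])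
  moreover have "2 * (p - 1) \<le> degree (cyclo_sqrt_poly D p)" using co by (intro le_degree) simp
  ultimately show "degree (cyclo_sqrt_poly D p) = 2 * (p - 1)" by simp
  then show "lead_coeff (cyclo_sqrt_poly D p) = 1" using co by simp
qed

text \<open>The setting of Schoenemann's irreducibility criterion: modulo \<open>p\<close> the
  polynomial is \<open>(X\<^sup>2 - D) ^ (p - 1)\<close>, and \<open>nonres\<close> says that
  \<open>X\<^sup>2 - D\<close> is irreducible there. The value of \<open>X\<^sup>2 - D\<close> at
  \<open>\<theta>\<close> is \<open>D * lam\<close>, and \<open>lam\<close> acts as a uniformizer
  above \<open>p\<close>.\<close>

locale cyclo_sqrt =
  fixes p :: nat and D :: int and \<eta> \<sigma> :: complex
  assumes p: "Factorial_Ring.prime p" "p > 2"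
    and eta: "\<eta> ^ p = 1" "\<eta> \<noteq> 1"
    and sigma: "\<sigma>\<^sup>2 = of_int D" and D0: "\<not> int p dvd D"
    and nonres: "\<And>x y :: int. int p dvd x\<^sup>2 - D * y\<^sup>2 \<Longrightarrow> int p dvd x \<and> int p dvd y"
begin

definition lam :: complex where "lam = \<eta>\<^sup>2 - 1"
definition \<theta> :: complex where "\<theta> = \<sigma> * \<eta>"

lemma eta_alg: "algebraic_int \<eta>"
  using p eta(1) by (intro algebraic_int_of_power[of \<eta> p]) auto

lemma sigma_alg: "algebraic_int \<sigma>"
  using sigma alg_int_of_int[of D] by (intro algebraic_int_of_power[of \<sigma> 2]) auto

lemma theta_alg: "algebraic_int \<theta>"
  unfolding \<theta>_def by (intro algebraic_int_times sigma_alg eta_alg)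

lemma lam_alg: "algebraic_int lam"
  unfolding lam_def by (intro algebraic_int_diff algebraic_int_power eta_alg) auto

lemma theta_sq: "\<theta>\<^sup>2 - of_int D = of_int D * lam"
  by (simp add: \<theta>_def lam_def power_mult_distrib sigma algebra_simps)

lemma lam_nonzero: "lam \<noteq> 0"
proof
  assume "lam = 0"
  then have e2: "\<eta>\<^sup>2 = 1" by (simp add: lam_def)
  have "odd p" using p prime_odd_nat by auto
  then obtain j where "p = 2 * j + 1" by (auto elim: oddE)
  then have "\<eta> ^ p = \<eta>" using e2 by (simp add: power_mult)
  then show False using eta by simp
qed

text \<open>Expand \<open>(1 + lam) ^ p = 1\<close>, cancel \<open>1\<close> and one factor
  \<open>lam\<close>, and use that \<open>p\<close> divides the inner binomial coefficients. In
  other words, \<open>lam ^ (p - 1)\<close> is \<open>- p * (1 + lam * \<tau>)\<close>.\<close>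

lemma lam_equation: "\<exists>\<tau>. algebraic_int \<tau> \<and> of_nat p = - (lam ^ (p - 1)) - lam * (of_nat p * \<tau>)"
proof -
  have e: "(1 + lam) ^ p = 1"
    unfolding lam_def using eta(1) by (simp add: power_mult[symmetric] mult.commute[of 2]) (simp add: power_mult)
  define b where "b k = (p choose k) div p" for k
  have b: "p choose k = p * b k" if "0 < k" "k < p" for k
    using dvd_choose_prime[of k p] that p by (simp add: b_def)
  define \<tau> where "\<tau> = (\<Sum>k = 2..<p. of_nat (b k) * lam ^ (k - 2))"
  have "(1 + lam) ^ p = (\<Sum>k\<le>p. of_nat (p choose k) * lam ^ k)"
    using binomial_ring[of lam 1 p] by (simp add: add.commute)
  also have "{..p} = {0, 1, p} \<union> {2..<p}" using p(2) by auto
  also have "(\<Sum>k\<in>{0, 1, p} \<union> {2..<p}. of_nat (p choose k) * lam ^ k) =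
      (\<Sum>k\<in>{0, 1, p}. of_nat (p choose k) * lam ^ k) + (\<Sum>k = 2..<p. of_nat (p choose k) * lam ^ k)"
    using p(2) by (intro sum.union_disjoint) auto
  also have "(\<Sum>k\<in>{0, 1, p}. of_nat (p choose k) * lam ^ k) = 1 + of_nat p * lam + lam ^ p"
    using p(2) by (simp add: add_ac)
  also have "(\<Sum>k = 2..<p. of_nat (p choose k) * lam ^ k) = lam * (lam * (of_nat p * \<tau>))"
    unfolding \<tau>_def sum_distrib_left
  proof (rule sum.cong)
    fix k assume k: "k \<in> {2..<p}"
    then have "k = Suc (Suc (k - 2))" by auto
    then have "lam ^ k = lam * (lam * lam ^ (k - 2))" by (metis power_Suc)
    then show "of_nat (p choose k) * lam ^ k = lam * (lam * (of_nat p * (of_nat (b k) * lam ^ (k - 2))))"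
      using b[of k] k by (simp add: mult_ac)
  qed simp
  finally have "lam * (of_nat p + lam ^ (p - 1) + lam * (of_nat p * \<tau>)) = 0"
    using e p(2) by (simp add: distrib_left power_eq_if[of lam p] algebra_simps)
  then have "of_nat p + lam ^ (p - 1) + lam * (of_nat p * \<tau>) = 0" using lam_nonzero by simp
  then have "of_nat p = - (lam ^ (p - 1)) - lam * (of_nat p * \<tau>)"
    by (simp add: eq_neg_iff_add_eq_0 eq_diff_eq add_ac)
  moreover have "algebraic_int \<tau>"
    unfolding \<tau>_def by (intro algebraic_int_sum algebraic_int_times algebraic_int_power lam_alg int_imp_algebraic_int) auto
  ultimately show ?thesis by blast
qed

text \<open>Bootstrapping: a power of \<open>lam\<close> dividing the \<open>p\<close> on the right
  side of the equation gains one more factor \<open>lam\<close>, as long as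
  \<open>lam ^ (p - 1)\<close> permits.\<close>

lemma lam_power_dvd_p: "j \<le> p - 1 \<Longrightarrow> alg_dvd (lam ^ j) (of_nat p)"
proof (induction j)
  case 0
  show ?case using alg_dvd_refl[of "of_nat p" 1] alg_int_of_int[of "int p"] by simp
next
  case (Suc j)
  obtain \<tau> where t: "algebraic_int \<tau>" "of_nat p = - (lam ^ (p - 1)) - lam * (of_nat p * \<tau>)" using lam_equation by blast
  obtain z where z: "algebraic_int z" "of_nat p = lam ^ j * z" using Suc unfolding alg_dvd_def by auto
  have "lam ^ (p - 1) = lam ^ Suc j * lam ^ (p - 1 - Suc j)"
    using Suc.prems by (simp only: power_add[symmetric] le_add_diff_inverse)
  then have "alg_dvd (lam ^ Suc j) (- (lam ^ (p - 1)))"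
    using alg_dvd_refl[of "- (lam ^ (p - 1 - Suc j))" "lam ^ Suc j"] by (simp add: algebraic_int_power lam_alg)
  moreover have eq: "lam * (of_nat p * \<tau>) = lam ^ Suc j * (z * \<tau>)" by (simp add: z(2))
  have "alg_dvd (lam ^ Suc j) (lam * (of_nat p * \<tau>))"
    unfolding eq by (rule alg_dvd_refl) (rule algebraic_int_times[OF z(1) t(1)])
  ultimately show ?case using alg_dvd_diff t(2) by metis
qed

text \<open>If \<open>lam\<close> were a unit, the equation would make \<open>1 / p\<close> an
  algebraic integer.\<close>

lemma lam_not_dvd_1: "\<not> alg_dvd lam 1"
proof
  assume "alg_dvd lam 1"
  then obtain z where z: "algebraic_int z" "1 = lam * z" unfolding alg_dvd_def by blast
  obtain \<tau> where t: "algebraic_int \<tau>" "of_nat p = - (lam ^ (p - 1)) - lam * (of_nat p * \<tau>)" using lam_equation by blast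
  have p0: "of_nat p \<noteq> (0::complex)" using p by simp
  have "x = - a - y" if "a = - x - y" for a x y :: complex using that by simp
  from this[OF t(2)] have "lam ^ (p - 1) = of_nat p * (- (1 + lam * \<tau>))" by (simp add: algebra_simps)
  then have "(lam * z) ^ (p - 1) = of_nat p * (- (1 + lam * \<tau>) * z ^ (p - 1))" by (simp add: power_mult_distrib mult_ac)
  then have "1 = of_nat p * (- (1 + lam * \<tau>) * z ^ (p - 1))" unfolding z(2)[symmetric] by simp
  then have "1 / of_nat p = - (1 + lam * \<tau>) * z ^ (p - 1)" using p0 by (simp add: field_simps)
  moreover have "algebraic_int (- (1 + lam * \<tau>) * z ^ (p - 1))"
    by (intro algebraic_int_times algebraic_int_minus algebraic_int_plus algebraic_int_power lam_alg t(1) z(1)) auto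
  ultimately show False using not_algebraic_int_inverse_prime[OF p(1)] by simp
qed

lemma p_dvd_if_lam_dvd: assumes "alg_dvd lam (of_int n)" shows "int p dvd n"
proof (rule ccontr)
  assume "\<not> int p dvd n"
  then have "coprime n (int p)" using p(1) by (metis coprime_commute prime_imp_coprime prime_nat_int_transfer)
  then obtain x y where xy: "n * x + int p * y = 1" using bezout_int[of n "int p"] by (metis coprime_imp_gcd_eq_1 mult.commute)
  have "alg_dvd lam (of_nat p)" using lam_power_dvd_p[of 1] p(2) by simp
  then have "alg_dvd lam (of_int n * of_int x + of_nat p * of_int y)"
    using assms by (intro alg_dvd_add alg_dvd_mult alg_int_of_int)
  moreover have "of_int n * of_int x + of_nat p * of_int y = (1::complex)"
    using xy by (metis of_int_1 of_int_add of_int_mult of_int_of_nat_eq)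
  ultimately show False using lam_not_dvd_1 by simp
qed

text \<open>Write \<open>g = Q * (X\<^sup>2 - D) + x + y * X\<close>. Modulo \<open>lam\<close> only
  \<open>x + y * \<theta>\<close> remains of \<open>g\<close> at \<open>\<theta>\<close>, and its
  product with \<open>x - y * \<theta>\<close> is \<open>x\<^sup>2 - D * y\<^sup>2\<close>, so
  \<open>p\<close> divides \<open>x\<close> and \<open>y\<close>. As \<open>lam ^ Suc n\<close>
  divides \<open>p\<close>, a factor \<open>lam\<close> can be cancelled, and \<open>D * Q\<close>
  satisfies the hypotheses for \<open>n\<close>.\<close>

lemma p_dvd_coeffs:
  fixes g :: "int poly"
  assumes "n \<le> p - 1" "\<And>i. i \<ge> 2 * n \<Longrightarrow> poly.coeff g i = 0" "alg_dvd (lam ^ n) (poly (map_poly of_int g) \<theta>)"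
  shows "int p dvd poly.coeff g i"
  using assms
proof (induction n arbitrary: g i)
  case 0
  then show ?case by simp
next
  case (Suc n)
  define H :: "int poly" where "H = [:- D, 0, 1:]"
  have H: "lead_coeff H = 1" "degree H = 2" by (auto simp: H_def)
  obtain Q R where QR: "g = Q * H + R" "\<And>i. i \<ge> degree H \<Longrightarrow> poly.coeff R i = 0"
      "\<And>i. i + degree H > degree g \<Longrightarrow> poly.coeff Q i = 0"
    using monic_division[of UNIV H g] H(1) by auto
  define x y where "x = poly.coeff R 0" and "y = poly.coeff R 1"
  have R: "R = [:x, y:]"
    by (rule poly_eqI) (use QR(2) H(2) in \<open>auto simp: x_def y_def coeff_pCons split: nat.splits\<close>)
  have degg: "degree g < 2 * Suc n"
    using Suc.prems(2) by (metis degree_0 leading_coeff_0_iff not_le_imp_less zero_less_Suc nat_0_less_mult_iff zero_less_numeral)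
  have Qh: "poly.coeff Q i = 0" if "i \<ge> 2 * n" for i using QR(3)[of i] that degg H(2) by simp
  have ev: "poly (map_poly of_int g) \<theta> = lam * (of_int D * poly (map_poly of_int Q) \<theta>) + (of_int x + of_int y * \<theta>)"
  proof -
    have "map_poly of_int H = ([:- of_int D, 0, 1:] :: complex poly)" by (simp add: H_def)
    then have "poly (map_poly of_int H) \<theta> = of_int D * lam"
      unfolding theta_sq[symmetric] by (simp add: power2_eq_square)
    moreover have "map_poly of_int R = ([:of_int x, of_int y:] :: complex poly)"
      by (rule poly_eqI) (simp add: R coeff_map_poly coeff_pCons split: nat.splits)
    ultimately show ?thesis unfolding QR(1)
      by (simp add: of_int_poly_hom.hom_add of_int_poly_hom.hom_mult mult_ac)
  qed
  have Qalg: "algebraic_int (of_int D * poly (map_poly of_int Q) \<theta>)"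
    by (intro algebraic_int_times alg_int_of_int alg_int_poly theta_alg)
  obtain z where z: "algebraic_int z" "poly (map_poly of_int g) \<theta> = lam ^ Suc n * z"
    using Suc.prems(3) unfolding alg_dvd_def by blast
  have r: "of_int x + of_int y * \<theta> = lam * (lam ^ n * z - of_int D * poly (map_poly of_int Q) \<theta>)"
    using ev z(2) by (simp add: algebra_simps)
  have "alg_dvd lam (of_int x + of_int y * \<theta>)"
    unfolding r by (intro alg_dvd_refl algebraic_int_diff algebraic_int_times algebraic_int_power lam_alg z(1) alg_int_of_int alg_int_poly theta_alg)
  then have "alg_dvd lam ((of_int x + of_int y * \<theta>) * (of_int x - of_int y * \<theta>))"
    by (intro alg_dvd_mult algebraic_int_diff algebraic_int_times alg_int_of_int theta_alg)
  moreover have "(of_int x + of_int y * \<theta>) * (of_int x - of_int y * \<theta>) = of_int (x\<^sup>2 - D * y\<^sup>2) - lam * of_int (D * y\<^sup>2)"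
  proof -
    have "(of_int x + of_int y * \<theta>) * (of_int x - of_int y * \<theta>) = of_int (x\<^sup>2) - of_int (y\<^sup>2) * \<theta>\<^sup>2"
      by (simp add: algebra_simps power2_eq_square)
    also have "\<theta>\<^sup>2 = of_int D + of_int D * lam" using theta_sq by (simp add: algebra_simps)
    finally show ?thesis by (simp add: algebra_simps)
  qed
  ultimately have "alg_dvd lam (of_int (x\<^sup>2 - D * y\<^sup>2) - lam * of_int (D * y\<^sup>2) + lam * of_int (D * y\<^sup>2))"
    using alg_dvd_refl[OF alg_int_of_int, of lam "D * y\<^sup>2"] by (simp only: alg_dvd_add)
  then have "int p dvd x\<^sup>2 - D * y\<^sup>2" by (intro p_dvd_if_lam_dvd) (simp only: diff_add_cancel)
  then have "int p dvd x \<and> int p dvd y" by (rule nonres)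
  then have pxy: "int p dvd x" "int p dvd y" by blast+
  obtain x' y' where xy': "x = int p * x'" "y = int p * y'" using pxy unfolding dvd_def by blast
  obtain u where u: "algebraic_int u" "of_nat p = lam ^ Suc n * u"
    using lam_power_dvd_p[OF Suc.prems(1)] unfolding alg_dvd_def by blast
  have "lam * (of_int D * poly (map_poly of_int Q) \<theta>) = lam * (lam ^ n * (z - u * (of_int x' + of_int y' * \<theta>)))"
  proof -
    have "of_int x + of_int y * \<theta> = lam ^ Suc n * (u * (of_int x' + of_int y' * \<theta>))"
      unfolding xy' using u(2) by (simp add: algebra_simps)
    then show ?thesis using ev z(2) by (simp add: algebra_simps)
  qed
  then have "of_int D * poly (map_poly of_int Q) \<theta> = lam ^ n * (z - u * (of_int x' + of_int y' * \<theta>))"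
    using lam_nonzero by simp
  moreover have "of_int D * poly (map_poly of_int Q) \<theta> = poly (map_poly of_int (Polynomial.smult D Q)) \<theta>"
  proof -
    have "map_poly of_int (Polynomial.smult D Q) = Polynomial.smult (of_int D :: complex) (map_poly of_int Q)"
      by (rule poly_eqI) (simp add: coeff_map_poly)
    then show ?thesis by simp
  qed
  moreover have "algebraic_int (z - u * (of_int x' + of_int y' * \<theta>))"
    by (intro algebraic_int_diff algebraic_int_plus algebraic_int_times z(1) u(1) alg_int_of_int theta_alg)
  ultimately have dv: "alg_dvd (lam ^ n) (poly (map_poly of_int (Polynomial.smult D Q)) \<theta>)"
    unfolding alg_dvd_def by metis
  have "int p dvd poly.coeff (Polynomial.smult D Q) j" for j
    using Suc.prems(1) Qh by (intro Suc.IH dv) auto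
  then have pQ: "int p dvd poly.coeff Q j" for j
    using D0 p(1) by (metis coeff_smult prime_dvd_mult_iff prime_nat_int_transfer)
  have "int p dvd poly.coeff (Q * H) i"
    unfolding coeff_mult by (intro dvd_sum dvd_mult2 pQ)
  moreover have "int p dvd poly.coeff R i" using pxy by (auto simp: R coeff_pCons split: nat.splits)
  ultimately show ?case unfolding QR(1) by simp
qed

text \<open>Descent: the value \<open>0\<close> is divisible by \<open>lam ^ (p - 1)\<close>, so
  \<open>p\<close> divides all coefficients, and the relation divided by \<open>p\<close> is of the
  same kind. Hence every power of \<open>p\<close> divides the coefficients.\<close>

lemma theta_independent:
  fixes g :: "int poly"
  assumes "degree g < 2 * (p - 1)" "poly (map_poly of_int g) \<theta> = 0"
  shows "g = 0"
proof -
  have all: "int p ^ n dvd poly.coeff g i" for n i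
    using assms
  proof (induction n arbitrary: g i)
    case (Suc n)
    have "int p dvd poly.coeff g j" for j
      by (rule p_dvd_coeffs[of "p - 1"]) (use Suc.prems in \<open>auto simp: coeff_eq_0 alg_dvd_def intro!: exI[of _ 0]\<close>)
    then have "[:int p:] dvd g" by (simp add: const_poly_dvd_iff)
    then obtain g' where g': "g = Polynomial.smult (int p) g'" by (auto elim!: dvdE)
    have p0: "int p \<noteq> 0" using p by simp
    have "map_poly of_int (Polynomial.smult (int p) g') = Polynomial.smult (of_nat p :: complex) (map_poly of_int g')"
      by (rule poly_eqI) (simp add: coeff_map_poly)
    then have "poly (map_poly of_int g') \<theta> = 0" using Suc.prems(2) p0 by (simp add: g')
    moreover have "degree g' < 2 * (p - 1)" using Suc.prems(1) p0 by (simp add: g')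
    ultimately have "int p ^ n dvd poly.coeff g' i" using Suc.IH by blast
    then show ?case by (simp add: g')
  qed simp
  have "poly.coeff g i = 0" for i
  proof (rule ccontr)
    assume nz: "poly.coeff g i \<noteq> 0"
    define N where "N = nat \<bar>poly.coeff g i\<bar>"
    have "int p ^ N \<le> \<bar>poly.coeff g i\<bar>" using all[of N i] nz by (intro zdvd_imp_le) auto
    moreover have "N < p ^ N"
      using less_exp[of N] power_mono[of 2 p N] p(2) by linarith
    then have "int N < int p ^ N" by (metis of_nat_less_iff of_nat_power)
    ultimately show False by (simp add: N_def)
  qed
  then show ?thesis by (simp add: poly_eq_iff)
qed

lemma theta_root: "poly (map_poly of_int (cyclo_sqrt_poly D p)) \<theta> = 0"
proof -
  have "\<theta> ^ (2 * p) = of_int D ^ p"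
  proof -
    have "\<theta> ^ (2 * p) = (\<sigma>\<^sup>2) ^ p * (\<eta> ^ p)\<^sup>2"
      by (simp add: \<theta>_def power_mult_distrib power_mult[symmetric] mult.commute)
    then show ?thesis using eta(1) sigma by simp
  qed
  then have "(\<theta>\<^sup>2 - of_int D) * poly (map_poly of_int (cyclo_sqrt_poly D p)) \<theta> = 0"
    by (simp add: poly_cyclo_sqrt_complex)
  moreover have "\<theta>\<^sup>2 - of_int D \<noteq> 0" unfolding theta_sq using lam_nonzero D0 by auto
  ultimately show ?thesis by simp
qed

end

section \<open>Counting roots modulo a prime\<close>

lemma dvd_poly_diff: "a - b dvd poly h a - poly h (b :: int)"
proof (induction h)
  case (pCons c h)
  have "poly (pCons c h) a - poly (pCons c h) b = a * (poly h a - poly h b) + (a - b) * poly h b"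
    by (simp add: algebra_simps)
  then show ?case using pCons.IH by simp
qed simp

lemma card_le_card_roots_mod:
  assumes q: "q > 0" and S: "finite S" "\<And>r. r \<in> S \<Longrightarrow> int q dvd poly h r"
    and inj: "\<And>r s. r \<in> S \<Longrightarrow> s \<in> S \<Longrightarrow> int q dvd r - s \<Longrightarrow> r = s"
  shows "card S \<le> card (roots_mod h q)"
proof -
  have "card S = card ((\<lambda>r. r mod int q) ` S)"
    using inj by (intro card_image[symmetric] inj_onI) (simp add: mod_eq_dvd_iff)
  also have "\<dots> \<le> card (roots_mod h q)"
  proof (rule card_mono)
    show "(\<lambda>r. r mod int q) ` S \<subseteq> roots_mod h q"
    proof
      fix x assume "x \<in> (\<lambda>r. r mod int q) ` S"
      then obtain r where r: "r \<in> S" "x = r mod int q" by auto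
      have "int q dvd r - x" using r by (simp add: mod_eq_dvd_iff[symmetric])
      then have "int q dvd poly h r - poly h x" using dvd_poly_diff dvd_trans by blast
      then have "int q dvd poly h x" using S(2)[OF r(1)] by (metis dvd_diff_right_iff dvd_diff_commute)
      then show "x \<in> roots_mod h q" using q r by (simp add: roots_mod_def)
    qed
  qed simp
  finally show ?thesis .
qed

text \<open>The powers of a primitive root whose exponents are multiples of
  \<open>(q - 1) div p\<close>.\<close>

lemma ex_roots_of_unity_mod:
  assumes p: "p > 0" and q: "Factorial_Ring.prime q" "[q = 1] (mod p)"
  shows "\<exists>W::int set. finite W \<and> card W = p \<and> (\<forall>x\<in>W. int q dvd x ^ p - 1) \<and>
     (\<forall>x\<in>W. \<forall>y\<in>W. int q dvd x - y \<longrightarrow> x = y)"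
proof -
  obtain g where g: "residue_primroot q g" using prime_primitive_root_exists[of q] q(1) prime_gt_1_nat by auto
  have q1: "q > 1" using q(1) by (rule prime_gt_1_nat)
  have "p dvd q - 1" using q(2) q1 by (simp add: cong_altdef_nat cong_sym_eq)
  then obtain m where m: "q - 1 = p * m" by blast
  have m0: "m > 0" using m q1 by (intro Nat.gr0I) auto
  have inj: "inj_on (\<lambda>i. g ^ i mod q) {..<q - 1}"
    using residue_primroot_is_generator[OF q1 g] q(1) by (simp add: totient_prime bij_betw_def)
  define f where "f i = int (g ^ (i * m) mod q)" for i
  have injf: "inj_on f {..<p}"
  proof (rule inj_onI)
    fix i j assume "i \<in> {..<p}" "j \<in> {..<p}" "f i = f j"
    then have "g ^ (i * m) mod q = g ^ (j * m) mod q" "i * m < q - 1" "j * m < q - 1"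
      using m m0 by (simp_all add: f_def mult_less_mono1)
    then have "i * m = j * m" using inj_onD[OF inj, of "i * m" "j * m"] by simp
    then show "i = j" using m0 by simp
  qed
  have "int q dvd f i ^ p - 1" for i
  proof -
    have "\<not> q dvd g"
    proof
      assume "q dvd g"
      moreover have "coprime q g" using g by (simp add: residue_primroot_def)
      ultimately have "is_unit q" by (simp add: coprime_absorb_left)
      then show False using q1 by simp
    qed
    then have "[g ^ (q - 1) = 1] (mod q)" using fermat_theorem[OF q(1)] by blast
    then have "[(g ^ (q - 1)) ^ i = 1 ^ i] (mod q)" by (rule cong_pow)
    moreover have "(g ^ (q - 1)) ^ i = (g ^ (i * m)) ^ p"
      unfolding m power_mult[symmetric] by (simp only: mult_ac)
    ultimately have "[(g ^ (i * m)) ^ p = 1] (mod q)" by simp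
    then have "[(g ^ (i * m) mod q) ^ p = 1] (mod q)" by (simp add: cong_def power_mod)
    then have "[int ((g ^ (i * m) mod q) ^ p) = int 1] (mod int q)" by (simp only: cong_int_iff)
    then show ?thesis by (simp add: f_def cong_iff_dvd_diff)
  qed
  moreover have "f i = f j" if "int q dvd f i - f j" for i j
  proof -
    have "f i mod int q = f j mod int q" using that by (simp add: mod_eq_dvd_iff)
    then show ?thesis by (simp add: f_def zmod_int)
  qed
  ultimately show ?thesis
    using card_image[OF injf] by (intro exI[of _ "f ` {..<p}"]) auto
qed

section \<open>Roots modulo \<open>q\<close> of the auxiliary polynomials\<close>

definition quartic_pow :: "int \<Rightarrow> nat \<Rightarrow> int poly" where
  "quartic_pow M p = (\<Sum>l<5. Polynomial.monom (poly.coeff (quartic M) l) (l * p))"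

lemma quartic_degree: "degree (quartic M) = 4"
  by (simp add: quartic_def)

lemma quartic_coeff_4: "poly.coeff (quartic M) 4 = 1"
  by (simp add: quartic_def eval_nat_numeral)

lemma poly_quartic_pow: "poly (quartic_pow M p) x = poly (quartic M) (x ^ p)"
proof -
  have "poly (quartic M) (x ^ p) = (\<Sum>l<5. poly.coeff (quartic M) l * (x ^ p) ^ l)"
    unfolding poly_altdef quartic_degree by (rule sum.cong) auto
  then show ?thesis
    by (simp add: quartic_pow_def poly_sum poly_monom power_mult[symmetric] mult.commute)
qed

lemma poly_of_int_quartic_pow:
  "poly (map_poly of_int (quartic_pow M p)) (x::'a::field_char_0) = poly (map_poly of_int (quartic M)) (x ^ p)"
proof -
  have "map_poly of_int (quartic_pow M p) = (\<Sum>l<5. Polynomial.monom (of_int (poly.coeff (quartic M) l)) (l * p) :: 'a poly)"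
    by (rule poly_eqI) (auto simp: quartic_pow_def coeff_map_poly coeff_sum intro!: sum.cong)
  moreover have "poly (map_poly of_int (quartic M)) (x ^ p) = (\<Sum>l<5. of_int (poly.coeff (quartic M) l) * (x ^ p) ^ l)"
    by (simp add: poly_altdef quartic_degree) (rule sum.cong, auto)
  ultimately show ?thesis by (simp add: poly_sum poly_monom power_mult[symmetric] mult.commute)
qed

lemma quartic_pow_monic:
  assumes "p > 0"
  shows "degree (quartic_pow M p) = 4 * p" "lead_coeff (quartic_pow M p) = 1"
proof -
  have co: "poly.coeff (quartic_pow M p) (4 * p) = 1"
  proof -
    have "poly.coeff (quartic_pow M p) (4 * p) = (\<Sum>l<5. if l = 4 then poly.coeff (quartic M) l else 0)"
      unfolding quartic_pow_def coeff_sum using assms by (intro sum.cong) auto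
    also have "\<dots> = 1" using quartic_coeff_4 by (subst sum.delta) auto
    finally show ?thesis .
  qed
  have "degree (quartic_pow M p) \<le> 4 * p"
    unfolding quartic_pow_def by (intro degree_sum_le) (auto intro!: order.trans[OF degree_monom_le])
  moreover have "4 * p \<le> degree (quartic_pow M p)" using co by (intro le_degree) simp
  ultimately show "degree (quartic_pow M p) = 4 * p" by simp
  then show "lead_coeff (quartic_pow M p) = 1" using co by simp
qed

lemma odd_power_eq_one_and_square_eq_one:
  assumes "odd p" "[x ^ p = 1] (mod m)" "[x\<^sup>2 = 1] (mod m)" shows "[x = (1::int)] (mod m)"
proof -
  obtain j where j: "p = 2 * j + 1" using assms(1) by (auto elim: oddE)
  have "[(x\<^sup>2) ^ j * x = 1 ^ j * x] (mod m)" using assms(3) by (intro cong_mult cong_pow) auto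
  then have "[x ^ p = x] (mod m)" by (simp add: j power_mult[symmetric] mult.commute)
  then show ?thesis using assms(2) by (metis cong_sym cong_trans)
qed

text \<open>The roots are \<open>s * x\<close> and \<open>- (s * x)\<close> for the
  \<open>p\<close>-th roots of unity \<open>x \<noteq> 1\<close> modulo \<open>q\<close>. The two
  families are disjoint because \<open>p\<close> is odd: \<open>x = - y\<close> would give
  \<open>1 = -1\<close> after raising to the power \<open>p\<close>.\<close>

lemma card_roots_mod_cyclo_sqrt:
  assumes p: "odd p" "p > 2" and q: "Factorial_Ring.prime q" "[q = 1] (mod p)" "q > 2"
    and D: "\<not> int q dvd D" and s: "int q dvd s\<^sup>2 - D"
  shows "2 * (p - 1) \<le> card (roots_mod (cyclo_sqrt_poly D p) q)"
proof -
  have Q: "Factorial_Ring.prime (int q)" using q(1) by simp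
  have pm: "int q dvd a * b \<longleftrightarrow> int q dvd a \<or> int q dvd b" for a b using Q by (rule prime_dvd_mult_iff)
  have q2: "\<not> int q dvd 2" using q(3) by (auto dest!: zdvd_imp_le)
  have ns: "\<not> int q dvd s" using D s by (metis dvd_diff_right_iff dvd_power zero_less_numeral dvd_trans pos2)
  obtain W :: "int set" where W: "finite W" "card W = p" "\<And>x. x \<in> W \<Longrightarrow> int q dvd x ^ p - 1"
      "\<And>x y. x \<in> W \<Longrightarrow> y \<in> W \<Longrightarrow> int q dvd x - y \<Longrightarrow> x = y"
    using ex_roots_of_unity_mod[of p q] p q by auto
  define W' where "W' = {x \<in> W. \<not> int q dvd x - 1}"
  have "card W \<le> card W' + 1"
  proof (cases "\<exists>x\<in>W. int q dvd x - 1")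
    case True
    then obtain x0 where x0: "x0 \<in> W" "int q dvd x0 - 1" by blast
    have "W - {x0} \<subseteq> W'"
    proof
      fix x assume x: "x \<in> W - {x0}"
      have "\<not> int q dvd x - 1"
      proof
        assume "int q dvd x - 1"
        then have "int q dvd (x - 1) - (x0 - 1)" using x0(2) by (rule dvd_diff)
        then show False using W(4)[of x x0] x x0 by simp
      qed
      then show "x \<in> W'" using x by (simp add: W'_def)
    qed
    then have "card (W - {x0}) \<le> card W'" using W(1) by (intro card_mono) (auto simp: W'_def)
    then show ?thesis using x0 W(1) by (simp add: card_Diff_singleton)
  next
    case False
    then have "W' = W" by (auto simp: W'_def)
    then show ?thesis by simp
  qed
  then have cW': "p - 1 \<le> card W'" using W(2) by simp
  have np: "\<not> int q dvd x" if "x \<in> W" for x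
  proof
    assume "int q dvd x"
    then have "int q dvd x ^ p" using p(2) dvd_power[of p x] dvd_trans by (metis gr_implies_not_zero neq0_conv)
    then have "int q dvd 1" using W(3)[OF that] by (metis dvd_diff_right_iff)
    then show False using Q by (simp add: not_prime_unit)
  qed
  define S where "S = (\<lambda>x. s * x) ` W' \<union> (\<lambda>x. - (s * x)) ` W'"
  have fW': "finite W'" using W(1) by (simp add: W'_def)
  have cross: "\<not> int q dvd s * x - (- (s * y))" if "x \<in> W" "y \<in> W" for x y
  proof
    assume "int q dvd s * x - (- (s * y))"
    then have "int q dvd s * (x + y)" by (simp add: algebra_simps)
    then have "int q dvd x - (- y)" using pm ns by simp
    then have "[x = - y] (mod int q)" by (simp only: cong_iff_dvd_diff)
    then have "[x ^ p = (- y) ^ p] (mod int q)" by (rule cong_pow)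
    moreover have "(- y) ^ p = - (y ^ p)" using p(1) by simp
    ultimately have "int q dvd x ^ p + y ^ p" by (simp add: cong_iff_dvd_diff)
    moreover have "int q dvd (x ^ p - 1) + (y ^ p - 1)" using W(3) that by (intro dvd_add) auto
    ultimately have "int q dvd (x ^ p + y ^ p) - ((x ^ p - 1) + (y ^ p - 1))" by (rule dvd_diff)
    then show False using q2 by simp
  qed
  have same: "x = y" if "x \<in> W" "y \<in> W" "int q dvd s * x - s * y" for x y
  proof -
    have "int q dvd s * (x - y)" using that(3) by (simp add: right_diff_distrib)
    then show ?thesis using pm ns W(4) that by blast
  qed
  have sub: "x \<in> W" if "x \<in> W'" for x using that by (simp add: W'_def)
  have "card S = card W' + card W'"
  proof -
    have "s \<noteq> 0" using ns by auto
    then have "card ((\<lambda>x. s * x) ` W') = card W'" "card ((\<lambda>x. - (s * x)) ` W') = card W'"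
      by (auto intro!: card_image inj_onI)
    moreover have "(\<lambda>x. s * x) ` W' \<inter> (\<lambda>x. - (s * x)) ` W' = {}"
    proof (rule ccontr)
      assume "(\<lambda>x. s * x) ` W' \<inter> (\<lambda>x. - (s * x)) ` W' \<noteq> {}"
      then obtain x y where "x \<in> W'" "y \<in> W'" "s * x = - (s * y)" by auto
      then show False using cross[of x y] sub by simp
    qed
    ultimately show ?thesis unfolding S_def using fW' by (simp add: card_Un_disjoint)
  qed
  moreover have "card S \<le> card (roots_mod (cyclo_sqrt_poly D p) q)"
  proof (rule card_le_card_roots_mod)
    show "q > 0" using q(3) by simp
    show "finite S" using fW' by (simp add: S_def)
    fix r assume "r \<in> S"
    then obtain x where x: "x \<in> W'" "r\<^sup>2 = s\<^sup>2 * x\<^sup>2" by (auto simp: S_def power_mult_distrib)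
    have xp: "[x ^ p = 1] (mod int q)" using W(3)[OF sub[OF x(1)]] by (simp add: cong_iff_dvd_diff)
    have sD: "[s\<^sup>2 = D] (mod int q)" using s by (simp add: cong_iff_dvd_diff)
    have "r ^ (2 * p) = (s\<^sup>2) ^ p * (x ^ p)\<^sup>2"
      using x(2) by (simp add: power_mult power_mult_distrib) (simp add: power_mult[symmetric] mult.commute)
    moreover have "[(s\<^sup>2) ^ p * (x ^ p)\<^sup>2 = D ^ p * 1\<^sup>2] (mod int q)"
      by (intro cong_mult cong_pow sD xp)
    ultimately have "int q dvd r ^ (2 * p) - D ^ p" by (simp add: cong_iff_dvd_diff)
    then have "int q dvd (r\<^sup>2 - D) * poly (cyclo_sqrt_poly D p) r" by (simp add: poly_cyclo_sqrt)
    moreover have "\<not> int q dvd r\<^sup>2 - D"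
    proof
      assume "int q dvd r\<^sup>2 - D"
      moreover have "[s\<^sup>2 * x\<^sup>2 - D = D * x\<^sup>2 - D] (mod int q)" by (intro cong_diff cong_mult sD) auto
      ultimately have "int q dvd D * x\<^sup>2 - D" unfolding x(2) by (simp add: cong_dvd_iff)
      then have "int q dvd D * (x\<^sup>2 - 1)" by (simp add: right_diff_distrib)
      then have "int q dvd x\<^sup>2 - 1" using pm D by blast
      then have "[x = 1] (mod int q)" using odd_power_eq_one_and_square_eq_one[OF p(1) xp] by (simp add: cong_iff_dvd_diff)
      then show False using x(1) by (simp add: W'_def cong_iff_dvd_diff)
    qed
    ultimately show "int q dvd poly (cyclo_sqrt_poly D p) r" using pm by blast
  next
    fix r r' assume rr: "r \<in> S" "r' \<in> S" "int q dvd r - r'"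
    have comm: "int q dvd - (s * x) - s * y \<Longrightarrow> int q dvd s * y - - (s * x)" for x y
      using dvd_diff_commute by (metis)
    have neg: "int q dvd - (s * x) - - (s * y) \<Longrightarrow> int q dvd s * x - s * y" for x y
      using dvd_diff_commute[of "int q" "s * y" "s * x"] by simp
    show "r = r'"
      using rr cross same sub comm neg unfolding S_def by (elim UnE imageE) (metis+)
  qed
  ultimately show ?thesis using cW' by linarith
qed

text \<open>Each root in \<open>S\<close> is a \<open>p\<close>-th power, and multiplying one of its
  \<open>p\<close>-th roots by the \<open>p\<close> roots of unity modulo \<open>q\<close> gives
  \<open>p\<close> roots of the substituted polynomial.\<close>

lemma card_roots_mod_quartic_pow:
  assumes p: "p > 0" and q: "Factorial_Ring.prime q" "[q = 1] (mod p)"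
    and S: "finite S" "\<And>x y. x \<in> S \<Longrightarrow> y \<in> S \<Longrightarrow> int q dvd x - y \<Longrightarrow> x = y"
    and root: "\<And>x. x \<in> S \<Longrightarrow> int q dvd poly (quartic M) x" "\<And>x. x \<in> S \<Longrightarrow> \<not> int q dvd x"
    and pow: "\<And>x. x \<in> S \<Longrightarrow> \<exists>y. int q dvd y ^ p - x"
  shows "card S * p \<le> card (roots_mod (quartic_pow M p) q)"
proof -
  have Q: "Factorial_Ring.prime (int q)" using q(1) by simp
  have pm: "int q dvd a * b \<longleftrightarrow> int q dvd a \<or> int q dvd b" for a b using Q by (rule prime_dvd_mult_iff)
  obtain W :: "int set" where W: "finite W" "card W = p" "\<And>x. x \<in> W \<Longrightarrow> int q dvd x ^ p - 1"
      "\<And>x y. x \<in> W \<Longrightarrow> y \<in> W \<Longrightarrow> int q dvd x - y \<Longrightarrow> x = y"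
    using ex_roots_of_unity_mod[of p q] p q by auto
  obtain t where t: "\<And>x. x \<in> S \<Longrightarrow> int q dvd t x ^ p - x" using pow by metis
  define R where "R = (\<lambda>(x, z). t x * z) ` (S \<times> W)"
  have pw: "int q dvd (t x * z) ^ p - x" if "x \<in> S" "z \<in> W" for x z
  proof -
    have "[(t x) ^ p * z ^ p = x * 1] (mod int q)"
      using t[OF that(1)] W(3)[OF that(2)] by (intro cong_mult) (simp_all add: cong_iff_dvd_diff)
    then show ?thesis by (simp add: power_mult_distrib cong_iff_dvd_diff)
  qed
  have key: "x = x' \<and> z = z'" if "x \<in> S" "x' \<in> S" "z \<in> W" "z' \<in> W" "int q dvd t x * z - t x' * z'" for x x' z z'
  proof -
    have "[(t x * z) ^ p = (t x' * z') ^ p] (mod int q)"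
      using that(5) by (intro cong_pow) (simp add: cong_iff_dvd_diff)
    then have d: "int q dvd (t x * z) ^ p - (t x' * z') ^ p" by (simp add: cong_iff_dvd_diff)
    have "int q dvd ((t x * z) ^ p - (t x' * z') ^ p) - ((t x * z) ^ p - x) + ((t x' * z') ^ p - x')"
      by (intro dvd_add dvd_diff d pw that)
    then have "int q dvd x - x'" by simp
    then have x: "x = x'" using S(2) that by blast
    have "\<not> int q dvd t x"
    proof
      assume "int q dvd t x"
      then have "int q dvd t x ^ p" using p dvd_power[of p "t x"] dvd_trans by blast
      then have "int q dvd x" using t[OF that(1)] by (metis dvd_diff_right_iff)
      then show False using root(2) that(1) by blast
    qed
    moreover have "int q dvd t x * (z - z')" using that(5) x by (simp add: right_diff_distrib)
    ultimately show ?thesis using x pm W(4) that by blast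
  qed
  have "inj_on (\<lambda>(x, z). t x * z) (S \<times> W)"
    by (rule inj_onI) (use key in fastforce)
  then have "card R = card S * p" unfolding R_def by (simp add: card_image W(2) card_cartesian_product)
  moreover have "card R \<le> card (roots_mod (quartic_pow M p) q)"
  proof (rule card_le_card_roots_mod)
    show "q > 0" using q(1) prime_gt_0_nat by blast
    show "finite R" using S(1) W(1) by (simp add: R_def)
    fix r assume "r \<in> R"
    then obtain x z where xz: "x \<in> S" "z \<in> W" "r = t x * z" by (auto simp: R_def)
    have "int q dvd poly (quartic M) (r ^ p) - poly (quartic M) x"
      using dvd_poly_diff[of "r ^ p" x] pw[OF xz(1,2)] xz(3) dvd_trans by blast
    then show "int q dvd poly (quartic_pow M p) r"
      using root(1)[OF xz(1)] unfolding poly_quartic_pow by (metis dvd_diff_left_iff)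
  next
    fix r r' assume "r \<in> R" "r' \<in> R" "int q dvd r - r'"
    then show "r = r'" using key by (auto simp: R_def)
  qed
  ultimately show ?thesis by simp
qed

section \<open>Quadratic residues and the splitting of the two quartics\<close>

lemma QuadRes_mult_nonres:
  assumes q: "Factorial_Ring.prime q" "2 < q" and ab: "\<not> QuadRes (int q) a" "\<not> QuadRes (int q) b"
  shows "QuadRes (int q) (a * b)"
proof -
  have "\<not> [a = 0] (mod int q)" "\<not> [b = 0] (mod int q)"
    using ab unfolding QuadRes_def by (metis cong_sym zero_power2)+
  then have "Legendre a (int q) = -1" "Legendre b (int q) = -1" using ab by (auto simp: Legendre_def)
  then have "[-1 = a ^ ((q - 1) div 2)] (mod int q)" "[-1 = b ^ ((q - 1) div 2)] (mod int q)"
    using euler_criterion[OF q, of a] euler_criterion[OF q, of b] by auto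
  then have "[(-1) * (-1) = a ^ ((q - 1) div 2) * b ^ ((q - 1) div 2)] (mod int q)" by (rule cong_mult)
  moreover have "[Legendre (a * b) (int q) = (a * b) ^ ((q - 1) div 2)] (mod int q)"
    by (rule euler_criterion[OF q])
  ultimately have "[Legendre (a * b) (int q) = 1] (mod int q)"
    by (simp add: power_mult_distrib) (metis cong_sym cong_trans)
  then have "int q dvd Legendre (a * b) (int q) - 1" by (simp add: cong_iff_dvd_diff)
  moreover have "\<not> int q dvd - 1 - 1" "\<not> int q dvd 0 - 1"
    using q by (auto dest!: zdvd_imp_le)
  ultimately show ?thesis unfolding Legendre_def by (metis (full_types))
qed

text \<open>Modulo \<open>p\<close> the discriminant \<open>L\<^sup>2 - 4\<close> is \<open>-8\<close>. If \<open>-8\<close> were a square modulo \<open>p\<close>, then, \<open>L / 2\<close> being a square root of \<open>-1\<close>, there would be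
  an element with fourth power \<open>-1\<close>, so that \<open>8\<close> would divide \<open>p - 1\<close>.\<close>

lemma disc_nonresidue:
  fixes L V x y :: int
  assumes p: "Factorial_Ring.prime p" "[p = 5] (mod 8)" and LV: "L\<^sup>2 + 4 = int p * V\<^sup>2"
    and xy: "int p dvd x\<^sup>2 - (L\<^sup>2 - 4) * y\<^sup>2"
  shows "int p dvd x \<and> int p dvd y"
proof -
  have P: "Factorial_Ring.prime (int p)" using p(1) by simp
  have pm: "int p dvd a * b \<longleftrightarrow> int p dvd a \<or> int p dvd b" for a b using P by (rule prime_dvd_mult_iff)
  have p5: "p \<ge> 5" using p(2) prime_gt_1_nat[OF p(1)] by (auto simp: cong_def)
  have n2: "\<not> int p dvd 2" "\<not> int p dvd 4"
    using p5 by (auto dest!: zdvd_imp_le)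
  have nD: "\<not> int p dvd L\<^sup>2 - 4"
  proof
    assume a: "int p dvd L\<^sup>2 - 4"
    have "int p dvd L\<^sup>2 + 4" using LV by simp
    from dvd_diff[OF this a] have "int p dvd (L\<^sup>2 + 4) - (L\<^sup>2 - 4)" .
    then have "int p dvd 2 * 4" by simp
    then show False using pm n2 by blast
  qed
  have "int p dvd y"
  proof (rule ccontr)
    assume ny: "\<not> int p dvd y"
    have nx: "\<not> int p dvd x"
    proof
      assume "int p dvd x"
      then have "int p dvd x\<^sup>2" by (simp add: power2_eq_square)
      then have "int p dvd (L\<^sup>2 - 4) * y\<^sup>2" using xy by (metis dvd_diff_right_iff)
      then show False using nD ny pm by (simp add: power2_eq_square)
    qed
    \<comment> \<open>Modulo \<open>p\<close> one has \<open>L\<^sup>2 = -4\<close>, so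
      \<open>(2 + L)\<^sup>2 = 4 * L\<close>, and \<open>x\<^sup>2 = -8 * y\<^sup>2\<close> by
      assumption. With these, \<open>2 * a\<^sup>2 = L * c\<^sup>2\<close>, so the square of
      \<open>a / c\<close> is \<open>L / 2\<close>, a square root of \<open>-1\<close>.\<close>
    define a c where "a = (2 + L) * y * L" and "c = 2 * x"
    have id: "4 * (a ^ 4 + c ^ 4) = (2 * a\<^sup>2 - L * c\<^sup>2) * (2 * a\<^sup>2 + L * c\<^sup>2) + (L\<^sup>2 + 4) * c ^ 4"
      by (simp add: algebra_simps power2_eq_square power4_eq_xxxx)
    have id2: "2 * a\<^sup>2 - L * c\<^sup>2 = 2 * L * y\<^sup>2 * (L + 2) * (L\<^sup>2 + 4) - 4 * L * (x\<^sup>2 - (L\<^sup>2 - 4) * y\<^sup>2)"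
      unfolding a_def c_def by (simp add: algebra_simps power2_eq_square)
    have pL: "int p dvd L\<^sup>2 + 4" using LV by simp
    have "int p dvd 2 * a\<^sup>2 - L * c\<^sup>2" unfolding id2 by (rule dvd_diff[OF dvd_mult[OF pL] dvd_mult[OF xy]])
    then have "int p dvd 4 * (a ^ 4 + c ^ 4)" unfolding id using pL by (intro dvd_add) auto
    then have ac: "int p dvd a ^ 4 + c ^ 4" using pm n2 by blast
    have nc: "\<not> int p dvd c" using nx n2 pm by (simp add: c_def)
    have na: "\<not> int p dvd a"
    proof
      assume "int p dvd a"
      then have "int p dvd a ^ 4" by (simp add: power4_eq_xxxx)
      then have "int p dvd c ^ 4" using ac by (simp add: dvd_add_right_iff)
      then show False using nc P prime_dvd_power by blast
    qed
    obtain k where k: "p = 8 * k + 5"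
    proof -
      have "p mod 8 = 5" using p(2) by (simp add: cong_def)
      then have "p = 8 * (p div 8) + 5" by presburger
      then show ?thesis using that by blast
    qed
    have "[a ^ 4 = - (c ^ 4)] (mod int p)" using ac by (simp add: cong_iff_dvd_diff)
    \<comment> \<open>The exponent \<open>2 * k + 1\<close> is \<open>(p - 1) div 4\<close>. It is
      odd, so the minus sign survives while both powers become \<open>1\<close> by Fermat's
      theorem.\<close>
    then have "[(a ^ 4) ^ (2 * k + 1) = (- (c ^ 4)) ^ (2 * k + 1)] (mod int p)" by (rule cong_pow)
    moreover have "(- (c ^ 4)) ^ (2 * k + 1) = - ((c ^ 4) ^ (2 * k + 1))" by (rule power_minus_odd) simp
    moreover have "4 * (2 * k + 1) = p - 1" using k by simp
    ultimately have 1: "[a ^ (p - 1) = - (c ^ (p - 1))] (mod int p)" by (simp only: power_mult[symmetric])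
    have fl: "[z ^ (p - 1) = 1] (mod int p)" if "\<not> int p dvd z" for z :: int
    proof -
      define n where "n = nat (z mod int p)"
      have n: "int n = z mod int p" using p5 by (simp add: n_def)
      have "\<not> int p dvd int n" using that by (simp add: n dvd_mod_iff)
      then have "\<not> p dvd n" by (simp only: int_dvd_int_iff not_False_eq_True)
      then have "[n ^ (p - 1) = 1] (mod p)" using fermat_theorem[OF p(1)] by blast
      then have "[int (n ^ (p - 1)) = int 1] (mod int p)" by (simp only: cong_int_iff)
      moreover have "[z ^ (p - 1) = (int n) ^ (p - 1)] (mod int p)" by (intro cong_pow) (simp add: n cong_def)
      ultimately show ?thesis by (metis cong_trans of_nat_1 of_nat_power)
    qed
    have "[1 = - (c ^ (p - 1))] (mod int p)" using 1 fl[OF na] by (metis cong_sym cong_trans)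
    moreover have "[- (c ^ (p - 1)) = - 1] (mod int p)" using fl[OF nc] by (simp add: cong_minus_minus_iff)
    ultimately have "[1 = - 1] (mod int p)" by (rule cong_trans)
    then show False using n2 by (simp add: cong_iff_dvd_diff)
  qed
  moreover have "int p dvd x"
  proof -
    have "int p dvd (L\<^sup>2 - 4) * y\<^sup>2" using \<open>int p dvd y\<close> by (simp add: power2_eq_square)
    then have "int p dvd x\<^sup>2" using xy by (metis dvd_diff_left_iff)
    then show ?thesis using P prime_dvd_power by blast
  qed
  ultimately show ?thesis by blast
qed

text \<open>This is \<open>X\<^sup>2 - (b / 2) * X + 1\<close>, doubled to have integer
  coefficients. The roots are \<open>(b + r) / 4\<close> and \<open>(b - r) / 4\<close>, with
  \<open>4\<close> inverted modulo \<open>q\<close>.\<close>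

lemma quadratic_two_roots_mod:
  fixes b r :: int
  assumes q: "Factorial_Ring.prime q" "q > 2" and r: "int q dvd r\<^sup>2 - (b\<^sup>2 - 16)" and nz: "\<not> int q dvd b\<^sup>2 - 16"
  shows "\<exists>x y. \<not> int q dvd x - y \<and> int q dvd 2 * x\<^sup>2 - b * x + 2 \<and> int q dvd 2 * y\<^sup>2 - b * y + 2"
proof -
  have Q: "Factorial_Ring.prime (int q)" using q(1) by simp
  have pm: "int q dvd a * b \<longleftrightarrow> int q dvd a \<or> int q dvd b" for a b using Q by (rule prime_dvd_mult_iff)
  have n2: "\<not> int q dvd 2" using q(2) by (auto dest!: zdvd_imp_le)
  have n4: "\<not> int q dvd 4" using n2 pm[of 2 2] by simp
  have n8: "\<not> int q dvd 8" using n2 n4 pm[of 2 4] by simp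
  have "coprime 4 (int q)" using n4 Q by (metis coprime_commute prime_imp_coprime)
  then obtain i where i: "[4 * i = 1] (mod int q)" using cong_solve_coprime_int by blast
  have nr: "\<not> int q dvd r"
  proof
    assume "int q dvd r"
    then have "int q dvd r\<^sup>2" by (simp add: power2_eq_square)
    then show False using r nz by (metis dvd_diff_right_iff)
  qed
  have root: "int q dvd 2 * x\<^sup>2 - b * x + 2" if x: "int q dvd 4 * x - b - t" and t: "t\<^sup>2 = r\<^sup>2" for x t
  proof -
    have "8 * (2 * x\<^sup>2 - b * x + 2) = (4 * x - b - t) * (4 * x - b + t) + (t\<^sup>2 - (b\<^sup>2 - 16))"
      by (simp add: algebra_simps power2_eq_square)
    moreover have "int q dvd (4 * x - b - t) * (4 * x - b + t) + (t\<^sup>2 - (b\<^sup>2 - 16))"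
      using x r by (simp add: t)
    ultimately show ?thesis using pm n8 by metis
  qed
  have step: "int q dvd 4 * ((b + t) * i) - b - t" for t
  proof -
    have "4 * ((b + t) * i) - b - t = (b + t) * (4 * i - 1)" by (simp add: algebra_simps)
    then show ?thesis using i by (simp add: cong_iff_dvd_diff)
  qed
  have "\<not> int q dvd (b + r) * i - (b + (- r)) * i"
  proof
    assume "int q dvd (b + r) * i - (b + (- r)) * i"
    then have "int q dvd r * (2 * i)" by (simp add: algebra_simps)
    then have "int q dvd 2 * i" using pm nr by blast
    moreover have "int q dvd 4 * i - 1" using i by (simp add: cong_iff_dvd_diff)
    ultimately have "int q dvd 2 * (2 * i) - (4 * i - 1)" by (rule dvd_diff[OF dvd_mult])
    then show False using Q by (simp add: not_prime_unit)
  qed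
  then show ?thesis
    using root[OF step[of r]] root[OF step[of "- r"]] by (intro exI[of _ "(b + r) * i"] exI[of _ "(b + (- r)) * i"]) simp
qed

text \<open>With \<open>s\<close> in the role of the square root of \<open>p\<close>, the quartic
  factors modulo \<open>q\<close> into two quadratics with the discriminants
  \<open>\<Delta> s\<close> and \<open>\<Delta> (- s)\<close> up to square factors. Modulo
  \<open>q\<close> their product is the square of \<open>4 * M * (M - 2) * V * s\<close>, so a
  square root of one yields a square root of the other.\<close>

lemma quartic_four_roots_mod:
  fixes s M V r :: int
  assumes q: "Factorial_Ring.prime q" "q > 2" and s: "int q dvd s\<^sup>2 - int p" and MV: "M\<^sup>2 + 4 = int p * V\<^sup>2"
    and nz: "\<not> int q dvd M" "\<not> int q dvd M - 2" "\<not> int q dvd V" "\<not> int q dvd int p"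
    and r: "int q dvd r\<^sup>2 - 2 * M * (M - 2) * V * s * (M + V * s)"
  shows "\<exists>S::int set. finite S \<and> card S = 4 \<and> (\<forall>x\<in>S. \<forall>y\<in>S. int q dvd x - y \<longrightarrow> x = y) \<and>
     (\<forall>x\<in>S. int q dvd poly (quartic M) x \<and> \<not> int q dvd x)"
proof -
  have Q: "Factorial_Ring.prime (int q)" using q(1) by simp
  have pm: "int q dvd a * b \<longleftrightarrow> int q dvd a \<or> int q dvd b" for a b using Q by (rule prime_dvd_mult_iff)
  have n2: "\<not> int q dvd 2" using q(2) by (auto dest!: zdvd_imp_le)
  have n4: "\<not> int q dvd 4" using n2 pm[of 2 2] by simp
  have ns: "\<not> int q dvd s"
  proof
    assume "int q dvd s"
    then have "int q dvd s\<^sup>2" by (simp add: power2_eq_square)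
    then show False using s nz(4) by (metis dvd_diff_right_iff)
  qed
  define \<kappa> where "\<kappa> = (M - 2) * V * s"
  define \<Delta> where "\<Delta> \<sigma> = 2 * M * (M - 2) * V * \<sigma> * (M + V * \<sigma>)" for \<sigma>
  have n\<kappa>: "\<not> int q dvd \<kappa>" using nz ns pm by (simp add: \<kappa>_def)
  have disc: "(M\<^sup>2 + (M - 2) * V * \<sigma>)\<^sup>2 - 16 = \<Delta> \<sigma> - (M\<^sup>2 - 4) * V\<^sup>2 * (\<sigma>\<^sup>2 - int p)" for \<sigma>
  proof -
    have "(M\<^sup>2 + (M - 2) * V * \<sigma>)\<^sup>2 - 16 - \<Delta> \<sigma> + (M\<^sup>2 - 4) * V\<^sup>2 * (\<sigma>\<^sup>2 - int p) = (M\<^sup>2 - 4) * ((M\<^sup>2 + 4) - int p * V\<^sup>2)"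
      by (simp add: \<Delta>_def algebra_simps power2_eq_square)
    then show ?thesis using MV by simp
  qed
  define m where "m = 4 * M * (M - 2) * V * s"
  have nm: "\<not> int q dvd m" using nz ns n4 pm by (simp add: m_def)
  have prod: "int q dvd \<Delta> s * \<Delta> (- s) - m\<^sup>2"
  proof -
    have "\<Delta> s * \<Delta> (- s) - m\<^sup>2 = 4 * M\<^sup>2 * (M - 2)\<^sup>2 * V\<^sup>2 * s\<^sup>2 * (V\<^sup>2 * (s\<^sup>2 - int p) + (int p * V\<^sup>2 - M\<^sup>2 - 4))"
      by (simp add: \<Delta>_def m_def algebra_simps power2_eq_square)
    also have "int p * V\<^sup>2 - M\<^sup>2 - 4 = 0" using MV by simp
    finally show ?thesis using s by (metis add.right_neutral dvd_mult)
  qed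
  have n\<Delta>: "\<not> int q dvd \<Delta> s" "\<not> int q dvd \<Delta> (- s)"
  proof -
    have "\<not> int q dvd \<Delta> s * \<Delta> (- s)"
    proof
      assume "int q dvd \<Delta> s * \<Delta> (- s)"
      then have "int q dvd m\<^sup>2" using prod by (metis dvd_diff_right_iff)
      then show False using nm pm by (simp add: power2_eq_square)
    qed
    then show "\<not> int q dvd \<Delta> s" "\<not> int q dvd \<Delta> (- s)" by auto
  qed
  have r: "int q dvd r\<^sup>2 - \<Delta> s" using r by (simp add: \<Delta>_def)
  have nr: "\<not> int q dvd r"
  proof
    assume "int q dvd r"
    then have "int q dvd r\<^sup>2" by (simp add: power2_eq_square)
    then show False using r n\<Delta>(1) by (metis dvd_diff_right_iff)
  qed
  have "coprime r (int q)" using nr Q by (metis coprime_commute prime_imp_coprime)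
  then obtain r' where r': "[r * r' = 1] (mod int q)" using cong_solve_coprime_int by blast
  \<comment> \<open>The quotient \<open>m / r\<close> is a square root of the second discriminant,
    since \<open>m\<^sup>2\<close> is the product of both.\<close>
  define r2 where "r2 = m * r'"
  have r2: "int q dvd r2\<^sup>2 - \<Delta> (- s)"
  proof -
    have "[r2\<^sup>2 * \<Delta> s = \<Delta> (- s) * \<Delta> s] (mod int q)"
    proof -
      have "[r2\<^sup>2 * \<Delta> s = r2\<^sup>2 * r\<^sup>2] (mod int q)" using r by (intro cong_mult) (simp_all add: cong_iff_dvd_diff dvd_diff_commute)
      also have "r2\<^sup>2 * r\<^sup>2 = m\<^sup>2 * (r * r')\<^sup>2" by (simp add: r2_def power_mult_distrib mult_ac)
      also have "[m\<^sup>2 * (r * r')\<^sup>2 = m\<^sup>2 * 1\<^sup>2] (mod int q)" by (intro cong_mult cong_pow r') simp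
      also have "[m\<^sup>2 * 1\<^sup>2 = \<Delta> s * \<Delta> (- s)] (mod int q)" using prod by (simp add: cong_iff_dvd_diff dvd_diff_commute)
      finally show ?thesis by (simp add: mult.commute)
    qed
    then have "int q dvd (r2\<^sup>2 - \<Delta> (- s)) * \<Delta> s" by (simp add: cong_iff_dvd_diff left_diff_distrib)
    then show ?thesis using pm n\<Delta>(1) by blast
  qed
  define b1 b2 where "b1 = M\<^sup>2 + \<kappa>" and "b2 = M\<^sup>2 - \<kappa>"
  have d1: "b1\<^sup>2 - 16 = \<Delta> s - (M\<^sup>2 - 4) * V\<^sup>2 * (s\<^sup>2 - int p)"
    using disc[of s] by (simp add: b1_def \<kappa>_def)
  have d2: "b2\<^sup>2 - 16 = \<Delta> (- s) - (M\<^sup>2 - 4) * V\<^sup>2 * (s\<^sup>2 - int p)"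
    using disc[of "- s"] by (simp add: b2_def \<kappa>_def)
  have tr: "int q dvd t\<^sup>2 - (c - d * (s\<^sup>2 - int p)) \<and> \<not> int q dvd c - d * (s\<^sup>2 - int p)"
    if "int q dvd t\<^sup>2 - c" "\<not> int q dvd c" for t c d
  proof -
    have k: "int q dvd d * (s\<^sup>2 - int p)" using s by simp
    have "t\<^sup>2 - (c - d * (s\<^sup>2 - int p)) = (t\<^sup>2 - c) + d * (s\<^sup>2 - int p)" by simp
    then have "int q dvd t\<^sup>2 - (c - d * (s\<^sup>2 - int p))" using k that(1) by (metis dvd_add)
    moreover have "\<not> int q dvd c - d * (s\<^sup>2 - int p)" using k that(2) by (simp add: dvd_diff_left_iff)
    ultimately show ?thesis by blast
  qed
  obtain x1 y1 where 1: "\<not> int q dvd x1 - y1" "int q dvd 2 * x1\<^sup>2 - b1 * x1 + 2" "int q dvd 2 * y1\<^sup>2 - b1 * y1 + 2"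
    using quadratic_two_roots_mod[OF q, of r b1] tr[OF r n\<Delta>(1)] unfolding d1 by blast
  obtain x2 y2 where 2: "\<not> int q dvd x2 - y2" "int q dvd 2 * x2\<^sup>2 - b2 * x2 + 2" "int q dvd 2 * y2\<^sup>2 - b2 * y2 + 2"
    using quadratic_two_roots_mod[OF q, of r2 b2] tr[OF r2 n\<Delta>(2)] unfolding d2 by blast
  have nzr: "\<not> int q dvd x" if "int q dvd 2 * x\<^sup>2 - b * x + 2" for x b
  proof
    assume "int q dvd x"
    then have "int q dvd (2 * x - b) * x" by simp
    moreover have "2 * x\<^sup>2 - b * x + 2 = (2 * x - b) * x + 2" by (simp add: algebra_simps power2_eq_square)
    ultimately have "int q dvd 2" using that by (metis dvd_add_right_iff)
    then show False using n2 by simp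
  qed
  have rt: "int q dvd poly (quartic M) x" if "int q dvd 2 * x\<^sup>2 - b1 * x + 2 \<or> int q dvd 2 * x\<^sup>2 - b2 * x + 2" for x
  proof -
    have "4 * poly (quartic M) x = (2 * x\<^sup>2 - b1 * x + 2) * (2 * x\<^sup>2 - b2 * x + 2) + (M - 2)\<^sup>2 * x\<^sup>2 * (V\<^sup>2 * (s\<^sup>2 - int p) + (int p * V\<^sup>2 - M\<^sup>2 - 4))"
      by (simp add: quartic_def b1_def b2_def \<kappa>_def algebra_simps power2_eq_square power3_eq_cube)
    also have "int p * V\<^sup>2 - M\<^sup>2 - 4 = 0" using MV by simp
    finally have "4 * poly (quartic M) x = (2 * x\<^sup>2 - b1 * x + 2) * (2 * x\<^sup>2 - b2 * x + 2) + (M - 2)\<^sup>2 * x\<^sup>2 * V\<^sup>2 * (s\<^sup>2 - int p)"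
      by (simp add: mult_ac)
    moreover have "int q dvd (2 * x\<^sup>2 - b1 * x + 2) * (2 * x\<^sup>2 - b2 * x + 2)" using that by auto
    moreover have "int q dvd (M - 2)\<^sup>2 * x\<^sup>2 * V\<^sup>2 * (s\<^sup>2 - int p)" using s by simp
    ultimately have "int q dvd 4 * poly (quartic M) x" by simp
    then show ?thesis using pm n4 by blast
  qed
  have cross: "\<not> int q dvd x - y" if x: "int q dvd 2 * x\<^sup>2 - b1 * x + 2" and y: "int q dvd 2 * y\<^sup>2 - b2 * y + 2" for x y
  proof
    assume xy: "int q dvd x - y"
    have "2 * \<kappa> * x = (2 * y\<^sup>2 - b2 * y + 2) - (2 * x\<^sup>2 - b1 * x + 2) + (x - y) * (2 * x + 2 * y - b2)"
      by (simp add: b1_def b2_def algebra_simps power2_eq_square)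
    then have "int q dvd 2 * \<kappa> * x" using x y xy by (metis dvd_add dvd_diff dvd_mult2)
    then show False using n2 n\<kappa> nzr[OF x] pm by blast
  qed
  have ne: "x1 \<noteq> y1" "x2 \<noteq> y2" "x1 \<noteq> x2" "x1 \<noteq> y2" "y1 \<noteq> x2" "y1 \<noteq> y2"
    using 1 2 cross[OF 1(2) 2(2)] cross[OF 1(2) 2(3)] cross[OF 1(3) 2(2)] cross[OF 1(3) 2(3)] by auto
  let ?S = "{x1, y1, x2, y2}"
  have c4: "card ?S = 4" using ne by simp
  have sep: "x = y" if "x \<in> ?S" "y \<in> ?S" "int q dvd x - y" for x y
  proof -
    have gen: "x = y" if "x \<in> {a, b, c, d}" "y \<in> {a, b, c, d}" "R x y" "\<And>x y. R x y \<Longrightarrow> R y x"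
      "\<not> R a b" "\<not> R c d" "\<not> R a c" "\<not> R a d" "\<not> R b c" "\<not> R b d" for R and a b c d x y :: int
      using that by blast
    have "int q dvd y - x" if "int q dvd x - y" for x y by (rule iffD1[OF dvd_diff_commute that])
    then show ?thesis
      by (rule gen[where R = "\<lambda>x y. int q dvd x - y", OF that _ 1(1) 2(1) cross[OF 1(2) 2(2)] cross[OF 1(2) 2(3)]
        cross[OF 1(3) 2(2)] cross[OF 1(3) 2(3)]])
  qed
  have "\<forall>x\<in>?S. int q dvd poly (quartic M) x \<and> \<not> int q dvd x"
    using rt nzr 1(2,3) 2(2,3) by blast
  then show ?thesis using c4 sep
    by (intro exI[of _ ?S] conjI ballI impI finite.insertI finite.emptyI; assumption?) blast+
qed

text \<open>Quadratic reciprocity for \<open>p\<close> congruent to \<open>1\<close> modulo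
  \<open>4\<close>: \<open>p\<close> is a square modulo \<open>q\<close> because \<open>q\<close>,
  congruent to \<open>1\<close>, is a square modulo \<open>p\<close>.\<close>

lemma ex_sqrt_p_mod:
  assumes p: "Factorial_Ring.prime p" "[p = 5] (mod 8)" and q: "Factorial_Ring.prime q" "q > 2" "[q = 1] (mod p)"
  shows "\<exists>s::int. int q dvd s\<^sup>2 - int p"
proof -
  have p8: "p mod 8 = 5" using p(2) by (simp add: cong_def)
  then have p2: "p > 2" using prime_gt_1_nat[OF p(1)] by presburger
  have qp: "q \<noteq> p"
  proof
    assume "q = p"
    then show False using q(3) p2 by (simp add: cong_def)
  qed
  have "even ((p - 1) div 2)" using p8 by presburger
  then have "Legendre (int p) (int q) * Legendre (int q) (int p) = 1"
    using Quadratic_Reciprocity[OF p(1) p2 q(1,2)] qp by simp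
  moreover have "Legendre (int q) (int p) = 1"
  proof -
    have c: "[int q = 1] (mod int p)" using q(3) by (metis cong_int_iff of_nat_1)
    then have "QuadRes (int p) (int q)" unfolding QuadRes_def by (intro exI[of _ 1]) (simp add: cong_sym)
    moreover have "\<not> [int q = 0] (mod int p)"
    proof
      assume "[int q = 0] (mod int p)"
      then have "[1 = 0] (mod int p)" using c by (metis cong_sym cong_trans)
      then show False using p2 by (simp add: cong_iff_dvd_diff)
    qed
    ultimately show ?thesis by (simp add: Legendre_def)
  qed
  ultimately have "Legendre (int p) (int q) = 1" by simp
  then have "QuadRes (int q) (int p)" by (auto simp: Legendre_def split: if_splits)
  then show ?thesis by (auto simp: QuadRes_def cong_iff_dvd_diff)
qed

text \<open>For \<open>- L\<close> the companion is \<open>- V\<close> and not \<open>V\<close>, so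
  that both discriminants contain the factor \<open>W = V * s * (L + V * s)\<close> and their
  product is \<open>(2 * L * W)\<^sup>2 * (L\<^sup>2 - 4)\<close>. If both were nonresidues, the
  product and hence \<open>L\<^sup>2 - 4\<close> would be a residue.\<close>

lemma quartic_pow_many_roots:
  fixes L V :: int
  assumes p: "Factorial_Ring.prime p" "[p = 5] (mod 8)" and q: "Factorial_Ring.prime q" "q > 2" "[q = 1] (mod p)"
    and LV: "L\<^sup>2 + 4 = int p * V\<^sup>2" and nz: "\<not> int q dvd L" "\<not> int q dvd L\<^sup>2 - 4" "\<not> int q dvd V" "\<not> int q dvd int p"
    and D: "\<not> QuadRes (int q) (L\<^sup>2 - 4)"
    and pow: "\<And>M x. M \<in> {L, - L} \<Longrightarrow> int q dvd poly (quartic M) x \<Longrightarrow> \<exists>y. int q dvd y ^ p - x"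
  shows "4 * p \<le> card (roots_mod (quartic_pow L p) q) \<or> 4 * p \<le> card (roots_mod (quartic_pow (- L) p) q)"
proof -
  have Q: "Factorial_Ring.prime (int q)" using q(1) by simp
  have pm: "int q dvd a * b \<longleftrightarrow> int q dvd a \<or> int q dvd b" for a b using Q by (rule prime_dvd_mult_iff)
  have p0: "p > 0" using prime_gt_0_nat[OF p(1)] .
  obtain s where s: "int q dvd s\<^sup>2 - int p" using ex_sqrt_p_mod[OF p q] by blast
  have nf: "\<not> int q dvd L - 2" "\<not> int q dvd L + 2"
  proof -
    have "L\<^sup>2 - 4 = (L - 2) * (L + 2)" by (simp add: algebra_simps power2_eq_square)
    then show "\<not> int q dvd L - 2" "\<not> int q dvd L + 2" using nz(2) by auto
  qed
  define W where "W = V * s * (L + V * s)"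
  have fin: "4 * p \<le> card (roots_mod (quartic_pow M p) q)"
    if M: "M \<in> {L, - L}" and MU: "M\<^sup>2 + 4 = int p * U\<^sup>2" "\<not> int q dvd M" "\<not> int q dvd M - 2" "\<not> int q dvd U"
      and res: "QuadRes (int q) (2 * M * (M - 2) * U * s * (M + U * s))" for M U
  proof -
    obtain r where "int q dvd r\<^sup>2 - 2 * M * (M - 2) * U * s * (M + U * s)"
      using res by (auto simp: QuadRes_def cong_iff_dvd_diff)
    then obtain S :: "int set" where S: "finite S" "card S = 4" "\<forall>x\<in>S. \<forall>y\<in>S. int q dvd x - y \<longrightarrow> x = y"
        "\<forall>x\<in>S. int q dvd poly (quartic M) x \<and> \<not> int q dvd x"
      using quartic_four_roots_mod[OF q(1,2) s MU(1,2,3,4) nz(4)] by blast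
    have "card S * p \<le> card (roots_mod (quartic_pow M p) q)"
      by (rule card_roots_mod_quartic_pow[OF p0 q(1,3)]) (use S pow[OF M] in auto)
    then show ?thesis using S(2) by simp
  qed
  show ?thesis
  proof (cases "QuadRes (int q) (2 * L * (L - 2) * V * s * (L + V * s))")
    case True
    then show ?thesis using fin[of L V] LV nz nf by simp
  next
    case F1: False
    have "QuadRes (int q) (2 * (- L) * (- L - 2) * (- V) * s * (- L + (- V) * s))"
    proof (rule ccontr)
      assume "\<not> QuadRes (int q) (2 * (- L) * (- L - 2) * (- V) * s * (- L + (- V) * s))"
      then have "QuadRes (int q) ((2 * L * (L - 2) * V * s * (L + V * s)) * (2 * (- L) * (- L - 2) * (- V) * s * (- L + (- V) * s)))"
        using F1 by (intro QuadRes_mult_nonres[OF q(1,2)])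
      moreover have "(2 * L * (L - 2) * V * s * (L + V * s)) * (2 * (- L) * (- L - 2) * (- V) * s * (- L + (- V) * s)) =
          (2 * L * W)\<^sup>2 * (L\<^sup>2 - 4)"
        by (simp add: W_def algebra_simps power2_eq_square)
      ultimately obtain y where y: "[y\<^sup>2 = (2 * L * W)\<^sup>2 * (L\<^sup>2 - 4)] (mod int q)" by (auto simp: QuadRes_def)
      have "\<not> int q dvd 2 * L * W"
      proof
        assume "int q dvd 2 * L * W"
        then have "int q dvd (2 * L * (L - 2) * V * s * (L + V * s))"
          by (simp add: W_def pm) blast
        then have "[0\<^sup>2 = 2 * L * (L - 2) * V * s * (L + V * s)] (mod int q)" by (simp add: cong_iff_dvd_diff)
        then show False using F1 unfolding QuadRes_def by blast
      qed
      then have "coprime (2 * L * W) (int q)" using Q by (metis coprime_commute prime_imp_coprime)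
      then obtain i where i: "[2 * L * W * i = 1] (mod int q)" using cong_solve_coprime_int by blast
      have "[(y * i)\<^sup>2 = (2 * L * W * i)\<^sup>2 * (L\<^sup>2 - 4)] (mod int q)"
      proof -
        have "[y\<^sup>2 * i\<^sup>2 = (2 * L * W)\<^sup>2 * (L\<^sup>2 - 4) * i\<^sup>2] (mod int q)" using y by (intro cong_mult) auto
        then show ?thesis by (simp add: power_mult_distrib mult_ac)
      qed
      also have "[(2 * L * W * i)\<^sup>2 * (L\<^sup>2 - 4) = 1\<^sup>2 * (L\<^sup>2 - 4)] (mod int q)" by (intro cong_mult cong_pow i) simp
      finally show False using D by (auto simp: QuadRes_def)
    qed
    then have "4 * p \<le> card (roots_mod (quartic_pow (- L) p) q)"
    proof (intro fin[of "- L" "- V"])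
      have "- L - 2 = - (L + 2)" by simp
      then show "\<not> int q dvd - L - 2" using nf(2) by (simp only: dvd_minus_iff not_False_eq_True)
    qed (use LV nz in auto)
    then show ?thesis by blast
  qed
qed

section \<open>The density contradiction\<close>

lemma sum_primes_dividing_bounded:
  fixes N :: int assumes "N \<noteq> 0"
  shows "(\<Sum>q | Factorial_Ring.prime q \<and> q \<le> Z \<and> P q \<and> int q dvd N. ln (real q) / real q) \<le>
    (\<Sum>q | Factorial_Ring.prime q \<and> int q dvd N. ln (real q) / real q)"
proof (rule sum_mono2)
  have "{q. Factorial_Ring.prime q \<and> int q dvd N} \<subseteq> {..nat \<bar>N\<bar>}"
    using assms by (auto dest!: dvd_imp_le_int simp: nat_le_iff le_nat_iff)
  then show "finite {q. Factorial_Ring.prime q \<and> int q dvd N}" by (rule finite_subset) simp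
qed (auto simp: prime_gt_0_nat Suc_le_eq intro!: divide_nonneg_nonneg)

text \<open>Markov's inequality: a prime satisfying \<open>P\<close> enters the weighted sum at
  least \<open>m\<close> times.\<close>

lemma sum_ln_over_primes_le_if_many_roots:
  assumes h: "\<And>Z. Z \<ge> 1 \<Longrightarrow> (\<Sum>q | Factorial_Ring.prime q \<and> q \<le> Z. real (card (roots_mod h q)) * (ln (real q) / real q)) \<le> ln (real Z) + C"
    and many: "\<And>q. Factorial_Ring.prime q \<Longrightarrow> P q \<Longrightarrow> m \<le> card (roots_mod h q)" and m: "m > 0" and Z: "Z \<ge> 1"
  shows "(\<Sum>q | Factorial_Ring.prime q \<and> q \<le> Z \<and> P q. ln (real q) / real q) \<le> (ln (real Z) + C) / real m"
proof -
  have nn: "0 \<le> ln (real q) / real q" if "Factorial_Ring.prime q" for q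
    using that by (auto simp: prime_gt_0_nat Suc_le_eq intro!: divide_nonneg_nonneg)
  have "real m * (\<Sum>q | Factorial_Ring.prime q \<and> q \<le> Z \<and> P q. ln (real q) / real q) =
      (\<Sum>q | Factorial_Ring.prime q \<and> q \<le> Z \<and> P q. real m * (ln (real q) / real q))" by (rule sum_distrib_left)
  also have "\<dots> \<le> (\<Sum>q | Factorial_Ring.prime q \<and> q \<le> Z \<and> P q. real (card (roots_mod h q)) * (ln (real q) / real q))"
    using many nn by (intro sum_mono mult_right_mono) auto
  also have "\<dots> \<le> (\<Sum>q | Factorial_Ring.prime q \<and> q \<le> Z. real (card (roots_mod h q)) * (ln (real q) / real q))"
    using nn by (intro sum_mono2 mult_nonneg_nonneg) auto
  also have "\<dots> \<le> ln (real Z) + C" by (rule h[OF Z])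
  finally show ?thesis using m by (simp add: pos_le_divide_eq mult.commute)
qed

text \<open>The root count is applied with the real \<open>p\<close>-th root \<open>c\<close> of
  \<open>a\<close>, whose powers below \<open>4 * p\<close> are independent.\<close>

lemma quartic_pow_roots_sum_bounded:
  assumes "unit_power p L V lw bw w v e"
  shows "\<exists>C. \<forall>Z\<ge>1. (\<Sum>q | Factorial_Ring.prime q \<and> q \<le> Z. real (card (roots_mod (quartic_pow (e * L) p) q)) * (ln (real q) / real q))
     \<le> ln (real Z) + C"
proof -
  interpret unit_power p L V lw bw w v e by fact
  have p0: "p > 0" using p by simp
  note mon = quartic_pow_monic[OF p0, of "e * L"]
  have of_c: "poly (map_poly of_int g) (complex_of_real c) = of_real (poly (map_poly of_int g) c)" for g :: "int poly"
    by (simp add: poly_altdef)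
  show ?thesis
  proof (rule sum_roots_mod_ln_le[where \<theta> = "complex_of_real c"])
    show "lead_coeff (quartic_pow (e * L) p) = 1" by (rule mon(2))
    show "degree (quartic_pow (e * L) p) > 0" using mon(1) p0 by simp
    have "a\<^sup>2 - A * a + 1 = 0" using a_props(1) by (simp add: power2_eq_square)
    then have "poly (map_poly of_int (quartic_pow (e * L) p)) c = 0"
      unfolding poly_of_int_quartic_pow c_props(1) quartic_factor by simp
    then show "poly (map_poly of_int (quartic_pow (e * L) p)) (complex_of_real c) = 0" unfolding of_c by simp
    fix g :: "int poly"
    assume "degree g < degree (quartic_pow (e * L) p)" "poly (map_poly of_int g) (complex_of_real c) = 0"
    then show "g = 0" using radical_independent[of g] mon(1) unfolding of_c by simp
  qed
qed

theorem ex_prime_with_non_pth_power_root: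
  fixes L V lw bw N :: int and w v :: real
  assumes p: "Factorial_Ring.prime p" "[p = 5] (mod 8)"
    and up: "unit_power p L V lw bw w v 1" "unit_power p L V lw bw w v (-1)" and N: "N \<noteq> 0"
  shows "\<exists>q M x. Factorial_Ring.prime q \<and> [q = 1] (mod p) \<and> \<not> int q dvd 2 * N * int p \<and> M \<in> {L, - L} \<and>
     int q dvd poly (quartic M) x \<and> \<not> (\<exists>y. int q dvd y ^ p - x)"
proof (rule ccontr)
  assume neg: "\<not> ?thesis"
  have p2: "p > 2" "p \<ge> 5" using unit_power.p[OF up(1)] by auto
  note LV = unit_power.v(2)[OF up(1)] unit_power.LV[OF up(1)]
  define D where "D = L\<^sup>2 - 4"
  \<comment> \<open>Besides the primes excluded in the statement, \<open>B\<close> contains those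
    modulo which the factorization of the quartics or the discriminants degenerate. They are
    finitely many and contribute a constant.\<close>
  define B where "B = 2 * N * int p * (L * V * D)"
  have L2: "L\<^sup>2 > 4" using LV(2) power_strict_mono[of 2 L 2] by simp
  have B0: "B \<noteq> 0" using N p2 LV L2 by (simp add: B_def D_def)
  let ?P = "\<lambda>Z R. \<Sum>q | Factorial_Ring.prime q \<and> q \<le> Z \<and> R q. ln (real q) / real q"
  define G where "G q \<longleftrightarrow> [q = 1] (mod p) \<and> \<not> int q dvd B" for q
  have good: "q > 2" "\<not> int q dvd L" "\<not> int q dvd V" "\<not> int q dvd D" "\<not> int q dvd int p" "\<not> int q dvd 2 * N * int p"
    if "Factorial_Ring.prime q" "G q" for q
  proof -
    have nB: "\<not> int q dvd B" using that by (simp add: G_def)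
    then show "\<not> int q dvd L" "\<not> int q dvd V" "\<not> int q dvd D" "\<not> int q dvd int p" "\<not> int q dvd 2 * N * int p"
      unfolding B_def by (auto simp: dvd_mult dvd_mult2)
    have "q \<noteq> 2" using nB unfolding B_def by auto
    then show "q > 2" using prime_ge_2_nat[OF that(1)] by simp
  qed
  have pows: "\<exists>y. int q dvd y ^ p - x" if "Factorial_Ring.prime q" "G q" "M \<in> {L, - L}" "int q dvd poly (quartic M) x" for q M x
    using neg that good(6)[OF that(1,2)] by (auto simp: G_def)
  obtain C1 where C1: "\<And>Z. Z \<ge> 1 \<Longrightarrow> ln (real Z) / real (p - 1) - C1 \<le> ?P Z (\<lambda>q. [q = 1] (mod p))"
    using mertens_primes_cong_1[OF p(1) p2(1)] by blast
  define CB where "CB = (\<Sum>q | Factorial_Ring.prime q \<and> int q dvd B. ln (real q) / real q)"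
  have CB: "?P Z (\<lambda>q. [q = 1] (mod p) \<and> int q dvd B) \<le> CB" for Z
    unfolding CB_def using sum_primes_dividing_bounded[OF B0, of Z "\<lambda>q. [q = 1] (mod p)"] by simp
  have "\<exists>C. \<forall>Z\<ge>1. (\<Sum>q | Factorial_Ring.prime q \<and> q \<le> Z. real (card (roots_mod (cyclo_sqrt_poly D p) q)) * (ln (real q) / real q)) \<le> ln (real Z) + C"
  proof -
    define \<eta> where "\<eta> = cis (2 * pi / real p)"
    interpret cs: cyclo_sqrt p D \<eta> "of_real (sqrt (of_int D))"
    proof
      show "Factorial_Ring.prime p" "p > 2" using p p2 by auto
      show "\<eta> ^ p = 1" using p2 by (simp add: \<eta>_def Complex.DeMoivre)
      show "\<eta> \<noteq> 1"
      proof
        assume "\<eta> = 1"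
        then have "cos (2 * pi / real p) = 1" by (simp add: \<eta>_def complex_eq_iff)
        moreover have "cos (2 * pi / real p) < cos 0"
        proof (rule cos_monotone_0_pi)
          show "0 < 2 * pi / real p" using p2 by simp
          have "2 * pi \<le> pi * real p" using p2 by simp
          then show "2 * pi / real p \<le> pi" using p2 by (simp add: divide_le_eq)
        qed simp
        ultimately show False by simp
      qed
      have "(sqrt (of_int D))\<^sup>2 = real_of_int D" using L2 by (simp add: D_def del: of_int_diff)
      then show "(complex_of_real (sqrt (of_int D)))\<^sup>2 = of_int D"
        by (metis of_real_of_int_eq of_real_power)
      show "int p dvd x \<and> int p dvd y" if "int p dvd x\<^sup>2 - D * y\<^sup>2" for x y
        using disc_nonresidue[OF p LV(1)] that unfolding D_def by blast
      show "\<not> int p dvd D"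
      proof
        assume "int p dvd D"
        then have "int p dvd 0\<^sup>2 - D * 1\<^sup>2" by simp
        then have "int p dvd 1" using disc_nonresidue[OF p LV(1), of 0 1] unfolding D_def by blast
        then show False using p2 by simp
      qed
    qed
    note mon = cyclo_sqrt_monic[of p D]
    show ?thesis
    proof (rule sum_roots_mod_ln_le[where \<theta> = cs.\<theta>])
      show "lead_coeff (cyclo_sqrt_poly D p) = 1" "degree (cyclo_sqrt_poly D p) > 0" using mon p2 by auto
      show "poly (map_poly of_int (cyclo_sqrt_poly D p)) cs.\<theta> = 0" by (rule cs.theta_root)
      show "g = 0" if "degree g < degree (cyclo_sqrt_poly D p)" "poly (map_poly of_int g) cs.\<theta> = 0" for g
        using cs.theta_independent[of g] that mon p2 by simp
    qed
  qed
  then obtain C2 where C2: "\<And>Z. Z \<ge> 1 \<Longrightarrow> (\<Sum>q | Factorial_Ring.prime q \<and> q \<le> Z. real (card (roots_mod (cyclo_sqrt_poly D p) q)) * (ln (real q) / real q)) \<le> ln (real Z) + C2"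
    by blast
  obtain C3 where C3: "\<And>Z. Z \<ge> 1 \<Longrightarrow> (\<Sum>q | Factorial_Ring.prime q \<and> q \<le> Z. real (card (roots_mod (quartic_pow L p) q)) * (ln (real q) / real q)) \<le> ln (real Z) + C3"
    using quartic_pow_roots_sum_bounded[OF up(1)] by auto
  obtain C4 where C4: "\<And>Z. Z \<ge> 1 \<Longrightarrow> (\<Sum>q | Factorial_Ring.prime q \<and> q \<le> Z. real (card (roots_mod (quartic_pow (- L) p) q)) * (ln (real q) / real q)) \<le> ln (real Z) + C4"
    using quartic_pow_roots_sum_bounded[OF up(2)] by auto
  have b2: "?P Z (\<lambda>q. G q \<and> QuadRes (int q) D) \<le> (ln (real Z) + C2) / real (2 * (p - 1))" if "Z \<ge> 1" for Z
  proof (rule sum_ln_over_primes_le_if_many_roots[OF C2 _ _ that])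
    fix q assume q: "Factorial_Ring.prime q" "G q \<and> QuadRes (int q) D"
    then obtain s where "int q dvd s\<^sup>2 - D" by (auto simp: QuadRes_def cong_iff_dvd_diff)
    then show "2 * (p - 1) \<le> card (roots_mod (cyclo_sqrt_poly D p) q)"
      using q good[of q] p2 prime_odd_nat[OF p(1)] by (intro card_roots_mod_cyclo_sqrt) (auto simp: G_def)
  qed (use p2 in auto)
  have b3: "?P Z (\<lambda>q. 4 * p \<le> card (roots_mod (quartic_pow L p) q)) \<le> (ln (real Z) + C3) / real (4 * p)" if "Z \<ge> 1" for Z
    by (rule sum_ln_over_primes_le_if_many_roots[OF C3 _ _ that]) (use p2 in auto)
  have b4: "?P Z (\<lambda>q. 4 * p \<le> card (roots_mod (quartic_pow (- L) p) q)) \<le> (ln (real Z) + C4) / real (4 * p)" if "Z \<ge> 1" for Z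
    by (rule sum_ln_over_primes_le_if_many_roots[OF C4 _ _ that]) (use p2 in auto)
  define E where "E = C1 + CB + C2 / real (2 * (p - 1)) + C3 / real (4 * p) + C4 / real (4 * p)"
  have key: "ln (real Z) / real (p - 1) \<le> ln (real Z) / real (2 * (p - 1)) + ln (real Z) / real (2 * p) + E" if Z: "Z \<ge> 1" for Z
  proof -
    define T where "T R = {q. Factorial_Ring.prime q \<and> q \<le> Z \<and> R q}" for R :: "nat \<Rightarrow> bool"
    have fT: "finite (T R)" for R unfolding T_def by (rule finite_subset[of _ "{..Z}"]) auto
    have nn: "0 \<le> ln (real q) / real q" if "q \<in> T R" for q R
      using that by (auto simp: T_def prime_gt_0_nat Suc_le_eq intro!: divide_nonneg_nonneg)
    let ?R1 = "\<lambda>q. [q = 1] (mod p) \<and> int q dvd B"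
    let ?R2 = "\<lambda>q. G q \<and> QuadRes (int q) D"
    let ?R3 = "\<lambda>q. 4 * p \<le> card (roots_mod (quartic_pow L p) q)"
    let ?R4 = "\<lambda>q. 4 * p \<le> card (roots_mod (quartic_pow (- L) p) q)"
    \<comment> \<open>A prime outside the first two classes does not divide \<open>B\<close> and has
      \<open>D\<close> as a nonresidue; then \<open>neg\<close> makes the roots of both quartics
      \<open>p\<close>-th powers, and one quartic has its full number of roots.\<close>
    have cover: "T (\<lambda>q. [q = 1] (mod p)) \<subseteq> T ?R1 \<union> (T ?R2 \<union> (T ?R3 \<union> T ?R4))"
    proof
      fix q assume q: "q \<in> T (\<lambda>q. [q = 1] (mod p))"
      then have qp: "Factorial_Ring.prime q" "q \<le> Z" "[q = 1] (mod p)" by (auto simp: T_def)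
      show "q \<in> T ?R1 \<union> (T ?R2 \<union> (T ?R3 \<union> T ?R4))"
      proof (cases "G q \<and> \<not> QuadRes (int q) D")
        case True
        have "?R3 q \<or> ?R4 q"
          using True good[OF qp(1)] pows[OF qp(1)] qp unfolding D_def
          by (intro quartic_pow_many_roots[OF p qp(1) _ qp(3) LV(1)]) auto
        then show ?thesis using qp by (auto simp: T_def)
      next
        case False
        then show ?thesis using qp by (auto simp: T_def G_def)
      qed
    qed
    have un: "(\<Sum>q\<in>T R \<union> S. ln (real q) / real q) \<le> (\<Sum>q\<in>T R. ln (real q) / real q) + (\<Sum>q\<in>S. ln (real q) / real q)"
      if "finite S" "\<And>q. q \<in> S \<Longrightarrow> 0 \<le> ln (real q) / real q" for R S
    proof -
      have "(\<Sum>q\<in>T R \<union> S. ln (real q) / real q) = (\<Sum>q\<in>T R. ln (real q) / real q) + (\<Sum>q\<in>S - T R. ln (real q) / real q)"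
        using fT that by (subst sum.union_disjoint[symmetric]) auto
      also have "(\<Sum>q\<in>S - T R. ln (real q) / real q) \<le> (\<Sum>q\<in>S. ln (real q) / real q)"
        using that by (intro sum_mono2) auto
      finally show ?thesis by simp
    qed
    have "(\<Sum>q\<in>T (\<lambda>q. [q = 1] (mod p)). ln (real q) / real q) \<le> (\<Sum>q\<in>T ?R1 \<union> (T ?R2 \<union> (T ?R3 \<union> T ?R4)). ln (real q) / real q)"
      using cover fT nn by (intro sum_mono2) blast+
    also have "\<dots> \<le> (\<Sum>q\<in>T ?R1. ln (real q) / real q) + (\<Sum>q\<in>T ?R2 \<union> (T ?R3 \<union> T ?R4). ln (real q) / real q)"
      by (rule un) (use fT nn in blast)+
    also have "(\<Sum>q\<in>T ?R2 \<union> (T ?R3 \<union> T ?R4). ln (real q) / real q) \<le> (\<Sum>q\<in>T ?R2. ln (real q) / real q) + (\<Sum>q\<in>T ?R3 \<union> T ?R4. ln (real q) / real q)"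
      by (rule un) (use fT nn in blast)+
    also have "(\<Sum>q\<in>T ?R3 \<union> T ?R4. ln (real q) / real q) \<le> (\<Sum>q\<in>T ?R3. ln (real q) / real q) + (\<Sum>q\<in>T ?R4. ln (real q) / real q)"
      by (rule un) (use fT nn in blast)+
    finally have tot: "?P Z (\<lambda>q. [q = 1] (mod p)) \<le> ?P Z ?R1 + (?P Z ?R2 + (?P Z ?R3 + ?P Z ?R4))"
      unfolding T_def by simp
    have ring: "a \<le> r2 + (r3 + r4) + (c1 + cb + d2 + d3 + d4)"
      if "a - c1 \<le> s" "s \<le> s1 + (s2 + (s3 + s4))" "s1 \<le> cb" "s2 \<le> r2 + d2" "s3 \<le> r3 + d3" "s4 \<le> r4 + d4"
      for a c1 s s1 s2 s3 s4 cb r2 r3 r4 d2 d3 d4 :: real using that by linarith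
    have half: "ln (real Z) / real (4 * p) + ln (real Z) / real (4 * p) = ln (real Z) / real (2 * p)"
      using p2 by (simp add: field_simps)
    show ?thesis
      using ring[OF C1[OF Z] tot CB b2[OF Z, unfolded add_divide_distrib] b3[OF Z, unfolded add_divide_distrib] b4[OF Z, unfolded add_divide_distrib]]
      unfolding half E_def .
  qed
  \<comment> \<open>The densities almost balance: the surplus is
    \<open>1 / (2 * p * (p - 1))\<close>. Being positive, it beats the constant \<open>E\<close>
    once \<open>ln Z\<close> is large.\<close>
  define \<epsilon> where "\<epsilon> = 1 / real (p - 1) - 1 / real (2 * (p - 1)) - 1 / real (2 * p)"
  have "\<epsilon> > 0"
  proof -
    have "\<epsilon> = 1 / real (2 * (p - 1)) - 1 / real (2 * p)" using p2 by (simp add: \<epsilon>_def field_simps)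
    moreover have "1 / real (2 * p) < 1 / real (2 * (p - 1))"
      using p2 by (intro divide_strict_left_mono) auto
    ultimately show ?thesis by simp
  qed
  have bd: "ln (real Z) * \<epsilon> \<le> E" if "Z \<ge> 1" for Z
  proof -
    have "ln (real Z) * \<epsilon> = ln (real Z) / real (p - 1) - ln (real Z) / real (2 * (p - 1)) - ln (real Z) / real (2 * p)"
      unfolding \<epsilon>_def by (simp only: right_diff_distrib times_divide_eq_right mult_1_right)
    moreover have "x \<le> E" if "x = a - b - c" "a \<le> b + c + E" for x a b c using that by linarith
    ultimately show ?thesis using key[OF that] by blast
  qed
  obtain Z :: nat where Z: "real Z > exp (E / \<epsilon>)" using reals_Archimedean2 by blast
  then have "real Z > 0" using exp_gt_zero less_trans by blast
  then have "ln (real Z) > E / \<epsilon>" using Z by (metis exp_gt_zero ln_exp ln_less_cancel_iff)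
  then have "ln (real Z) * \<epsilon> > E" using \<open>\<epsilon> > 0\<close> by (simp add: divide_less_eq)
  moreover have "Z \<ge> 1" using \<open>real Z > 0\<close> by simp
  ultimately show False using bd[of Z] by simp
qed

section \<open>The quadratic field, its embeddings and its integers\<close>

lemma CC_simps [simp]:
  "carrier CC = UNIV" "x \<otimes>\<^bsub>CC\<^esub> y = x * y" "x \<oplus>\<^bsub>CC\<^esub> y = x + y" "\<one>\<^bsub>CC\<^esub> = 1" "\<zero>\<^bsub>CC\<^esub> = 0"
  by (simp_all add: ring_of_type_algebra_def)

lemma CC_minus [simp]: "\<ominus>\<^bsub>CC\<^esub> x = - x"
proof -
  interpret CC: ring CC by (rule ring_from_type_algebra)
  show ?thesis by (rule CC.minus_equality) simp_all
qed

lemma CC_inv: "x \<noteq> 0 \<Longrightarrow> inv\<^bsub>CC\<^esub> x = inverse x"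
proof -
  interpret CC: ring CC by (rule ring_from_type_algebra)
  assume "x \<noteq> 0" then show ?thesis by (intro CC.inv_char) simp_all
qed

lemma real_subfield_quad: "Factorial_Ring.prime p \<Longrightarrow> real_subfield (quad_ext \<rat> (sqrt (real p)))"
  by (rule real_subfield_quad_ext[OF real_subfield_Rats sqrt_prime_not_Rats]) simp_all

lemma quad_eq_iff:
  assumes "Factorial_Ring.prime p" "x \<in> \<rat>" "y \<in> \<rat>" "x' \<in> \<rat>" "y' \<in> \<rat>"
  shows "x + y * sqrt (real p) = x' + y' * sqrt (real p) \<longleftrightarrow> x = x' \<and> y = y'"
  by (rule quad_ext_eq_iff[OF real_subfield_Rats sqrt_prime_not_Rats[OF assms(1)] assms(2-)])

text \<open>Coordinates over the rationals replace the inductively generated field, so that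
  embeddings, norms and units can be computed with pairs of rationals.\<close>

lemma quad_field_eq:
  assumes p: "Factorial_Ring.prime p"
  shows "quad_field p = complex_of_real ` quad_ext \<rat> (sqrt (real p))"
proof
  note E = real_subfieldD[OF real_subfield_quad[OF p]]
  show "quad_field p \<subseteq> complex_of_real ` quad_ext \<rat> (sqrt (real p))"
  proof
    fix x assume "x \<in> quad_field p"
    then have "x \<in> generate_field CC {of_real (sqrt (real p))}" by (simp add: quad_field_def)
    then show "x \<in> complex_of_real ` quad_ext \<rat> (sqrt (real p))"
    proof induction
      case one
      show ?case using E(1) by (intro image_eqI[of _ _ 1]) simp_all
    next
      case (incl h)
      then show ?case using gen_in_quad_ext[OF real_subfield_Rats] by auto
    next
      case (a_inv h)
      then obtain r where "h = of_real r" "r \<in> quad_ext \<rat> (sqrt (real p))" by blast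
      then show ?case using E(7)[of r] by (intro image_eqI[of _ _ "- r"]) simp_all
    next
      case (m_inv h)
      then obtain r where "h = of_real r" "r \<in> quad_ext \<rat> (sqrt (real p))" by blast
      then show ?case using E(9)[of r] m_inv by (intro image_eqI[of _ _ "inverse r"]) (simp_all add: CC_inv)
    next
      case (eng_add h k)
      then obtain r r' where "h = of_real r" "r \<in> quad_ext \<rat> (sqrt (real p))" "k = of_real r'" "r' \<in> quad_ext \<rat> (sqrt (real p))" by blast
      then show ?case using E(6)[of r r'] by (intro image_eqI[of _ _ "r + r'"]) simp_all
    next
      case (eng_mult h k)
      then obtain r r' where "h = of_real r" "r \<in> quad_ext \<rat> (sqrt (real p))" "k = of_real r'" "r' \<in> quad_ext \<rat> (sqrt (real p))" by blast
      then show ?case using E(4)[of r r'] by (intro image_eqI[of _ _ "r * r'"]) simp_all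
    qed
  qed
  define G where "G = generate_field CC {complex_of_real (sqrt (real p))}"
  have add: "x + y \<in> G" and mult: "x * y \<in> G" and neg: "- x \<in> G" if "x \<in> G" "y \<in> G" for x y
    using that generate_field.eng_add[of x CC _ y] generate_field.eng_mult[of x CC _ y] generate_field.a_inv[of x CC] by (simp_all add: G_def)
  have one: "1 \<in> G" using generate_field.one[of CC] by (simp add: G_def)
  have zero: "0 \<in> G" using add[OF one neg[OF one one]] by simp
  have inv: "inverse x \<in> G" if "x \<in> G" for x
    using that zero generate_field.m_inv[of x CC] by (cases "x = 0") (simp_all add: G_def CC_inv)
  have nat: "of_nat n \<in> G" for n by (induction n) (auto intro: zero one add)
  have int: "of_int n \<in> G" for n by (cases n) (use nat neg in \<open>auto simp del: of_nat_Suc\<close>)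
  have rat: "complex_of_real r \<in> G" if r: "r \<in> \<rat>" for r
  proof -
    obtain a b where "r = of_int a / of_int b" using r by (elim Rats_cases') blast
    then have "complex_of_real r = of_int a * inverse (of_int b)" by (simp add: field_simps)
    then show ?thesis using mult[OF int inv[OF int]] by simp
  qed
  have gen: "complex_of_real (sqrt (real p)) \<in> G" unfolding G_def by (rule generate_field.incl) simp
  show "complex_of_real ` quad_ext \<rat> (sqrt (real p)) \<subseteq> quad_field p"
    using add[OF rat mult[OF rat gen]] by (auto simp: quad_ext_def quad_field_def G_def)
qed

definition quad_coords :: "nat \<Rightarrow> complex \<Rightarrow> real \<times> real" where
  "quad_coords p z = (SOME xy. fst xy \<in> \<rat> \<and> snd xy \<in> \<rat> \<and> z = of_real (fst xy + snd xy * sqrt (real p)))"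

text \<open>The map \<open>x + y * sqrt p \<mapsto> x + e * y * sqrt p\<close>, which is a
  homomorphism if \<open>e\<^sup>2 = 1\<close>. The restriction makes it extensional, as
  \<open>field_embeddings\<close> demands.\<close>

definition quad_emb :: "nat \<Rightarrow> real \<Rightarrow> complex \<Rightarrow> complex" where
  "quad_emb p e = restrict (\<lambda>z. of_real (fst (quad_coords p z) + e * snd (quad_coords p z) * sqrt (real p))) (quad_field p)"

lemma quad_emb_eq:
  assumes p: "Factorial_Ring.prime p" and xy: "x \<in> \<rat>" "y \<in> \<rat>"
  shows "quad_emb p e (of_real (x + y * sqrt (real p))) = of_real (x + e * y * sqrt (real p))"
proof -
  let ?z = "complex_of_real (x + y * sqrt (real p))"
  have "fst (quad_coords p ?z) \<in> \<rat> \<and> snd (quad_coords p ?z) \<in> \<rat> \<and>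
      ?z = of_real (fst (quad_coords p ?z) + snd (quad_coords p ?z) * sqrt (real p))"
    unfolding quad_coords_def by (rule someI[of _ "(x, y)"]) (simp add: xy)
  then have "fst (quad_coords p ?z) = x \<and> snd (quad_coords p ?z) = y"
    using quad_eq_iff[OF p xy, of "fst (quad_coords p ?z)" "snd (quad_coords p ?z)"] of_real_eq_iff by metis
  moreover have "?z \<in> quad_field p" unfolding quad_field_eq[OF p] using quad_extI[OF xy] by blast
  ultimately show ?thesis by (simp add: quad_emb_def)
qed

lemma quad_fieldE:
  assumes "Factorial_Ring.prime p" "z \<in> quad_field p"
  obtains x y where "x \<in> \<rat>" "y \<in> \<rat>" "z = complex_of_real (x + y * sqrt (real p))"
  using assms(2) unfolding quad_field_eq[OF assms(1)] quad_ext_def by blast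

lemma quad_emb_in_field_embeddings:
  assumes p: "Factorial_Ring.prime p" and e: "e \<in> \<rat>" "e\<^sup>2 = 1"
  shows "quad_emb p e \<in> field_embeddings (quad_field p)"
proof -
  let ?s = "sqrt (real p)"
  have "quad_emb p e \<in> extensional (quad_field p)" by (simp add: quad_emb_def)
  moreover have "quad_emb p e \<in> Ring.ring_hom (CC\<lparr>carrier := quad_field p\<rparr>) CC"
  proof (rule ring_hom_memI)
    fix z z' assume "z \<in> carrier (CC\<lparr>carrier := quad_field p\<rparr>)" "z' \<in> carrier (CC\<lparr>carrier := quad_field p\<rparr>)"
    then have zK: "z \<in> quad_field p" "z' \<in> quad_field p" by simp_all
    obtain x y where xy1: "x \<in> \<rat>" "y \<in> \<rat>" and z1: "z = of_real (x + y * ?s)" by (rule quad_fieldE[OF p zK(1)])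
    obtain x' y' where xy2: "x' \<in> \<rat>" "y' \<in> \<rat>" and z2: "z' = of_real (x' + y' * ?s)" by (rule quad_fieldE[OF p zK(2)])
    note xy = xy1 xy2 and z = z1 z2
    have m: "(x + y * ?s) * (x' + y' * ?s) = (x * x' + real p * (y * y')) + (x * y' + y * x') * ?s"
    proof -
      have "(x + y * ?s) * (x' + y' * ?s) = x * x' + (?s * ?s) * (y * y') + (x * y' + y * x') * ?s"
        by (simp only: algebra_simps)
      then show ?thesis by simp
    qed
    have r: "x * x' + real p * (y * y') \<in> \<rat>" "x * y' + y * x' \<in> \<rat>" "x + x' \<in> \<rat>" "y + y' \<in> \<rat>" using xy by simp_all
    have ss: "?s * ?s = real p" by simp
    have ee: "e * e = 1" using e by (simp add: power2_eq_square)
    have "z * z' = of_real ((x * x' + real p * (y * y')) + (x * y' + y * x') * ?s)" unfolding z m[symmetric] by simp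
    moreover have "(x * x' + real p * (y * y')) + e * (x * y' + y * x') * ?s = (x + e * y * ?s) * (x' + e * y' * ?s)"
    proof -
      have "(x + e * y * ?s) * (x' + e * y' * ?s) = x * x' + (e * e) * (?s * ?s) * (y * y') + e * (x * y' + y * x') * ?s"
        by (simp only: algebra_simps)
      then show ?thesis unfolding ee ss by simp
    qed
    ultimately show "quad_emb p e (z \<otimes>\<^bsub>CC\<lparr>carrier := quad_field p\<rparr>\<^esub> z') = quad_emb p e z \<otimes>\<^bsub>CC\<^esub> quad_emb p e z'"
      using quad_emb_eq[OF p r(1,2), of e] quad_emb_eq[OF p xy(1,2), of e] quad_emb_eq[OF p xy(3,4), of e] z
      by (simp del: of_real_add of_real_mult add: of_real_mult[symmetric])
    have "z + z' = of_real ((x + x') + (y + y') * ?s)" unfolding z by (simp add: algebra_simps)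
    then show "quad_emb p e (z \<oplus>\<^bsub>CC\<lparr>carrier := quad_field p\<rparr>\<^esub> z') = quad_emb p e z \<oplus>\<^bsub>CC\<^esub> quad_emb p e z'"
      using quad_emb_eq[OF p r(3,4), of e] quad_emb_eq[OF p xy(1,2), of e] quad_emb_eq[OF p xy(3,4), of e] z
      by (simp add: algebra_simps)
  next
    show "quad_emb p e \<one>\<^bsub>CC\<lparr>carrier := quad_field p\<rparr>\<^esub> = \<one>\<^bsub>CC\<^esub>"
      using quad_emb_eq[OF p, of 1 0 e] by simp
  qed simp
  ultimately show ?thesis by (simp add: field_embeddings_def)
qed

text \<open>An embedding fixes the rationals and sends the square root of \<open>p\<close> to one of
  the two square roots of \<open>p\<close>.\<close>

lemma field_embeddings_quad_field:
  assumes p: "Factorial_Ring.prime p"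
  shows "field_embeddings (quad_field p) = {quad_emb p 1, quad_emb p (-1)}"
proof
  show "{quad_emb p 1, quad_emb p (-1)} \<subseteq> field_embeddings (quad_field p)"
    using quad_emb_in_field_embeddings[OF p] by simp
  show "field_embeddings (quad_field p) \<subseteq> {quad_emb p 1, quad_emb p (-1)}"
  proof
    fix \<sigma> assume "\<sigma> \<in> field_embeddings (quad_field p)"
    then have h: "\<sigma> \<in> Ring.ring_hom (CC\<lparr>carrier := quad_field p\<rparr>) CC" and ext: "\<sigma> \<in> extensional (quad_field p)"
      by (auto simp: field_embeddings_def)
    have K: "of_real (x + y * sqrt (real p)) \<in> quad_field p" if "x \<in> \<rat>" "y \<in> \<rat>" for x y
      unfolding quad_field_eq[OF p] using quad_extI[OF that] by blast
    have KR: "of_real x \<in> quad_field p" if "x \<in> \<rat>" for x using K[OF that, of 0] by simp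
    have Ks: "of_real (sqrt (real p)) \<in> quad_field p" using K[of 0 1] by simp
    have add: "\<sigma> (x + y) = \<sigma> x + \<sigma> y" and mult: "\<sigma> (x * y) = \<sigma> x * \<sigma> y" if "x \<in> quad_field p" "y \<in> quad_field p" for x y
      using ring_hom_add[OF h, of x y] ring_hom_mult[OF h, of x y] that by simp_all
    have one: "\<sigma> 1 = 1" using ring_hom_one[OF h] by simp
    have zero: "\<sigma> 0 = 0" using add[of 0 0] KR[of 0] by simp
    have nat: "\<sigma> (of_nat n) = of_nat n" for n
    proof (induction n)
      case (Suc n)
      then show ?case using add[of 1 "of_nat n"] KR[of 1] KR[of "of_nat n"] one by simp
    qed (simp add: zero)
    have minus: "\<sigma> (- x) = - \<sigma> x" if "x = complex_of_real r" "r \<in> \<rat>" for x r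
      using add[of x "- x"] KR[of r] KR[of "- r"] that zero by (simp add: eq_neg_iff_add_eq_0 add.commute)
    have int: "\<sigma> (of_int n) = of_int n" for n
    proof (cases n)
      case (neg m)
      then show ?thesis using minus[of "of_nat (Suc m)" "of_nat (Suc m)"] nat[of "Suc m"] by (simp del: of_nat_Suc)
    qed (simp add: nat)
    have rat: "\<sigma> (of_real r) = of_real r" if r: "r \<in> \<rat>" for r
    proof -
      obtain a b where ab: "b > 0" "r = of_int a / of_int b" using r by (elim Rats_cases') blast
      have "\<sigma> (of_int b * of_real r) = of_int b * \<sigma> (of_real r)"
        using mult[of "of_int b" "of_real r"] KR[of "of_int b"] KR[OF r] int by simp
      moreover have "of_int b * complex_of_real r = of_int a" using ab by simp
      ultimately have "of_int b * \<sigma> (of_real r) = of_int b * complex_of_real r" using int[of a] by metis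
      moreover have "complex_of_int b \<noteq> 0" using ab(1) by simp
      ultimately show ?thesis by (metis mult_left_cancel)
    qed
    let ?s = "complex_of_real (sqrt (real p))"
    have ss: "?s * ?s = of_nat p" by (simp flip: of_real_mult)
    have "\<sigma> ?s * \<sigma> ?s = of_nat p" using mult[OF Ks Ks] nat[of p] ss by simp
    then have "(\<sigma> ?s - ?s) * (\<sigma> ?s + ?s) = 0" using ss by (simp add: algebra_simps)
    then have "\<exists>e\<in>{1, -1}. \<sigma> ?s = of_real e * ?s" by (auto simp: eq_neg_iff_add_eq_0)
    then obtain e where e: "e \<in> {1, -1}" "\<sigma> ?s = of_real e * ?s" by blast
    have "\<sigma> = quad_emb p e"
    proof (rule extensionalityI[OF ext])
      show "quad_emb p e \<in> extensional (quad_field p)" by (simp add: quad_emb_def)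
      fix z assume "z \<in> quad_field p"
      then obtain x y where xy: "x \<in> \<rat>" "y \<in> \<rat>" and z: "z = of_real (x + y * sqrt (real p))" by (rule quad_fieldE[OF p])
      have "\<sigma> z = \<sigma> (of_real x + of_real y * ?s)" unfolding z by simp
      also have "\<dots> = of_real x + of_real y * \<sigma> ?s"
        using add[of "of_real x" "of_real y * ?s"] mult[of "of_real y" ?s] KR xy Ks K[of 0 y] rat by simp
      also have "\<dots> = quad_emb p e z" unfolding z quad_emb_eq[OF p xy] e(2) by simp
      finally show "\<sigma> z = quad_emb p e z" .
    qed
    then show "\<sigma> \<in> {quad_emb p 1, quad_emb p (-1)}" using e(1) by auto
  qed
qed

lemma
  assumes p: "Factorial_Ring.prime p" and xy: "x \<in> \<rat>" "y \<in> \<rat>"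
  shows field_norm_quad_field: "field_norm (quad_field p) (of_real (x + y * sqrt (real p))) = of_real (x\<^sup>2 - real p * y\<^sup>2)"
    and field_trace_quad_field: "field_trace (quad_field p) (of_real (x + y * sqrt (real p))) = of_real (2 * x)"
proof -
  have "sqrt (real p) > 0" using prime_gt_0_nat[OF p] by simp
  moreover have "quad_emb p 1 (of_real (sqrt (real p))) = of_real (sqrt (real p))"
    "quad_emb p (-1) (of_real (sqrt (real p))) = of_real (- sqrt (real p))"
    using quad_emb_eq[OF p, of 0 1 1] quad_emb_eq[OF p, of 0 1 "-1"] by simp_all
  ultimately have "quad_emb p 1 (of_real (sqrt (real p))) \<noteq> quad_emb p (-1) (of_real (sqrt (real p)))"
    by (simp del: of_real_minus)
  \<comment> \<open>Norm and trace run over a set of embeddings, so the two must be distinct to be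
    counted separately.\<close>
  then have ne: "quad_emb p 1 \<noteq> quad_emb p (-1)" by metis
  have ss: "sqrt (real p) * sqrt (real p) = real p" by simp
  have "(x + 1 * y * sqrt (real p)) * (x + -1 * y * sqrt (real p)) = x\<^sup>2 - (sqrt (real p) * sqrt (real p)) * y\<^sup>2"
    by (simp only: algebra_simps power2_eq_square)
  then show "field_norm (quad_field p) (of_real (x + y * sqrt (real p))) = of_real (x\<^sup>2 - real p * y\<^sup>2)"
    unfolding field_norm_def field_embeddings_quad_field[OF p] ss using ne quad_emb_eq[OF p xy]
    by (simp del: of_real_add of_real_mult of_real_diff add: of_real_mult[symmetric])
  show "field_trace (quad_field p) (of_real (x + y * sqrt (real p))) = of_real (2 * x)"
    unfolding field_trace_def field_embeddings_quad_field[OF p] using ne quad_emb_eq[OF p xy] by simp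
qed

section \<open>The Lucas sequences of the unit\<close>

lemma seq_rec_nat:
  "seqL t (int (Suc (Suc n))) = t * seqL t (int (Suc n)) + seqL t (int n)"
  "seqF t (int (Suc (Suc n))) = t * seqF t (int (Suc n)) + seqF t (int n)"
  using seqL_rec(3)[of t "int n"] seqF_rec(3)[of t "int n"] by (simp_all add: add.commute)

lemma nat_induct_two:
  assumes "P 0" "P (Suc 0)" "\<And>n. P n \<Longrightarrow> P (Suc n) \<Longrightarrow> P (Suc (Suc n))" shows "P (n::nat)"
proof -
  have "P n \<and> P (Suc n)" by (induction n) (use assms in auto)
  then show ?thesis by blast
qed

text \<open>The base satisfies the equation \<open>u * u = t * u + 1\<close>, which is the
  recurrence of both sequences. The root \<open>s\<close> is kept general, so that the conjugate
  power is covered by taking \<open>- sqrt p\<close>.\<close>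

lemma power_quad_eq_seq:
  fixes s :: real and t b :: int
  assumes s: "s\<^sup>2 = real p" and tb: "t\<^sup>2 + 4 = int p * b\<^sup>2"
  shows "((of_int t + of_int b * s) / 2) ^ n = (of_int (seqL t (int n)) + of_int (b * seqF t (int n)) * s) / 2"
proof -
  define u where "u = (of_int t + of_int b * s) / 2"
  have "real_of_int (t\<^sup>2 + 4) = of_int (int p * b\<^sup>2)" using tb by simp
  then have "(of_int t)\<^sup>2 + 4 = s\<^sup>2 * (of_int b)\<^sup>2" using s by simp
  then have u: "u * u = of_int t * u + 1" by (simp add: u_def field_simps power2_eq_square)
  have "u ^ n = (of_int (seqL t (int n)) + of_int (b * seqF t (int n)) * s) / 2"
  proof (induction n rule: nat_induct_two)
    case (3 n)
    have "u ^ Suc (Suc n) = (u * u) * u ^ n" by simp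
    also have "\<dots> = of_int t * u ^ Suc n + u ^ n" unfolding u by (simp add: algebra_simps)
    also have "\<dots> = (of_int (seqL t (int (Suc (Suc n)))) + of_int (b * seqF t (int (Suc (Suc n)))) * s) / 2"
      unfolding 3 seq_rec_nat by (simp add: field_simps del: of_nat_Suc)
    finally show ?case .
  qed (simp_all add: seqL_rec seqF_rec u_def)
  then show ?thesis by (simp add: u_def)
qed

text \<open>The product of the two conjugate powers: the base has norm \<open>-1\<close>, and so has
  each of its odd powers.\<close>

lemma seq_norm:
  assumes tb: "t\<^sup>2 + 4 = int p * b\<^sup>2" and n: "odd n"
  shows "(seqL t (int n))\<^sup>2 + 4 = int p * (b * seqF t (int n))\<^sup>2"
proof -
  let ?L = "real_of_int (seqL t (int n))" and ?V = "real_of_int (b * seqF t (int n))" and ?s = "sqrt (real p)"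
  have eq: "((of_int t + of_int b * ?s) / 2) ^ n = (?L + ?V * ?s) / 2"
    "((of_int t + of_int b * (- ?s)) / 2) ^ n = (?L + ?V * (- ?s)) / 2"
    by (rule power_quad_eq_seq[OF _ tb]; simp)+
  have ss: "?s * ?s = real p" by simp
  have nm: "((x + y * ?s) / 2) * ((x + y * (- ?s)) / 2) = (x\<^sup>2 - real p * y\<^sup>2) / 4" for x y
  proof -
    have "((x + y * ?s) / 2) * ((x + y * (- ?s)) / 2) = (x * x - (?s * ?s) * (y * y)) / 4" by (simp only: algebra_simps times_divide_times_eq) simp
    then show ?thesis unfolding ss by (simp add: power2_eq_square)
  qed
  have "real_of_int (t\<^sup>2 + 4) = of_int (int p * b\<^sup>2)" using tb by simp
  then have "((of_int t)\<^sup>2 - real p * (of_int b)\<^sup>2) / 4 = - 1" by (simp add: field_simps)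
  then have "((of_int t + of_int b * ?s) / 2) * ((of_int t + of_int b * (- ?s)) / 2) = -1" unfolding nm .
  then have "((of_int t + of_int b * ?s) / 2) ^ n * ((of_int t + of_int b * (- ?s)) / 2) ^ n = -1"
    using n by (simp only: power_mult_distrib[symmetric]) simp
  then have "(?L\<^sup>2 - real p * ?V\<^sup>2) / 4 = -1" unfolding eq nm .
  then have "real_of_int ((seqL t (int n))\<^sup>2 + 4) = of_int (int p * (b * seqF t (int n))\<^sup>2)" by (simp add: field_simps)
  then show ?thesis by (simp only: of_int_eq_iff)
qed

lemma seq_pos:
  assumes "t > 0" shows "seqL t (int n) > 0" "n > 0 \<Longrightarrow> seqF t (int n) > 0"
proof -
  show "seqL t (int n) > 0"
    by (induction n rule: nat_induct_two) (use assms in \<open>simp_all add: seqL_rec seq_rec_nat add_pos_pos del: of_nat_Suc\<close>, simp_all add: seqL_rec)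
  have F: "seqF t (int n) \<ge> 0 \<and> seqF t (int (Suc n)) > 0" for n
  proof (induction n)
    case 0 show ?case using seqF_rec(1,2)[of t] by simp
  next
    case (Suc n) then show ?case unfolding seq_rec_nat using assms by (simp add: add_pos_nonneg)
  qed
  show "n > 0 \<Longrightarrow> seqF t (int n) > 0" using F[of "n - 1"] by simp
qed

lemma seq_neg:
  "seqL t (- int n) = (-1) ^ n * seqL t (int n)" "seqF t (- int n) = - ((-1) ^ n) * seqF t (int n)"
proof -
  have shift: "- int (Suc (Suc n)) + 2 = - int n" "- int (Suc (Suc n)) + 1 = - int (Suc n)" for n by simp_all
  show "seqL t (- int n) = (-1) ^ n * seqL t (int n)"
  proof (induction n rule: nat_induct_two)
    case 2
    then show ?case using seqL_rec(3)[of t "-1"] seqL_rec(1,2)[of t] by simp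
  next
    case (3 n)
    then show ?case using seqL_rec(3)[of t "- int (Suc (Suc n))"] unfolding shift seq_rec_nat by (simp add: algebra_simps del: of_nat_Suc)
  qed simp
  show "seqF t (- int n) = - ((-1) ^ n) * seqF t (int n)"
  proof (induction n rule: nat_induct_two)
    case 2
    then show ?case using seqF_rec(3)[of t "-1"] seqF_rec(1,2)[of t] by simp
  next
    case (3 n)
    then show ?case using seqF_rec(3)[of t "- int (Suc (Suc n))"] unfolding shift seq_rec_nat by (simp add: algebra_simps del: of_nat_Suc)
  qed (simp add: seqF_rec)
qed

text \<open>Modulo \<open>p\<close> the characteristic polynomial
  \<open>X\<^sup>2 - t * X - 1\<close> has discriminant \<open>t\<^sup>2 + 4 = 0\<close> and the
  double root \<open>t / 2\<close>, so \<open>seqF t (n + 1)\<close> is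
  \<open>(n + 1) * (t / 2) ^ n\<close>. The congruence \<open>d\<close> is this formula multiplied
  by \<open>2 ^ n\<close>.\<close>

lemma prime_dvd_seqF:
  assumes p: "Factorial_Ring.prime p" "p > 2" and tb: "t\<^sup>2 + 4 = int p * b\<^sup>2"
  shows "int p dvd seqF t (int p)"
proof -
  have d: "int p dvd 2 ^ n * seqF t (int (Suc n)) - (int n + 1) * t ^ n" for n
  proof (induction n rule: nat_induct_two)
    case 1 show ?case using seqF_rec(2)[of t] by simp
  next
    case 2 show ?case using seq_rec_nat(2)[of t 0] seqF_rec(1,2)[of t] by simp
  next
    case (3 n)
    have id: "2 * (2 * A) * (t * y + x) - (k + 3) * (t * (t * T)) =
      2 * t * (2 * A * y - (k + 2) * (t * T)) + 4 * (A * x - (k + 1) * T) + (k + 1) * T * (t\<^sup>2 + 4)"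
      for A x y k T :: int by (simp add: algebra_simps power2_eq_square)
    have k: "int (Suc n) + 1 = int n + 2" "int (Suc (Suc n)) + 1 = int n + 3" by simp_all
    have d: "int p dvd t\<^sup>2 + 4" using tb by simp
    show ?case unfolding seq_rec_nat(2)[of t "Suc n"] power_Suc k id
      by (rule dvd_add[OF dvd_add[OF dvd_mult[OF 3(2)[unfolded power_Suc k]] dvd_mult[OF 3(1)]] dvd_mult[OF d]])
  qed
  have "int p dvd 2 ^ (p - 1) * seqF t (int p) - int p * t ^ (p - 1)" using d[of "p - 1"] p by (simp add: of_nat_diff)
  from dvd_add[OF this dvd_triv_left[of _ "t ^ (p - 1)"]] have "int p dvd 2 ^ (p - 1) * seqF t (int p)" by (simp only: diff_add_cancel)
  moreover have "\<not> int p dvd 2 ^ (p - 1)"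
  proof
    assume "int p dvd 2 ^ (p - 1)"
    then have "int p dvd 2" using p(1) prime_dvd_power[of "int p"] by simp
    then show False using p(2) by (auto dest!: zdvd_imp_le)
  qed
  ultimately show ?thesis using p(1) prime_dvd_mult_iff[of "int p"] by simp
qed

text \<open>The power \<open>u ^ p\<close> has the same shape as \<open>u\<close>, with
  \<open>t1\<close> and \<open>b1\<close> in place of \<open>t\<close> and \<open>b\<close>. So the
  preceding divisibility applies twice in \<open>u ^ p\<^sup>2 = (u ^ p) ^ p\<close>, each time with
  one factor \<open>p\<close>.\<close>

lemma prime_square_dvd_seqF:
  assumes p: "Factorial_Ring.prime p" "p > 2" and tb: "t\<^sup>2 + 4 = int p * b\<^sup>2"
  shows "(int p)\<^sup>2 dvd b * seqF t (int (p\<^sup>2))"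
proof -
  define t1 where "t1 = seqL t (int p)"
  define b1 where "b1 = b * seqF t (int p)"
  let ?s = "sqrt (real p)"
  have ss: "?s\<^sup>2 = real p" by simp
  have o: "odd p" using p by (simp add: prime_odd_nat)
  have tb1: "t1\<^sup>2 + 4 = int p * b1\<^sup>2" unfolding t1_def b1_def by (rule seq_norm[OF tb o])
  have "((of_int t + of_int b * ?s) / 2) ^ (p\<^sup>2) = (((of_int t + of_int b * ?s) / 2) ^ p) ^ p"
    by (simp add: power2_eq_square power_mult)
  then have "(of_int (seqL t (int (p\<^sup>2))) + of_int (b * seqF t (int (p\<^sup>2))) * ?s) / 2 =
    (of_int (seqL t1 (int p)) + of_int (b1 * seqF t1 (int p)) * ?s) / 2"
    unfolding power_quad_eq_seq[OF ss tb] t1_def[symmetric] b1_def[symmetric] power_quad_eq_seq[OF ss tb1] .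
  then have "real_of_int (seqL t (int (p\<^sup>2))) + of_int (b * seqF t (int (p\<^sup>2))) * ?s =
    of_int (seqL t1 (int p)) + of_int (b1 * seqF t1 (int p)) * ?s" by simp
  then have "real_of_int (b * seqF t (int (p\<^sup>2))) = of_int (b1 * seqF t1 (int p))"
    using quad_ext_eq_iff[OF real_subfield_Rats sqrt_prime_not_Rats[OF p(1)]] by (metis Rats_of_int)
  then have "b * seqF t (int (p\<^sup>2)) = b1 * seqF t1 (int p)" by (simp only: of_int_eq_iff)
  moreover have "int p dvd b1" unfolding b1_def using prime_dvd_seqF[OF p tb] by simp
  ultimately show ?thesis using prime_dvd_seqF[OF p tb1] by (simp add: power2_eq_square mult_dvd_mono)
qed

section \<open>Integers and units of the quadratic field; the norm of the fundamental unit\<close>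

lemma algebraic_int_quad_conjugate:
  assumes p: "Factorial_Ring.prime p" and xy: "x \<in> \<rat>" "y \<in> \<rat>"
    and z: "algebraic_int (complex_of_real (x + y * sqrt (real p)))"
  shows "algebraic_int (complex_of_real (x - y * sqrt (real p)))"
proof -
  have of_c: "poly (map_poly of_int g) (complex_of_real c) = of_real (poly (map_poly of_int g) c)" for g :: "int poly" and c
    by (simp add: poly_altdef)
  obtain f where f: "lead_coeff f = 1" "poly (map_poly of_int f) (complex_of_real (x + y * sqrt (real p))) = 0"
    using z unfolding algebraic_int_altdef_ipoly by blast
  \<comment> \<open>Integer polynomials commute with conjugation, so a monic one that vanishes at a
    number of the field also vanishes at its conjugate.\<close>
  have "\<exists>U\<in>\<rat>. \<exists>W\<in>\<rat>. poly (map_poly of_int g) (x + y * sqrt (real p)) = U + W * sqrt (real p) \<and>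
      poly (map_poly of_int g) (x - y * sqrt (real p)) = U - W * sqrt (real p)" for g :: "int poly"
  proof (induction g)
    case 0
    show ?case by (intro bexI[of _ 0]) simp_all
  next
    case (pCons a g)
    then obtain U W where UW: "U \<in> \<rat>" "W \<in> \<rat>" "poly (map_poly of_int g) (x + y * sqrt (real p)) = U + W * sqrt (real p)"
      "poly (map_poly of_int g) (x - y * sqrt (real p)) = U - W * sqrt (real p)" by blast
    have pc: "poly (map_poly of_int (pCons a g)) c = of_int a + c * poly (map_poly of_int g) c" for c :: real
      by (simp add: Polynomial.map_poly_pCons[where f = of_int])
    have ss: "sqrt (real p) * sqrt (real p) = real p" by simp
    have m: "(x + y * s) * (U + W * s) = (x * U + (s * s) * (y * W)) + (x * W + y * U) * s"
       "(x - y * s) * (U - W * s) = (x * U + (s * s) * (y * W)) - (x * W + y * U) * s" for s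
      by (simp_all add: algebra_simps)
    show ?case unfolding pc UW(3,4) m ss
      using xy UW(1,2) by (intro bexI[of _ "of_int a + (x * U + real p * (y * W))"] bexI[of _ "x * W + y * U"]) simp_all
  qed
  then obtain U W where UW: "U \<in> \<rat>" "W \<in> \<rat>" "poly (map_poly of_int f) (x + y * sqrt (real p)) = U + W * sqrt (real p)"
      "poly (map_poly of_int f) (x - y * sqrt (real p)) = U - W * sqrt (real p)" by blast
  have "poly (map_poly of_int f) (x + y * sqrt (real p)) = 0" using f(2) unfolding of_c by simp
  then have "U + W * sqrt (real p) = 0 + 0 * sqrt (real p)" using UW(3) by simp
  then have "U = 0 \<and> W = 0" using quad_eq_iff[OF p UW(1,2), of 0 0] by simp
  then have "poly (map_poly of_int f) (complex_of_real (x - y * sqrt (real p))) = 0" unfolding of_c using UW(4) by simp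
  then show ?thesis unfolding algebraic_int_altdef_ipoly using f(1) by blast
qed

lemma quad_norm_mult: "(x + y * sqrt (real p)) * (x - y * sqrt (real p)) = x\<^sup>2 - real p * y\<^sup>2"
proof -
  have "(x + y * sqrt (real p)) * (x - y * sqrt (real p)) = x\<^sup>2 - (sqrt (real p) * sqrt (real p)) * y\<^sup>2"
    by (simp only: algebra_simps power2_eq_square)
  then show ?thesis by simp
qed

lemma quad_norm_algebraic_int:
  assumes p: "Factorial_Ring.prime p" and xy: "x \<in> \<rat>" "y \<in> \<rat>"
    and z: "algebraic_int (complex_of_real (x + y * sqrt (real p)))"
  shows "x\<^sup>2 - real p * y\<^sup>2 \<in> \<int>"
proof -
  have r: "x\<^sup>2 - real p * y\<^sup>2 \<in> \<rat>" using xy by simp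
  have "algebraic_int (complex_of_real (x + y * sqrt (real p)) * complex_of_real (x - y * sqrt (real p)))"
    by (rule algebraic_int_times[OF z algebraic_int_quad_conjugate[OF p xy z]])
  then have a: "algebraic_int (complex_of_real (x\<^sup>2 - real p * y\<^sup>2))"
    by (simp only: of_real_mult[symmetric] quad_norm_mult)
  obtain f where f: "poly (map_poly of_int f) (complex_of_real (x\<^sup>2 - real p * y\<^sup>2)) = 0" "lead_coeff f = (1::int)"
    using a unfolding algebraic_int_altdef_ipoly by blast
  have "poly (map_poly of_int f) (complex_of_real (x\<^sup>2 - real p * y\<^sup>2)) = of_real (poly (map_poly of_int f) (x\<^sup>2 - real p * y\<^sup>2))"
    by (simp add: poly_altdef)
  then have "poly (map_poly of_int f) (x\<^sup>2 - real p * y\<^sup>2) = 0" using f(1) of_real_eq_0_iff by metis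
  then have "algebraic_int (x\<^sup>2 - real p * y\<^sup>2)" unfolding algebraic_int_altdef_ipoly using f(2) by blast
  then show ?thesis using r by (rule rational_algebraic_int_is_int)
qed

lemma Units_ring_of_integers:
  "z \<in> Units (ring_of_integers K) \<longleftrightarrow> z \<in> K \<and> algebraic_int z \<and> (\<exists>w\<in>K. algebraic_int w \<and> w * z = 1)"
  by (auto simp: Units_def ring_of_integers_def mult.commute)

text \<open>Norms are multiplicative and integral on algebraic integers, so the norm of a unit
  divides \<open>1\<close>.\<close>

lemma unit_norm:
  fixes t b :: int
  assumes p: "Factorial_Ring.prime p" and u: "complex_of_real ((of_int t + of_int b * sqrt (real p)) / 2) \<in> Units (ring_of_integers (quad_field p))"
  shows "t\<^sup>2 - int p * b\<^sup>2 = 4 \<or> t\<^sup>2 - int p * b\<^sup>2 = -4"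
proof -
  define x y where "x = real_of_int t / 2" and "y = real_of_int b / 2"
  have xy: "x \<in> \<rat>" "y \<in> \<rat>" by (simp_all add: x_def y_def)
  have eq: "(of_int t + of_int b * sqrt (real p)) / 2 = x + y * sqrt (real p)" by (simp add: x_def y_def add_divide_distrib)
  note u = u[unfolded eq Units_ring_of_integers]
  then obtain w where w: "w \<in> quad_field p" "algebraic_int w" "w * of_real (x + y * sqrt (real p)) = 1" by blast
  obtain x' y' where xy': "x' \<in> \<rat>" "y' \<in> \<rat>" and w': "w = of_real (x' + y' * sqrt (real p))" by (rule quad_fieldE[OF p w(1)])
  have "(x' + y' * sqrt (real p)) * (x + y * sqrt (real p)) = 1" using w(3) unfolding w' by (metis of_real_eq_1_iff of_real_mult)
  moreover have ss: "sqrt (real p) * sqrt (real p) = real p" by simp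
  moreover have "(x' + y' * s) * (x + y * s) = (x' * x + (s * s) * (y' * y)) + (x' * y + y' * x) * s" for s by (simp add: algebra_simps)
  ultimately have "(x' * x + real p * (y' * y)) + (x' * y + y' * x) * sqrt (real p) = 1 + 0 * sqrt (real p)" by simp
  then have c: "x' * x + real p * (y' * y) = 1 \<and> x' * y + y' * x = 0"
    using quad_eq_iff[OF p, of "x' * x + real p * (y' * y)" "x' * y + y' * x" 1 0] xy xy' by simp
  have "(x'\<^sup>2 - real p * y'\<^sup>2) * (x\<^sup>2 - real p * y\<^sup>2) = (x' * x + real p * (y' * y))\<^sup>2 - real p * (x' * y + y' * x)\<^sup>2"
    by (simp add: power2_eq_square algebra_simps)
  also have "\<dots> = 1" using c by simp
  finally have pr: "(x'\<^sup>2 - real p * y'\<^sup>2) * (x\<^sup>2 - real p * y\<^sup>2) = 1" .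
  have "x\<^sup>2 - real p * y\<^sup>2 \<in> \<int>" using quad_norm_algebraic_int[OF p xy] u by blast
  then obtain m where m: "x\<^sup>2 - real p * y\<^sup>2 = of_int m" by (auto elim: Ints_cases)
  have "x'\<^sup>2 - real p * y'\<^sup>2 \<in> \<int>" using quad_norm_algebraic_int[OF p xy'] w w' by blast
  then obtain m' where m': "x'\<^sup>2 - real p * y'\<^sup>2 = of_int m'" by (auto elim: Ints_cases)
  have "m' * m = 1" using pr unfolding m m' by (metis of_int_eq_1_iff of_int_mult)
  then have "m = 1 \<or> m = -1" by (auto simp: zmult_eq_1_iff)
  moreover have "real_of_int (t\<^sup>2 - int p * b\<^sup>2) = of_int (4 * m)"
    using m by (simp add: x_def y_def field_simps)
  then have "t\<^sup>2 - int p * b\<^sup>2 = 4 * m" by (simp only: of_int_eq_iff)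
  ultimately show ?thesis by auto
qed

text \<open>The inverse is \<open>e\<close> times the conjugate, and both conjugates are roots of
  \<open>X\<^sup>2 - x * X + e\<close>.\<close>

lemma unit_of_norm:
  fixes x y :: int
  assumes p: "Factorial_Ring.prime p" and xy: "x\<^sup>2 - int p * y\<^sup>2 = 4 * e" "e = 1 \<or> e = -1"
  shows "complex_of_real ((of_int x + of_int y * sqrt (real p)) / 2) \<in> Units (ring_of_integers (quad_field p))"
proof -
  let ?s = "sqrt (real p)"
  have ai: "complex_of_real ((of_int x + of_int y' * ?s) / 2) \<in> quad_field p \<and> algebraic_int (complex_of_real ((of_int x + of_int y' * ?s) / 2))"
    if "y'\<^sup>2 = y\<^sup>2" for y'
  proof -
    define c where "c = (of_int x + of_int y' * ?s) / 2"
    have "c = of_int x / 2 + of_int y' / 2 * ?s" by (simp add: c_def add_divide_distrib)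
    moreover have "of_int x / 2 + of_int y' / 2 * ?s \<in> quad_ext \<rat> ?s" by (intro quad_extI) simp_all
    ultimately have 1: "complex_of_real c \<in> quad_field p" unfolding quad_field_eq[OF p] by (metis imageI)
    have "real_of_int (x\<^sup>2 - int p * y'\<^sup>2) = of_int (4 * e)" using xy that by simp
    then have "(of_int x)\<^sup>2 - real p * (of_int y')\<^sup>2 = 4 * real_of_int e" by simp
    moreover have "c * c - of_int x * c = - ((of_int x)\<^sup>2 - (?s * ?s) * (of_int y')\<^sup>2) / 4"
      by (simp only: c_def power2_eq_square) (simp add: field_simps)
    ultimately have "c * c - of_int x * c + of_int e = 0" by simp
    then have "poly (map_poly of_int [:e, - x, 1:]) c = 0" by (simp add: map_poly_pCons algebra_simps)
    moreover have "poly (map_poly of_int [:e, - x, 1:]) (complex_of_real c) = of_real (poly (map_poly of_int [:e, - x, 1:]) c)"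
      by (simp add: map_poly_pCons)
    ultimately have "algebraic_int (complex_of_real c)" unfolding algebraic_int_altdef_ipoly
      by (intro exI[of _ "[:e, - x, 1:]"]) simp
    then show ?thesis using 1 unfolding c_def by blast
  qed
  define w where "w = complex_of_real (of_int e * ((of_int x + of_int (- y) * ?s) / 2))"
  have w: "w = complex_of_real ((of_int x + of_int (- y) * ?s) / 2) \<or> w = - complex_of_real ((of_int x + of_int (- y) * ?s) / 2)"
    using xy(2) by (auto simp: w_def)
  have 0: "complex_of_real ((of_int x + of_int (- y) * ?s) / 2) \<in> quad_field p"
    "algebraic_int (complex_of_real ((of_int x + of_int (- y) * ?s) / 2))" using ai[of "- y"] by simp_all
  have neg: "- z \<in> quad_field p" if "z \<in> quad_field p" for z
    using generate_field.a_inv[of z CC] that by (simp add: quad_field_def)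
  have "w \<in> quad_field p" "algebraic_int w" using w 0 neg[OF 0(1)] by (auto simp del: of_real_divide of_real_add)
  moreover have "of_int e * ((of_int x + of_int (- y) * ?s) / 2) * ((of_int x + of_int y * ?s) / 2) = 1"
  proof -
    have "real_of_int (x\<^sup>2 - int p * y\<^sup>2) = of_int (4 * e)" using xy by simp
    then have "(of_int x)\<^sup>2 - real p * (of_int y)\<^sup>2 = 4 * real_of_int e" by simp
    then have "(of_int x + of_int y * ?s) * (of_int x - of_int y * ?s) = 4 * real_of_int e" unfolding quad_norm_mult .
    moreover have "of_int e * ((of_int x + of_int (- y) * ?s) / 2) * ((of_int x + of_int y * ?s) / 2) =
       of_int e / 4 * ((of_int x + of_int y * ?s) * (of_int x - of_int y * ?s))" by simp
    ultimately have "of_int e * ((of_int x + of_int (- y) * ?s) / 2) * ((of_int x + of_int y * ?s) / 2) =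
       of_int e / 4 * (4 * of_int e)" by (simp only:)
    also have "\<dots> = 1" using xy(2) by auto
    finally show ?thesis .
  qed
  then have "w * complex_of_real ((of_int x + of_int y * ?s) / 2) = 1" unfolding w_def
    by (metis of_real_1 of_real_mult)
  ultimately show ?thesis using ai[of y] unfolding Units_ring_of_integers by blast
qed

text \<open>The prime \<open>p\<close> divides one of the factors; after its removal two coprime
  numbers have a square as product.\<close>

lemma coprime_mult_eq_prime_square:
  assumes p: "Factorial_Ring.prime (p::nat)" and ac: "coprime a c" "a * c = p * b\<^sup>2"
  shows "(\<exists>x y. a = p * x\<^sup>2 \<and> c = y\<^sup>2) \<or> (\<exists>x y. a = x\<^sup>2 \<and> c = p * y\<^sup>2)"
proof -
  have sq: "\<exists>x y. a = x\<^sup>2 \<and> c = y\<^sup>2" if "coprime a c" "a * c = b\<^sup>2" for a c :: nat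
  proof -
    have "is_nth_power 2 (a * c)" using that(2) by (auto simp: is_nth_power_def)
    then have "is_nth_power 2 a \<and> is_nth_power 2 c" using is_nth_power_mult_coprime_nat_iff[OF that(1)] by blast
    then show ?thesis by (auto simp: is_nth_power_def)
  qed
  have p0: "p > 0" using p by (rule prime_gt_0_nat)
  have "p dvd a * c" using ac(2) by simp
  then consider "p dvd a" | "p dvd c" using prime_dvd_mult_iff[OF p] by blast
  then show ?thesis
  proof cases
    case 1
    then obtain a' where a': "a = p * a'" by blast
    then have "a' * c = b\<^sup>2" "coprime a' c" using ac p0 by auto
    then show ?thesis using sq[of a' c] a' by blast
  next
    case 2
    then obtain c' where c': "c = p * c'" by blast
    then have "a * c' = b\<^sup>2" "coprime a c'" using ac p0 by auto
    then show ?thesis using sq[of a c'] c' by blast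
  qed
qed

context
  fixes p :: nat and t b :: int and u :: real
  assumes p: "Factorial_Ring.prime p" and u: "u = (of_int t + of_int b * sqrt (real p)) / 2" and fu: "fundamental_unit p u"
begin

lemma unit_eq_power:
  fixes x y :: int
  assumes "x\<^sup>2 - int p * y\<^sup>2 = 4 * e" "e = 1 \<or> e = -1" "(of_int x + of_int y * sqrt (real p)) / 2 > 1"
  shows "\<exists>j>0. (of_int x + of_int y * sqrt (real p)) / 2 = u ^ j"
proof -
  let ?z = "(of_int x + of_int y * sqrt (real p)) / 2"
  have u1: "u > 1" using fu by (simp add: fundamental_unit_def)
  have "complex_of_real ?z \<in> Units (ring_of_integers (quad_field p))" by (rule unit_of_norm[OF p assms(1,2)])
  then obtain j :: int where "complex_of_real ?z = of_real u powi j \<or> complex_of_real ?z = - (of_real u powi j)"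
    using fu unfolding fundamental_unit_def by blast
  then have "complex_of_real ?z = of_real (u powi j) \<or> complex_of_real ?z = of_real (- (u powi j))" by simp
  then have "?z = u powi j \<or> ?z = - (u powi j)" by (simp only: of_real_eq_iff)
  moreover have "u powi j > 0" using u1 by simp
  ultimately have z: "?z = u powi j" using assms(3) by linarith
  have "j > 0"
  proof (rule ccontr)
    assume "\<not> j > 0"
    then have "u powi j = 1 / u ^ nat (- j)" by (simp add: power_int_def field_simps)
    moreover have "1 \<le> u ^ nat (- j)" using u1 by (intro one_le_power) simp
    ultimately have "u powi j \<le> 1" by simp
    then show False using z assms(3) by linarith
  qed
  then have "?z = u ^ nat j" "nat j > 0" using z by (auto simp: power_int_def)
  then show ?thesis by blast
qed

lemma fundamental_unit_le:
  fixes x y :: int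
  assumes "x\<^sup>2 - int p * y\<^sup>2 = 4" "x > 0" "y > 0"
  shows "of_int t + of_int b * sqrt (real p) \<le> of_int x + of_int y * sqrt (real p)"
proof -
  have "p \<ge> 2" using p by (rule prime_ge_2_nat)
  then have "int p * y\<^sup>2 \<ge> 1" using assms(3) by (simp add: int_one_le_iff_zero_less)
  then have "x\<^sup>2 > 2\<^sup>2" using assms(1) by simp
  then have "x > 2" using assms(2) power2_less_imp_less[of 2 x] by simp
  moreover have "real_of_int y * sqrt (real p) \<ge> 0" using assms(3) by simp
  ultimately have "(of_int x + of_int y * sqrt (real p)) / 2 > 1" by simp
  then obtain j where j: "j > 0" "(of_int x + of_int y * sqrt (real p)) / 2 = u ^ j" using unit_eq_power[of x y 1] assms(1) by auto
  have "u > 1" using fu by (simp add: fundamental_unit_def)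
  then have "u ^ 1 \<le> u ^ j" using j(1) by (intro power_increasing) auto
  then show ?thesis using j(2) u by simp
qed

text \<open>A unit above \<open>1\<close> is a power of \<open>u\<close>, so its norm is a power of
  the norm of \<open>u\<close>, which is \<open>1\<close> here.\<close>

lemma no_norm_minus_one:
  fixes x y :: int
  assumes N: "t\<^sup>2 - int p * b\<^sup>2 = 4" and xy: "x > 0" "y > 0"
  shows "x\<^sup>2 - int p * y\<^sup>2 \<noteq> -4"
proof
  assume m: "x\<^sup>2 - int p * y\<^sup>2 = -4"
  let ?s = "sqrt (real p)"
  have "p \<ge> 2" using p by (rule prime_ge_2_nat)
  then have "?s > 1" by simp
  then have "real_of_int y * ?s > 1" using xy(2) by (smt (verit) mult_le_cancel_right1 of_int_1_le_iff int_one_le_iff_zero_less)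
  then have "(of_int x + of_int y * ?s) / 2 > 1" using xy(1) by (simp add: int_one_le_iff_zero_less)
  then obtain j where j: "(of_int x + of_int y * ?s) / 2 = u ^ j" using unit_eq_power[of x y "-1"] m by auto
  have uu: "u = of_int t / 2 + of_int b / 2 * ?s" by (simp add: u add_divide_distrib)
  obtain U W where UW: "U \<in> \<rat>" "W \<in> \<rat>" "u ^ j = U + W * ?s" "(of_int t / 2 - of_int b / 2 * ?s) ^ j = U - W * ?s"
    using quad_ext_conjugate_power[OF real_subfield_Rats, of ?s "of_int t / 2" "of_int b / 2" j] unfolding uu by auto
  have "U + W * ?s = of_int x / 2 + of_int y / 2 * ?s" using j UW(3) by (simp add: add_divide_distrib)
  then have UWxy: "U = of_int x / 2" "W = of_int y / 2" using quad_eq_iff[OF p UW(1,2), of "of_int x / 2" "of_int y / 2"] by auto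
  have "(U + W * ?s) * (U - W * ?s) = ((of_int x)\<^sup>2 - real p * (of_int y)\<^sup>2) / 4"
    unfolding quad_norm_mult UWxy by (simp add: field_simps)
  also have "\<dots> = of_int (x\<^sup>2 - int p * y\<^sup>2) / 4" by simp
  also have "\<dots> = -1" unfolding m by simp
  finally have "(u * (of_int t / 2 - of_int b / 2 * ?s)) ^ j = -1" using UW(3,4) by (simp add: power_mult_distrib)
  moreover have "u * (of_int t / 2 - of_int b / 2 * ?s) = ((of_int t)\<^sup>2 - real p * (of_int b)\<^sup>2) / 4"
    unfolding uu quad_norm_mult by (simp add: field_simps)
  moreover have "((of_int t)\<^sup>2 - real p * (of_int b)\<^sup>2) / 4 = of_int (t\<^sup>2 - int p * b\<^sup>2) / 4" by simp
  ultimately show False unfolding N by simp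
qed

text \<open>If \<open>u\<close> had norm \<open>1\<close>, then \<open>(t - 2) * (t + 2) = p * b\<^sup>2\<close> would make \<open>u\<close> the square of a smaller
  unit, of norm \<open>1\<close> or \<open>-1\<close>.\<close>

lemma fundamental_unit_norm:
  assumes p4: "p mod 4 = 1" and tb: "t > 0" "b > 0"
  shows "t\<^sup>2 + 4 = int p * b\<^sup>2"
proof (rule ccontr)
  assume "t\<^sup>2 + 4 \<noteq> int p * b\<^sup>2"
  then have N: "t\<^sup>2 - int p * b\<^sup>2 = 4" using unit_norm[OF p] fu u unfolding fundamental_unit_def by fastforce
  define T B where "T = nat t" and "B = nat b"
  have TB: "t = int T" "b = int B" "T > 0" "B > 0" using tb by (simp_all add: T_def B_def)
  have "int (T\<^sup>2) = int (p * B\<^sup>2 + 4)" using N unfolding TB by simp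
  then have N': "T\<^sup>2 = p * B\<^sup>2 + 4" by (simp only: of_nat_eq_iff)
  have p0: "p > 0" using p by (rule prime_gt_0_nat)
  \<comment> \<open>Minimality of \<open>u\<close> among the units of norm \<open>1\<close> with
    positive coordinates.\<close>
  have less: False if "int x ^ 2 - int p * int y ^ 2 = 4" "0 < x" "0 < y" "x < T" "y \<le> B" for x y
  proof -
    have "real_of_int t + of_int b * sqrt (real p) \<le> of_int (int x) + of_int (int y) * sqrt (real p)"
      using fundamental_unit_le[of "int x" "int y"] that by simp
    moreover have "real y * sqrt (real p) \<le> real B * sqrt (real p)" using that by (intro mult_right_mono) auto
    ultimately show False using that(4) unfolding TB by simp
  qed
  have minus: False if "int x ^ 2 - int p * int y ^ 2 = -4" "0 < x" "0 < y" for x y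
    using no_norm_minus_one[OF N, of "int x" "int y"] that by simp
  have "T\<^sup>2 > 2\<^sup>2" unfolding N' using p0 TB by simp
  then have T2: "T > 2" using power2_less_imp_less by blast
  show False
  proof (cases "odd T")
    case True
    \<comment> \<open>For odd \<open>T\<close> the factors \<open>T - 2\<close> and
      \<open>T + 2\<close> are coprime. Of the two ways to distribute \<open>p\<close>, one gives a
      solution of norm \<open>1\<close> below \<open>(T, B)\<close>, the other a solution of norm
      \<open>-1\<close>.\<close>
    define a where "a = T - 2"
    have a: "T = a + 2" "a > 0" "odd a" using T2 True by (auto simp: a_def)
    have "coprime a (a + 4)"
    proof -
      have "coprime a 4" using a(3) coprime_power_right_iff[of a 2 2] by (simp add: coprime_right_2_iff_odd)
      then show ?thesis by (simp only: coprime_iff_gcd_eq_1 gcd_add2)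
    qed
    moreover have "a * (a + 4) = p * B\<^sup>2" using N' a(1) by (simp add: power2_eq_square algebra_simps)
    ultimately consider x y where "a = p * x\<^sup>2" "a + 4 = y\<^sup>2" | x y where "a = x\<^sup>2" "a + 4 = p * y\<^sup>2"
      using coprime_mult_eq_prime_square[OF p] by blast
    then show False
    proof cases
      case (1 x y)
      have x0: "x > 0" using 1 a(2) by (intro Nat.gr0I) auto
      have "2\<^sup>2 < y\<^sup>2" using 1(2) a(2) by simp
      then have y2: "y > 2" using power2_less_imp_less by blast
      have "3 * y \<le> y\<^sup>2" using y2 by (simp add: power2_eq_square)
      then have "y < T" using 1(2) a(1) y2 by linarith
      have "a * (a + 4) = (p * x\<^sup>2) * y\<^sup>2" by (simp only: 1(2)) (simp only: 1(1))
      then have "p * B\<^sup>2 = p * (x * y)\<^sup>2" using \<open>a * (a + 4) = p * B\<^sup>2\<close> by (metis mult.assoc power_mult_distrib)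
      then have "B = x * y" using p0 by simp
      then have "x \<le> B" using y2 by simp
      have "y\<^sup>2 = p * x\<^sup>2 + 4" using 1 by simp
      then have "int (y\<^sup>2) = int (p * x\<^sup>2 + 4)" by simp
      then show False using less[of y x] x0 y2 \<open>y < T\<close> \<open>x \<le> B\<close> by simp
    next
      case (2 x y)
      have "x > 0" "y > 0" using 2 a(2) by (auto intro!: Nat.gr0I)
      moreover have "x\<^sup>2 + 4 = p * y\<^sup>2" using 2 by simp
      then have "int (x\<^sup>2 + 4) = int (p * y\<^sup>2)" by simp
      ultimately show False using minus[of x y] by simp
    qed
  next
    case False
    then obtain m where m: "T = 2 * m" by auto
    have "odd p" using p4 by presburger
    have "even (p * B\<^sup>2)" using N' m by (metis dvd_add_left_iff even_mult_iff even_numeral power2_eq_square dvd_triv_left)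
    then have "even B" using \<open>odd p\<close> by simp
    then obtain n where n: "B = 2 * n" by auto
    have mn: "m\<^sup>2 = p * n\<^sup>2 + 1" using N' unfolding m n by (simp add: power_mult_distrib)
    have m4: "even x \<Longrightarrow> x\<^sup>2 mod 4 = 0" "odd x \<Longrightarrow> x\<^sup>2 mod 4 = 1" for x :: nat
    proof -
      show "even x \<Longrightarrow> x\<^sup>2 mod 4 = 0" by (auto simp: power_mult_distrib elim!: evenE)
      assume "odd x"
      then obtain k where "x = 2 * k + 1" by (rule oddE)
      then have "x\<^sup>2 = 4 * (k * k + k) + 1" by (simp add: power2_eq_square algebra_simps)
      then show "x\<^sup>2 mod 4 = 1" by (simp only: mod_mult_self4) simp
    qed
    \<comment> \<open>Squares modulo \<open>4\<close> force \<open>n\<close> to be even and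
      \<open>m\<close> to be odd. Then \<open>m\<^sup>2 - 1 = 4 * k * (k + 1)\<close>, and the
      coprime factors are \<open>k\<close> and \<open>k + 1\<close>.\<close>
    have "(p * n\<^sup>2) mod 4 = n\<^sup>2 mod 4" using p4 by (metis mod_mult_left_eq mult_1)
    then have mm: "m\<^sup>2 mod 4 = (n\<^sup>2 mod 4 + 1) mod 4" unfolding mn by (metis mod_add_left_eq)
    have en: "even n" using m4[of n] m4[of m] mm by (cases "even n"; cases "even m") simp_all
    have om: "odd m" using m4[of n] m4[of m] mm en by (cases "even m") simp_all
    obtain c where c: "n = 2 * c" using en by auto
    obtain k where k: "m = 2 * k + 1" using om by (rule oddE)
    have kc: "k * (k + 1) = p * c\<^sup>2" using mn unfolding c k by (simp add: power2_eq_square algebra_simps)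
    have c0: "c > 0" using TB n c by simp
    have k0: "k > 0" using kc c0 p0 by (intro Nat.gr0I) auto
    have "coprime k (k + 1)" by simp
    then consider x y where "k = p * x\<^sup>2" "k + 1 = y\<^sup>2" | x y where "k = x\<^sup>2" "k + 1 = p * y\<^sup>2"
      using coprime_mult_eq_prime_square[OF p _ kc] by blast
    then show False
    proof cases
      case (1 x y)
      have x0: "x > 0" using 1 k0 by (intro Nat.gr0I) auto
      have "1\<^sup>2 < y\<^sup>2" using 1(2) k0 by simp
      then have y2: "y > 1" using power2_less_imp_less by blast
      have "2 * y \<le> y\<^sup>2" using y2 by (simp add: power2_eq_square)
      then have "2 * y < T" using 1(2) m k y2 by linarith
      have "k * (k + 1) = (p * x\<^sup>2) * y\<^sup>2" by (simp only: 1(2)) (simp only: 1(1))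
      then have "p * c\<^sup>2 = p * (x * y)\<^sup>2" using kc by (metis mult.assoc power_mult_distrib)
      then have "c = x * y" using p0 by simp
      then have "2 * x \<le> B" using y2 n c by simp
      have "(2 * y)\<^sup>2 = p * (2 * x)\<^sup>2 + 4" using 1 by (simp add: power_mult_distrib)
      then have "int ((2 * y)\<^sup>2) = int (p * (2 * x)\<^sup>2 + 4)" by simp
      then show False using less[of "2 * y" "2 * x"] x0 y2 \<open>2 * y < T\<close> \<open>2 * x \<le> B\<close> by simp
    next
      case (2 x y)
      have "x > 0" "y > 0" using 2 k0 by (auto intro!: Nat.gr0I)
      moreover have "(2 * x)\<^sup>2 + 4 = p * (2 * y)\<^sup>2" using 2 by (simp add: power_mult_distrib)
      then have "int ((2 * x)\<^sup>2 + 4) = int (p * (2 * y)\<^sup>2)" by simp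
      ultimately show False using minus[of "2 * x" "2 * y"] by simp
    qed
  qed
qed

end

section \<open>Reduction modulo a prime\<close>

lemma reduce_poly_monic_quartic:
  fixes c0 c1 c2 c3 :: int
  assumes q: "q > 1"
  shows "reduce_poly q [:of_int c0, of_int c1, of_int c2, of_int c3, 1:] =
    [1, c3 mod int q, c2 mod int q, c1 mod int q, c0 mod int q]"
proof -
  define h where "h c = (THE z::int. of_int z = (c::complex)) mod int q" for c
  have h: "h (of_int z) = z mod int q" for z by (simp add: h_def)
  have h0: "h 0 = 0" and h1: "h 1 = 1" using h[of 0] h[of 1] q by simp_all
  have "map_poly h [:of_int c0, of_int c1, of_int c2, of_int c3, 1:] =
      [:c0 mod int q, c1 mod int q, c2 mod int q, c3 mod int q, 1:]"
    by (simp add: Polynomial.map_poly_pCons[of h] h0 h1 h)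
  then show ?thesis unfolding reduce_poly_def h_def[symmetric] by (simp add: cCons_def)
qed

text \<open>The prime field is realized as \<open>residue_ring\<close>; these facts translate
  evaluation and \<open>p\<close>-th powers in it into congruences between integers.\<close>

lemma
  assumes q: "Factorial_Ring.prime q"
  shows field_residue_ring: "field (residue_ring (int q))"
    and card_residue_ring: "card (carrier (residue_ring (int q))) = q"
    and mod_in_residue_ring: "x mod int q \<in> carrier (residue_ring (int q))"
    and zero_residue_ring: "\<zero>\<^bsub>residue_ring (int q)\<^esub> = 0"
    and pth_powers_residue_ring: "y \<in> pth_powers (residue_ring (int q)) p \<Longrightarrow> \<exists>z. y = z ^ p mod int q"
    and eval_ext_residue_ring: "eval_ext (residue_ring (int q)) [1, c3 mod int q, c2 mod int q, c1 mod int q, c0 mod int q] (x mod int q) =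
      (x ^ 4 + c3 * x ^ 3 + c2 * x\<^sup>2 + c1 * x + c0) mod int q"
proof -
  interpret residues_prime q "residue_ring (int q)" by unfold_locales (use q in simp_all)
  show "field (residue_ring (int q))" by (rule is_field)
  show "card (carrier (residue_ring (int q))) = q" using prime_gt_0_nat[OF q] by (simp add: res_carrier_eq)
  show "x mod int q \<in> carrier (residue_ring (int q))" by (rule mod_in_carrier)
  show "\<zero>\<^bsub>residue_ring (int q)\<^esub> = 0" by (rule res_zero_eq)
  show "\<exists>z. y = z ^ p mod int q" if y: "y \<in> pth_powers (residue_ring (int q)) p"
  proof -
    obtain z where "z \<in> carrier (residue_ring (int q))" "y = z [^]\<^bsub>residue_ring (int q)\<^esub> p" using y by (auto simp: pth_powers_def)
    then show ?thesis using pow_cong[of z p] by (auto simp: res_carrier_eq)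
  qed
  have n: "add_pow (residue_ring (int q)) (k::nat) \<one>\<^bsub>residue_ring (int q)\<^esub> = int k mod int q" for k
  proof (induction k)
    case 0 show ?case by (simp add: res_zero_eq)
  next
    case (Suc k) then show ?case by (simp add: res_add_eq res_one_eq mod_simps add.commute)
  qed
  have i: "add_pow (residue_ring (int q)) (k::int) \<one>\<^bsub>residue_ring (int q)\<^esub> = k mod int q" if "k \<ge> 0" for k
    using that by (simp add: add_pow_int_ge n)
  have q0: "int q > 0" using prime_gt_0_nat[OF q] by simp
  have "map (\<lambda>c. add_pow (residue_ring (int q)) c \<one>\<^bsub>residue_ring (int q)\<^esub>) [1, c3 mod int q, c2 mod int q, c1 mod int q, c0 mod int q] =
     [1 mod int q, c3 mod int q, c2 mod int q, c1 mod int q, c0 mod int q]"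
    using q0 by (simp only: list.map) (simp add: i)
  moreover have "ring.eval (residue_ring (int q)) [k4, k3, k2, k1, k0] z = k4 \<otimes>\<^bsub>residue_ring (int q)\<^esub> z [^]\<^bsub>residue_ring (int q)\<^esub> (4::nat) \<oplus>\<^bsub>residue_ring (int q)\<^esub>
      (k3 \<otimes>\<^bsub>residue_ring (int q)\<^esub> z [^]\<^bsub>residue_ring (int q)\<^esub> (3::nat) \<oplus>\<^bsub>residue_ring (int q)\<^esub>
      (k2 \<otimes>\<^bsub>residue_ring (int q)\<^esub> z [^]\<^bsub>residue_ring (int q)\<^esub> (2::nat) \<oplus>\<^bsub>residue_ring (int q)\<^esub>
      (k1 \<otimes>\<^bsub>residue_ring (int q)\<^esub> z [^]\<^bsub>residue_ring (int q)\<^esub> (1::nat) \<oplus>\<^bsub>residue_ring (int q)\<^esub>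
      (k0 \<otimes>\<^bsub>residue_ring (int q)\<^esub> z [^]\<^bsub>residue_ring (int q)\<^esub> (0::nat) \<oplus>\<^bsub>residue_ring (int q)\<^esub> 0 mod int q))))" for k4 k3 k2 k1 k0 z
    by (simp add: numeral_eq_Suc res_zero_eq)
  ultimately show "eval_ext (residue_ring (int q)) [1, c3 mod int q, c2 mod int q, c1 mod int q, c0 mod int q] (x mod int q) =
      (x ^ 4 + c3 * x ^ 3 + c2 * x\<^sup>2 + c1 * x + c0) mod int q"
    unfolding eval_ext_def by (simp only: pow_cong mult_cong add_cong) (simp add: add.assoc)
qed

section \<open>The quartic of the theorem\<close>

text \<open>At the odd index \<open>p\<^sup>2\<close>, negating the index changes the sign of
  \<open>seqL\<close> and leaves \<open>seqF\<close> fixed, so \<open>e\<close> acts only through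
  \<open>M = e * L\<close>. The norm is simplified by
  \<open>p * V\<^sup>2 = M\<^sup>2 + 4\<close>.\<close>

lemma f_poly_alpha:
  fixes t b :: int and e :: int
  assumes p: "Factorial_Ring.prime p" "odd p" and e: "e = 1 \<or> e = -1" and tb: "t\<^sup>2 + 4 = int p * b\<^sup>2"
    and M: "M = e * seqL t (int (p\<^sup>2))"
  shows "f_poly p (alpha p t b (e * int (p\<^sup>2)) (int (p\<^sup>2))) =
    [:of_int 1, of_int (- e * M\<^sup>2), of_int (M ^ 3 - 2 * M\<^sup>2 + 4 * M - 2), of_int (- e * M\<^sup>2), 1:]"
    and "(seqL t (e * int (p\<^sup>2)) * seqF t (int (p\<^sup>2)) - 2 * seqF t (e * int (p\<^sup>2))) * b = (M - 2) * (b * seqF t (int (p\<^sup>2)))"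
proof -
  define L V where "L = seqL t (int (p\<^sup>2))" and "V = b * seqF t (int (p\<^sup>2))"
  have o: "odd (p\<^sup>2)" using p(2) by simp
  have LV: "L\<^sup>2 + 4 = int p * V\<^sup>2" unfolding L_def V_def by (rule seq_norm[OF tb o])
  have s: "seqL t (e * int (p\<^sup>2)) = M" "seqF t (e * int (p\<^sup>2)) = seqF t (int (p\<^sup>2))"
    using e M seq_neg[of t "p\<^sup>2"] o by (auto simp del: of_nat_power)
  have ee: "e * e = 1" using e by auto
  have LM: "L = e * M" unfolding M L_def[symmetric] using ee by (simp add: mult.assoc[symmetric])
  then have MV: "M\<^sup>2 + 4 = int p * V\<^sup>2" using LV ee e by (auto simp: power2_eq_square)
  show co: "(seqL t (e * int (p\<^sup>2)) * seqF t (int (p\<^sup>2)) - 2 * seqF t (e * int (p\<^sup>2))) * b = (M - 2) * (b * seqF t (int (p\<^sup>2)))"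
    unfolding s by (simp add: algebra_simps del: of_nat_power)
  define x y where "x = real_of_int (e * M\<^sup>2) / 2" and "y = real_of_int ((M - 2) * V) / 2"
  have xy: "x \<in> \<rat>" "y \<in> \<rat>" unfolding x_def y_def by (intro Rats_divide Rats_of_int; simp)+
  have "seqL t (int (p\<^sup>2)) * M = e * M\<^sup>2" unfolding L_def[symmetric] LM by (simp add: power2_eq_square)
  then have al: "alpha p t b (e * int (p\<^sup>2)) (int (p\<^sup>2)) = of_real (x + y * sqrt (real p))"
    unfolding alpha_def co unfolding V_def[symmetric] s(1) by (simp add: x_def y_def add_divide_distrib del: of_int_mult of_int_diff)
  have "real_of_int (M\<^sup>2 + 4) = of_int (int p * V\<^sup>2)" using MV by simp
  then have MVr: "real p * (of_int V)\<^sup>2 = (of_int M)\<^sup>2 + 4" by simp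
  have e2: "real_of_int e * of_int e = 1" using ee by (metis of_int_1 of_int_mult)
  have "x\<^sup>2 - real p * y\<^sup>2 = ((of_int e * of_int e) * (of_int M) ^ 4 - (of_int M - 2)\<^sup>2 * (real p * (of_int V)\<^sup>2)) / 4"
    by (simp add: x_def y_def power_divide power_mult_distrib power2_eq_square power4_eq_xxxx field_simps)
  also have "\<dots> = of_int (M ^ 3 - 2 * M\<^sup>2 + 4 * M - 4)"
    unfolding e2 MVr by (simp add: power2_eq_square power3_eq_cube power4_eq_xxxx field_simps)
  finally have n: "field_norm (quad_field p) (alpha p t b (e * int (p\<^sup>2)) (int (p\<^sup>2))) = of_int (M ^ 3 - 2 * M\<^sup>2 + 4 * M - 4)"
    unfolding al field_norm_quad_field[OF p(1) xy] by (metis of_real_of_int_eq)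
  have tr: "field_trace (quad_field p) (alpha p t b (e * int (p\<^sup>2)) (int (p\<^sup>2))) = of_int (e * M\<^sup>2)"
    unfolding al field_trace_quad_field[OF p(1) xy] by (simp add: x_def)
  show "f_poly p (alpha p t b (e * int (p\<^sup>2)) (int (p\<^sup>2))) =
    [:of_int 1, of_int (- e * M\<^sup>2), of_int (M ^ 3 - 2 * M\<^sup>2 + 4 * M - 2), of_int (- e * M\<^sup>2), 1:]"
    unfolding f_poly_def n tr Let_def by simp
qed

theorem theorem2:
  fixes p :: nat and t b :: int and u :: real
  assumes "Factorial_Ring.prime p" and "[p = 5] (mod 8)"
    and "t > 0" and "b > 0"
    and "u = (of_int t + of_int b * sqrt (real p)) / 2"
    and "fundamental_unit p u"
    and "\<forall>n::nat. n > 0 \<and> squarefree n \<longrightarrow> extended_riemann_hypothesis (kummer_field p u n)"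
  shows "\<exists>(m0::int) (n0::int) (q::nat).
           [m0 = 1] (mod 2) \<and> [n0 = 1] (mod 2) \<and> Factorial_Ring.prime q \<and>
           [(seqL t m0 * seqF t n0 - 2 * seqF t m0) * b = 0] (mod (int p)\<^sup>2) \<and>
           \<not> int q dvd 2 * b * int p \<and>
           (\<exists>i \<in> {1, 2, 4::nat}. \<exists>F::int ring. field F \<and> card (carrier F) = q ^ i \<and>
              (\<exists>a \<in> carrier F - pth_powers F p.
                 eval_ext F (reduce_poly q (f_poly p (alpha p t b m0 n0))) a = \<zero>\<^bsub>F\<^esub>))"
proof -
  note p = assms(1)
  have p8: "p mod 8 = 5" using assms(2) by (simp add: cong_def)
  then have p5: "p \<ge> 5" "p mod 4 = 1" "odd p" by presburger+
  have tb: "t\<^sup>2 + 4 = int p * b\<^sup>2" by (rule fundamental_unit_norm[OF p assms(5,6) p5(2) assms(3,4)])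
  let ?s = "sqrt (real p)"
  have ss: "?s\<^sup>2 = real p" by simp
  define L V where "L = seqL t (int (p\<^sup>2))" and "V = b * seqF t (int (p\<^sup>2))"
  have o: "odd (p\<^sup>2)" using p5 by simp
  have LV: "L\<^sup>2 + 4 = int p * V\<^sup>2" unfolding L_def V_def by (rule seq_norm[OF tb o])
  have V0: "V > 0" unfolding V_def using seq_pos(2)[OF assms(3), of "p\<^sup>2"] assms(4) p5 by simp
  have pV: "(int p)\<^sup>2 dvd V" unfolding V_def by (rule prime_square_dvd_seqF[OF p _ tb]) (use p5 in simp)
  have L0: "L > 2"
  proof -
    have "(int p)\<^sup>2 \<le> V" using pV V0 by (rule zdvd_imp_le)
    moreover have "(5::int)\<^sup>2 \<le> (int p)\<^sup>2" using p5 by (intro power_mono) auto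
    ultimately have "2 \<le> V" by simp
    then have "(2::int)\<^sup>2 \<le> V\<^sup>2" by (intro power_mono) auto
    moreover have "5 * V\<^sup>2 \<le> int p * V\<^sup>2" using p5 by (intro mult_right_mono) auto
    ultimately have "2\<^sup>2 < L\<^sup>2" using LV by simp
    moreover have "L > 0" unfolding L_def by (rule seq_pos(1)[OF assms(3)])
    ultimately show ?thesis using power2_less_imp_less[of 2 L] by simp
  qed
  have up: "unit_power p L V (seqL t (int p)) (b * seqF t (int p)) (u ^ p) (u ^ (p\<^sup>2)) e" if "e = 1 \<or> e = -1" for e
  proof
    show "Factorial_Ring.prime p" "p \<ge> 5" "L > 2" "V > 0" "L\<^sup>2 + 4 = int p * V\<^sup>2" "e = 1 \<or> e = -1" by fact+
    show "u ^ p = (of_int (seqL t (int p)) + of_int (b * seqF t (int p)) * ?s) / 2"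
      "u ^ (p\<^sup>2) = (of_int L + of_int V * ?s) / 2"
      unfolding assms(5) L_def V_def by (rule power_quad_eq_seq[OF ss tb])+
    show "(seqL t (int p))\<^sup>2 + 4 = int p * (b * seqF t (int p))\<^sup>2" by (rule seq_norm[OF tb p5(3)])
    show "u ^ p\<^sup>2 = (u ^ p) ^ p" by (simp add: power2_eq_square power_mult)
    \<comment> \<open>The smallest case is \<open>t = b = 1\<close> and \<open>p = 5\<close>, the
      golden ratio; it exceeds \<open>8 / 5\<close>, and the fifth power of \<open>8 / 5\<close>
      exceeds \<open>10\<close>.\<close>
    have "?s \<ge> 11 / 5" using p5 by (intro real_le_rsqrt) (simp add: power2_eq_square)
    moreover have "real_of_int b * ?s \<ge> 1 * ?s" using assms(4) by (intro mult_right_mono) auto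
    moreover have "real_of_int t \<ge> 1" using assms(3) by simp
    ultimately have u: "u \<ge> 8 / 5" unfolding assms(5) by simp
    have "(10::real) \<le> (8 / 5) ^ 5" by (simp add: power_divide)
    also have "\<dots> \<le> u ^ 5" using u by (intro power_mono) auto
    also have "\<dots> \<le> u ^ p" using u p5 by (intro power_increasing) auto
    finally show "u ^ p \<ge> 10" .
  qed
  obtain q M x where q: "Factorial_Ring.prime q" and nq: "\<not> int q dvd 2 * b * int p" and M: "M \<in> {L, - L}"
    and x: "int q dvd poly (quartic M) x" and np: "\<not> (\<exists>y. int q dvd y ^ p - x)"
    using ex_prime_with_non_pth_power_root[OF p assms(2) up[of 1] up[of "-1"], of b] assms(4) by auto
  obtain e :: int where e: "e = 1 \<or> e = -1" "M = e * L" using M by (metis insertE minus_mult_left mult_1 singletonD)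
  define m0 where "m0 = e * int (p\<^sup>2)"
  note f = f_poly_alpha[OF p p5(3) e(1) tb e(2)[unfolded L_def], folded m0_def]
  have q1: "q > 1" using q by (rule prime_gt_1_nat)
  \<comment> \<open>The witness lies in the prime field, so \<open>i = 1\<close>. Passing from the
    quartic to the polynomial of the theorem turns \<open>x\<close> into \<open>e * x\<close>; this
    is a \<open>p\<close>-th power only if \<open>x\<close> is, because \<open>e ^ p = e\<close> for
    odd \<open>p\<close>.\<close>
  let ?F = "residue_ring (int q)" and ?a = "(e * x) mod int q"
  have "odd (int (p\<^sup>2))" using o by simp
  then obtain k where k: "int (p\<^sup>2) = 2 * k + 1" by (rule oddE)
  then have "m0 = 2 * k + 1 \<or> m0 = - (2 * k + 1)" using e(1) by (auto simp: m0_def)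
  then have "[m0 = 1] (mod 2)" "[int (p\<^sup>2) = 1] (mod 2)" unfolding cong_def k by presburger+
  moreover have "[(seqL t m0 * seqF t (int (p\<^sup>2)) - 2 * seqF t m0) * b = 0] (mod (int p)\<^sup>2)"
    unfolding f(2) V_def[symmetric] using pV by (simp add: cong_0_iff)
  moreover have "?a \<notin> pth_powers ?F p"
  proof
    assume "?a \<in> pth_powers ?F p"
    then obtain z where "?a = z ^ p mod int q" using pth_powers_residue_ring[OF q] by blast
    then have "int q dvd z ^ p - e * x" by (metis mod_eq_dvd_iff)
    then have "int q dvd e * (z ^ p - e * x)" by simp
    moreover have "e * (z ^ p - e * x) = (e * z) ^ p - x" using e(1) p5(3) by auto
    ultimately show False using np by metis
  qed
  moreover have "eval_ext ?F (reduce_poly q (f_poly p (alpha p t b m0 (int (p\<^sup>2))))) ?a = \<zero>\<^bsub>?F\<^esub>"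
  proof -
    have "eval_ext ?F (reduce_poly q (f_poly p (alpha p t b m0 (int (p\<^sup>2))))) ?a =
      ((e * x) ^ 4 + (- e * M\<^sup>2) * (e * x) ^ 3 + (M ^ 3 - 2 * M\<^sup>2 + 4 * M - 2) * (e * x)\<^sup>2 + (- e * M\<^sup>2) * (e * x) + 1) mod int q"
      unfolding f(1) reduce_poly_monic_quartic[OF q1] by (rule eval_ext_residue_ring[OF q])
    also have "(e * x) ^ 4 + (- e * M\<^sup>2) * (e * x) ^ 3 + (M ^ 3 - 2 * M\<^sup>2 + 4 * M - 2) * (e * x)\<^sup>2 + (- e * M\<^sup>2) * (e * x) + 1 = poly (quartic M) x"
      using e(1) by (auto simp: quartic_def algebra_simps power2_eq_square power3_eq_cube power4_eq_xxxx)
    also have "\<dots> mod int q = \<zero>\<^bsub>?F\<^esub>" using x by (simp add: zero_residue_ring[OF q])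
    finally show ?thesis .
  qed
  ultimately show ?thesis
    using q nq field_residue_ring[OF q] card_residue_ring[OF q] mod_in_residue_ring[OF q, of "e * x"]
    by (intro exI[of _ m0] exI[of _ "int (p\<^sup>2)"] exI[of _ q] conjI bexI[of _ 1] exI[of _ ?F] bexI[of _ ?a]) auto
qed

end
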